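(* Assume that $(W,S)$ is irreducible and let $\mathcal O\in\mathrm{Cl}(W)$ be an elliptic conjugacy class. Then there exist a $\mathbb Z[\mathbf q^{\pm1}]$-linear function $F:\overline H\to\mathbb Z[\mathbf q^{\pm1}]$ and an integer $z>0$ such that $$F(T_{\mathcal O'})\equiv z\,\delta_{\mathcal O,\mathcal O'}\pmod{\mathbf q-1}$$ holds for all $\mathcal O'\in\mathrm{Cl}(W)$.
   Context: $(W,S)$ is the Weyl group of a split Kac--Moody group, i.e. a crystallographic Coxeter system ($S$ finite, orders of products of two distinct simple reflections in $\{2,3,4,6,\infty\}$). A conjugacy class $\mathcal O$ of $W$ is elliptic if $\mathcal O\cap W_J=\emptyset$ for every $J\subsetneq S$, where $W_J$ is the subgroup generated by $J$. $H$ is the $\mathbb Z[\mathbf q^{\pm1}]$-algebra with generators $T_s$ ($s\in S$), relations $(T_s+1)(T_s-\mathbf q)=0$ and the braid relations, with standard basis $\{T_w\}_{w\in W}$; $\overline H=H/[H,H]$ with $[H,H]$ the span of commutators. For $\mathcal O\in\mathrm{Cl}(W)$ (set of conjugacy classes), $T_{\mathcal O}\in\overline H$ is the image of $T_w$ for any $w\in\mathcal O$ of minimal length (independent of $w$). *)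

theory Defs
  imports
    "HOL-Algebra.QuotRing"
    "HOL-Algebra.Module"
    "HOL-Algebra.Generated_Groups"
    "HOL-Algebra.Multiplicative_Group"
    "HOL-Library.Poly_Mapping"
begin

definition word_prod :: "'w monoid \<Rightarrow> 'w list \<Rightarrow> 'w" where
  "word_prod W ss = foldr (\<otimes>\<^bsub>W\<^esub>) ss \<one>\<^bsub>W\<^esub>"

text \<open>\<open>alt_word n s t\<close> is the word \<open>s t s t \<dots>\<close> with \<open>n\<close> letters.\<close>

definition alt_word :: "nat \<Rightarrow> 's \<Rightarrow> 's \<Rightarrow> 's list" where
  "alt_word n s t = map (\<lambda>i. if even i then s else t) [0..<n]"

text \<open>
  \<^const>\<open>group.ord\<close> is \<open>0\<close> on elements of infinite order, so \<open>cox_m W s t = 0\<close> encodes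
  \<open>m(s,t) = \<infinity>\<close>.
\<close>

definition cox_m :: "'w monoid \<Rightarrow> 'w \<Rightarrow> 'w \<Rightarrow> nat" where
  "cox_m W s t = group.ord W (s \<otimes>\<^bsub>W\<^esub> t)"

text \<open>
  One application of a relation \<open>(s t)^m(s,t) = 1\<close>. The case \<open>s = t\<close> is included and gives
  \<open>s s = 1\<close>, so that words (as opposed to words in letters and inverse letters) suffice to
  describe the presented group. For \<open>m(s,t) = \<infinity>\<close> the relator is the empty word.
\<close>

inductive coxeter_step :: "'w monoid \<Rightarrow> 'w set \<Rightarrow> 'w list \<Rightarrow> 'w list \<Rightarrow> bool"
  for W :: "'w monoid" and S :: "'w set" where
  "\<lbrakk>u \<in> lists S; v \<in> lists S; s \<in> S; t \<in> S\<rbrakk>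
    \<Longrightarrow> coxeter_step W S (u @ alt_word (2 * cox_m W s t) s t @ v) (u @ v)"

text \<open>
  The last conjunct says that \<open>W\<close> is presented by the generators \<open>S\<close> and the relations
  \<open>(s t)^m(s,t) = 1\<close>.
\<close>

definition coxeter_system :: "'w monoid \<Rightarrow> 'w set \<Rightarrow> bool" where
  "coxeter_system W S \<longleftrightarrow>
     group W \<and> S \<subseteq> carrier W \<and> generate W S = carrier W \<and>
     (\<forall>s\<in>S. group.ord W s = 2) \<and>
     (\<forall>u\<in>lists S. \<forall>v\<in>lists S.
        word_prod W u = word_prod W v \<longleftrightarrow> equivclp (coxeter_step W S) u v)"

text \<open>The Weyl groups of split Kac--Moody groups; the value \<open>0\<close> stands for \<open>\<infinity>\<close>.\<close>

definition crystallographic_coxeter_system :: "'w monoid \<Rightarrow> 'w set \<Rightarrow> bool" where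
  "crystallographic_coxeter_system W S \<longleftrightarrow>
     coxeter_system W S \<and> finite S \<and>
     (\<forall>s\<in>S. \<forall>t\<in>S. s \<noteq> t \<longrightarrow> cox_m W s t \<in> {2, 3, 4, 6, 0})"

text \<open>The Coxeter graph is nonempty and connected.\<close>

definition irreducible_coxeter :: "'w monoid \<Rightarrow> 'w set \<Rightarrow> bool" where
  "irreducible_coxeter W S \<longleftrightarrow>
     S \<noteq> {} \<and>
     \<not> (\<exists>J. J \<noteq> {} \<and> J \<subset> S \<and> (\<forall>s\<in>J. \<forall>t\<in>S - J. cox_m W s t = 2))"

definition cox_length :: "'w monoid \<Rightarrow> 'w set \<Rightarrow> 'w \<Rightarrow> nat" where
  "cox_length W S w = (LEAST n. \<exists>ss\<in>lists S. length ss = n \<and> word_prod W ss = w)"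

definition reduced_expressions :: "'w monoid \<Rightarrow> 'w set \<Rightarrow> 'w \<Rightarrow> 'w list set" where
  "reduced_expressions W S w =
     {ss \<in> lists S. word_prod W ss = w \<and> length ss = cox_length W S w}"

definition conj_classes :: "'w monoid \<Rightarrow> 'w set set" where
  "conj_classes W =
     {{g \<otimes>\<^bsub>W\<^esub> w \<otimes>\<^bsub>W\<^esub> inv\<^bsub>W\<^esub> g | g. g \<in> carrier W} | w. w \<in> carrier W}"

definition elliptic :: "'w monoid \<Rightarrow> 'w set \<Rightarrow> 'w set \<Rightarrow> bool" where
  "elliptic W S \<O> \<longleftrightarrow> (\<forall>J. J \<subset> S \<longrightarrow> \<O> \<inter> generate W J = {})"

definition min_length_elements :: "'w monoid \<Rightarrow> 'w set \<Rightarrow> 'w set \<Rightarrow> 'w set" where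
  "min_length_elements W S \<O> =
     {w \<in> \<O>. \<forall>w'\<in>\<O>. cox_length W S w \<le> cox_length W S w'}"

text \<open>
  A finitely supported function \<open>int \<Rightarrow> int\<close> is read as exponent \<open>\<mapsto>\<close> coefficient; the
  multiplication of \<^theory>\<open>HOL-Library.Poly_Mapping\<close> is convolution.
\<close>

type_synonym laurent = "int \<Rightarrow>\<^sub>0 int"

definition qq :: laurent where
  "qq = Poly_Mapping.single 1 1"

definition laurent_ring :: "laurent ring" where
  "laurent_ring = \<lparr>carrier = UNIV, mult = (*), one = 1, zero = 0, add = (+)\<rparr>"

text \<open>
  A copy of the lists carrying concatenation as its (additively written) monoid structure, so
  that the convolution product on \<open>'a free_monoid \<Rightarrow>\<^sub>0 laurent\<close> makes this type the free
  associative algebra over the Laurent polynomials on the letters of type \<open>'a\<close>.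
\<close>

datatype 'a free_monoid = Word (letters: "'a list")

instantiation free_monoid :: (type) monoid_add
begin

definition zero_free_monoid :: "'a free_monoid" where
  "0 = Word []"

definition plus_free_monoid :: "'a free_monoid \<Rightarrow> 'a free_monoid \<Rightarrow> 'a free_monoid" where
  "x + y = Word (letters x @ letters y)"

instance
  by standard (simp_all add: zero_free_monoid_def plus_free_monoid_def)

end

type_synonym 'a free_alg = "'a free_monoid \<Rightarrow>\<^sub>0 laurent"

definition word_monom :: "'a list \<Rightarrow> 'a free_alg" where
  "word_monom ss = Poly_Mapping.single (Word ss) 1"

definition scalar :: "laurent \<Rightarrow> 'a free_alg" where
  "scalar c = Poly_Mapping.single 0 c"

definition free_algebra :: "'a set \<Rightarrow> 'a free_alg ring" where
  "free_algebra S =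
     \<lparr>carrier = {x. \<forall>k\<in>Poly_Mapping.keys x. letters k \<in> lists S},
      mult = (*), one = 1, zero = 0, add = (+)\<rparr>"

definition hecke_relators :: "'w monoid \<Rightarrow> 'w set \<Rightarrow> 'w free_alg set" where
  "hecke_relators W S =
     {(word_monom [s] + 1) * (word_monom [s] - scalar qq) | s. s \<in> S} \<union>
     {word_monom (alt_word (cox_m W s t) s t) - word_monom (alt_word (cox_m W s t) t s)
        | s t. s \<in> S \<and> t \<in> S \<and> s \<noteq> t \<and> cox_m W s t \<noteq> 0}"

definition hecke_ideal :: "'w monoid \<Rightarrow> 'w set \<Rightarrow> 'w free_alg set" where
  "hecke_ideal W S = Idl\<^bsub>free_algebra S\<^esub> (hecke_relators W S)"

definition hecke_algebra ::
    "'w monoid \<Rightarrow> 'w set \<Rightarrow> (laurent, 'w free_alg set) module" where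
  "hecke_algebra W S =
     ring.extend (free_algebra S Quot hecke_ideal W S)
       (module.fields
         (\<lambda>c X. (hecke_ideal W S +>\<^bsub>free_algebra S\<^esub> scalar c)
                  \<otimes>\<^bsub>free_algebra S Quot hecke_ideal W S\<^esub> X))"

text \<open>
  The standard basis element \<open>T\<^sub>w = T\<^sub>s\<^sub>1 \<cdots> T\<^sub>s\<^sub>n\<close>. By Matsumoto's theorem and the braid
  relations it does not depend on the reduced expression chosen.
\<close>

definition hecke_T :: "'w monoid \<Rightarrow> 'w set \<Rightarrow> 'w \<Rightarrow> 'w free_alg set" where
  "hecke_T W S w =
     hecke_ideal W S +>\<^bsub>free_algebra S\<^esub>
       word_monom (SOME ss. ss \<in> reduced_expressions W S w)"

definition module_span :: "('r, 'a) ring_scheme \<Rightarrow> ('r, 'm) module \<Rightarrow> 'm set \<Rightarrow> 'm set" where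
  "module_span R M A = \<Inter>{N. submodule N R M \<and> A \<subseteq> N}"

text \<open>
  The quotient \<open>M / N\<close> as a module. The record type extends that of rings, but only the module
  operations are meaningful here.
\<close>

definition quotient_module :: "('r, 'm) module \<Rightarrow> 'm set \<Rightarrow> ('r, 'm set) module" where
  "quotient_module M N =
     \<lparr>carrier = a_rcosets\<^bsub>M\<^esub> N, mult = undefined, one = undefined,
      zero = N, add = set_add M, smult = (\<lambda>c X. \<Union>x\<in>X. N +>\<^bsub>M\<^esub> (c \<odot>\<^bsub>M\<^esub> x))\<rparr>"

definition commutator_span :: "'w monoid \<Rightarrow> 'w set \<Rightarrow> 'w free_alg set set" where
  "commutator_span W S =
     module_span laurent_ring (hecke_algebra W S)
       {a \<otimes>\<^bsub>hecke_algebra W S\<^esub> b \<ominus>\<^bsub>hecke_algebra W S\<^esub> b \<otimes>\<^bsub>hecke_algebra W S\<^esub> a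
          | a b. a \<in> carrier (hecke_algebra W S) \<and> b \<in> carrier (hecke_algebra W S)}"

definition cocenter :: "'w monoid \<Rightarrow> 'w set \<Rightarrow> (laurent, 'w free_alg set set) module" where
  "cocenter W S = quotient_module (hecke_algebra W S) (commutator_span W S)"

definition to_cocenter :: "'w monoid \<Rightarrow> 'w set \<Rightarrow> 'w free_alg set \<Rightarrow> 'w free_alg set set" where
  "to_cocenter W S h = commutator_span W S +>\<^bsub>hecke_algebra W S\<^esub> h"

definition linear_functional :: "(laurent, 'm) module \<Rightarrow> ('m \<Rightarrow> laurent) \<Rightarrow> bool" where
  "linear_functional M F \<longleftrightarrow>
     (\<forall>x\<in>carrier M. \<forall>y\<in>carrier M. F (x \<oplus>\<^bsub>M\<^esub> y) = F x + F y) \<and>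
     (\<forall>c. \<forall>x\<in>carrier M. F (c \<odot>\<^bsub>M\<^esub> x) = c * F x)"

text \<open>
  The element \<open>T\<^sub>\<O>\<close> of the cocenter is the common image of the \<open>T\<^sub>w\<close> with \<open>w\<close> of minimal length
  in \<open>\<O>\<close>. That these images agree is a theorem on Coxeter groups; to avoid depending on it, the
  following is the set of all these images, and a statement about \<open>T\<^sub>\<O>\<close> is made for each of its
  members.
\<close>

definition class_T :: "'w monoid \<Rightarrow> 'w set \<Rightarrow> 'w set \<Rightarrow> 'w free_alg set set set" where
  "class_T W S \<O> = (\<lambda>w. to_cocenter W S (hecke_T W S w)) ` min_length_elements W S \<O>"

end

theory Submission
  imports Defs "HOL-Library.Function_Algebras"
begin

text \<open>
  Realise \<open>W\<close> by a generalized Cartan matrix on the integral root lattice. A functional on the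
  cocenter is a function on words that is invariant under rotation and satisfies the quadratic and
  braid relations. For the class of \<open>a\<close> such a function arises as a regularised trace. Let \<open>g\<close> commute
  with \<open>a\<close> and fix every root of finite \<open>g\<close>-orbit, and orient a root \<open>\<beta>\<close> by the eventual sign of
  \<open>g\<^sup>n \<beta>\<close>. The Hecke algebra acts on the span of \<open>W\<close> with this orientation in place of the length function. Up to
  conjugation \<open>a = u a\<^sub>0\<close> with \<open>u\<close> in a finite parabolic subgroup \<open>W\<^sub>K\<close> whose simple roots are permuted by
  \<open>a\<^sub>0\<close>. If \<open>\<phi>\<close> is a twisted trace function on the Hecke algebra of \<open>W\<^sub>K\<close>, one sums \<open>\<phi> w\<close> times the
  matrix coefficient from \<open>h\<close> to \<open>w a\<^sub>0 h\<close> over \<open>w\<close> in \<open>W\<^sub>K\<close> and over the minimal representatives \<open>h\<close> of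
  \<open>W\<^sub>K h\<close>, modulo a group \<open>\<Gamma>\<close> centralising \<open>a\<close>. At \<open>q = 1\<close> this counts conjugators from \<open>w a\<^sub>0\<close> to the given
  element, so it is supported on the class of \<open>a\<close> when \<open>\<phi>\<close> is supported on the twisted class of \<open>u\<close>.

  What remains is that the sum is finite. If \<open>a\<close> has finitely many periodic roots, they generate a
  finite reflection group, and \<open>\<Gamma>\<close> is their pointwise stabiliser in the centraliser of \<open>a\<close>. Otherwise
  pairs of periodic roots produce a nonzero \<open>a\<close>-fixed vector \<open>\<delta>\<close> with nonnegative orbit. The stabiliser of
  \<open>\<delta>\<close> is parabolic up to conjugation, so ellipticity makes \<open>\<delta>\<close> invariant under \<open>W\<close>, and irreducibility
  makes \<open>W\<close> affine. There \<open>g\<close> and \<open>\<Gamma>\<close> consist of translations, \<open>u\<close> is twisted elliptic in \<open>W\<^sub>K\<close>, hence \<open>\<phi>\<close> can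
  be chosen to vanish on all non-elliptic elements, and finiteness is an instance of Dickson's lemma.
\<close>


text \<open>Formed with the length function, the sum over h of the coefficients from h to
  \<open>a h\<close> may have infinitely many nonzero terms. Signs at infinity are invariant under
  whatever commutes with g, so equal terms can be collected modulo \<Gamma>. The price is paid at
  the roots fixed by g: they have no direction at infinity, ordinary positivity must be used there,
  and a respects it only after a factor in the finite group \<open>W_K\<close> has been split off.
  The function \<phi> puts this factor back. If w lies in a smaller stable parabolic subgroup,
  \<open>w a0\<close> may have too many conjugators for a finite sum. Hence \<phi> must vanish there
  identically and not merely at q = 1, which is why divisibility by all powers of q - 1 enters. The
  integer z counts conjugators modulo \<Gamma>, weighted by \<phi> at q = 1. Since a generalized
  Cartan matrix need not be symmetrizable, no invariant form is available; arguments about angles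
  are replaced by commuting reflections, finite inversion sets and integer arithmetic with cleared
  denominators.\<close>

declare plus_fun_apply [simp del] zero_fun_apply [simp del] minus_apply [simp del] uminus_apply [simp del]

section \<open>The root system\<close>

text \<open>The allowed orders are those for which 4 cos^2(\<pi>/m) is an integer, namely the
  product \<open>A s t * A t s\<close>, so that W acts on an integral lattice. For m = \<infinity>
  the choice -2, -2 makes the rank two subsystem affine.\<close>

locale coxeter_gcm = group W for W :: "'w monoid" (structure) +
  fixes S :: "'w set" and A :: "'w \<Rightarrow> 'w \<Rightarrow> int"
  assumes cox: "coxeter_system W S" and fin [simp]: "finite S"
    and A_diag: "s \<in> S \<Longrightarrow> A s s = 2"
    and A_rel: "\<lbrakk>s \<in> S; t \<in> S; s \<noteq> t\<rbrakk> \<Longrightarrow>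
      (cox_m W s t, A s t, A t s) \<in>
        {(2,0,0), (3,-1,-1), (4,-1,-2), (4,-2,-1), (6,-1,-3), (6,-3,-1), (0,-2,-2)}"
begin

section \<open>The action of words on the root lattice, and the length function\<close>

definition coroot :: "'w \<Rightarrow> ('w \<Rightarrow> int) \<Rightarrow> int" where
  "coroot s v = (\<Sum>t\<in>S. A s t * v t)"

definition sr :: "'w \<Rightarrow> 'w \<Rightarrow> int" where
  "sr s = (\<lambda>x. if x = s then 1 else 0)"

definition smul :: "int \<Rightarrow> ('w \<Rightarrow> int) \<Rightarrow> 'w \<Rightarrow> int" (infixr \<open>\<cdot>\<close> 75) where
  "c \<cdot> v = (\<lambda>x. c * v x)"

definition rf :: "'w \<Rightarrow> ('w \<Rightarrow> int) \<Rightarrow> 'w \<Rightarrow> int" where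
  "rf s v = v - coroot s v \<cdot> sr s"

lemma sr_apply: "sr s x = (if x = s then 1 else 0)"
  by (simp add: sr_def)

lemma smul_apply: "(c \<cdot> v) x = c * v x"
  by (simp add: smul_def)

lemmas pw_simps = plus_fun_apply zero_fun_apply minus_apply uminus_apply smul_apply sr_apply
lemmas pw = fun_eq_iff pw_simps

lemma coroot_add [simp]: "coroot s (v + w) = coroot s v + coroot s w"
  by (simp add: coroot_def pw_simps algebra_simps sum.distrib)

lemma coroot_diff [simp]: "coroot s (v - w) = coroot s v - coroot s w"
  by (simp add: coroot_def pw_simps algebra_simps sum_subtractf)

lemma coroot_smul [simp]: "coroot s (c \<cdot> v) = c * coroot s v"
  by (simp add: coroot_def pw_simps algebra_simps sum_distrib_left)

lemma coroot_sr: "t \<in> S \<Longrightarrow> coroot s (sr t) = A s t"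
proof -
  assume "t \<in> S"
  have "coroot s (sr t) = (\<Sum>x\<in>S. if x = t then A s t else 0)"
    unfolding coroot_def sr_def by (rule sum.cong) auto
  then show ?thesis using \<open>t \<in> S\<close> by simp
qed

lemma refl_add: "rf s (v + w) = rf s v + rf s w"
  by (auto simp: rf_def pw algebra_simps)

lemma refl_smul: "rf s (c \<cdot> v) = c \<cdot> rf s v"
  by (auto simp: rf_def pw algebra_simps)

text \<open>Both reflections preserve the affine plane through \<open>v\<close> spanned by two
  simple roots. This reduces the Coxeter relation on an arbitrary vector to arithmetic in two
  coordinates.\<close>

definition plane :: "('w \<Rightarrow> int) \<Rightarrow> 'w \<Rightarrow> 'w \<Rightarrow> int \<Rightarrow> int \<Rightarrow> 'w \<Rightarrow> int" where
  "plane v s t x y = v + x \<cdot> sr s + y \<cdot> sr t"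

lemma refl_plane1:
  assumes "s \<in> S" "t \<in> S"
  shows "rf s (plane v s t x y) = plane v s t (- x - coroot s v - A s t * y) y"
  using assms by (auto simp: rf_def plane_def pw algebra_simps coroot_sr A_diag)

lemma refl_plane2:
  assumes "s \<in> S" "t \<in> S"
  shows "rf t (plane v s t x y) = plane v s t x (- y - coroot t v - A t s * x)"
  using assms by (auto simp: rf_def plane_def pw algebra_simps coroot_sr A_diag)

lemma plane_0: "plane v s t 0 0 = v"
  by (auto simp: plane_def pw)

lemma refl_invol: "s \<in> S \<Longrightarrow> rf s (rf s v) = v"
  using refl_plane1[of s s v] A_diag[of s]
  by (auto simp: rf_def pw algebra_simps coroot_sr)

definition actw :: "'w list \<Rightarrow> ('w \<Rightarrow> int) \<Rightarrow> 'w \<Rightarrow> int" where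
  "actw ss v = foldr rf ss v"

lemma actw_simps [simp]: "actw [] v = v" "actw (s # ss) v = rf s (actw ss v)"
  "actw (xs @ ys) v = actw xs (actw ys v)"
  by (simp_all add: actw_def)

lemma alt_word_0 [simp]: "alt_word 0 s t = []"
  by (simp add: alt_word_def)

lemma alt_word_Suc: "alt_word (Suc n) s t = s # alt_word n t s"
proof -
  have "[0..<Suc n] = 0 # map Suc [0..<n]" by (metis map_Suc_upt upt_conv_Cons zero_less_Suc)
  then show ?thesis by (simp add: alt_word_def o_def)
qed

lemma actw_relator:
  assumes st: "s \<in> S" "t \<in> S"
  shows "actw (alt_word (2 * cox_m W s t) s t) v = v"
proof (cases "s = t")
  case True
  have "actw (alt_word (2 * n) s s) v = v" for n
    by (induction n) (simp_all add: alt_word_Suc refl_invol st)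
  then show ?thesis using True by simp
next
  case False
  define T where "T = (\<lambda>v. rf s (rf t v))"
  have step: "actw (alt_word (2 * n) s t) v = (T ^^ n) v" for n
    by (induction n) (simp_all add: alt_word_Suc T_def)
  have T: "T (plane v s t x y) = plane v s t (- x - coroot s v + A s t * (y + coroot t v + A t s * x)) (- y - coroot t v - A t s * x)" for x y
    using st by (simp add: T_def refl_plane1 refl_plane2 algebra_simps)
  \<comment> \<open>Each finite m is checked by unrolling the coordinate formula; for m =
    \<infinity>, encoded as 0, the power is the identity.\<close>
  have "(T ^^ cox_m W s t) (plane v s t 0 0) = plane v s t 0 0"
    using A_rel[OF st False]
    by (elim insertE emptyE) (simp_all add: eval_nat_numeral T)
  then show ?thesis by (simp add: plane_0 step)
qed

lemma S_carrier: "s \<in> S \<Longrightarrow> s \<in> carrier W"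
  and generate_S: "generate W S = carrier W"
  and ord_S: "s \<in> S \<Longrightarrow> ord s = 2"
  and presentation: "u \<in> lists S \<Longrightarrow> v \<in> lists S \<Longrightarrow>
     word_prod W u = word_prod W v \<longleftrightarrow> equivclp (coxeter_step W S) u v"
  using cox by (auto simp: coxeter_system_def)

lemma word_prod_simps [simp]: "word_prod W [] = \<one>" "word_prod W (s # ss) = s \<otimes> word_prod W ss"
  by (simp_all add: word_prod_def)

lemma word_prod_closed [simp]: "ss \<in> lists S \<Longrightarrow> word_prod W ss \<in> carrier W"
  by (induction ss) (auto intro: S_carrier)

lemma word_prod_append:
  "xs \<in> lists S \<Longrightarrow> ys \<in> lists S \<Longrightarrow> word_prod W (xs @ ys) = word_prod W xs \<otimes> word_prod W ys"
  by (induction xs) (auto simp: m_assoc S_carrier)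

lemma S_sq: "s \<in> S \<Longrightarrow> s \<otimes> s = \<one>"
  using ord_S[of s] pow_ord_eq_1[of s] S_carrier[of s] by (simp add: numeral_2_eq_2)

lemma S_sq2 [simp]: "s \<in> S \<Longrightarrow> x \<in> carrier W \<Longrightarrow> s \<otimes> (s \<otimes> x) = x"
  "s \<in> S \<Longrightarrow> x \<in> carrier W \<Longrightarrow> x \<otimes> s \<otimes> s = x"
  using S_sq S_carrier by (metis m_assoc l_one) (metis S_sq S_carrier m_assoc r_one)

lemma inv_S: "s \<in> S \<Longrightarrow> inv s = s"
  using S_sq S_carrier inv_equality by blast

lemma generate_word:
  assumes "J \<subseteq> S" "w \<in> generate W J"
  shows "\<exists>ss\<in>lists J. word_prod W ss = w"
  using assms(2)
proof induction
  case one show ?case by (rule bexI[of _ "[]"]) auto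
next
  case (incl h) then show ?case using assms(1) by (intro bexI[of _ "[h]"]) (auto simp: S_carrier)
next
  case (inv h) then show ?case using assms(1) by (intro bexI[of _ "[h]"]) (auto simp: S_carrier inv_S)
next
  case (eng h1 h2)
  then obtain x y where "x \<in> lists J" "y \<in> lists J" "word_prod W x = h1" "word_prod W y = h2" by blast
  then show ?case using assms(1) word_prod_append[of x y]
    by (intro bexI[of _ "x @ y"]) (auto simp: lists_mono[THEN subsetD])
qed

lemma word_generate: "ss \<in> lists J \<Longrightarrow> J \<subseteq> S \<Longrightarrow> word_prod W ss \<in> generate W J"
  by (induction ss) (auto intro: generate.one generate.eng generate.incl)

lemma ex_word: "w \<in> carrier W \<Longrightarrow> \<exists>ss\<in>lists S. word_prod W ss = w"
  using generate_word[of S w] generate_S by auto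

lemma step_inv:
  assumes "coxeter_step W S u v"
  shows "actw u x = actw v x" "even (length u) = even (length v)"
proof -
  from assms obtain a b s t where *: "s \<in> S" "t \<in> S"
    "u = a @ alt_word (2 * cox_m W s t) s t @ b" "v = a @ b"
    by (auto elim!: coxeter_step.cases)
  show "actw u x = actw v x" using actw_relator[OF *(1,2)] by (simp only: *(3,4) actw_simps)
  show "even (length u) = even (length v)" by (simp add: *(3,4) alt_word_def)
qed

text \<open>Both quantities are constant along relators, so they descend to the group: the first
  gives the reflection representation, the second the sign character that keeps
  \<open>len (w \<otimes> s)\<close> different from \<open>len w\<close>.\<close>

lemma word_inv:
  assumes "u \<in> lists S" "v \<in> lists S" "word_prod W u = word_prod W v"
  shows "actw u x = actw v x" "even (length u) = even (length v)"
proof -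
  have "equivclp (coxeter_step W S) u v" using assms presentation by blast
  then have "actw u x = actw v x \<and> even (length u) = even (length v)"
    unfolding equivclp_def
  proof (induction rule: rtranclp_induct)
    case base then show ?case by simp
  next
    case (step y z) then show ?case using step_inv[of y z] step_inv[of z y] by (auto simp: symclp_def)
  qed
  then show "actw u x = actw v x" "even (length u) = even (length v)" by auto
qed

definition act :: "'w \<Rightarrow> ('w \<Rightarrow> int) \<Rightarrow> 'w \<Rightarrow> int" where
  "act w = actw (SOME ss. ss \<in> lists S \<and> word_prod W ss = w)"

lemma act_word: "ss \<in> lists S \<Longrightarrow> act (word_prod W ss) v = actw ss v"
proof -
  assume ss: "ss \<in> lists S"
  let ?P = "\<lambda>xs. xs \<in> lists S \<and> word_prod W xs = word_prod W ss"
  have "?P (SOME xs. ?P xs)" by (rule someI[of ?P ss]) (simp add: ss)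
  then show ?thesis unfolding act_def using ss by (intro word_inv(1)) auto
qed

lemma act_one [simp]: "act \<one> v = v"
  using act_word[of "[]"] by simp

lemma act_S: "s \<in> S \<Longrightarrow> act s v = rf s v"
  using act_word[of "[s]" v] by (simp add: S_carrier)

lemma act_mult:
  assumes "x \<in> carrier W" "y \<in> carrier W"
  shows "act (x \<otimes> y) v = act x (act y v)"
proof -
  obtain xs ys where "xs \<in> lists S" "ys \<in> lists S" "x = word_prod W xs" "y = word_prod W ys"
    using assms ex_word by metis
  then show ?thesis using act_word[of "xs @ ys" v] by (simp add: word_prod_append act_word)
qed

lemma act_add: "w \<in> carrier W \<Longrightarrow> act w (u + v) = act w u + act w v"
proof -
  have "actw ss (u + v) = actw ss u + actw ss v" for ss
    by (induction ss) (simp_all only: actw_simps refl_add)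
  then show "w \<in> carrier W \<Longrightarrow> ?thesis" using ex_word act_word by metis
qed

lemma act_smul: "w \<in> carrier W \<Longrightarrow> act w (c \<cdot> v) = c \<cdot> act w v"
proof -
  have "actw ss (c \<cdot> v) = c \<cdot> actw ss v" for ss
    by (induction ss) (simp_all only: actw_simps refl_smul)
  then show "w \<in> carrier W \<Longrightarrow> ?thesis" using ex_word act_word by metis
qed

lemma smul_neg1: "(- 1) \<cdot> v = - v" by (auto simp: pw)
lemma smul_0 [simp]: "0 \<cdot> v = 0" "c \<cdot> 0 = 0" by (auto simp: pw)

lemma act_uminus: "w \<in> carrier W \<Longrightarrow> act w (- v) = - act w v"
  using act_smul[of w "-1" v] by (simp add: smul_neg1)

lemma act_diff: "w \<in> carrier W \<Longrightarrow> act w (u - v) = act w u - act w v"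
  using act_add[of w u "- v"] by (simp add: act_uminus)

lemma act_zero [simp]: "w \<in> carrier W \<Longrightarrow> act w 0 = 0"
  using act_smul[of w 0 0] by simp

lemma act_sum: "w \<in> carrier W \<Longrightarrow> act w (\<Sum>i\<in>I. f i) = (\<Sum>i\<in>I. act w (f i))"
  by (induction I rule: infinite_finite_induct) (auto simp: act_add)

lemma act_inv [simp]:
  assumes "w \<in> carrier W" shows "act w (act (inv w) v) = v" "act (inv w) (act w v) = v"
  using assms act_mult[of w "inv w" v] act_mult[of "inv w" w v] by auto

lemma act_eq_iff [simp]: "w \<in> carrier W \<Longrightarrow> act w u = act w v \<longleftrightarrow> u = v"
  by (metis act_inv(2))

definition len :: "'w \<Rightarrow> nat" where "len w = cox_length W S w"

lemma len_word: "ss \<in> lists S \<Longrightarrow> len (word_prod W ss) \<le> length ss"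
  unfolding len_def cox_length_def by (rule Least_le) auto

lemma reduced_word:
  assumes "w \<in> carrier W"
  obtains ss where "ss \<in> lists S" "length ss = len w" "word_prod W ss = w"
proof -
  have "\<exists>n. \<exists>ss\<in>lists S. length ss = n \<and> word_prod W ss = w" using ex_word[OF assms] by blast
  from LeastI_ex[OF this] show ?thesis using that unfolding len_def cox_length_def by blast
qed

lemma len_mult:
  assumes "x \<in> carrier W" "y \<in> carrier W" shows "len (x \<otimes> y) \<le> len x + len y"
proof -
  obtain xs ys where "xs \<in> lists S" "length xs = len x" "word_prod W xs = x"
    "ys \<in> lists S" "length ys = len y" "word_prod W ys = y"
    using reduced_word assms by metis
  then show ?thesis using len_word[of "xs @ ys"] by (simp add: word_prod_append)
qed

lemma len_S: "s \<in> S \<Longrightarrow> len s \<le> 1"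
  using len_word[of "[s]"] by (simp add: S_carrier)

lemma len_one [simp]: "len \<one> = 0"
  using len_word[of "[]"] by simp

lemma len_0: "w \<in> carrier W \<Longrightarrow> len w = 0 \<Longrightarrow> w = \<one>"
  by (metis length_0_conv reduced_word word_prod_simps(1))

lemma len_parity:
  assumes "w \<in> carrier W" "s \<in> S" shows "even (len (w \<otimes> s)) \<longleftrightarrow> odd (len w)"
proof -
  obtain xs where xs: "xs \<in> lists S" "length xs = len w" "word_prod W xs = w"
    using reduced_word assms by metis
  obtain ys where ys: "ys \<in> lists S" "length ys = len (w \<otimes> s)" "word_prod W ys = w \<otimes> s"
    using reduced_word assms S_carrier by (metis m_closed)
  have "even (length (xs @ [s])) = even (length ys)"
    using xs ys assms by (intro word_inv) (auto simp: word_prod_append S_carrier)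
  then show ?thesis using xs ys by auto
qed

lemma len_right:
  assumes "w \<in> carrier W" "s \<in> S"
  shows "len (w \<otimes> s) = Suc (len w) \<or> Suc (len (w \<otimes> s)) = len w"
proof -
  have "len (w \<otimes> s) \<le> len w + 1" using len_mult[of w s] len_S[of s] assms S_carrier[of s] by linarith
  moreover have "len w \<le> len (w \<otimes> s) + 1"
    using len_mult[of "w \<otimes> s" s] len_S[of s] assms S_carrier[of s] by auto
  moreover have "len (w \<otimes> s) \<noteq> len w" using len_parity[OF assms] by auto
  ultimately show ?thesis by linarith
qed

lemma ex_descent:
  assumes "w \<in> carrier W" "w \<noteq> \<one>"
  obtains s where "s \<in> S" "Suc (len (w \<otimes> s)) = len w"
proof -
  obtain xs where xs: "xs \<in> lists S" "length xs = len w" "word_prod W xs = w"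
    using reduced_word assms by metis
  have "xs \<noteq> []" using xs assms by auto
  then obtain ys s where ys: "xs = ys @ [s]" by (metis rev_exhaust)
  have "ys \<in> lists S" "s \<in> S" using xs(1) ys by auto
  then have "w \<otimes> s = word_prod W ys"
    unfolding xs(3)[symmetric] ys by (simp add: word_prod_append S_carrier)
  then have "len (w \<otimes> s) < len w" using len_word[of ys] xs ys by auto
  then show ?thesis using that[of s] xs ys len_right[OF assms(1), of s] by auto
qed

end

lemma not_distinct_adjE:
  assumes "\<not> distinct_adj xs"
  obtains a c b where "xs = a @ c # c # b"
proof -
  have "\<exists>a c b. xs = a @ c # c # b" using assms
  proof (induction xs)
    case Nil then show ?case by simp
  next
    case (Cons x xs)
    show ?case
    proof (cases "xs \<noteq> [] \<and> hd xs = x")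
      case True
      then show ?thesis by (metis append_Nil list.collapse)
    next
      case False
      then have "\<not> distinct_adj xs" using Cons.prems by (cases xs) auto
      then show ?thesis using Cons.IH by (metis append_Cons)
    qed
  qed
  then show ?thesis using that by blast
qed

text \<open>Coordinates in a rank two plane after j alternating reflections. Exchanging the two
  coordinates and the two Cartan integers at every step lets one formula stand for both
  reflections.\<close>

primrec dih :: "nat \<Rightarrow> int \<Rightarrow> int \<Rightarrow> int \<Rightarrow> int \<Rightarrow> int \<times> int" where
  "dih 0 a b x y = (x, y)"
| "dih (Suc j) a b x y = dih j b a (- y - b * x) x"

context coxeter_gcm
begin

section \<open>Rank two computations and positivity of roots\<close>

lemma alt_split:
  "alt_word (m + n) s t = alt_word m s t @ (if even m then alt_word n s t else alt_word n t s)"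
  by (induction m arbitrary: s t) (auto simp: alt_word_Suc)

lemma rev_alt: "rev (alt_word n s t) = (if even n then alt_word n t s else alt_word n s t)"
proof (induction n)
  case (Suc n)
  show ?case using alt_split[of n 1 s t] Suc by (auto simp: alt_word_Suc)
qed simp

lemma alt_word_lists: "s \<in> S \<Longrightarrow> t \<in> S \<Longrightarrow> alt_word n s t \<in> lists S"
  by (auto simp: alt_word_def)

lemma rev_lists: "rev xs \<in> lists J \<longleftrightarrow> xs \<in> lists J"
  by (simp add: in_lists_conv_set)

lemma length_alt [simp]: "length (alt_word n s t) = n"
  by (simp add: alt_word_def)

lemma alt_char:
  "\<lbrakk>ys \<in> lists {s,t}; distinct_adj ys; ys = [] \<or> hd ys = t\<rbrakk> \<Longrightarrow> ys = alt_word (length ys) t s"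
proof (induction ys arbitrary: s t)
  case (Cons y ys)
  have "ys = alt_word (length ys) s t"
  proof (rule Cons.IH)
    show "ys \<in> lists {t, s}" using Cons.prems by auto
    show "distinct_adj ys" using Cons.prems by (cases ys) auto
    show "ys = [] \<or> hd ys = s" using Cons.prems by (cases ys) auto
  qed
  then show ?case using Cons.prems by (auto simp: alt_word_Suc)
qed simp

lemma word_prod_rev: "xs \<in> lists S \<Longrightarrow> word_prod W (rev xs) = inv (word_prod W xs)"
proof (induction xs)
  case (Cons x xs)
  then have "word_prod W (rev xs @ [x]) = word_prod W (rev xs) \<otimes> x"
    by (subst word_prod_append) (auto simp: S_carrier)
  then show ?case using Cons by (simp add: inv_mult_group S_carrier inv_S)
qed simp

lemma braid_word:
  assumes "s \<in> S" "t \<in> S"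
  shows "word_prod W (alt_word (cox_m W s t) s t) = word_prod W (alt_word (cox_m W s t) t s)"
proof -
  let ?m = "cox_m W s t"
  note L = alt_word_lists[OF assms, of ?m] alt_word_lists[OF assms(2,1), of ?m]
  have "coxeter_step W S ([] @ alt_word (2 * ?m) s t @ []) ([] @ [])"
    using assms by (intro coxeter_step.intros) auto
  then have "word_prod W (alt_word (2 * ?m) s t) = \<one>"
    using presentation[of "alt_word (2 * ?m) s t" "[]"] alt_word_lists[OF assms]
    by (auto simp: equivclp_def symclp_def)
  moreover have "alt_word (2 * ?m) s t = alt_word ?m s t @ rev (alt_word ?m t s)"
    using alt_split[of ?m ?m s t] by (auto simp: rev_alt mult_2)
  ultimately have "word_prod W (alt_word ?m s t) \<otimes> inv (word_prod W (alt_word ?m t s)) = \<one>"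
    using L by (metis word_prod_append word_prod_rev rev_lists)
  then show ?thesis
    using assms by (metis alt_word_lists inv_closed inv_equality inv_inv word_prod_closed)
qed

lemma braid_rev:
  assumes "s \<in> S" "t \<in> S"
  shows "word_prod W (rev (alt_word (cox_m W s t) t s)) = word_prod W (rev (alt_word (cox_m W s t) s t))"
  using braid_word[OF assms] assms by (simp add: word_prod_rev alt_word_lists)

definition nonneg :: "('w \<Rightarrow> int) \<Rightarrow> bool" where
  "nonneg v \<longleftrightarrow> (\<forall>x. v x \<ge> 0)"

definition pos :: "('w \<Rightarrow> int) \<Rightarrow> bool" where
  "pos v \<longleftrightarrow> nonneg v \<and> v \<noteq> 0"

text \<open>The step takes (x, y) to (2x - y, x), and the invariant \<open>x \<ge> y \<ge> 0\<close>
  reproduces itself.\<close>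

lemma dihedral_nonneg_inf:
  assumes st: "s \<in> S" "t \<in> S" and "A s t = -2" "A t s = -2" "x \<ge> y" "y \<ge> 0"
  shows "\<exists>x' y'. 0 \<le> x' \<and> 0 \<le> y' \<and> actw (rev (alt_word j t s)) (plane 0 s t x y) = plane 0 s t x' y'"
  using assms
proof (induction j arbitrary: s t x y)
  case 0 then show ?case by (intro exI[of _ x] exI[of _ y]) simp
next
  case (Suc j)
  have sw: "plane v s t x y = plane v t s y x" for v x y s t by (auto simp: plane_def pw)
  have c0: "coroot t 0 = 0" by (simp add: coroot_def pw_simps)
  have "rf t (plane 0 s t x y) = plane 0 t s (2 * x - y) x"
    using Suc.prems refl_plane2[of s t 0 x y] sw[of 0 s t] by (simp add: c0 algebra_simps)
  then show ?case using Suc.IH[of t s x "2 * x - y"] Suc.prems sw[of 0 t s]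
    by (auto simp: alt_word_Suc)
qed

lemma plane_swap: "plane v s t x y = plane v t s y x"
  by (auto simp: plane_def pw)

lemma actw_dih:
  assumes "s \<in> S" "t \<in> S"
  shows "actw (rev (alt_word j t s)) (plane 0 s t x y) =
    (case dih j (A s t) (A t s) x y of (p, q) \<Rightarrow> if even j then plane 0 s t p q else plane 0 t s p q)"
  using assms
proof (induction j arbitrary: s t x y)
  case (Suc j)
  have c0: "coroot t 0 = 0" by (simp add: coroot_def pw_simps)
  have "rf t (plane 0 s t x y) = plane 0 t s (- y - A t s * x) x"
    using Suc.prems refl_plane2[of s t 0 x y] plane_swap[of 0 s t] by (simp add: c0)
  then show ?case using Suc.IH[OF Suc.prems(2,1), of "- y - A t s * x" x]
    by (simp add: alt_word_Suc split: prod.splits)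
qed simp

lemma dihedral_nonneg:
  assumes st: "s \<in> S" "t \<in> S" "s \<noteq> t" and j: "cox_m W s t = 0 \<or> j < cox_m W s t"
  shows "\<exists>x y. 0 \<le> x \<and> 0 \<le> y \<and> actw (rev (alt_word j t s)) (sr s) = plane 0 s t x y"
proof -
  have s: "sr s = plane 0 s t 1 0" by (auto simp: plane_def pw)
  show ?thesis
  proof (cases "cox_m W s t = 0")
    case True
    then have "A s t = -2" "A t s = -2" using A_rel[OF st] by auto
    from dihedral_nonneg_inf[OF st(1,2) this, of 0 1 j] show ?thesis unfolding s by simp
  next
    case False
    then have jm: "j < cox_m W s t" using j by simp
    have "j \<in> {0,1,2,3,4,5}" using A_rel[OF st] jm by auto
    \<comment> \<open>Since j < m \<le> 6, only finitely many numerical cases remain; they list the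
      positive roots of the finite crystallographic rank two systems.\<close>
    then have "case dih j (A s t) (A t s) 1 0 of (p, q) \<Rightarrow> 0 \<le> p \<and> 0 \<le> q"
      using A_rel[OF st] jm by (elim insertE emptyE) (simp_all add: eval_nat_numeral)
    then obtain p q where pq: "dih j (A s t) (A t s) 1 0 = (p, q)" "0 \<le> p" "0 \<le> q" by auto
    have "actw (rev (alt_word j t s)) (sr s) = (if even j then plane 0 s t p q else plane 0 s t q p)"
      unfolding s using actw_dih[OF st(1,2), of j 1 0] plane_swap[of 0 t s p q] pq(1) by simp
    then show ?thesis using pq(2,3) by metis
  qed
qed

lemma pos_sr [simp]: "pos (sr s)"
  by (auto simp: pos_def nonneg_def pw)

lemma root_nz: "w \<in> carrier W \<Longrightarrow> act w (sr s) \<noteq> 0"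
  using act_eq_iff[of w "sr s" 0] pos_sr[of s] by (auto simp: pos_def)

lemma act_plane: "w \<in> carrier W \<Longrightarrow> act w (plane v s t x y) = act w v + x \<cdot> act w (sr s) + y \<cdot> act w (sr t)"
  unfolding plane_def by (simp only: act_add act_smul)

text \<open>Write \<open>w\<close> as \<open>v\<close> times a word in s and t with \<open>v\<close>
  as short as possible. Minimality brings \<open>v\<close> under the induction hypothesis for both
  letters. The word is alternating and shorter than m, so it sends \<open>sr s\<close> to a
  nonnegative combination of the two simple roots.\<close>

theorem root_pos:
  assumes "w \<in> carrier W" "s \<in> S" "len (w \<otimes> s) > len w"
  shows "pos (act w (sr s))"
  using assms
proof (induction "len w" arbitrary: w s rule: less_induct)
  case less
  show ?case
  proof (cases "w = \<one>")
    case True then show ?thesis by simp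
  next
    case False
    obtain t where t: "t \<in> S" "Suc (len (w \<otimes> t)) = len w" using ex_descent less.prems False by metis
    have st: "s \<noteq> t" using t less.prems by auto
    have wS: "w \<in> carrier W" "s \<in> carrier W" "t \<in> carrier W" using less.prems t S_carrier by auto
    define P where "P = (\<lambda>n. \<exists>v xs. v \<in> carrier W \<and> xs \<in> lists {s,t} \<and> w = v \<otimes> word_prod W xs \<and>
      len w = len v + length xs \<and> len v = n)"
    have P0: "P (len (w \<otimes> t))" unfolding P_def
      by (rule exI[of _ "w \<otimes> t"], rule exI[of _ "[t]"]) (use t wS in auto)
    define n where "n = (LEAST n. P n)"
    have Pn: "P n" unfolding n_def by (rule LeastI, rule P0)
    have nle: "n \<le> k" if "P k" for k unfolding n_def using that by (rule Least_le)
    obtain v xs where v: "v \<in> carrier W" "xs \<in> lists {s,t}" "w = v \<otimes> word_prod W xs"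
      "len w = len v + length xs" "len v = n" using Pn unfolding P_def by blast
    have xsS: "xs \<in> lists S" using v(2) t(1) less.prems(2) by auto
    have up: "len (v \<otimes> c) > len v" if c: "c \<in> {s,t}" for c
    proof (rule ccontr)
      assume nup: "\<not> ?thesis"
      have cS: "c \<in> S" "c \<in> carrier W" using c less.prems t S_carrier by auto
      then have l: "Suc (len (v \<otimes> c)) = len v" using len_right[of v c] v(1) nup by auto
      have "P (len (v \<otimes> c))" unfolding P_def
        by (rule exI[of _ "v \<otimes> c"], rule exI[of _ "c # xs"])
          (use v l c cS xsS in \<open>auto simp: m_assoc\<close>)
      then show False using nle l v(5) by fastforce
    qed
    have vlt: "len v < len w" using nle[OF P0] v(5) t by linarith
    have IHs: "pos (act v (sr c))" if "c \<in> {s,t}" for c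
      using less.hyps[OF vlt v(1) _ up[OF that]] that less.prems t by auto
    have short: "len (v \<otimes> word_prod W ys) \<le> len v + length ys" if "ys \<in> lists S" for ys
      using len_mult[OF v(1) word_prod_closed[OF that]] len_word[OF that] by linarith
    have da: "distinct_adj xs"
    proof (rule ccontr)
      assume "\<not> ?thesis"
      then obtain a c b where abc: "xs = a @ c # c # b" by (rule not_distinct_adjE)
      then have "a \<in> lists S" "b \<in> lists S" "c \<in> S" using xsS by auto
      then have "word_prod W xs = word_prod W (a @ b)" unfolding abc
        by (simp add: word_prod_append)
      then have "len w \<le> len v + length (a @ b)" using v(3) short[of "a @ b"] abc xsS by auto
      then show False using v(4) abc by auto
    qed
    \<comment> \<open>A spelling of the dihedral part ending in s would cancel against the s of
      \<open>w \<otimes> s\<close> and contradict the length hypothesis. This excludes the last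
      letter s and, after a braid move, all words of length at least m.\<close>
    have noend: False if "ys \<in> lists S" "word_prod W xs = word_prod W (ys @ [s])" "length ys < length xs" for ys
    proof -
      have "w \<otimes> s = v \<otimes> word_prod W ys"
        using that v(1) less.prems(2) wS unfolding v(3) that(2) by (simp add: word_prod_append m_assoc S_sq)
      then have "len (w \<otimes> s) \<le> len v + length ys" using short[OF that(1)] by simp
      then show False using v(4) that(3) less.prems(3) by linarith
    qed
    have last: "rev xs = [] \<or> hd (rev xs) = t"
    proof (rule ccontr)
      assume "\<not> ?thesis"
      then have "xs \<noteq> []" "last xs \<noteq> t" by (auto simp: hd_rev)
      then have "last xs = s" using v(2) last_in_set[of xs] by auto
      then have "xs = butlast xs @ [s]" using \<open>xs \<noteq> []\<close> by (metis append_butlast_last_id)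
      moreover have "butlast xs \<in> lists S" using xsS by (meson in_listsI in_listsD in_set_butlastD)
      ultimately show False using noend[of "butlast xs"] \<open>xs \<noteq> []\<close> by simp
    qed
    have rx: "rev xs = alt_word (length xs) t s"
      using alt_char[of "rev xs" s t] v(2) da last by (simp add: in_lists_conv_set)
    then have xs: "xs = rev (alt_word (length xs) t s)" by (metis rev_rev_ident)
    have j: "cox_m W s t = 0 \<or> length xs < cox_m W s t"
    proof (rule ccontr)
      assume H: "\<not> ?thesis"
      let ?m = "cox_m W s t"
      have m: "?m \<noteq> 0" "?m \<le> length xs" using H by auto
      define k where "k = length xs - ?m"
      have len: "length xs = ?m + k" using m by (simp add: k_def)
      define R where "R = rev (if even ?m then alt_word k t s else alt_word k s t)"
      have RS: "R \<in> lists S" "length R = k"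
        using alt_word_lists[of s t k] alt_word_lists[of t s k] t less.prems by (auto simp: R_def in_lists_conv_set)
      have e: "xs = R @ rev (alt_word ?m t s)"
        using xs unfolding len alt_split R_def by simp
      obtain m' where m': "?m = Suc m'" using m(1) not0_implies_Suc by blast
      have "rev (alt_word ?m s t) = rev (alt_word m' t s) @ [s]" unfolding m' by (simp add: alt_word_Suc)
      moreover have altS: "rev (alt_word n a b) \<in> lists S" if "a \<in> {s,t}" "b \<in> {s,t}" for n a b
        using alt_word_lists[of a b n] that t less.prems by (auto simp: in_lists_conv_set)
      moreover have "word_prod W xs = word_prod W (R @ rev (alt_word ?m s t))"
        unfolding e using braid_rev[OF less.prems(2) t(1)] RS altS by (simp add: word_prod_append)
      ultimately have "word_prod W xs = word_prod W ((R @ rev (alt_word m' t s)) @ [s])" by simp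
      moreover have "length (R @ rev (alt_word m' t s)) < length xs" using len RS m' by simp
      ultimately show False using noend RS altS by (metis append_in_lists_conv insertI1 insertI2)
    qed
    obtain x y where xy: "0 \<le> x" "0 \<le> y" "actw xs (sr s) = plane 0 s t x y"
      using dihedral_nonneg[OF less.prems(2) t(1) st j] xs by auto
    have "act w (sr s) = act v (plane 0 s t x y)"
      using v(1,3) xsS xy(3) by (simp add: act_mult act_word)
    also have "\<dots> = x \<cdot> act v (sr s) + y \<cdot> act v (sr t)" using v(1) by (simp only: act_plane) simp
    finally have "nonneg (act w (sr s))" using IHs[of s] IHs[of t] xy by (auto simp: pos_def nonneg_def pw_simps)
    then show ?thesis using root_nz wS by (simp add: pos_def)
  qed
qed

lemma act_S_sr: "s \<in> S \<Longrightarrow> act s (sr s) = - sr s"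
  by (auto simp: act_S rf_def pw coroot_sr A_diag)

lemma act_mult_s: "w \<in> carrier W \<Longrightarrow> s \<in> S \<Longrightarrow> act (w \<otimes> s) (sr s) = - act w (sr s)"
  by (simp add: act_mult S_carrier act_S_sr act_uminus)

lemma not_pos_neg: "pos v \<Longrightarrow> \<not> pos (- v)"
  by (auto simp: pos_def nonneg_def pw) (metis antisym_conv)

lemma pos_iff_len:
  assumes "w \<in> carrier W" "s \<in> S"
  shows "pos (act w (sr s)) \<longleftrightarrow> len (w \<otimes> s) > len w"
proof
  assume p: "pos (act w (sr s))"
  show "len (w \<otimes> s) > len w"
  proof (rule ccontr)
    assume "\<not> ?thesis"
    then have "len ((w \<otimes> s) \<otimes> s) > len (w \<otimes> s)" using len_right[OF assms] assms by auto
    then have "pos (act (w \<otimes> s) (sr s))" using assms S_carrier by (intro root_pos) auto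
    then show False using p not_pos_neg assms by (auto simp: act_mult_s)
  qed
qed (use assms root_pos in auto)

definition roots :: "('w \<Rightarrow> int) set" where
  "roots = {act w (sr s) | w s. w \<in> carrier W \<and> s \<in> S}"

lemma roots_act: "w \<in> carrier W \<Longrightarrow> \<beta> \<in> roots \<Longrightarrow> act w \<beta> \<in> roots"
  unfolding roots_def by clarsimp (metis act_mult m_closed)

lemma roots_sr: "s \<in> S \<Longrightarrow> sr s \<in> roots"
  unfolding roots_def using act_one one_closed by (metis (mono_tags, lifting) mem_Collect_eq)

lemma roots_uminus: "\<beta> \<in> roots \<Longrightarrow> - \<beta> \<in> roots"
  unfolding roots_def by clarsimp (metis act_mult_s m_closed S_carrier)

lemma root_sign: "\<beta> \<in> roots \<Longrightarrow> pos \<beta> \<or> pos (- \<beta>)"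
proof -
  assume "\<beta> \<in> roots"
  then obtain w s where ws: "w \<in> carrier W" "s \<in> S" "\<beta> = act w (sr s)" unfolding roots_def by blast
  show ?thesis
  proof (cases "len (w \<otimes> s) > len w")
    case False
    then have "len ((w \<otimes> s) \<otimes> s) > len (w \<otimes> s)" using len_right[OF ws(1,2)] ws by auto
    then have "pos (act (w \<otimes> s) (sr s))" using ws S_carrier by (intro root_pos) auto
    then show ?thesis using ws by (simp add: act_mult_s)
  qed (use root_pos ws in auto)
qed

lemma root_neg_iff: "\<beta> \<in> roots \<Longrightarrow> pos (- \<beta>) \<longleftrightarrow> \<not> pos \<beta>"
  using root_sign not_pos_neg by blast

lemma root_nonneg: "\<beta> \<in> roots \<Longrightarrow> \<beta> x > 0 \<Longrightarrow> pos \<beta>"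
proof -
  assume a: "\<beta> \<in> roots" "\<beta> x > 0"
  have "\<not> pos (- \<beta>)"
  proof
    assume "pos (- \<beta>)"
    then have "(- \<beta>) x \<ge> 0" unfolding pos_def nonneg_def by blast
    then show False using a by (simp add: pw_simps)
  qed
  then show ?thesis using root_sign a by blast
qed

lemma root_support: "\<beta> \<in> roots \<Longrightarrow> x \<notin> S \<Longrightarrow> \<beta> x = 0"
proof -
  have "v x = 0 \<Longrightarrow> x \<notin> S \<Longrightarrow> ss \<in> lists S \<Longrightarrow> actw ss v x = 0" for ss v
  proof (induction ss)
    case (Cons a ss)
    then have "a \<noteq> x" "actw ss v x = 0" by auto
    then show ?case by (simp add: rf_def pw_simps)
  qed simp
  then show "\<beta> \<in> roots \<Longrightarrow> x \<notin> S \<Longrightarrow> \<beta> x = 0"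
    unfolding roots_def using ex_word act_word by (clarsimp simp: ) (metis sr_apply)
qed

lemma cancel_inv: "x \<in> carrier W \<Longrightarrow> y \<in> carrier W \<Longrightarrow> x \<otimes> (inv x \<otimes> y) = y"
  "x \<in> carrier W \<Longrightarrow> y \<in> carrier W \<Longrightarrow> inv x \<otimes> (x \<otimes> y) = y"
  by (simp_all add: m_assoc[symmetric])

lemma nonneg_act_S: "x \<noteq> s \<Longrightarrow> s \<in> S \<Longrightarrow> act s \<beta> x = \<beta> x"
  by (simp add: act_S rf_def pw_simps)

lemma root_pos_nonneg: "pos \<beta> \<Longrightarrow> \<beta> x \<ge> 0"
  by (simp add: pos_def nonneg_def)

text \<open>The reflection changes only the coordinate at s, so a sign change leaves no other
  nonzero coordinate. The remaining multiple of \<open>sr s\<close> is \<open>sr s\<close> itself,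
  because it is conjugate to a simple root, which has a coordinate equal to 1.\<close>

lemma simple_flip:
  assumes b: "\<beta> \<in> roots" "pos \<beta>" and s: "s \<in> S" and np: "\<not> pos (act s \<beta>)"
  shows "\<beta> = sr s"
proof -
  have z: "\<beta> x = 0" if "x \<noteq> s" for x
  proof -
    have "\<not> act s \<beta> x > 0" using np root_nonneg[OF roots_act[OF S_carrier[OF s] b(1)]] by blast
    then show ?thesis using nonneg_act_S[OF that s] root_pos_nonneg[OF b(2), of x] by simp
  qed
  define n where "n = \<beta> s"
  have bn: "\<beta> = n \<cdot> sr s" using z by (auto simp: pw n_def)
  have "n \<noteq> 0"
  proof
    assume "n = 0" then show False using bn b(2) by (simp add: pos_def)
  qed
  moreover have "n \<ge> 0" unfolding n_def using root_pos_nonneg[OF b(2)] .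
  ultimately have n: "n > 0" by simp
  obtain w t where w: "w \<in> carrier W" "t \<in> S" "\<beta> = act w (sr t)" using b(1) unfolding roots_def by blast
  have "sr t = act (inv w) (n \<cdot> sr s)" using w bn by simp
  then have "sr t = n \<cdot> act (inv w) (sr s)" using w by (simp add: act_smul)
  then have "sr t t = (n \<cdot> act (inv w) (sr s)) t" by (rule arg_cong)
  then have "1 = n * act (inv w) (sr s) t" by (simp add: sr_apply smul_apply)
  then have "n = 1" using n by (metis pos_zmult_eq_1_iff)
  then show ?thesis using bn by (simp add: smul_def)
qed

section \<open>Inversion sets and faithfulness\<close>

definition Inv :: "'w \<Rightarrow> ('w \<Rightarrow> int) set" where
  "Inv w = {\<beta> \<in> roots. pos \<beta> \<and> \<not> pos (act w \<beta>)}"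

text \<open>Prepending a letter s adds at most the one root that the rest of the word sends to
  \<open>sr s\<close>, by \<open>simple_flip\<close>.\<close>

lemma finite_Inv: "w \<in> carrier W \<Longrightarrow> finite (Inv w)"
proof -
  have "finite (Inv (word_prod W ss))" if "ss \<in> lists S" for ss
    using that
  proof (induction ss)
    case Nil then show ?case by (simp add: Inv_def)
  next
    case (Cons s ss)
    let ?w = "word_prod W ss"
    have w: "?w \<in> carrier W" "s \<in> S" "s \<in> carrier W" using Cons S_carrier by auto
    have "Inv (s \<otimes> ?w) \<subseteq> Inv ?w \<union> {act (inv ?w) (sr s)}"
    proof
      fix \<beta> assume b: "\<beta> \<in> Inv (s \<otimes> ?w)"
      show "\<beta> \<in> Inv ?w \<union> {act (inv ?w) (sr s)}"
      proof (cases "pos (act ?w \<beta>)")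
        case True
        have "act ?w \<beta> = sr s"
          using simple_flip[OF roots_act True w(2)] b w by (simp add: Inv_def act_mult)
        then show ?thesis using w act_inv(2)[of ?w \<beta>] by simp
      qed (use b in \<open>auto simp: Inv_def\<close>)
    qed
    then show ?case using Cons by (auto intro: finite_subset)
  qed
  then show "w \<in> carrier W \<Longrightarrow> ?thesis" using ex_word by metis
qed

lemma pos_all_one:
  assumes "w \<in> carrier W" "\<And>s. s \<in> S \<Longrightarrow> pos (act w (sr s))"
  shows "w = \<one>"
proof (rule ccontr)
  assume "w \<noteq> \<one>"
  then obtain s where "s \<in> S" "Suc (len (w \<otimes> s)) = len w" using ex_descent assms by metis
  then show False using assms pos_iff_len[of w s] by auto
qed

lemma act_faithful:
  assumes "w \<in> carrier W" "\<And>s. s \<in> S \<Longrightarrow> act w (sr s) = sr s"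
  shows "w = \<one>"
  using assms by (intro pos_all_one) auto

lemma eq_by_act:
  assumes "w \<in> carrier W" "v \<in> carrier W" "\<And>s. s \<in> S \<Longrightarrow> act w (sr s) = act v (sr s)"
  shows "w = v"
proof -
  have "inv v \<otimes> w = \<one>"
    using assms by (intro act_faithful) (auto simp: act_mult)
  then show ?thesis using assms by (metis inv_equality inv_inv inv_closed)
qed

section \<open>Reflections in arbitrary roots\<close>

lemma act_conj_S:
  assumes "w \<in> carrier W" "s \<in> S"
  shows "act (w \<otimes> s \<otimes> inv w) v = v - coroot s (act (inv w) v) \<cdot> act w (sr s)"
  using assms by (simp add: act_mult S_carrier act_S rf_def act_diff act_smul)

text \<open>Two reflections with the same root \<open>sr t\<close> cannot be compared through an
  invariant form, as \<open>A\<close> need not be symmetrizable. But their product changes only the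
  coordinate at t and fixes \<open>sr t\<close>, hence keeps all simple roots positive and is
  trivial.\<close>

lemma simple_conj:
  assumes w: "w \<in> carrier W" and st: "s \<in> S" "t \<in> S" and e: "act w (sr s) = sr t"
  shows "w \<otimes> s = t \<otimes> w"
proof -
  let ?r = "w \<otimes> s \<otimes> inv w"
  have C: "w \<in> carrier W" "s \<in> carrier W" "t \<in> carrier W" using assms S_carrier by auto
  define f where "f v = coroot s (act (inv w) v)" for v
  have r: "act ?r v = v - f v \<cdot> sr t" for v using act_conj_S[OF w st(1)] e by (simp add: f_def)
  have f2: "f (sr t) = 2" using e w st act_inv(2)[OF w, of "sr s"] by (simp add: f_def coroot_sr A_diag)
  have "?r \<otimes> t = \<one>"
  proof (rule pos_all_one)
    fix u assume u: "u \<in> S"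
    have rt: "act (?r \<otimes> t) v = v - (f v - coroot t v) \<cdot> sr t" for v
    proof -
      have "f (v - c \<cdot> sr t) = f v - 2 * c" for c
        using w f2 by (simp add: f_def act_diff act_smul)
      then show ?thesis using C st by (simp add: act_mult act_S r rf_def) (simp add: pw algebra_simps)
    qed
    show "pos (act (?r \<otimes> t) (sr u))"
    proof (cases "u = t")
      case True
      then show ?thesis using rt[of "sr t"] f2 st by (simp add: coroot_sr A_diag)
    next
      case False
      have "act (?r \<otimes> t) (sr u) u = 1" unfolding rt using False by (simp add: pw_simps)
      then show ?thesis using root_nonneg[OF roots_act[OF _ roots_sr[OF u]], of "?r \<otimes> t" u] C by simp
    qed
  qed (use C in auto)
  then have "?r = t" using C st by (metis inv_S inv_equality inv_closed m_closed)
  then show ?thesis using C by (metis inv_solve_right m_closed)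
qed

text \<open>The reflection in a root, taken from any presentation of it as a conjugate of a simple
  root; \<open>rfl_eq\<close> shows that the choice does not matter.\<close>

definition rfl :: "('w \<Rightarrow> int) \<Rightarrow> 'w" where
  "rfl \<gamma> = (SOME r. \<exists>w s. w \<in> carrier W \<and> s \<in> S \<and> \<gamma> = act w (sr s) \<and> r = w \<otimes> s \<otimes> inv w)"

text \<open>The value of the coroot of \<open>\<gamma>\<close> on \<open>v\<close>, read off from
  the reflection.\<close>

definition npair :: "('w \<Rightarrow> int) \<Rightarrow> ('w \<Rightarrow> int) \<Rightarrow> int" where
  "npair v \<gamma> = (THE c. act (rfl \<gamma>) v = v - c \<cdot> \<gamma>)"

lemma rfl_eq:
  assumes "w \<in> carrier W" "s \<in> S"
  shows "rfl (act w (sr s)) = w \<otimes> s \<otimes> inv w"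
proof -
  let ?P = "\<lambda>r. \<exists>v t. v \<in> carrier W \<and> t \<in> S \<and> act w (sr s) = act v (sr t) \<and> r = v \<otimes> t \<otimes> inv v"
  have "?P (SOME r. ?P r)" by (rule someI[of ?P "w \<otimes> s \<otimes> inv w"]) (use assms in blast)
  then obtain v t where v: "v \<in> carrier W" "t \<in> S" "act w (sr s) = act v (sr t)"
    "rfl (act w (sr s)) = v \<otimes> t \<otimes> inv v" unfolding rfl_def by blast
  have C: "s \<in> carrier W" "t \<in> carrier W" using assms v S_carrier by auto
  have "act (inv v \<otimes> w) (sr s) = sr t" using assms v by (simp add: act_mult)
  then have "(inv v \<otimes> w) \<otimes> s = t \<otimes> (inv v \<otimes> w)" using assms v by (intro simple_conj) auto
  then have "v \<otimes> ((inv v \<otimes> w) \<otimes> s) \<otimes> inv w = v \<otimes> (t \<otimes> (inv v \<otimes> w)) \<otimes> inv w" by simp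
  then have "w \<otimes> s \<otimes> inv w = v \<otimes> t \<otimes> inv v"
    using assms v C by (simp add: m_assoc cancel_inv)
  then show ?thesis using v by simp
qed

lemma root_nonzero: "\<gamma> \<in> roots \<Longrightarrow> \<gamma> \<noteq> 0"
  using root_sign[of \<gamma>] by (auto simp: pos_def)

lemma smul_eq_iff: "v \<noteq> 0 \<Longrightarrow> a \<cdot> v = b \<cdot> v \<longleftrightarrow> a = b"
  by (auto simp: pw)

lemma diff_smul_eq_iff: "v \<noteq> 0 \<Longrightarrow> u - a \<cdot> v = u - b \<cdot> v \<longleftrightarrow> a = b"
  by (auto simp: pw)

lemma rootE:
  assumes "\<gamma> \<in> roots"
  obtains w s where "w \<in> carrier W" "s \<in> S" "\<gamma> = act w (sr s)" "rfl \<gamma> = w \<otimes> s \<otimes> inv w"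
    "\<And>v. npair v \<gamma> = coroot s (act (inv w) v)"
proof -
  obtain w s where w: "w \<in> carrier W" "s \<in> S" "\<gamma> = act w (sr s)" using assms unfolding roots_def by blast
  have r: "rfl \<gamma> = w \<otimes> s \<otimes> inv w" using rfl_eq w by simp
  have "npair v \<gamma> = coroot s (act (inv w) v)" for v
    unfolding npair_def r act_conj_S[OF w(1,2)] w(3)[symmetric]
    by (simp add: diff_smul_eq_iff[OF root_nonzero[OF assms]])
  then show ?thesis using that w r by blast
qed

lemma rfl_closed [simp]: "\<gamma> \<in> roots \<Longrightarrow> rfl \<gamma> \<in> carrier W"
  by (elim rootE) (simp add: S_carrier)

lemma act_rfl: "\<gamma> \<in> roots \<Longrightarrow> act (rfl \<gamma>) v = v - npair v \<gamma> \<cdot> \<gamma>"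
  by (elim rootE) (simp add: act_conj_S)

lemma npair_lin:
  assumes "\<gamma> \<in> roots"
  shows "npair (u + v) \<gamma> = npair u \<gamma> + npair v \<gamma>" "npair (u - v) \<gamma> = npair u \<gamma> - npair v \<gamma>"
    "npair (c \<cdot> v) \<gamma> = c * npair v \<gamma>" "npair (- v) \<gamma> = - npair v \<gamma>" "npair 0 \<gamma> = 0"
proof -
  obtain w s where w: "w \<in> carrier W" "\<And>v. npair v \<gamma> = coroot s (act (inv w) v)"
    using assms by (elim rootE) blast
  then show "npair (u + v) \<gamma> = npair u \<gamma> + npair v \<gamma>" "npair (u - v) \<gamma> = npair u \<gamma> - npair v \<gamma>"
    and c: "npair (c \<cdot> v) \<gamma> = c * npair v \<gamma>" for c v
    by (simp_all add: act_add act_diff act_smul)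
  show "npair (- v) \<gamma> = - npair v \<gamma>" "npair 0 \<gamma> = 0"
    using c[of "-1" v] c[of 0 0] by (simp_all add: smul_neg1)
qed

lemma npair_self: "\<gamma> \<in> roots \<Longrightarrow> npair \<gamma> \<gamma> = 2"
  by (elim rootE) (simp add: coroot_sr A_diag)

lemma act_rfl_self: "\<gamma> \<in> roots \<Longrightarrow> act (rfl \<gamma>) \<gamma> = - \<gamma>"
  by (simp add: act_rfl npair_self) (auto simp: pw)

lemma npair_sr: "s \<in> S \<Longrightarrow> npair v (sr s) = coroot s v" "s \<in> S \<Longrightarrow> rfl (sr s) = s"
proof -
  assume s: "s \<in> S"
  show r: "rfl (sr s) = s" using rfl_eq[of \<one> s] s by (simp add: S_carrier)
  show "npair v (sr s) = coroot s v"
    unfolding npair_def r act_S[OF s] rf_def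
    by (simp add: diff_smul_eq_iff[OF root_nonzero[OF roots_sr[OF s]]])
qed

lemma rfl_act:
  assumes "x \<in> carrier W" "\<gamma> \<in> roots"
  shows "rfl (act x \<gamma>) = x \<otimes> rfl \<gamma> \<otimes> inv x" "npair (act x v) (act x \<gamma>) = npair v \<gamma>"
proof -
  obtain w s where w: "w \<in> carrier W" "s \<in> S" "\<gamma> = act w (sr s)" "rfl \<gamma> = w \<otimes> s \<otimes> inv w"
    using assms(2) by (elim rootE)
  have "rfl (act x \<gamma>) = (x \<otimes> w) \<otimes> s \<otimes> inv (x \<otimes> w)"
    unfolding w(3) act_mult[OF assms(1) w(1), symmetric] using assms w by (intro rfl_eq) auto
  then show r: "rfl (act x \<gamma>) = x \<otimes> rfl \<gamma> \<otimes> inv x"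
    using assms w by (simp add: inv_mult_group m_assoc S_carrier)
  have "act x v - npair (act x v) (act x \<gamma>) \<cdot> act x \<gamma> = act x v - npair v \<gamma> \<cdot> act x \<gamma>"
    using act_rfl[OF roots_act[OF assms], of "act x v"] assms act_rfl[OF assms(2), of v]
    by (simp add: r act_mult act_diff act_smul)
  then show "npair (act x v) (act x \<gamma>) = npair v \<gamma>"
    using smul_eq_iff[OF root_nonzero[OF roots_act[OF assms]]] by simp
qed

lemma rfl_sq: "\<gamma> \<in> roots \<Longrightarrow> rfl \<gamma> \<otimes> rfl \<gamma> = \<one>"
proof -
  assume g: "\<gamma> \<in> roots"
  have "act (rfl \<gamma>) (act (rfl \<gamma>) v) = v" for v
    using g by (simp add: act_rfl npair_lin npair_self) (auto simp: pw algebra_simps)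
  then show ?thesis using g by (intro act_faithful) (auto simp: act_mult)
qed

section \<open>Standard parabolic subgroups\<close>

lemma gen_sub: "J \<subseteq> S \<Longrightarrow> w \<in> generate W J \<Longrightarrow> w \<in> carrier W"
  using generate_incl[of J] S_carrier by blast

lemma gen_subgroup: "J \<subseteq> S \<Longrightarrow> subgroup (generate W J) W"
  using S_carrier by (intro generate_is_subgroup) blast

lemma gen_mult: "x \<in> generate W J \<Longrightarrow> y \<in> generate W J \<Longrightarrow> x \<otimes> y \<in> generate W J"
  by (rule generate.eng)

lemma gen_one: "\<one> \<in> generate W J" by (rule generate.one)

lemma gen_S: "k \<in> J \<Longrightarrow> k \<in> generate W J" by (rule generate.incl)

lemma gen_inv: "J \<subseteq> S \<Longrightarrow> x \<in> generate W J \<Longrightarrow> inv x \<in> generate W J"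
  using gen_subgroup subgroup.m_inv_closed by metis

lemma act_gen_outside:
  assumes "J \<subseteq> S" "w \<in> generate W J" "x \<notin> J"
  shows "act w v x = v x"
proof -
  obtain ss where ss: "ss \<in> lists J" "word_prod W ss = w" using generate_word assms by blast
  have "actw ss v x = v x" using ss(1)
  proof (induction ss)
    case (Cons a ss)
    then have "a \<noteq> x" "actw ss v x = v x" using assms by auto
    then show ?case by (simp add: rf_def pw_simps)
  qed simp
  then show ?thesis using act_word[of ss v] ss assms by (auto simp: lists_mono[THEN subsetD])
qed

lemma pos_gen_one:
  assumes J: "J \<subseteq> S" and w: "w \<in> generate W J" and p: "\<And>k. k \<in> J \<Longrightarrow> pos (act w (sr k))"
  shows "w = \<one>"
proof (rule pos_all_one)
  fix s assume s: "s \<in> S"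
  show "pos (act w (sr s))"
  proof (cases "s \<in> J")
    case False
    then have "act w (sr s) s = 1" using act_gen_outside[OF J w] by (simp add: sr_apply)
    then show ?thesis using root_nonneg[OF roots_act[OF gen_sub[OF J w] roots_sr[OF s]], of s] by simp
  qed (use p in auto)
qed (use gen_sub J w in auto)

lemma gen_descent:
  assumes J: "J \<subseteq> S" and w: "w \<in> generate W J" "w \<noteq> \<one>"
  obtains k where "k \<in> J" "Suc (len (w \<otimes> k)) = len w"
proof -
  obtain k where k: "k \<in> J" "\<not> pos (act w (sr k))" using pos_gen_one[OF J w(1)] w(2) by blast
  then show ?thesis
    using that pos_iff_len[of w k] len_right[of w k] gen_sub[OF J w(1)] J by auto
qed

text \<open>An element of \<open>W_J\<close> leaves the coordinates outside J alone, so its descents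
  can be taken inside J. The induction thus follows words in J that are reduced for the length of
  W.\<close>

lemma gen_induct [consumes 2, case_names one mult]:
  assumes J: "J \<subseteq> S" and w: "w \<in> generate W J" and one: "P \<one>"
    and step: "\<And>w k. \<lbrakk>w \<in> generate W J; k \<in> J; len (w \<otimes> k) = Suc (len w); P w\<rbrakk> \<Longrightarrow> P (w \<otimes> k)"
  shows "P w"
  using w
proof (induction "len w" arbitrary: w)
  case 0 then show ?case using len_0[of w] gen_sub[OF J] one by simp
next
  case (Suc n)
  then have "w \<noteq> \<one>" by auto
  then obtain k where k: "k \<in> J" "Suc (len (w \<otimes> k)) = len w" using gen_descent[OF J] Suc by metis
  have wk: "w \<otimes> k \<in> generate W J" using Suc k by (auto intro: gen_mult gen_S)
  have "P (w \<otimes> k)" using Suc k wk by (intro Suc) auto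
  moreover have kk: "w \<otimes> k \<otimes> k = w" using k(1) J gen_sub[OF J Suc.prems] by (intro S_sq2) auto
  ultimately show ?case using step[of "w \<otimes> k" k] wk k by simp
qed

lemma gen_reduced:
  assumes J: "J \<subseteq> S" and w: "w \<in> generate W J"
  shows "\<exists>ss\<in>lists J. length ss = len w \<and> word_prod W ss = w"
  using assms
proof (induction rule: gen_induct)
  case one then show ?case by (intro bexI[of _ "[]"]) auto
next
  case (mult w k)
  then obtain ss where "ss \<in> lists J" "length ss = len w" "word_prod W ss = w" by blast
  moreover have "word_prod W (ss @ [k]) = w \<otimes> k"
    using calculation mult J by (subst word_prod_append) (auto simp: S_carrier subset_iff)
  ultimately show ?case using mult by (intro bexI[of _ "ss @ [k]"]) auto
qed

lemma len_inv: "w \<in> carrier W \<Longrightarrow> len (inv w) = len w"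
proof -
  have "len (inv w) \<le> len w" if w: "w \<in> carrier W" for w
  proof -
    obtain ss where ss: "ss \<in> lists S" "length ss = len w" "word_prod W ss = w" using reduced_word w by metis
    then show ?thesis using len_word[of "rev ss"] by (simp add: word_prod_rev rev_lists)
  qed
  from this[of w] this[of "inv w"] show "w \<in> carrier W \<Longrightarrow> ?thesis" by simp
qed

lemma len_left:
  assumes "w \<in> carrier W" "s \<in> S"
  shows "len (s \<otimes> w) = Suc (len w) \<or> Suc (len (s \<otimes> w)) = len w"
    "pos (act (inv w) (sr s)) \<longleftrightarrow> len (s \<otimes> w) > len w"
proof -
  have "len (s \<otimes> w) = len (inv w \<otimes> s)"
    using assms len_inv[of "s \<otimes> w"] S_carrier by (simp add: inv_mult_group inv_S)
  then show "len (s \<otimes> w) = Suc (len w) \<or> Suc (len (s \<otimes> w)) = len w"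
    "pos (act (inv w) (sr s)) \<longleftrightarrow> len (s \<otimes> w) > len w"
    using assms len_right[of "inv w" s] pos_iff_len[of "inv w" s] len_inv by auto
qed

end

section \<open>Evaluation at q = 1\<close>

abbreviation "lookup \<equiv> Poly_Mapping.lookup"
abbreviation "keys \<equiv> Poly_Mapping.keys"
abbreviation "single \<equiv> Poly_Mapping.single"

definition ev1 :: "laurent \<Rightarrow> int" where
  "ev1 x = (\<Sum>k\<in>keys x. lookup x k)"

lemma ev1_superset:
  assumes "finite A" "keys x \<subseteq> A"
  shows "ev1 x = (\<Sum>k\<in>A. lookup x k)"
  unfolding ev1_def using assms by (intro sum.mono_neutral_left) (auto simp: in_keys_iff)

lemma ev1_add: "ev1 (x + y) = ev1 x + ev1 y"
  by (simp add: ev1_superset[of "keys x \<union> keys y"] keys_add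
      lookup_add sum.distrib)

lemma ev1_diff: "ev1 (x - y) = ev1 x - ev1 y"
  using ev1_add[of "x - y" y] by simp

lemma ev1_zero [simp]: "ev1 0 = 0" by (simp add: ev1_def)

lemma ev1_minus: "ev1 (- x) = - ev1 x"
  using ev1_diff[of 0 x] by simp

lemma ev1_single [simp]: "ev1 (single n c) = c"
  by (simp add: ev1_def)

text \<open>Laurent polynomials form the free abelian group on the powers of q, so additive
  identities need only be checked on monomials.\<close>

lemma laurent_induct [case_names zero single diff]:
  fixes x :: laurent
  assumes "P 0" "\<And>n. P (single n 1)" "\<And>a b. P a \<Longrightarrow> P b \<Longrightarrow> P (a - b)"
  shows "P x"
  using frag_induction[of x UNIV P] assms by simp

lemma ev1_mult: "ev1 (x * y) = ev1 x * ev1 y"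
proof (induction x rule: laurent_induct)
  case (single n)
  show ?case
  proof (induction y rule: laurent_induct)
    case (diff a b) then show ?case by (simp add: right_diff_distrib ev1_diff)
  qed (simp_all add: mult_single)
next
  case (diff a b) then show ?case by (simp add: left_diff_distrib ev1_diff)
qed simp

lemma ev1_one [simp]: "ev1 1 = 1"
  using ev1_single[of 0 1] by simp

lemma ev1_qq [simp]: "ev1 qq = 1" by (simp add: qq_def)

lemma ev1_of_int [simp]: "ev1 (of_int n) = n"
  using ev1_single[of 0 n] by (simp flip: single_of_int)

lemma ev1_sum: "ev1 (\<Sum>i\<in>I. f i) = (\<Sum>i\<in>I. ev1 (f i))"
  by (induction I rule: infinite_finite_induct) (simp_all add: ev1_add)

lemma qq_power_dvd: "(qq - 1) dvd (single n 1 - 1)"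
proof -
  have q: "single (int m) 1 = qq ^ m" for m
  proof (induction m)
    case (Suc m)
    have "single (int (Suc m)) 1 = qq * single (int m) (1::int)"
      by (simp add: qq_def mult_single add.commute)
    then show ?case by (simp add: Suc)
  qed simp
  have p: "(qq - 1) dvd (single (int m) 1 - 1)" for m
    unfolding q by (simp add: power_diff_1_eq)
  show ?thesis
  proof (cases "n \<ge> 0")
    case True then show ?thesis using p[of "nat n"] by simp
  next
    case False
    have "single n 1 - 1 = - (single n (1::int) * (single (int (nat (- n))) 1 - 1))"
      using False by (simp add: right_diff_distrib mult_single)
    then show ?thesis using p[of "nat (- n)"] by (metis dvd_minus_iff dvd_mult)
  qed
qed

lemma dvd_minus_ev1: "(qq - 1) dvd (x - of_int (ev1 x))"
proof (induction x rule: laurent_induct)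
  case (single n) then show ?case using qq_power_dvd by simp
next
  case (diff a b)
  have "a - b - of_int (ev1 (a - b)) = (a - of_int (ev1 a)) - (b - of_int (ev1 b))" by (simp add: ev1_diff)
  then show ?case using diff by (metis dvd_diff)
qed simp

lemma dvd_iff_ev1: "(qq - 1) dvd x \<longleftrightarrow> ev1 x = 0"
proof
  assume "(qq - 1) dvd x"
  then show "ev1 x = 0" by (auto simp: dvd_def ev1_mult ev1_diff)
qed (use dvd_minus_ev1[of x] in auto)

lemma lookup_qq_mult: "lookup (qq * x) k = lookup x (k - 1)"
proof (induction x rule: laurent_induct)
  case (single n) then show ?case by (auto simp: qq_def mult_single lookup_single when_def)
next
  case (diff a b) then show ?case by (simp add: right_diff_distrib lookup_minus)
qed simp

text \<open>Each factor q - 1 widens the range of exponents by at least one, so only 0 is divisible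
  by all its powers. This is how functions are later shown to vanish identically.\<close>

lemma power_dvd_width:
  assumes "(qq - 1) ^ n dvd x" "x \<noteq> 0"
  shows "int n \<le> Max (keys x) - Min (keys x)"
  using assms
proof (induction n arbitrary: x)
  case 0
  then have "keys x \<noteq> {}" by simp
  then show ?case by simp
next
  case (Suc n)
  then obtain y where y: "x = (qq - 1) * y" "(qq - 1) ^ n dvd y" by (auto simp: dvd_def mult.assoc)
  then have y0: "y \<noteq> 0" using Suc by auto
  let ?M = "Max (keys y)" and ?m = "Min (keys y)"
  have k: "keys y \<noteq> {}" using y0 by simp
  have l: "lookup x k = lookup y (k - 1) - lookup y k" for k
    by (simp add: y left_diff_distrib lookup_minus lookup_qq_mult)
  have "?M + 1 \<notin> keys y"
    by (meson Max_ge finite_keys less_add_one not_le)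
  then have "lookup x (?M + 1) \<noteq> 0"
    using l[of "?M + 1"] k Max_in[of "keys y"] by (simp add: in_keys_iff)
  then have M: "?M + 1 \<le> Max (keys x)" by (intro Max_ge) (auto simp: in_keys_iff)
  have "?m - 1 \<notin> keys y"
    by (metis Min_le finite_keys less_add_one diff_add_cancel not_le)
  then have "lookup x ?m \<noteq> 0"
    using l[of ?m] k Min_in[of "keys y"] by (simp add: in_keys_iff)
  then have m: "Min (keys x) \<le> ?m" by (intro Min_le) (auto simp: in_keys_iff)
  show ?case using Suc.IH[OF y(2) y0] M m by simp
qed

lemma power_dvd_zero: "(\<And>n. (qq - 1) ^ n dvd x) \<Longrightarrow> x = 0"
proof (rule ccontr)
  let ?w = "Max (keys x) - Min (keys x)"
  assume "\<And>n. (qq - 1) ^ n dvd x" "x \<noteq> 0"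
  then have "int (nat ?w + 1) \<le> ?w" using power_dvd_width by blast
  then show False by linarith
qed

lemma qq_minus_1_nonzero: "qq - 1 \<noteq> (0::laurent)"
proof
  assume "qq - 1 = (0::laurent)"
  then have "lookup (qq - 1) 0 = (0::int)" by simp
  then show False by (simp add: lookup_minus qq_def lookup_single)
qed

section \<open>Matrix coefficients of oriented Hecke modules\<close>

definition qinv :: laurent where "qinv = single (- 1) 1"

lemma qinv: "qinv * qq = 1" "qq * qinv = 1"
  by (simp_all add: qq_def qinv_def mult_single)

context coxeter_gcm
begin

text \<open>The coefficient of \<open>x\<close> when the letters of the word act in turn on the
  basis vector \<open>h\<close> of a right module with basis W. If \<open>h\<close> sends
  \<open>sr s\<close> to a root with \<open>ori\<close>, then \<open>T_s\<close> takes
  \<open>h\<close> to \<open>h \<otimes> s\<close>, and otherwise to \<open>qq\<close> times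
  \<open>h \<otimes> s\<close> plus \<open>qq - 1\<close> times \<open>h\<close>. For
  \<open>ori = pos\<close> this is the right regular module.\<close>

primrec coef :: "(('w \<Rightarrow> int) \<Rightarrow> bool) \<Rightarrow> 'w list \<Rightarrow> 'w \<Rightarrow> 'w \<Rightarrow> laurent" where
  "coef ori [] h x = (if x = h then 1 else 0)"
| "coef ori (s # ss) h x = (if ori (act h (sr s)) then coef ori ss (h \<otimes> s) x
     else qq * coef ori ss (h \<otimes> s) x + (qq - 1) * coef ori ss h x)"

definition orient :: "(('w \<Rightarrow> int) \<Rightarrow> bool) \<Rightarrow> bool" where
  "orient ori \<longleftrightarrow> (\<forall>\<beta>\<in>roots. ori (- \<beta>) \<longleftrightarrow> \<not> ori \<beta>)"

lemma root_hs: "h \<in> carrier W \<Longrightarrow> s \<in> S \<Longrightarrow> act h (sr s) \<in> roots"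
  by (simp add: roots_act roots_sr)

lemma orient_flip:
  "orient ori \<Longrightarrow> h \<in> carrier W \<Longrightarrow> s \<in> S \<Longrightarrow> ori (act (h \<otimes> s) (sr s)) \<longleftrightarrow> \<not> ori (act h (sr s))"
  by (simp add: act_mult_s orient_def root_hs)

lemma hs_ne: "h \<in> carrier W \<Longrightarrow> s \<in> S \<Longrightarrow> h \<otimes> s \<noteq> h"
  using len_right[of h s] by force

lemma hs_eq_iff: "h \<in> carrier W \<Longrightarrow> x \<in> carrier W \<Longrightarrow> s \<in> S \<Longrightarrow> x \<otimes> s = h \<longleftrightarrow> x = h \<otimes> s"
  by (metis S_sq2(2))

text \<open>The recursion peels letters off at the source; this is the same operator read at the
  target, where \<open>x\<close> is reached from \<open>x \<otimes> s\<close> or from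
  itself.\<close>

lemma coef_snoc:
  assumes o: "orient ori" and s: "s \<in> S" and x: "x \<in> carrier W"
    and "ss \<in> lists S" "h \<in> carrier W"
  shows "coef ori (ss @ [s]) h x = (if ori (act x (sr s)) then qq * coef ori ss h (x \<otimes> s)
     else coef ori ss h (x \<otimes> s) + (qq - 1) * coef ori ss h x)"
  using assms(4,5)
proof (induction ss arbitrary: h)
  case Nil
  then show ?case
    using orient_flip[OF o _ s, of h] hs_ne[OF _ s, of h] hs_eq_iff[OF _ x s, of h]
    by (cases "x = h"; cases "x = h \<otimes> s") (auto simp: s)
next
  case (Cons r ss)
  then have "h \<otimes> r \<in> carrier W" "ss \<in> lists S" using S_carrier by auto
  then show ?case using Cons by (simp add: algebra_simps)
qed

primrec subw :: "'w list \<Rightarrow> 'w set" where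
  "subw [] = {\<one>}"
| "subw (s # ss) = subw ss \<union> (\<otimes>) s ` subw ss"

lemma finite_subw [simp]: "finite (subw ss)" by (induction ss) auto

lemma subw_carrier: "ss \<in> lists S \<Longrightarrow> subw ss \<subseteq> carrier W"
  by (induction ss) (auto simp: S_carrier)

lemma coef_support:
  "ss \<in> lists S \<Longrightarrow> h \<in> carrier W \<Longrightarrow> coef ori ss h x \<noteq> 0 \<Longrightarrow> \<exists>v\<in>subw ss. x = h \<otimes> v"
proof (induction ss arbitrary: h)
  case (Cons s ss)
  have s: "s \<in> carrier W" "ss \<in> lists S" using Cons.prems S_carrier by auto
  have "coef ori ss (h \<otimes> s) x \<noteq> 0 \<or> coef ori ss h x \<noteq> 0"
    using Cons.prems by (auto split: if_splits)
  then show ?case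
  proof
    assume "coef ori ss (h \<otimes> s) x \<noteq> 0"
    then obtain v where "v \<in> subw ss" "x = h \<otimes> s \<otimes> v" using Cons s by blast
    then show ?thesis using s Cons.prems subw_carrier[OF s(2)]
      by (intro bexI[of _ "s \<otimes> v"]) (auto simp: m_assoc subset_iff)
  qed (use Cons s in auto)
qed (auto split: if_splits)

text \<open>At q = 1 the orientation becomes invisible and the module is the regular representation
  of the group.\<close>

lemma ev1_coef:
  "ss \<in> lists S \<Longrightarrow> h \<in> carrier W \<Longrightarrow> ev1 (coef ori ss h x) = (if x = h \<otimes> word_prod W ss then 1 else 0)"
proof (induction ss arbitrary: h)
  case (Cons s ss)
  then have "s \<in> carrier W" "ss \<in> lists S" using S_carrier by auto
  then show ?case using Cons.IH[of "h \<otimes> s"] Cons.prems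
    by (auto simp add: ev1_add ev1_mult ev1_diff m_assoc)
qed simp

text \<open>Left multiplication by \<open>T_k\<close>, on coefficient functions with respect to the
  standard basis.\<close>

definition Lop :: "'w \<Rightarrow> ('w \<Rightarrow> laurent) \<Rightarrow> 'w \<Rightarrow> laurent" where
  "Lop k m x = (if pos (act (inv x) (sr k)) then qq * m (k \<otimes> x) else m (k \<otimes> x) + (qq - 1) * m x)"

text \<open>The condition under which left multiplication by \<open>T_k\<close>, formed with
  ordinary positivity, still commutes with the oriented right module: ordinary sign on the wall of
  k, and invariance under k everywhere else.\<close>

definition compat :: "(('w \<Rightarrow> int) \<Rightarrow> bool) \<Rightarrow> 'w \<Rightarrow> bool" where
  "compat ori k \<longleftrightarrow> ori (sr k) \<and>
     (\<forall>\<beta>\<in>roots. \<beta> \<noteq> sr k \<longrightarrow> \<beta> \<noteq> - sr k \<longrightarrow> ori (act k \<beta>) = ori \<beta>)"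

lemma pos_flip: "\<beta> \<in> roots \<Longrightarrow> s \<in> S \<Longrightarrow> \<beta> \<noteq> sr s \<Longrightarrow> \<beta> \<noteq> - sr s \<Longrightarrow> pos (act s \<beta>) = pos \<beta>"
  using simple_flip[of \<beta> s] simple_flip[of "- \<beta>" s] root_neg_iff[of \<beta>] root_neg_iff[of "act s \<beta>"]
  by (metis act_uminus roots_act S_carrier minus_minus roots_uminus)

lemma inv_hs: "h \<in> carrier W \<Longrightarrow> s \<in> S \<Longrightarrow> act (inv (h \<otimes> s)) v = act s (act (inv h) v)"
  by (simp add: inv_mult_group S_carrier act_mult inv_S)

text \<open>Left and right multiplication interfere only where \<open>h\<close> sends
  \<open>sr s\<close> to plus or minus \<open>sr k\<close>. There
  \<open>h \<otimes> s = k \<otimes> h\<close>, and \<open>ori (sr k)\<close> settles both signs.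
  Elsewhere neither operator changes the sign test of the other.\<close>

lemma Lop_coef:
  assumes o: "orient ori" "compat ori k" and k: "k \<in> S" and x: "x \<in> carrier W"
    and "ss \<in> lists S" "h \<in> carrier W"
  shows "Lop k (coef ori ss h) x = (if pos (act (inv h) (sr k)) then coef ori ss (k \<otimes> h) x
    else qq * coef ori ss (k \<otimes> h) x + (qq - 1) * coef ori ss h x)"
  using assms(5,6)
proof (induction ss arbitrary: h rule: list.induct)
  case Nil
  have kc: "k \<in> carrier W" using k S_carrier by blast
  have flip: "pos (act (inv (k \<otimes> y)) (sr k)) \<longleftrightarrow> \<not> pos (act (inv y) (sr k))" if "y \<in> carrier W" for y
  proof -
    have "act (inv (k \<otimes> y)) (sr k) = - act (inv y) (sr k)"
      using that k kc by (simp add: inv_mult_group act_mult inv_S act_S_sr act_uminus)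
    then show ?thesis using root_neg_iff[OF root_hs[of "inv y" k]] that k by simp
  qed
  have e: "k \<otimes> x = h \<longleftrightarrow> x = k \<otimes> h" using Nil x k by (metis S_sq2(1))
  have ne: "k \<otimes> h \<noteq> h" using len_left[of h k] Nil k by force
  show ?case using e ne flip[of h] Nil unfolding Lop_def
    by (cases "x = h"; cases "x = k \<otimes> h") (auto simp: k)
next
  case (Cons s ss)
  have C: "s \<in> S" "s \<in> carrier W" "k \<in> carrier W" "ss \<in> lists S" "h \<otimes> s \<in> carrier W" "h \<in> carrier W"
    using Cons.prems(1) Cons.prems(2) S_carrier[OF k] S_carrier[of s] by simp_all
  let ?b = "act h (sr s)" and ?p = "\<lambda>h. pos (act (inv h) (sr k))"
  have lin: "Lop k (coef ori (s # ss) h) x = (if ori ?b then Lop k (coef ori ss (h \<otimes> s)) x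
     else qq * Lop k (coef ori ss (h \<otimes> s)) x + (qq - 1) * Lop k (coef ori ss h) x)"
    by (simp add: Lop_def algebra_simps)
  note IH = Cons.IH[OF C(4,5)] Cons.IH[OF C(4,6)]
  have p: "?p (h \<otimes> s) = pos (act s (act (inv h) (sr k)))" using C by (simp add: inv_hs)
  have A: "k \<otimes> (h \<otimes> s) = k \<otimes> h \<otimes> s" using C by (simp add: m_assoc)
  consider "?b = sr k" | "?b = - sr k" | "?b \<noteq> sr k" "?b \<noteq> - sr k" by blast
  then show ?case
  proof cases
    case 1
    then have i: "act (inv h) (sr k) = sr s" using C by (metis act_inv(2))
    have hs: "h \<otimes> s = k \<otimes> h" using simple_conj[OF C(6,1) k] 1 by simp
    have np: "\<not> ?p (h \<otimes> s)" "?p h" using p i C by (auto simp: act_S_sr not_pos_neg)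
    have ob: "ori ?b" "\<not> ori (act (k \<otimes> h) (sr s))"
      using 1 o orient_flip[OF o(1) C(6,1)] hs by (auto simp: compat_def)
    have kk: "k \<otimes> h \<otimes> s = h" using hs C by (metis S_sq2(2))
    show ?thesis using np ob kk hs unfolding lin IH A by (simp add: k C)
  next
    case 2
    then have "act (h \<otimes> s) (sr s) = sr k" using C by (simp add: act_mult_s)
    then have "h \<otimes> s \<otimes> s = k \<otimes> (h \<otimes> s)" using simple_conj[OF C(5,1) k] by simp
    then have hs: "h \<otimes> s = k \<otimes> h" using C k by (metis S_sq2)
    have i: "act (inv h) (sr k) = - sr s" using 2 C act_inv(2)[of h "sr s"]
      by (metis act_uminus inv_closed minus_minus)
    have np: "?p (h \<otimes> s)" "\<not> ?p h" using p i C by (auto simp: act_S_sr not_pos_neg act_uminus)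
    have ob: "\<not> ori ?b" "ori (act (k \<otimes> h) (sr s))"
      using 2 o orient_flip[OF o(1) C(6,1)] hs k roots_sr by (auto simp: compat_def orient_def)
    have kk: "k \<otimes> h \<otimes> s = h" using hs C by (metis S_sq2(2))
    show ?thesis using np ob kk hs unfolding lin IH A by (simp add: k C algebra_simps)
  next
    case 3
    have ne: "act (inv h) (sr k) \<noteq> sr s" "act (inv h) (sr k) \<noteq> - sr s"
      using 3 C by (metis act_inv(1), metis act_inv(1) act_uminus minus_minus)
    have pe: "?p (h \<otimes> s) = ?p h" using p pos_flip[OF _ C(1) ne] root_hs[of "inv h" k] C k by simp
    have oe: "ori (act (k \<otimes> h) (sr s)) = ori ?b"
      using o(2) 3 root_hs[OF C(6,1)] C by (simp add: compat_def act_mult)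
    show ?thesis using pe oe unfolding lin by (simp add: IH A algebra_simps)
  qed
qed

lemma coef_invariant:
  assumes z: "z \<in> carrier W" and o: "\<And>\<beta>. \<beta> \<in> roots \<Longrightarrow> ori (act z \<beta>) = ori \<beta>"
    and x: "x \<in> carrier W"
  shows "ss \<in> lists S \<Longrightarrow> h \<in> carrier W \<Longrightarrow> coef ori ss (z \<otimes> h) (z \<otimes> x) = coef ori ss h x"
proof (induction ss arbitrary: h)
  case (Cons s ss)
  then have C: "s \<in> S" "s \<in> carrier W" "ss \<in> lists S" "h \<otimes> s \<in> carrier W" using S_carrier by auto
  have "z \<otimes> h \<otimes> s = z \<otimes> (h \<otimes> s)" using z Cons.prems C by (simp add: m_assoc)
  then show ?case using Cons.IH[OF C(3)] Cons.prems C o z root_hs[OF _ C(1)] by (simp add: act_mult)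
qed (use z x in simp)

section \<open>Braid relations in the regular module\<close>

lemma orient_pos: "orient pos"
  by (simp add: orient_def root_neg_iff)

lemma compat_pos: "k \<in> S \<Longrightarrow> compat pos k"
  by (simp add: compat_def pos_flip)

lemma coef_reduced:
  "\<lbrakk>ss \<in> lists S; h \<in> carrier W; len (h \<otimes> word_prod W ss) = len h + length ss\<rbrakk> \<Longrightarrow>
    coef pos ss h x = (if x = h \<otimes> word_prod W ss then 1 else 0)"
proof (induction ss arbitrary: h)
  case (Cons s ss)
  have C: "s \<in> S" "s \<in> carrier W" "ss \<in> lists S" "h \<otimes> s \<in> carrier W" "h \<in> carrier W"
    using Cons.prems S_carrier by auto
  have e: "h \<otimes> s \<otimes> word_prod W ss = h \<otimes> word_prod W (s # ss)" using C by (simp add: m_assoc)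
  have "len (h \<otimes> s \<otimes> word_prod W ss) \<le> len (h \<otimes> s) + length ss"
    using len_mult[OF C(4) word_prod_closed[OF C(3)]] len_word[OF C(3)] by linarith
  then have l: "len (h \<otimes> s) = Suc (len h)"
    using len_right[OF C(5,1)] Cons.prems(3) e by auto
  then have "pos (act h (sr s))" using pos_iff_len C by simp
  then show ?case using Cons.IH[OF C(3,4)] l e Cons.prems(3) by simp
qed simp

text \<open>Left multiplication carries the starting point from \<one> to any \<open>h\<close> one
  letter at a time, so identities between right operators need only be tested at \<one>.\<close>

lemma coef_pos_eq:
  assumes uv: "u \<in> lists S" "v \<in> lists S"
    and e: "\<And>x. x \<in> carrier W \<Longrightarrow> coef pos u \<one> x = coef pos v \<one> x"
    and "h \<in> carrier W" "x \<in> carrier W"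
  shows "coef pos u h x = coef pos v h x"
  using assms(4,5)
proof (induction "len h" arbitrary: h x)
  case 0 then show ?case using e len_0 by auto
next
  case (Suc n)
  have "inv h \<noteq> \<one>" using Suc len_inv[of h] by auto
  then obtain k where k: "k \<in> S" "Suc (len (inv h \<otimes> k)) = len (inv h)"
    using ex_descent[of "inv h"] Suc.prems by auto
  let ?h = "k \<otimes> h"
  have kc: "k \<in> carrier W" using k S_carrier by blast
  have l: "len ?h = n"
    using k Suc len_inv[of ?h] len_inv[of h] kc by (simp add: inv_mult_group inv_S)
  have hh: "k \<otimes> ?h = h" using k Suc by simp
  have p: "pos (act (inv ?h) (sr k))" using len_left(2)[of ?h k] k Suc kc l hh by simp
  have IH: "coef pos u ?h y = coef pos v ?h y" if "y \<in> carrier W" for y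
    using Suc.hyps(1)[of ?h y] l that kc Suc.prems by simp
  have "Lop k (coef pos u ?h) x = Lop k (coef pos v ?h) x"
    unfolding Lop_def using IH Suc.prems kc by simp
  then show ?case
    using Lop_coef[OF orient_pos compat_pos[OF k(1)] k(1) Suc.prems(2), of _ ?h] uv kc Suc.prems p hh by simp
qed

lemma len_alt_rev:
  assumes "s \<in> S" "t \<in> S" "s \<noteq> t" "cox_m W s t = 0 \<or> j \<le> cox_m W s t" "cox_m W s t = cox_m W t s"
  shows "len (word_prod W (rev (alt_word j s t))) = j"
  using assms
proof (induction j arbitrary: s t)
  case (Suc j)
  let ?w = "word_prod W (rev (alt_word j t s))"
  have L: "rev (alt_word j t s) \<in> lists S" using Suc.prems by (simp add: rev_lists alt_word_lists)
  have IH: "len ?w = j" using Suc by auto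
  have "cox_m W s t = 0 \<or> j < cox_m W s t" using Suc.prems by auto
  from dihedral_nonneg[OF Suc.prems(1-3) this] obtain x y where
    "0 \<le> x" "0 \<le> y" "actw (rev (alt_word j t s)) (sr s) = plane 0 s t x y" by blast
  then have "nonneg (act ?w (sr s))" by (simp add: act_word[OF L] nonneg_def plane_def pw_simps)
  then have "pos (act ?w (sr s))" using L Suc.prems root_nz by (simp add: pos_def)
  then have "len (?w \<otimes> s) = Suc j" using pos_iff_len[of ?w s] len_right[of ?w s] L Suc.prems IH by auto
  then show ?case using Suc.prems L
    by (simp add: alt_word_Suc word_prod_append S_carrier)
qed simp

lemma cox_m_sym: "s \<in> S \<Longrightarrow> t \<in> S \<Longrightarrow> cox_m W s t = cox_m W t s"
proof -
  assume st: "s \<in> S" "t \<in> S"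
  then have "t \<otimes> s = inv (s \<otimes> t)" by (simp add: inv_mult_group S_carrier inv_S)
  then show ?thesis using st S_carrier unfolding cox_m_def by simp
qed

lemma coef_pos_braid:
  assumes st: "s \<in> S" "t \<in> S" "s \<noteq> t" "cox_m W s t \<noteq> 0" and h: "h \<in> carrier W" "x \<in> carrier W"
  shows "coef pos (alt_word (cox_m W s t) s t) h x = coef pos (alt_word (cox_m W s t) t s) h x"
proof (rule coef_pos_eq[OF _ _ _ h])
  let ?m = "cox_m W s t"
  show L: "alt_word ?m s t \<in> lists S" "alt_word ?m t s \<in> lists S" using st alt_word_lists by auto
  have "len (word_prod W (alt_word ?m a b)) = ?m" if "{a,b} = {s,t}" for a b
  proof -
    have ab: "a \<in> S" "b \<in> S" "a \<noteq> b" "cox_m W a b = ?m" using that st cox_m_sym by (auto simp: doubleton_eq_iff)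
    then show ?thesis
      using len_alt_rev[of a b ?m] cox_m_sym[of a b] len_inv[of "word_prod W (alt_word ?m a b)"]
        alt_word_lists[of a b ?m] by (simp add: word_prod_rev)
  qed
  then show "coef pos (alt_word ?m s t) \<one> y = coef pos (alt_word ?m t s) \<one> y" for y
    using coef_reduced[OF L(1) one_closed, of y] coef_reduced[OF L(2) one_closed, of y] L
      braid_word[OF st(1,2)] by (simp add: insert_commute)
qed

lemma coef_append_eq:
  assumes o: "orient ori" and uv: "u \<in> lists S" "v \<in> lists S" and h: "h \<in> carrier W"
    and e: "\<And>x. x \<in> carrier W \<Longrightarrow> coef ori u h x = coef ori v h x"
  shows "r \<in> lists S \<Longrightarrow> x \<in> carrier W \<Longrightarrow> coef ori (u @ r) h x = coef ori (v @ r) h x"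
proof (induction r arbitrary: x rule: rev_induct)
  case (snoc s r)
  then have C: "s \<in> S" "s \<in> carrier W" "r \<in> lists S" using S_carrier by auto
  then show ?case
    using coef_snoc[OF o C(1) snoc.prems(2) _ h, of "u @ r"] coef_snoc[OF o C(1) snoc.prems(2) _ h, of "v @ r"]
      snoc uv by simp
qed (use e in simp)

text \<open>A word tests the orientation at finitely many roots only. If these tests agree with
  positivity after translation by \<open>z\<close>, the coefficient can be computed in the ordinary
  module.\<close>

lemma coef_transport:
  assumes z: "z \<in> carrier W" and h: "h \<in> carrier W" and st: "s \<in> S" "t \<in> S" and x: "x \<in> carrier W"
    and e: "\<And>u c. \<lbrakk>u \<in> lists {s,t}; length u \<le> n; c \<in> {s,t}\<rbrakk> \<Longrightarrow>
       ori (act (h \<otimes> word_prod W u) (sr c)) = pos (act (z \<otimes> h \<otimes> word_prod W u) (sr c))"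
  shows "\<lbrakk>ss \<in> lists {s,t}; u \<in> lists {s,t}; length u + length ss \<le> n\<rbrakk> \<Longrightarrow>
    coef ori ss (h \<otimes> word_prod W u) x = coef pos ss (z \<otimes> h \<otimes> word_prod W u) (z \<otimes> x)"
proof (induction ss arbitrary: u)
  case Nil
  then have "u \<in> lists S" using st by auto
  then show ?case using z h x by (simp add: m_assoc)
next
  case (Cons c ss)
  have C: "c \<in> S" "c \<in> {s,t}" "ss \<in> lists {s,t}" "u @ [c] \<in> lists {s,t}" "u \<in> lists S"
    using Cons.prems st by auto
  have "word_prod W (u @ [c]) = word_prod W u \<otimes> c"
    using C by (simp add: word_prod_append S_carrier)
  moreover have "c \<in> carrier W" using C S_carrier by blast
  ultimately have a: "h \<otimes> word_prod W u \<otimes> c = h \<otimes> word_prod W (u @ [c])"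
    "z \<otimes> h \<otimes> word_prod W u \<otimes> c = z \<otimes> h \<otimes> word_prod W (u @ [c])"
    using z h C by (simp_all add: m_assoc)
  show ?case using Cons.IH[OF C(3), of u] Cons.IH[OF C(3,4)] Cons.prems e[of u c] C a by simp
qed

section \<open>Twisted parabolic subgroups\<close>

definition ht :: "('w \<Rightarrow> int) \<Rightarrow> int" where "ht v = (\<Sum>s\<in>S. v s)"

lemma ht_add: "ht (u + v) = ht u + ht v" by (simp add: ht_def pw_simps sum.distrib)
lemma ht_smul: "ht (c \<cdot> v) = c * ht v" by (simp add: ht_def pw_simps sum_distrib_left)
lemma ht_zero [simp]: "ht 0 = 0" by (simp add: ht_def pw_simps)
lemma ht_sum: "ht (\<Sum>i\<in>I. f i) = (\<Sum>i\<in>I. ht (f i))"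
  by (induction I rule: infinite_finite_induct) (auto simp: ht_add)
lemma ht_sr: "s \<in> S \<Longrightarrow> ht (sr s) = 1" by (simp add: ht_def pw_simps)

lemma ht_nonneg: "nonneg v \<Longrightarrow> 0 \<le> ht v" by (simp add: ht_def nonneg_def sum_nonneg)

lemma ht_pos: "\<gamma> \<in> roots \<Longrightarrow> pos \<gamma> \<Longrightarrow> ht \<gamma> \<ge> 1"
proof -
  assume g: "\<gamma> \<in> roots" "pos \<gamma>"
  then obtain x where x: "\<gamma> x \<noteq> 0" by (auto simp: pos_def pw)
  then have xS: "x \<in> S" using root_support[OF g(1)] by blast
  have "\<gamma> x \<le> ht \<gamma>" unfolding ht_def using root_pos_nonneg[OF g(2)] xS by (intro member_le_sum) auto
  then show ?thesis using x root_pos_nonneg[OF g(2), of x] by linarith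
qed

definition PhiK :: "'w set \<Rightarrow> ('w \<Rightarrow> int) set" where
  "PhiK K = {\<gamma> \<in> roots. \<forall>x. x \<notin> K \<longrightarrow> \<gamma> x = 0}"

lemma sum_fun_apply: "(\<Sum>i\<in>I. f i) x = (\<Sum>i\<in>I. f i x)" for f :: "'b \<Rightarrow> 'w \<Rightarrow> int"
  by (induction I rule: infinite_finite_induct) (simp_all add: pw_simps)

lemma support_expand:
  assumes "finite K" "\<And>x. x \<notin> K \<Longrightarrow> v x = 0"
  shows "v = (\<Sum>k\<in>K. v k \<cdot> sr k)"
proof
  fix x
  have "(\<Sum>k\<in>K. v k \<cdot> sr k) x = (\<Sum>k\<in>K. if k = x then v x else 0)"
    unfolding sum_fun_apply by (rule sum.cong) (auto simp: pw_simps)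
  then show "v x = (\<Sum>k\<in>K. v k \<cdot> sr k) x" using assms by simp
qed

lemma act_expand:
  assumes "finite K" "\<And>x. x \<notin> K \<Longrightarrow> v x = 0" "w \<in> carrier W"
  shows "act w v = (\<Sum>k\<in>K. v k \<cdot> act w (sr k))"
proof -
  have "act w v = act w (\<Sum>k\<in>K. v k \<cdot> sr k)"
    using support_expand[OF assms(1,2)] by (rule arg_cong)
  then show ?thesis by (simp add: act_sum act_smul assms(3))
qed

lemma PhiK_pos:
  assumes K: "K \<subseteq> S" and w: "w \<in> carrier W" and p: "\<And>k. k \<in> K \<Longrightarrow> pos (act w (sr k))"
    and g: "\<gamma> \<in> PhiK K"
  shows "pos (act w \<gamma>) \<longleftrightarrow> pos \<gamma>"
proof -
  have fK: "finite K" using finite_subset[OF K] fin by blast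
  have *: "pos (act w \<gamma>)" if g: "\<gamma> \<in> PhiK K" "pos \<gamma>" for \<gamma>
  proof -
    have "nonneg (act w \<gamma>)"
      using act_expand[OF fK _ w, of \<gamma>] g p root_pos_nonneg[OF g(2)]
      by (auto simp: PhiK_def nonneg_def sum_fun_apply pw_simps pos_def intro!: sum_nonneg)
    then show ?thesis using g w root_nonzero roots_act by (auto simp: PhiK_def pos_def)
  qed
  have r: "\<gamma> \<in> roots" "- \<gamma> \<in> PhiK K" using g roots_uminus by (auto simp: PhiK_def pw_simps)
  show ?thesis using *[OF g] *[OF r(2)] root_neg_iff[OF r(1)] root_neg_iff[OF roots_act[OF w r(1)]]
    by (auto simp: act_uminus w)
qed

text \<open>Heights decide: \<open>w\<close> sends each simple root of K to height at least 1, so a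
  root whose image has height 1 has coordinates summing to 1.\<close>

lemma PhiK_simple:
  assumes K: "K \<subseteq> S" and w: "w \<in> carrier W" and p: "\<And>k. k \<in> K \<Longrightarrow> pos (act w (sr k))"
    and g: "\<gamma> \<in> PhiK K" and s: "s \<in> S" "act w \<gamma> = sr s"
  shows "\<exists>k\<in>K. \<gamma> = sr k"
proof -
  have fK: "finite K" using finite_subset[OF K] fin by blast
  have gp: "pos \<gamma>" using PhiK_pos[OF K w p g] s by simp
  have g0: "\<gamma> x = 0" if "x \<notin> K" for x using g that by (simp add: PhiK_def)
  have c: "0 \<le> \<gamma> k" for k using root_pos_nonneg[OF gp] .
  have h: "ht (act w (sr k)) \<ge> 1" if "k \<in> K" for k
    using ht_pos[OF root_hs[OF w] p] that K by auto
  have "1 = ht (act w \<gamma>)" using s by (simp add: ht_sr)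
  also have "\<dots> = (\<Sum>k\<in>K. \<gamma> k * ht (act w (sr k)))"
    using act_expand[OF fK g0 w] by (simp add: ht_sum ht_smul)
  also have "\<dots> \<ge> (\<Sum>k\<in>K. \<gamma> k * 1)" by (intro sum_mono mult_left_mono) (use h c in auto)
  finally have le: "(\<Sum>k\<in>K. \<gamma> k) \<le> 1" by simp
  obtain k where k: "\<gamma> k \<noteq> 0" using gp by (auto simp: pos_def pw)
  then have kK: "k \<in> K" using g0 by blast
  have sp: "(\<Sum>k\<in>K. \<gamma> k) = \<gamma> k + (\<Sum>k\<in>K-{k}. \<gamma> k)" using fK kK by (simp add: sum.remove)
  have rest: "(\<Sum>k\<in>K-{k}. \<gamma> k) \<ge> 0" using c by (simp add: sum_nonneg)
  have k1: "\<gamma> k = 1" "(\<Sum>k\<in>K-{k}. \<gamma> k) = 0" using sp rest le k c[of k] by linarith+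
  then have "\<gamma> x = 0" if "x \<noteq> k" for x
  proof (cases "x \<in> K")
    case True
    then show ?thesis using k1(2) that c fK sum_nonneg_eq_0_iff[of "K - {k}" \<gamma>] by auto
  qed (use g0 in auto)
  then have "\<gamma> = sr k" using k1 by (auto simp: pw)
  then show ?thesis using kK by blast
qed

text \<open>If \<phi> is read as the linear functional with value \<open>\<phi> w\<close> on
  \<open>T_w\<close>, this is its value on \<open>T_k T_w\<close>, and \<open>ract\<close> is its
  value on \<open>T_w T_k\<close>.\<close>

definition lact :: "('w \<Rightarrow> laurent) \<Rightarrow> 'w \<Rightarrow> 'w \<Rightarrow> laurent" where
  "lact \<phi> k w = (if pos (act (inv w) (sr k)) then \<phi> (k \<otimes> w) else qq * \<phi> (k \<otimes> w) + (qq - 1) * \<phi> w)"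

definition ract :: "('w \<Rightarrow> laurent) \<Rightarrow> 'w \<Rightarrow> 'w \<Rightarrow> laurent" where
  "ract \<phi> k w = (if pos (act w (sr k)) then \<phi> (w \<otimes> k) else qq * \<phi> (w \<otimes> k) + (qq - 1) * \<phi> w)"

text \<open>The sign test takes opposite values at \<open>w\<close> and
  \<open>k \<otimes> w\<close>; reindexing by this pairing shows that \<open>lact\<close> is the
  transpose of left multiplication.\<close>

lemma sum_lact:
  assumes K: "K \<subseteq> S" "k \<in> K"
  shows "(\<Sum>w\<in>generate W K. \<phi> w * (if pos (act (inv w) (sr k)) then qq * c (k \<otimes> w) else c (k \<otimes> w) + (qq - 1) * c w))
    = (\<Sum>w\<in>generate W K. c w * lact \<phi> k w)" (is "?L = ?R")
proof -
  let ?G = "generate W K" and ?p = "\<lambda>w. pos (act (inv w) (sr k))"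
  have kS: "k \<in> S" "k \<in> carrier W" using K S_carrier by auto
  have Gc: "w \<in> carrier W" if "w \<in> ?G" for w using gen_sub[OF K(1) that] .
  have kG: "k \<otimes> w \<in> ?G" if "w \<in> ?G" for w using that K by (simp add: gen_mult gen_S)
  have flip: "?p (k \<otimes> w) \<longleftrightarrow> \<not> ?p w" if "w \<in> ?G" for w
  proof -
    have "act (inv (k \<otimes> w)) (sr k) = - act (inv w) (sr k)"
      using Gc[OF that] kS by (simp add: inv_mult_group act_mult inv_S act_S_sr act_uminus)
    then show ?thesis using root_neg_iff[OF root_hs[of "inv w" k]] Gc[OF that] kS by simp
  qed
  have "?L = (\<Sum>w\<in>?G. \<phi> w * ((if ?p w then qq else 1) * c (k \<otimes> w))) + (\<Sum>w\<in>?G. \<phi> w * (if ?p w then 0 else (qq - 1) * c w))"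
    unfolding sum.distrib[symmetric] by (rule sum.cong) (auto simp: algebra_simps)
  also have "(\<Sum>w\<in>?G. \<phi> w * ((if ?p w then qq else 1) * c (k \<otimes> w))) =
    (\<Sum>w\<in>?G. \<phi> (k \<otimes> w) * ((if ?p w then 1 else qq) * c w))"
    by (rule sum.reindex_bij_witness[of _ "\<lambda>w. k \<otimes> w" "\<lambda>w. k \<otimes> w"]) (auto simp: kG Gc kS flip)
  finally show ?thesis unfolding sum.distrib[symmetric]
    by (auto simp: lact_def algebra_simps intro!: sum.cong)
qed

lemma sum_ract:
  assumes K: "K \<subseteq> S" "k \<in> K"
  shows "(\<Sum>w\<in>generate W K. \<phi> w * (if pos (act w (sr k)) then qq * c (w \<otimes> k) else c (w \<otimes> k) + (qq - 1) * c w))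
    = (\<Sum>w\<in>generate W K. c w * ract \<phi> k w)" (is "?L = ?R")
proof -
  let ?G = "generate W K" and ?p = "\<lambda>w. pos (act w (sr k))"
  have kS: "k \<in> S" "k \<in> carrier W" using K S_carrier by auto
  have Gc: "w \<in> carrier W" if "w \<in> ?G" for w using gen_sub[OF K(1) that] .
  have kG: "w \<otimes> k \<in> ?G" if "w \<in> ?G" for w using that K by (simp add: gen_mult gen_S)
  have flip: "?p (w \<otimes> k) \<longleftrightarrow> \<not> ?p w" if "w \<in> ?G" for w
    using orient_flip[OF orient_pos Gc[OF that] kS(1)] .
  have "?L = (\<Sum>w\<in>?G. \<phi> w * ((if ?p w then qq else 1) * c (w \<otimes> k))) + (\<Sum>w\<in>?G. \<phi> w * (if ?p w then 0 else (qq - 1) * c w))"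
    unfolding sum.distrib[symmetric] by (rule sum.cong) (auto simp: algebra_simps)
  also have "(\<Sum>w\<in>?G. \<phi> w * ((if ?p w then qq else 1) * c (w \<otimes> k))) =
    (\<Sum>w\<in>?G. \<phi> (w \<otimes> k) * ((if ?p w then 1 else qq) * c w))"
    by (rule sum.reindex_bij_witness[of _ "\<lambda>w. w \<otimes> k" "\<lambda>w. w \<otimes> k"]) (auto simp: kG Gc kS flip)
  finally show ?thesis unfolding sum.distrib[symmetric]
    by (auto simp: ract_def algebra_simps intro!: sum.cong)
qed

end

locale twisted_parabolic = coxeter_gcm W S A for W :: "'w monoid" (structure) and S A +
  fixes K :: "'w set" and a0 :: 'w and \<sigma> :: "'w \<Rightarrow> 'w"
  assumes K: "K \<subseteq> S" and fin_K: "finite (generate W K)" and a0: "a0 \<in> carrier W"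
    and \<sigma>: "bij_betw \<sigma> K K" "\<And>k. k \<in> K \<Longrightarrow> act a0 (sr k) = sr (\<sigma> k)"
begin

abbreviation WK where "WK \<equiv> generate W K"

lemma WK_c: "w \<in> WK \<Longrightarrow> w \<in> carrier W" using gen_sub[OF K] .

lemma PhiK_sr: "k \<in> K \<Longrightarrow> sr k \<in> PhiK K" using K roots_sr by (auto simp: PhiK_def pw_simps)

lemma PhiK_gen: "w \<in> WK \<Longrightarrow> \<beta> \<in> PhiK K \<Longrightarrow> act w \<beta> \<in> PhiK K"
  using act_gen_outside[OF K] roots_act WK_c by (auto simp: PhiK_def)

lemma PhiK_gen_iff: "w \<in> WK \<Longrightarrow> act w \<beta> \<in> PhiK K \<longleftrightarrow> \<beta> \<in> PhiK K"
  using PhiK_gen[of w \<beta>] PhiK_gen[of "inv w" "act w \<beta>"] gen_inv[OF K] WK_c by auto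

lemma a0_inv_K: "k \<in> K \<Longrightarrow> \<exists>j\<in>K. act (inv a0) (sr k) = sr j"
  using \<sigma> a0 by (metis (no_types, opaque_lifting) act_inv(2) bij_betw_def imageE)

lemma PhiK_a0: "\<beta> \<in> PhiK K \<Longrightarrow> act a0 \<beta> \<in> PhiK K" "\<beta> \<in> PhiK K \<Longrightarrow> act (inv a0) \<beta> \<in> PhiK K"
proof -
  have fK: "finite K" using finite_subset[OF K] fin by blast
  have *: "act x \<beta> \<in> PhiK K" if b: "\<beta> \<in> PhiK K" and x: "x \<in> carrier W" "\<And>k. k \<in> K \<Longrightarrow> \<exists>j\<in>K. act x (sr k) = sr j" for x \<beta>
  proof -
    have "act x \<beta> y = 0" if "y \<notin> K" for y
    proof -
      have "act x (sr k) y = 0" if "k \<in> K" for k using x(2)[OF that] \<open>y \<notin> K\<close> by (auto simp: pw_simps)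
      then show ?thesis using act_expand[OF fK _ x(1), of \<beta>] b by (auto simp: PhiK_def sum_fun_apply pw_simps)
    qed
    then show ?thesis using b x roots_act by (auto simp: PhiK_def)
  qed
  have a0K: "\<exists>j\<in>K. act a0 (sr k) = sr j" if "k \<in> K" for k
    using \<sigma>(2)[OF that] bij_betwE[OF \<sigma>(1)] that by blast
  show "\<beta> \<in> PhiK K \<Longrightarrow> act a0 \<beta> \<in> PhiK K" "\<beta> \<in> PhiK K \<Longrightarrow> act (inv a0) \<beta> \<in> PhiK K"
    using *[OF _ a0 a0K] *[OF _ inv_closed[OF a0] a0_inv_K] by auto
qed

lemma a0_pos: "\<gamma> \<in> PhiK K \<Longrightarrow> pos (act (inv a0) \<gamma>) = pos \<gamma>"
  using PhiK_pos[OF K, of "inv a0"] a0 a0_inv_K by (metis inv_closed pos_sr)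

end

section \<open>The regularised trace\<close>

text \<open>\<open>W_K\<close> preserves the orientation outside its own roots, \<open>a0\<close>
  preserves all of it, and \<Gamma> is a group of symmetries of the whole construction.
  \<open>fin_orb\<close> is the finiteness of the trace, asked only for those w where \<phi> does
  not vanish.\<close>

locale coxeter_datum = twisted_parabolic W S A K a0 \<sigma> for W :: "'w monoid" (structure) and S A K a0 \<sigma> +
  fixes ori :: "('w \<Rightarrow> int) \<Rightarrow> bool" and \<Gamma> :: "'w set" and \<phi> :: "'w \<Rightarrow> laurent"
  assumes ori: "orient ori"
    and ori_K: "\<gamma> \<in> PhiK K \<Longrightarrow> ori \<gamma> = pos \<gamma>"
    and ori_act_K: "\<lbrakk>k \<in> K; \<beta> \<in> roots; \<beta> \<notin> PhiK K\<rbrakk> \<Longrightarrow> ori (act k \<beta>) = ori \<beta>"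
    and braid: "\<lbrakk>s \<in> S; t \<in> S; s \<noteq> t; cox_m W s t \<noteq> 0; h \<in> carrier W; x \<in> carrier W\<rbrakk> \<Longrightarrow>
      coef ori (alt_word (cox_m W s t) s t) h x = coef ori (alt_word (cox_m W s t) t s) h x"
    and ori_a0: "\<beta> \<in> roots \<Longrightarrow> ori (act a0 \<beta>) = ori \<beta>"
    and \<Gamma>: "subgroup \<Gamma> W"
    and \<Gamma>_K: "\<lbrakk>z \<in> \<Gamma>; k \<in> K\<rbrakk> \<Longrightarrow> act z (sr k) = sr k"
    and \<Gamma>_a0: "z \<in> \<Gamma> \<Longrightarrow> z \<otimes> a0 = a0 \<otimes> z"
    and \<Gamma>_ori: "\<lbrakk>z \<in> \<Gamma>; \<beta> \<in> roots\<rbrakk> \<Longrightarrow> ori (act z \<beta>) = ori \<beta>"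
    and \<phi>: "\<lbrakk>k \<in> K; w \<in> generate W K\<rbrakk> \<Longrightarrow> lact \<phi> k w = ract \<phi> (\<sigma> k) w"
    and fin_orb: "\<lbrakk>w \<in> generate W K; \<phi> w \<noteq> 0; v \<in> carrier W\<rbrakk> \<Longrightarrow>
      \<exists>F. finite F \<and> F \<subseteq> carrier W \<and>
        (\<forall>h\<in>carrier W. (\<forall>k\<in>K. pos (act (inv h) (sr k))) \<longrightarrow> w \<otimes> a0 \<otimes> h = h \<otimes> v \<longrightarrow>
           (\<exists>z\<in>\<Gamma>. \<exists>h'\<in>F. h = z \<otimes> h'))"
begin

text \<open>Elements without left descent in K, that is, the minimal representatives of the cosets
  \<open>W_K h\<close>.\<close>

definition Y :: "'w set" where
  "Y = {h \<in> carrier W. \<forall>k\<in>K. pos (act (inv h) (sr k))}"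

text \<open>The block of matrix coefficients from \<open>h1\<close> to the coset of
  \<open>a0 \<otimes> h2\<close>, contracted with \<phi>. The diagonal blocks are the summands of
  the trace.\<close>

definition tm :: "'w list \<Rightarrow> 'w \<Rightarrow> 'w \<Rightarrow> laurent" where
  "tm v h1 h2 = (\<Sum>w\<in>WK. \<phi> w * coef ori v h1 (w \<otimes> a0 \<otimes> h2))"

lemma Y_c: "h \<in> Y \<Longrightarrow> h \<in> carrier W" by (simp add: Y_def)

lemma \<Gamma>_c: "z \<in> \<Gamma> \<Longrightarrow> z \<in> carrier W" using subgroup.mem_carrier[OF \<Gamma>] .

lemma ori_gen: "w \<in> WK \<Longrightarrow> \<beta> \<in> roots \<Longrightarrow> \<beta> \<notin> PhiK K \<Longrightarrow> ori (act w \<beta>) = ori \<beta>"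
proof -
  have "\<beta> \<notin> PhiK K \<Longrightarrow> \<beta> \<in> roots \<Longrightarrow> ori (act (word_prod W ss) \<beta>) = ori \<beta>" if "ss \<in> lists K" for ss
    using that
  proof (induction ss)
    case (Cons k ss)
    have ss: "word_prod W ss \<in> WK" "word_prod W ss \<in> carrier W" "k \<in> carrier W"
      using Cons word_generate[OF _ K] WK_c K S_carrier by auto
    then show ?case using Cons ori_act_K[of k "act (word_prod W ss) \<beta>"] PhiK_gen_iff[of "word_prod W ss"]
      by (simp add: act_mult roots_act)
  qed simp
  then show "w \<in> WK \<Longrightarrow> \<beta> \<in> roots \<Longrightarrow> \<beta> \<notin> PhiK K \<Longrightarrow> ?thesis"
    using generate_word[OF K] by metis
qed

lemma Y_PhiK: "h \<in> Y \<Longrightarrow> \<gamma> \<in> PhiK K \<Longrightarrow> pos (act (inv h) \<gamma>) = pos \<gamma>"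
  using PhiK_pos[OF K, of "inv h"] by (auto simp: Y_def)

lemma Y_simple: "h \<in> Y \<Longrightarrow> s \<in> S \<Longrightarrow> act h (sr s) \<in> PhiK K \<Longrightarrow> \<exists>k\<in>K. act h (sr s) = sr k"
  using PhiK_simple[OF K, of "inv h" "act h (sr s)" s] by (auto simp: Y_def)

lemma Y_step: "h \<in> Y \<Longrightarrow> s \<in> S \<Longrightarrow> act h (sr s) \<notin> PhiK K \<Longrightarrow> h \<otimes> s \<in> Y"
proof -
  assume a: "h \<in> Y" "s \<in> S" "act h (sr s) \<notin> PhiK K"
  have hc: "h \<in> carrier W" "s \<in> carrier W" using a Y_c S_carrier by auto
  have "pos (act (inv (h \<otimes> s)) (sr k))" if k: "k \<in> K" for k
  proof -
    have r: "act (inv h) (sr k) \<in> roots" "pos (act (inv h) (sr k))" using k K root_hs hc a by (auto simp: Y_def)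
    have "act (inv h) (sr k) \<noteq> sr s"
      using a(3) PhiK_sr[OF k] hc by (metis act_inv(1))
    then show ?thesis using simple_flip[OF r a(2)] hc a(2) by (auto simp: inv_hs)
  qed
  then show ?thesis using hc by (simp add: Y_def)
qed

lemma coef_gen_ori:
  assumes "h \<in> Y" "s \<in> S" "w \<in> WK"
  shows "ori (act (w \<otimes> a0 \<otimes> h) (sr s)) = (if act h (sr s) \<in> PhiK K then pos (act w (act a0 (act h (sr s)))) else ori (act h (sr s)))"
proof -
  have c: "h \<in> carrier W" "w \<in> carrier W" "act h (sr s) \<in> roots" using assms Y_c WK_c root_hs by auto
  have e: "act (w \<otimes> a0 \<otimes> h) (sr s) = act w (act a0 (act h (sr s)))" using c a0 by (simp add: act_mult)
  show ?thesis
  proof (cases "act h (sr s) \<in> PhiK K")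
    case True
    then show ?thesis using e PhiK_gen[OF assms(3) PhiK_a0(1)] ori_K by simp
  next
    case False
    have "act a0 (act h (sr s)) \<notin> PhiK K" using False PhiK_a0(2)[of "act a0 (act h (sr s))"] a0 by auto
    then show ?thesis using e False ori_gen[OF assms(3)] ori_a0 c roots_act[OF a0] by simp
  qed
qed

lemma orient_K: "k \<in> K \<Longrightarrow> compat ori k"
  unfolding compat_def
proof (intro conjI ballI impI)
  assume k: "k \<in> K"
  then show "ori (sr k)" using ori_K PhiK_sr by auto
  fix \<beta> assume b: "\<beta> \<in> roots" "\<beta> \<noteq> sr k" "\<beta> \<noteq> - sr k"
  show "ori (act k \<beta>) = ori \<beta>"
  proof (cases "\<beta> \<in> PhiK K")
    case True
    then have "act k \<beta> \<in> PhiK K" using PhiK_gen k gen_S by blast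
    then show ?thesis using ori_K True pos_flip b k K by auto
  qed (use ori_act_K k b in auto)
qed

text \<open>On a wall of K the first letter s acts as left multiplication by k, since
  \<open>h \<otimes> s = k \<otimes> h\<close>. At the far end the letter passes \<open>a0\<close>
  and becomes right multiplication of w by \<open>\<sigma> k\<close>. The twisted trace property of
  \<phi> identifies the two, so rotation is exact for each such \<open>h\<close> separately.\<close>

lemma tm_cons_type1:
  assumes h: "h \<in> Y" and s: "s \<in> S" and k: "k \<in> K" and e: "act h (sr s) = sr k" and v: "v \<in> lists S"
  shows "tm (s # v) h h = tm (v @ [s]) h h"
proof -
  have c: "h \<in> carrier W" "s \<in> carrier W" "k \<in> S" "k \<in> carrier W" using h s k K Y_c S_carrier by auto
  let ?c = "\<lambda>w. coef ori v h (w \<otimes> a0 \<otimes> h)"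
  have sk: "\<sigma> k \<in> K" using \<sigma> k by (auto simp: bij_betw_def)
  have skc: "\<sigma> k \<in> carrier W" using sk K S_carrier by auto
  have hs: "h \<otimes> s = k \<otimes> h" using simple_conj[OF c(1) s c(3) e] .
  have a0k: "a0 \<otimes> k = \<sigma> k \<otimes> a0" using simple_conj[OF a0 c(3) _ \<sigma>(2)[OF k]] sk K by auto
  have ok: "ori (sr k)" using ori_K PhiK_sr k by auto
  have phk: "pos (act (inv h) (sr k))" using h k by (simp add: Y_def)
  have 1: "coef ori (s # v) h (w \<otimes> a0 \<otimes> h) =
      (if pos (act (inv w) (sr k)) then qq * ?c (k \<otimes> w) else ?c (k \<otimes> w) + (qq - 1) * ?c w)" if w: "w \<in> WK" for w
  proof -
    have wc: "w \<in> carrier W" using WK_c w .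
    have g: "act (inv w) (sr k) \<in> PhiK K" using PhiK_gen gen_inv[OF K w] PhiK_sr k by blast
    have "act (inv (w \<otimes> a0 \<otimes> h)) (sr k) = act (inv h) (act (inv a0) (act (inv w) (sr k)))"
      using wc a0 c by (simp add: inv_mult_group act_mult)
    then have "pos (act (inv (w \<otimes> a0 \<otimes> h)) (sr k)) = pos (act (inv w) (sr k))"
      using Y_PhiK[OF h PhiK_a0(2)[OF g]] a0_pos[OF g] by simp
    then show ?thesis
      using Lop_coef[OF ori orient_K[OF k] c(3) _ v c(1), of "w \<otimes> a0 \<otimes> h"] wc a0 c
      by (cases "pos (act (inv w) (sr k))") (simp_all add: e ok hs phk Lop_def m_assoc)
  qed
  have 2: "coef ori (v @ [s]) h (w \<otimes> a0 \<otimes> h) =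
      (if pos (act w (sr (\<sigma> k))) then qq * ?c (w \<otimes> \<sigma> k) else ?c (w \<otimes> \<sigma> k) + (qq - 1) * ?c w)" if w: "w \<in> WK" for w
  proof -
    have wc: "w \<in> carrier W" using WK_c w .
    have "w \<otimes> a0 \<otimes> h \<otimes> s = w \<otimes> a0 \<otimes> (k \<otimes> h)" using wc a0 c hs by (simp add: m_assoc)
    also have "\<dots> = w \<otimes> (a0 \<otimes> k) \<otimes> h" using wc a0 c by (simp add: m_assoc)
    also have "\<dots> = w \<otimes> \<sigma> k \<otimes> a0 \<otimes> h" unfolding a0k using wc a0 c skc by (simp add: m_assoc)
    finally show ?thesis
      using coef_snoc[OF ori s _ v c(1), of "w \<otimes> a0 \<otimes> h"] wc a0 c coef_gen_ori[OF h s w] PhiK_sr[OF k]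
      by (simp add: e \<sigma>(2)[OF k])
  qed
  note 2 = 2[symmetric]
  have "tm (s # v) h h = (\<Sum>w\<in>WK. ?c w * lact \<phi> k w)"
    unfolding tm_def sum_lact[OF K k, symmetric] by (intro sum.cong refl arg_cong2[where f = "(*)"] 1)
  also have "\<dots> = (\<Sum>w\<in>WK. ?c w * ract \<phi> (\<sigma> k) w)" using \<phi>[OF k] by simp
  also have "\<dots> = tm (v @ [s]) h h"
    unfolding tm_def sum_ract[OF K sk, symmetric] by (intro sum.cong refl arg_cong2[where f = "(*)"] 2)
  finally show ?thesis .
qed

lemma tm_cons_type2:
  assumes h: "h \<in> Y" and s: "s \<in> S" and e: "act h (sr s) \<notin> PhiK K" and v: "v \<in> lists S"
  shows "tm (s # v) h h - tm (v @ [s]) h h = (if ori (act h (sr s))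
    then tm v (h \<otimes> s) h - qq * tm v h (h \<otimes> s) else qq * tm v (h \<otimes> s) h - tm v h (h \<otimes> s))"
proof -
  have c: "h \<in> carrier W" "s \<in> carrier W" using h s Y_c S_carrier by auto
  have 1: "tm (s # v) h h = (if ori (act h (sr s)) then tm v (h \<otimes> s) h
      else qq * tm v (h \<otimes> s) h + (qq - 1) * tm v h h)"
    by (simp add: tm_def sum_distrib_left sum.distrib[symmetric] algebra_simps)
  have "coef ori (v @ [s]) h (w \<otimes> a0 \<otimes> h) = (if ori (act h (sr s)) then qq * coef ori v h (w \<otimes> a0 \<otimes> (h \<otimes> s))
      else coef ori v h (w \<otimes> a0 \<otimes> (h \<otimes> s)) + (qq - 1) * coef ori v h (w \<otimes> a0 \<otimes> h))" if w: "w \<in> WK" for w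
    using coef_snoc[OF ori s _ v c(1), of "w \<otimes> a0 \<otimes> h"] WK_c[OF w] a0 c coef_gen_ori[OF h s w] e
    by (simp add: m_assoc)
  then have 2: "tm (v @ [s]) h h = (if ori (act h (sr s)) then qq * tm v h (h \<otimes> s)
      else tm v h (h \<otimes> s) + (qq - 1) * tm v h h)"
    by (simp add: tm_def sum_distrib_left sum.distrib[symmetric] algebra_simps)
  show ?thesis unfolding 1 2 by (simp add: algebra_simps)
qed

text \<open>Off the walls the defect of a rotation need not vanish, but only the mixed blocks
  between \<open>h\<close> and \<open>h \<otimes> s\<close> remain in it. Exchanging these two
  elements reverses the orientation and hence the sign.\<close>

lemma tm_antisym:
  assumes h: "h \<in> Y" and s: "s \<in> S" and e: "act h (sr s) \<notin> PhiK K" and v: "v \<in> lists S"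
  shows "tm (s # v) (h \<otimes> s) (h \<otimes> s) - tm (v @ [s]) (h \<otimes> s) (h \<otimes> s) = - (tm (s # v) h h - tm (v @ [s]) h h)"
proof -
  have c: "h \<in> carrier W" "s \<in> carrier W" using h s Y_c S_carrier by auto
  have e': "act (h \<otimes> s) (sr s) \<notin> PhiK K"
    using e roots_uminus[of "act (h \<otimes> s) (sr s)"] c s by (auto simp: act_mult_s PhiK_def pw_simps root_hs)
  show ?thesis
    unfolding tm_cons_type2[OF h s e v] tm_cons_type2[OF Y_step[OF h s e] s e' v]
    using orient_flip[OF ori c(1) s] c s by simp
qed

lemma tm_invariant:
  assumes z: "z \<in> \<Gamma>" and h: "h1 \<in> carrier W" "h2 \<in> carrier W" and v: "v \<in> lists S"
  shows "tm v (z \<otimes> h1) (z \<otimes> h2) = tm v h1 h2"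
  unfolding tm_def
proof (rule sum.cong[OF refl])
  fix w assume w: "w \<in> WK"
  have c: "z \<in> carrier W" "w \<in> carrier W" using z w \<Gamma>_c WK_c by auto
  have "w \<otimes> z = z \<otimes> w" using K w
  proof (induction rule: gen_induct)
    case (mult w k)
    have kc: "k \<in> S" "k \<in> carrier W" "w \<in> carrier W" using mult K S_carrier WK_c by auto
    have "z \<otimes> k = k \<otimes> z" using simple_conj[OF c(1) kc(1) kc(1) \<Gamma>_K[OF z]] mult by simp
    then show ?case using mult kc c by (metis m_assoc)
  qed (use c in simp)
  then have "w \<otimes> a0 \<otimes> (z \<otimes> h2) = z \<otimes> (w \<otimes> a0 \<otimes> h2)"
    using c h a0 \<Gamma>_a0[OF z] by (metis m_assoc m_closed)
  then show "\<phi> w * coef ori v (z \<otimes> h1) (w \<otimes> a0 \<otimes> (z \<otimes> h2)) = \<phi> w * coef ori v h1 (w \<otimes> a0 \<otimes> h2)"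
    using coef_invariant[of z ori "w \<otimes> a0 \<otimes> h2" v h1] \<Gamma>_ori[OF z] v c h a0 by simp
qed

definition \<Omega> :: "'w set set" where "\<Omega> = (\<lambda>h. \<Gamma> #> h) ` Y"

definition rep :: "'w set \<Rightarrow> 'w" where "rep Q = (SOME h. h \<in> Q)"

text \<open>One representative per orbit; only orbits with nonzero value are summed, so the index
  set can be finite while \<open>\<Omega>\<close> is infinite.\<close>

definition orbsum :: "('w \<Rightarrow> laurent) \<Rightarrow> laurent" where
  "orbsum F = (\<Sum>Q\<in>{Q \<in> \<Omega>. F (rep Q) \<noteq> 0}. F (rep Q))"

definition orbfun :: "('w \<Rightarrow> laurent) \<Rightarrow> bool" where
  "orbfun F \<longleftrightarrow> (\<forall>z\<in>\<Gamma>. \<forall>h\<in>Y. F (z \<otimes> h) = F h) \<and> finite {Q \<in> \<Omega>. F (rep Q) \<noteq> 0}"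

lemma \<Gamma>_Y: "z \<in> \<Gamma> \<Longrightarrow> h \<in> Y \<Longrightarrow> z \<otimes> h \<in> Y"
proof -
  assume a: "z \<in> \<Gamma>" "h \<in> Y"
  have "act (inv (z \<otimes> h)) (sr k) = act (inv h) (sr k)" if "k \<in> K" for k
  proof -
    have "act (inv z) (sr k) = sr k"
      using \<Gamma>_K[OF subgroup.m_inv_closed[OF \<Gamma> a(1)] that] .
    then show ?thesis using a \<Gamma>_c Y_c by (simp add: inv_mult_group act_mult)
  qed
  then show ?thesis using a \<Gamma>_c by (auto simp: Y_def)
qed

lemma rep_in: "Q \<in> \<Omega> \<Longrightarrow> rep Q \<in> Q"
proof -
  assume "Q \<in> \<Omega>"
  then obtain h where "h \<in> Y" "Q = \<Gamma> #> h" by (auto simp: \<Omega>_def)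
  then have "h \<in> Q" using rcos_self[OF _ \<Gamma>] Y_c by auto
  then show ?thesis unfolding rep_def by (rule someI)
qed

lemma orbit_eq:
  assumes "h \<in> Y" "y \<in> \<Gamma> #> h"
  shows "y \<in> Y" "\<Gamma> #> y = \<Gamma> #> h" "\<exists>z\<in>\<Gamma>. y = z \<otimes> h"
proof -
  show z: "\<exists>z\<in>\<Gamma>. y = z \<otimes> h" using assms(2) by (auto simp: r_coset_def)
  then show "y \<in> Y" using \<Gamma>_Y assms by blast
  show "\<Gamma> #> y = \<Gamma> #> h" using repr_independence[OF assms(2) Y_c[OF assms(1)] \<Gamma>] by simp
qed

lemma rep_orbit:
  assumes "Q \<in> \<Omega>"
  shows "rep Q \<in> Y" "\<Gamma> #> rep Q = Q"
proof -
  obtain h where h: "h \<in> Y" "Q = \<Gamma> #> h" using assms by (auto simp: \<Omega>_def)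
  then have "rep Q \<in> \<Gamma> #> h" using rep_in[OF assms] by simp
  then show "rep Q \<in> Y" "\<Gamma> #> rep Q = Q" using orbit_eq(1,2)[OF h(1)] h(2) by simp_all
qed

lemma rep_rcoset:
  assumes "h \<in> Y" "orbfun F" shows "F (rep (\<Gamma> #> h)) = F h"
proof -
  have "\<Gamma> #> h \<in> \<Omega>" using assms by (auto simp: \<Omega>_def)
  then obtain z where "z \<in> \<Gamma>" "rep (\<Gamma> #> h) = z \<otimes> h" using rep_in orbit_eq(3)[OF assms(1)] by metis
  then show ?thesis using assms by (simp add: orbfun_def)
qed

lemma orbsum_superset:
  assumes "finite B" "B \<subseteq> \<Omega>" "\<And>Q. Q \<in> \<Omega> \<Longrightarrow> F (rep Q) \<noteq> 0 \<Longrightarrow> Q \<in> B"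
  shows "orbsum F = (\<Sum>Q\<in>B. F (rep Q))"
  unfolding orbsum_def using assms by (intro sum.mono_neutral_left) auto

lemma orbsum_lin:
  assumes "orbfun F" "orbfun G"
  shows "orbsum (\<lambda>h. a * F h + b * G h) = a * orbsum F + b * orbsum G"
    "orbfun (\<lambda>h. a * F h + b * G h)"
proof -
  let ?B = "{Q \<in> \<Omega>. F (rep Q) \<noteq> 0} \<union> {Q \<in> \<Omega>. G (rep Q) \<noteq> 0}"
  have B: "finite ?B" "?B \<subseteq> \<Omega>" using assms by (auto simp: orbfun_def)
  note S = orbsum_superset[OF B]
  have "orbsum F = (\<Sum>Q\<in>?B. F (rep Q))" "orbsum G = (\<Sum>Q\<in>?B. G (rep Q))"
    by (rule S; force)+
  moreover have "orbsum (\<lambda>h. a * F h + b * G h) = (\<Sum>Q\<in>?B. a * F (rep Q) + b * G (rep Q))"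
    by (rule S) auto
  ultimately show "orbsum (\<lambda>h. a * F h + b * G h) = a * orbsum F + b * orbsum G"
    by (simp add: sum.distrib sum_distrib_left)
  have "{Q \<in> \<Omega>. a * F (rep Q) + b * G (rep Q) \<noteq> 0} \<subseteq> ?B" by auto
  then show "orbfun (\<lambda>h. a * F h + b * G h)" using assms B(1) by (auto simp: orbfun_def intro: finite_subset)
qed

text \<open>The involution \<open>h \<mapsto> h s\<close> on the orbits off the walls of \<open>K\<close> reverses the sign of every term.\<close>

lemma orbsum_antisym:
  assumes D: "orbfun D" and s: "s \<in> S"
    and D0: "\<And>h. \<lbrakk>h \<in> Y; act h (sr s) \<in> PhiK K\<rbrakk> \<Longrightarrow> D h = 0"
    and Ds: "\<And>h. \<lbrakk>h \<in> Y; act h (sr s) \<notin> PhiK K\<rbrakk> \<Longrightarrow> D (h \<otimes> s) = - D h"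
  shows "orbsum D = 0"
proof -
  let ?B = "{Q \<in> \<Omega>. D (rep Q) \<noteq> 0}"
  let ?i = "\<lambda>Q. \<Gamma> #> (rep Q \<otimes> s)"
  have sc: "s \<in> carrier W" using s S_carrier by blast
  have step: "?i Q \<in> ?B \<and> ?i (?i Q) = Q \<and> D (rep (?i Q)) = - D (rep Q)" if Q: "Q \<in> ?B" for Q
  proof -
    have y: "rep Q \<in> Y" "\<Gamma> #> rep Q = Q" "rep Q \<in> carrier W" using rep_orbit Q Y_c by auto
    have t: "act (rep Q) (sr s) \<notin> PhiK K" using D0 y Q by auto
    have ys: "rep Q \<otimes> s \<in> Y" using Y_step[OF y(1) s t] .
    have d: "D (rep (?i Q)) = - D (rep Q)" using rep_rcoset[OF ys D] Ds[OF y(1) t] by simp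
    have io: "?i Q \<in> \<Omega>" using ys by (auto simp: \<Omega>_def)
    obtain z where z: "z \<in> \<Gamma>" "rep (?i Q) = z \<otimes> (rep Q \<otimes> s)"
      using rep_in[OF io] orbit_eq(3)[OF ys] by metis
    have "rep (?i Q) \<otimes> s = z \<otimes> rep Q"
      using z \<Gamma>_c y sc s by (simp add: m_assoc S_sq)
    moreover have "\<Gamma> #> (z \<otimes> rep Q) = \<Gamma> #> rep Q"
      by (rule orbit_eq(2)[OF y(1)]) (use z in \<open>auto simp: r_coset_def\<close>)
    ultimately show ?thesis using d io Q y by simp
  qed
  have "orbsum D = (\<Sum>Q\<in>?B. D (rep (?i Q)))"
    unfolding orbsum_def by (rule sum.reindex_bij_witness[of _ ?i ?i]) (use step in auto)
  also have "\<dots> = - orbsum D" unfolding orbsum_def sum_negf[symmetric] by (rule sum.cong) (use step in auto)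
  \<comment> \<open>The sum equals its own negative, and Laurent polynomials over the integers have
    no 2-torsion.\<close>
  finally have "2 * orbsum D = 0" by simp
  then show ?thesis by simp
qed

definition tr :: "'w list \<Rightarrow> laurent" where "tr v = orbsum (\<lambda>h. tm v h h)"

text \<open>A nonzero block at \<open>h\<close> yields w with \<open>\<phi> w \<noteq> 0\<close> and
  a subword product x of v with \<open>w \<otimes> a0 \<otimes> h = h \<otimes> x\<close>. There are
  finitely many such pairs, and \<open>fin_orb\<close> handles each.\<close>

lemma orbfun_tm: "v \<in> lists S \<Longrightarrow> orbfun (\<lambda>h. tm v h h)"
proof -
  assume v: "v \<in> lists S"
  let ?I = "{w \<in> WK. \<phi> w \<noteq> 0} \<times> subw v"
  define P where "P p F \<longleftrightarrow> finite F \<and> F \<subseteq> carrier W \<and>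
      (\<forall>h\<in>Y. fst p \<otimes> a0 \<otimes> h = h \<otimes> snd p \<longrightarrow> (\<exists>z\<in>\<Gamma>. \<exists>h'\<in>F. h = z \<otimes> h'))" for p F
  have "\<exists>F. P p F" if "p \<in> ?I" for p
  proof -
    obtain w x where p: "p = (w, x)" by fastforce
    then have "w \<in> WK" "\<phi> w \<noteq> 0" "x \<in> carrier W" using that subw_carrier[OF v] by auto
    from fin_orb[OF this] show ?thesis unfolding P_def Y_def p by auto
  qed
  then obtain F where F': "\<And>p. p \<in> ?I \<Longrightarrow> P p (F p)" by meson
  note F = F'[unfolded P_def]
  have fI: "finite ?I" using fin_K by auto
  have "{Q \<in> \<Omega>. tm v (rep Q) (rep Q) \<noteq> 0} \<subseteq> (\<lambda>h. \<Gamma> #> h) ` (\<Union>p\<in>?I. F p)"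
  proof
    fix Q assume "Q \<in> {Q \<in> \<Omega>. tm v (rep Q) (rep Q) \<noteq> 0}"
    then have Q: "Q \<in> \<Omega>" "tm v (rep Q) (rep Q) \<noteq> 0" by auto
    let ?h = "rep Q"
    obtain w where w: "w \<in> WK" "\<phi> w * coef ori v ?h (w \<otimes> a0 \<otimes> ?h) \<noteq> 0"
      using Q(2) unfolding tm_def by (meson sum.neutral)
    have hY: "?h \<in> Y" using rep_orbit[OF Q(1)] by blast
    obtain x where x: "x \<in> subw v" "w \<otimes> a0 \<otimes> ?h = ?h \<otimes> x"
      using coef_support[OF v Y_c[OF hY], of ori "w \<otimes> a0 \<otimes> ?h"] w by auto
    have p: "(w, x) \<in> ?I" using w x by auto
    then obtain z h' where zh: "z \<in> \<Gamma>" "h' \<in> F (w, x)" "?h = z \<otimes> h'" using F[OF p] hY x by (metis fst_conv snd_conv)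
    have h'c: "h' \<in> carrier W" using F[OF p] zh by blast
    have "?h \<in> \<Gamma> #> h'" using zh by (auto simp: r_coset_def)
    then have "\<Gamma> #> h' = Q" using repr_independence[OF _ h'c \<Gamma>] rep_orbit(2)[OF Q(1)] by metis
    then show "Q \<in> (\<lambda>h. \<Gamma> #> h) ` (\<Union>p\<in>?I. F p)" using zh p by blast
  qed
  moreover have "finite ((\<lambda>h. \<Gamma> #> h) ` (\<Union>p\<in>?I. F p))" using F fI by auto
  ultimately have "finite {Q \<in> \<Omega>. tm v (rep Q) (rep Q) \<noteq> 0}" by (rule finite_subset)
  then show ?thesis using tm_invariant[OF _ Y_c Y_c v] by (auto simp: orbfun_def)
qed

lemma tr_rotate1: "s \<in> S \<Longrightarrow> v \<in> lists S \<Longrightarrow> tr (s # v) = tr (v @ [s])"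
proof -
  assume s: "s \<in> S" and v: "v \<in> lists S"
  have o: "orbfun (\<lambda>h. tm (s # v) h h)" "orbfun (\<lambda>h. tm (v @ [s]) h h)"
    using orbfun_tm[of "s # v"] orbfun_tm[of "v @ [s]"] s v by simp_all
  let ?D = "\<lambda>h. 1 * tm (s # v) h h + (-1) * tm (v @ [s]) h h"
  have "orbsum ?D = 0"
  proof (rule orbsum_antisym[OF orbsum_lin(2)[OF o] s])
    fix h assume h: "h \<in> Y"
    { assume "act h (sr s) \<in> PhiK K"
      then show "?D h = 0" using Y_simple[OF h s] tm_cons_type1[OF h s _ _ v] by auto }
    { assume "act h (sr s) \<notin> PhiK K"
      then show "?D (h \<otimes> s) = - ?D h" using tm_antisym[OF h s _ v] by simp }
  qed
  then show ?thesis unfolding orbsum_lin(1)[OF o] by (simp add: tr_def)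
qed

lemma tr_rotate: "u \<in> lists S \<Longrightarrow> v \<in> lists S \<Longrightarrow> tr (u @ v) = tr (v @ u)"
proof -
  have "v \<in> lists S \<Longrightarrow> tr (u @ v) = tr (v @ u)" if "u \<in> lists S" for u v
    using that
  proof (induction u arbitrary: v)
    case (Cons s u)
    then show ?case using tr_rotate1[of s "u @ v"] Cons.IH[of "v @ [s]"] by simp
  qed simp
  then show "u \<in> lists S \<Longrightarrow> v \<in> lists S \<Longrightarrow> ?thesis" by blast
qed

lemma tr_quadratic: "s \<in> S \<Longrightarrow> v \<in> lists S \<Longrightarrow> tr (s # s # v) = (qq - 1) * tr (s # v) + qq * tr v"
proof -
  assume s: "s \<in> S" and v: "v \<in> lists S"
  have c: "coef ori (s # s # v) h x = (qq - 1) * coef ori (s # v) h x + qq * coef ori v h x"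
    if "h \<in> carrier W" for h x
    using orient_flip[OF ori that s] that s S_carrier[OF s] by (simp add: algebra_simps)
  have "tm (s # s # v) h h = (qq - 1) * tm (s # v) h h + qq * tm v h h" if "h \<in> Y" for h
    unfolding tm_def sum_distrib_left sum.distrib[symmetric] c[OF Y_c[OF that]]
    by (simp add: algebra_simps)
  then have "tr (s # s # v) = orbsum (\<lambda>h. (qq - 1) * tm (s # v) h h + qq * tm v h h)"
    unfolding tr_def orbsum_def by (intro sum.cong) (auto simp: rep_orbit)
  then show ?thesis using orbsum_lin(1)[OF orbfun_tm orbfun_tm, of "s # v" v] s v by (simp add: tr_def)
qed

lemma tr_braid:
  assumes "s \<in> S" "t \<in> S" "s \<noteq> t" "cox_m W s t \<noteq> 0" "v \<in> lists S"
  shows "tr (alt_word (cox_m W s t) s t @ v) = tr (alt_word (cox_m W s t) t s @ v)"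
proof -
  let ?u = "alt_word (cox_m W s t) s t" and ?u' = "alt_word (cox_m W s t) t s"
  have "tm (?u @ v) h h = tm (?u' @ v) h h" if h: "h \<in> Y" for h
    unfolding tm_def
  proof (rule sum.cong[OF refl])
    fix w assume "w \<in> WK"
    then have "w \<otimes> a0 \<otimes> h \<in> carrier W" using WK_c a0 Y_c h by simp
    then show "\<phi> w * coef ori (?u @ v) h (w \<otimes> a0 \<otimes> h) = \<phi> w * coef ori (?u' @ v) h (w \<otimes> a0 \<otimes> h)"
      using coef_append_eq[OF ori alt_word_lists[OF assms(1,2)] alt_word_lists[OF assms(2,1)] Y_c[OF h] braid[OF assms(1-4) Y_c[OF h]] assms(5)] by simp
  qed
  then show ?thesis unfolding tr_def orbsum_def by (intro sum.cong) (auto simp: rep_orbit)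
qed

lemma ev1_tm:
  assumes "v \<in> lists S" "h \<in> carrier W"
  shows "ev1 (tm v h h) = (\<Sum>w\<in>WK. if w \<otimes> a0 \<otimes> h = h \<otimes> word_prod W v then ev1 (\<phi> w) else 0)"
  unfolding tm_def ev1_sum by (intro sum.cong) (auto simp: ev1_mult ev1_coef assms)

lemma ev1_tr:
  assumes "finite B" "B \<subseteq> \<Omega>" "\<And>Q. Q \<in> \<Omega> \<Longrightarrow> tm v (rep Q) (rep Q) \<noteq> 0 \<Longrightarrow> Q \<in> B"
  shows "ev1 (tr v) = (\<Sum>Q\<in>B. ev1 (tm v (rep Q) (rep Q)))"
  unfolding tr_def by (simp add: orbsum_superset[OF assms] ev1_sum)

lemma finite_supp: "v \<in> lists S \<Longrightarrow> finite {Q \<in> \<Omega>. tm v (rep Q) (rep Q) \<noteq> 0}"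
  using orbfun_tm by (simp add: orbfun_def)

lemma ev1_tr_cong:
  assumes "u \<in> lists S" "v \<in> lists S" "word_prod W u = word_prod W v"
  shows "ev1 (tr u) = ev1 (tr v)"
proof -
  let ?B = "{Q \<in> \<Omega>. tm u (rep Q) (rep Q) \<noteq> 0} \<union> {Q \<in> \<Omega>. tm v (rep Q) (rep Q) \<noteq> 0}"
  have B: "finite ?B" "?B \<subseteq> \<Omega>" using finite_supp assms by auto
  have "ev1 (tr u) = (\<Sum>Q\<in>?B. ev1 (tm u (rep Q) (rep Q)))" "ev1 (tr v) = (\<Sum>Q\<in>?B. ev1 (tm v (rep Q) (rep Q)))"
    by (rule ev1_tr[OF B]; simp)+
  moreover have "ev1 (tm u (rep Q) (rep Q)) = ev1 (tm v (rep Q) (rep Q))" if "Q \<in> ?B" for Q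
  proof -
    have c: "rep Q \<in> carrier W" using rep_orbit(1)[of Q] that Y_c by blast
    show ?thesis unfolding ev1_tm[OF assms(1) c] ev1_tm[OF assms(2) c] assms(3) ..
  qed
  ultimately show ?thesis by simp
qed

lemma ev1_tr_zero:
  assumes v: "v \<in> lists S" and n: "\<And>h w. \<lbrakk>h \<in> carrier W; w \<in> WK; ev1 (\<phi> w) \<noteq> 0\<rbrakk> \<Longrightarrow> w \<otimes> a0 \<otimes> h \<noteq> h \<otimes> word_prod W v"
  shows "ev1 (tr v) = 0"
proof -
  let ?B = "{Q \<in> \<Omega>. tm v (rep Q) (rep Q) \<noteq> 0}"
  have "ev1 (tr v) = (\<Sum>Q\<in>?B. ev1 (tm v (rep Q) (rep Q)))"
    by (rule ev1_tr) (use finite_supp[OF v] in auto)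
  moreover have "ev1 (tm v (rep Q) (rep Q)) = 0" if "Q \<in> ?B" for Q
  proof -
    have c: "rep Q \<in> carrier W" using rep_orbit(1)[of Q] that Y_c by blast
    show ?thesis unfolding ev1_tm[OF v c] using n[OF c] by (intro sum.neutral) auto
  qed
  ultimately show ?thesis by simp
qed

lemma one_Y: "\<one> \<in> Y" by (simp add: Y_def)

text \<open>At q = 1 all summands are nonnegative, and the orbit of \<one> contributes at least
  \<open>ev1 (\<phi> u)\<close>.\<close>

lemma ev1_tr_pos:
  assumes v: "v \<in> lists S" and nn: "\<And>w. w \<in> WK \<Longrightarrow> ev1 (\<phi> w) \<ge> 0"
    and u: "u \<in> WK" "ev1 (\<phi> u) > 0" "word_prod W v = u \<otimes> a0"
  shows "ev1 (tr v) > 0"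
proof -
  let ?B = "{Q \<in> \<Omega>. tm v (rep Q) (rep Q) \<noteq> 0}"
  let ?Q = "\<Gamma> #> \<one>"
  have e: "ev1 (tr v) = (\<Sum>Q\<in>?B. ev1 (tm v (rep Q) (rep Q)))"
    by (rule ev1_tr) (use finite_supp[OF v] in auto)
  have n: "ev1 (tm v (rep Q) (rep Q)) \<ge> 0" if "Q \<in> ?B" for Q
    using rep_orbit(1)[of Q] that Y_c v nn by (auto simp: ev1_tm intro!: sum_nonneg)
  have fin: "finite WK" using fin_K .
  have "ev1 (tm v \<one> \<one>) \<ge> (if u \<otimes> a0 \<otimes> \<one> = \<one> \<otimes> word_prod W v then ev1 (\<phi> u) else 0)"
    unfolding ev1_tm[OF v one_closed] using nn by (intro member_le_sum[OF u(1) _ fin]) auto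
  then have p: "ev1 (tm v \<one> \<one>) > 0" using u WK_c a0 by simp
  have r: "tm v (rep ?Q) (rep ?Q) = tm v \<one> \<one>" using rep_rcoset[OF one_Y orbfun_tm[OF v]] .
  have QB: "?Q \<in> ?B" using r p one_Y by (auto simp: \<Omega>_def)
  have "ev1 (tm v (rep ?Q) (rep ?Q)) \<le> (\<Sum>Q\<in>?B. ev1 (tm v (rep Q) (rep Q)))"
    by (intro member_le_sum[OF QB]) (use n finite_supp[OF v] in auto)
  then show ?thesis using r p e by simp
qed

end

context coxeter_gcm
begin

section \<open>Twisted traces on a finite Hecke algebra\<close>

definition Rop :: "'w \<Rightarrow> ('w \<Rightarrow> laurent) \<Rightarrow> 'w \<Rightarrow> laurent" where
  "Rop s m x = (if pos (act x (sr s)) then qq * m (x \<otimes> s) else m (x \<otimes> s) + (qq - 1) * m x)"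

definition Lword :: "'w list \<Rightarrow> ('w \<Rightarrow> laurent) \<Rightarrow> 'w \<Rightarrow> laurent" where
  "Lword ks = foldr Lop ks"

definition Rword :: "'w list \<Rightarrow> ('w \<Rightarrow> laurent) \<Rightarrow> 'w \<Rightarrow> laurent" where
  "Rword ks = fold Rop ks"

lemma Lword_simps [simp]: "Lword [] m = m" "Lword (k # ks) m = Lop k (Lword ks m)"
  by (simp_all add: Lword_def)

lemma Rword_simps [simp]: "Rword [] m = m" "Rword (k # ks) m = Rword ks (Rop k m)"
  by (simp_all add: Rword_def)

text \<open>Functions are compared only on the carrier, because products such as
  \<open>k \<otimes> x\<close> are unspecified off it.\<close>

definition ceq :: "('w \<Rightarrow> laurent) \<Rightarrow> ('w \<Rightarrow> laurent) \<Rightarrow> bool" (infix \<open>\<doteq>\<close> 50) where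
  "m \<doteq> m' \<longleftrightarrow> (\<forall>x\<in>carrier W. m x = m' x)"

lemma ceq_refl [simp]: "m \<doteq> m" by (simp add: ceq_def)
lemma ceq_sym: "m \<doteq> m' \<Longrightarrow> m' \<doteq> m" by (simp add: ceq_def)
lemma ceq_trans [trans]: "m \<doteq> m' \<Longrightarrow> m' \<doteq> m'' \<Longrightarrow> m \<doteq> m''" by (simp add: ceq_def)

lemma Lop_ceq: "k \<in> S \<Longrightarrow> m \<doteq> m' \<Longrightarrow> Lop k m \<doteq> Lop k m'"
  by (simp add: ceq_def Lop_def S_carrier)

lemma Rop_ceq: "k \<in> S \<Longrightarrow> m \<doteq> m' \<Longrightarrow> Rop k m \<doteq> Rop k m'"
  by (simp add: ceq_def Rop_def S_carrier)

lemma Lword_ceq: "ks \<in> lists S \<Longrightarrow> m \<doteq> m' \<Longrightarrow> Lword ks m \<doteq> Lword ks m'"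
  by (induction ks) (simp_all add: Lop_ceq)

lemma Rword_ceq: "ks \<in> lists S \<Longrightarrow> m \<doteq> m' \<Longrightarrow> Rword ks m \<doteq> Rword ks m'"
  by (induction ks arbitrary: m m') (simp_all add: Rop_ceq)

lemma Lop_lin: "Lop k (\<lambda>x. a * m x + b * m' x) = (\<lambda>x. a * Lop k m x + b * Lop k m' x)"
  by (auto simp: Lop_def algebra_simps)

lemma Rop_lin: "Rop k (\<lambda>x. a * m x + b * m' x) = (\<lambda>x. a * Rop k m x + b * Rop k m' x)"
  by (auto simp: Rop_def algebra_simps)

lemma Lword_lin: "Lword ks (\<lambda>x. a * m x + b * m' x) = (\<lambda>x. a * Lword ks m x + b * Lword ks m' x)"
  by (induction ks) (simp_all add: Lop_lin)

lemma ev1_Lword: "ks \<in> lists S \<Longrightarrow> x \<in> carrier W \<Longrightarrow> ev1 (Lword ks m x) = ev1 (m (inv (word_prod W ks) \<otimes> x))"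
proof (induction ks arbitrary: x)
  case (Cons k ks)
  then have "k \<in> carrier W" "k \<in> S" "ks \<in> lists S" using S_carrier by auto
  then show ?case using Cons.IH[of "k \<otimes> x"] Cons.prems
    by (simp add: Lop_def ev1_add ev1_mult ev1_diff inv_mult_group m_assoc inv_S)
qed simp

lemma sgn_flip:
  assumes "x \<in> carrier W" "k \<in> S"
  shows "pos (act (inv (k \<otimes> x)) (sr k)) \<longleftrightarrow> \<not> pos (act (inv x) (sr k))"
proof -
  have "act (inv (k \<otimes> x)) (sr k) = - act (inv x) (sr k)"
    using assms S_carrier by (simp add: inv_mult_group act_mult inv_S act_S_sr act_uminus)
  then show ?thesis using root_neg_iff[OF root_hs[of "inv x" k]] assms by simp
qed

text \<open>Associativity of the Hecke algebra in terms of coefficients. The sign tests of the two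
  operators interact only when \<open>k \<otimes> x = x \<otimes> s\<close>, and there they
  coincide.\<close>

lemma LR_commute:
  assumes k: "k \<in> S" and s: "s \<in> S"
  shows "Lop k (Rop s m) \<doteq> Rop s (Lop k m)"
  unfolding ceq_def
proof
  fix x assume x: "x \<in> carrier W"
  have C: "k \<in> carrier W" "s \<in> carrier W" using assms S_carrier by auto
  have A: "k \<otimes> (x \<otimes> s) = k \<otimes> x \<otimes> s" using x C by (simp add: m_assoc)
  let ?p = "\<lambda>x. pos (act (inv x) (sr k))" and ?r = "\<lambda>x. pos (act x (sr s))"
  have rf: "?r (x \<otimes> s) \<longleftrightarrow> \<not> ?r x" using orient_flip[OF orient_pos x s] .
  have pf: "?p (k \<otimes> x) \<longleftrightarrow> \<not> ?p x" using sgn_flip[OF x k] .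
  consider (eq) "act x (sr s) = sr k \<or> act x (sr s) = - sr k" | (ne) "act x (sr s) \<noteq> sr k" "act x (sr s) \<noteq> - sr k" by blast
  then show "Lop k (Rop s m) x = Rop s (Lop k m) x"
  proof cases
    case eq
    have ks: "k \<otimes> x = x \<otimes> s"
    proof (cases "act x (sr s) = sr k")
      case True then show ?thesis using simple_conj[OF x s k] by simp
    next
      case False
      then have "act (x \<otimes> s) (sr s) = sr k" using eq x s by (simp add: act_mult_s)
      then have "x \<otimes> s \<otimes> s = k \<otimes> (x \<otimes> s)" using simple_conj[OF _ s k, of "x \<otimes> s"] x C by simp
      then show ?thesis using x k s C by (metis S_sq2 m_closed)
    qed
    have pr: "?p x \<longleftrightarrow> ?r x"
    proof (cases "act x (sr s) = sr k")
      case True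
      then have "act (inv x) (sr k) = sr s" using x by (metis act_inv(2))
      then show ?thesis using True by simp
    next
      case False
      then have e: "act x (sr s) = - sr k" using eq by simp
      then have "act (inv x) (sr k) = - sr s" using x by (metis act_inv(2) act_uminus minus_minus)
      then show ?thesis using e not_pos_neg[OF pos_sr] by simp
    qed
    have "k \<otimes> x \<otimes> s = x" using ks x s by simp
    then show ?thesis using ks pr rf pf x A k C by (auto simp: Lop_def Rop_def algebra_simps)
  next
    case ne
    have "act (inv x) (sr k) \<noteq> sr s" "act (inv x) (sr k) \<noteq> - sr s"
      using ne x by (metis act_inv(1), metis act_inv(1) act_uminus minus_minus)
    then have p: "?p (x \<otimes> s) = ?p x"
      using pos_flip[OF _ s] root_hs[of "inv x" k] x k s by (simp add: inv_hs)
    have r: "?r (k \<otimes> x) = ?r x" using pos_flip[OF root_hs[OF x s] k ne] x C by (simp add: act_mult)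
    show ?thesis using p r A by (auto simp: Lop_def Rop_def algebra_simps)
  qed
qed

lemma Rop_quadratic:
  assumes "s \<in> S" shows "Rop s (Rop s m) \<doteq> (\<lambda>x. (qq - 1) * Rop s m x + qq * m x)"
  unfolding ceq_def
proof
  fix x assume x: "x \<in> carrier W"
  show "Rop s (Rop s m) x = (qq - 1) * Rop s m x + qq * m x"
    using orient_flip[OF orient_pos x assms] x assms by (simp add: Rop_def algebra_simps)
qed

lemma LwordR_commute: "ks \<in> lists S \<Longrightarrow> s \<in> S \<Longrightarrow> Lword ks (Rop s m) \<doteq> Rop s (Lword ks m)"
proof (induction ks)
  case (Cons k ks)
  then have k: "k \<in> S" "ks \<in> lists S" by auto
  have "Lop k (Lword ks (Rop s m)) \<doteq> Lop k (Rop s (Lword ks m))" using Cons k by (intro Lop_ceq) auto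
  also have "\<dots> \<doteq> Rop s (Lop k (Lword ks m))" using k Cons by (intro LR_commute) auto
  finally show ?case by simp
qed simp

lemma coef_Rop: "v \<in> lists S \<Longrightarrow> h \<in> carrier W \<Longrightarrow> s \<in> S \<Longrightarrow> coef pos (v @ [s]) h \<doteq> Rop s (coef pos v h)"
  by (simp add: ceq_def coef_snoc[OF orient_pos] Rop_def)

lemma Rword_snoc: "Rword (u @ [s]) m = Rop s (Rword u m)" by (simp add: Rword_def)

lemma coef_Rword: "v \<in> lists S \<Longrightarrow> h \<in> carrier W \<Longrightarrow> coef pos v h \<doteq> Rword v (coef pos [] h)"
proof (induction v rule: rev_induct)
  case (snoc s v)
  then have k: "s \<in> S" "v \<in> lists S" by auto
  have "coef pos (v @ [s]) h \<doteq> Rop s (coef pos v h)" using k snoc by (intro coef_Rop) auto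
  also have "\<dots> \<doteq> Rop s (Rword v (coef pos [] h))"
    by (rule Rop_ceq[OF k(1) snoc.IH[OF k(2) snoc.prems(2)]])
  finally show ?case unfolding Rword_snoc .
qed simp

text \<open>Right multiplication by the inverse of \<open>T_s\<close>, which is
  \<open>q^-1 T_s + (q^-1 - 1)\<close>.\<close>

definition Rinv :: "'w \<Rightarrow> ('w \<Rightarrow> laurent) \<Rightarrow> 'w \<Rightarrow> laurent" where
  "Rinv s m = (\<lambda>x. qinv * Rop s m x + qinv * (1 - qq) * m x)"

lemma Rinv_ceq: "k \<in> S \<Longrightarrow> m \<doteq> m' \<Longrightarrow> Rinv k m \<doteq> Rinv k m'"
  using Rop_ceq[of k m m'] by (simp add: ceq_def Rinv_def)

lemma Rinv_right: "s \<in> S \<Longrightarrow> Rop s (Rinv s m) \<doteq> m" and Rinv_left: "s \<in> S \<Longrightarrow> Rinv s (Rop s m) \<doteq> m"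
proof -
  assume s: "s \<in> S"
  have q: "qinv * ((qq - 1) * r + qq * z) + qinv * (1 - qq) * r = z" for r z
  proof -
    have "qinv * ((qq - 1) * r + qq * z) + qinv * (1 - qq) * r = (qinv * qq) * z"
      by (simp add: algebra_simps)
    then show ?thesis by (simp add: qinv)
  qed
  have *: "qinv * Rop s (Rop s m) x + qinv * (1 - qq) * Rop s m x = m x" if "x \<in> carrier W" for x
    using Rop_quadratic[OF s, of m] that q by (simp add: ceq_def)
  then show "Rinv s (Rop s m) \<doteq> m" by (simp add: Rinv_def ceq_def)
  show "Rop s (Rinv s m) \<doteq> m" using * by (simp add: Rinv_def ceq_def Rop_lin)
qed

definition Rinvword :: "'w list \<Rightarrow> ('w \<Rightarrow> laurent) \<Rightarrow> 'w \<Rightarrow> laurent" where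
  "Rinvword ks = foldr Rinv ks"

lemma Rinvword_simps [simp]: "Rinvword [] m = m" "Rinvword (k # ks) m = Rinv k (Rinvword ks m)"
  by (simp_all add: Rinvword_def)

lemma Rinvword_ceq: "ks \<in> lists S \<Longrightarrow> m \<doteq> m' \<Longrightarrow> Rinvword ks m \<doteq> Rinvword ks m'"
  by (induction ks) (simp_all add: Rinv_ceq)

lemma Rinvword_right: "ks \<in> lists S \<Longrightarrow> Rword ks (Rinvword ks m) \<doteq> m"
proof (induction ks)
  case (Cons k ks)
  then have k: "k \<in> S" "ks \<in> lists S" by auto
  have "Rword ks (Rop k (Rinv k (Rinvword ks m))) \<doteq> Rword ks (Rinvword ks m)"
    using k by (intro Rword_ceq Rinv_right)
  then show ?case using Cons k ceq_trans by auto
qed simp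

lemma Rinvword_left: "ks \<in> lists S \<Longrightarrow> Rinvword ks (Rword ks m) \<doteq> m"
proof (induction ks arbitrary: m)
  case (Cons k ks)
  then have k: "k \<in> S" "ks \<in> lists S" by auto
  have "Rinv k (Rinvword ks (Rword ks (Rop k m))) \<doteq> Rinv k (Rop k m)"
    using k Cons by (intro Rinv_ceq) auto
  then show ?case using Rinv_left[OF k(1)] ceq_trans by auto
qed simp

lemma Lword_Rinv: "ks \<in> lists S \<Longrightarrow> s \<in> S \<Longrightarrow> Lword ks (Rinv s m) \<doteq> Rinv s (Lword ks m)"
  using LwordR_commute[of ks s m] by (simp add: Rinv_def Lword_lin ceq_def)

lemma Lword_Rinvword: "ks \<in> lists S \<Longrightarrow> rs \<in> lists S \<Longrightarrow> Lword ks (Rinvword rs m) \<doteq> Rinvword rs (Lword ks m)"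
proof (induction rs)
  case (Cons s rs)
  then have k: "s \<in> S" "rs \<in> lists S" by auto
  have "Lword ks (Rinv s (Rinvword rs m)) \<doteq> Rinv s (Lword ks (Rinvword rs m))"
    using Cons k by (intro Lword_Rinv) auto
  also have "\<dots> \<doteq> Rinv s (Rinvword rs (Lword ks m))" using Cons k by (intro Rinv_ceq) auto
  finally show ?case by simp
qed simp

text \<open>\<open>coef pos [] w\<close> is the basis vector \<open>T_w\<close>; with additive
  lengths every letter lengthens the element and the quadratic relation never enters.\<close>

lemma Lword_delta:
  "\<lbrakk>ks \<in> lists S; w \<in> carrier W; len (word_prod W ks \<otimes> w) = length ks + len w\<rbrakk> \<Longrightarrow>
    Lword ks (coef pos [] w) \<doteq> coef pos [] (word_prod W ks \<otimes> w)"
proof (induction ks)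
  case (Cons k ks)
  have C: "k \<in> S" "k \<in> carrier W" "ks \<in> lists S" "word_prod W ks \<otimes> w \<in> carrier W" using Cons.prems S_carrier by auto
  let ?h = "word_prod W ks \<otimes> w"
  have e: "k \<otimes> ?h = word_prod W (k # ks) \<otimes> w" using C Cons.prems by (simp add: m_assoc)
  have "len ?h \<le> length ks + len w"
    using len_mult[OF word_prod_closed[OF C(3)] Cons.prems(2)] len_word[OF C(3)] by linarith
  then have l: "len ?h = length ks + len w" "len (k \<otimes> ?h) > len ?h"
    using len_left(1)[OF C(4,1)] Cons.prems(3) e by auto
  have "Lop k (Lword ks (coef pos [] w)) \<doteq> Lop k (coef pos [] ?h)"
    by (rule Lop_ceq[OF C(1) Cons.IH[OF C(3) Cons.prems(2) l(1)]])
  also have "\<dots> \<doteq> coef pos [] (k \<otimes> ?h)"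
    using Lop_coef[OF orient_pos compat_pos[OF C(1)] C(1) _ _ C(4), of _ "[]"] len_left(2)[OF C(4,1)] l
    by (simp add: ceq_def)
  finally show ?case unfolding e Lword_simps .
qed simp

section \<open>Minimal coset and double coset representatives\<close>

lemma min_coset_add:
  assumes J: "J \<subseteq> S" and x: "x \<in> carrier W" and p: "\<And>k. k \<in> J \<Longrightarrow> pos (act x (sr k))"
    and w: "w \<in> generate W J"
  shows "len (x \<otimes> w) = len x + len w"
  using J w
proof (induction rule: gen_induct)
  case (mult w k)
  have C: "w \<in> carrier W" "k \<in> S" "k \<in> carrier W" using mult gen_sub[OF J] J S_carrier by auto
  have "pos (act w (sr k))" using pos_iff_len[OF C(1,2)] mult by simp
  moreover have "act w (sr k) \<in> PhiK J"
    using act_gen_outside[OF J mult(1)] root_hs[OF C(1,2)] mult(2) by (auto simp: PhiK_def sr_apply)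
  ultimately have "pos (act (x \<otimes> w) (sr k))" using PhiK_pos[OF J x p] C x by (simp add: act_mult)
  then have "len (x \<otimes> w \<otimes> k) = Suc (len (x \<otimes> w))"
    using pos_iff_len[of "x \<otimes> w" k] len_right[of "x \<otimes> w" k] C x by auto
  then show ?case using mult C x by (simp add: m_assoc)
qed (use x in simp)

lemma min_coset_add_left:
  assumes J: "J \<subseteq> S" and x: "x \<in> carrier W" and p: "\<And>k. k \<in> J \<Longrightarrow> pos (act (inv x) (sr k))"
    and w: "w \<in> generate W J"
  shows "len (w \<otimes> x) = len w + len x"
proof -
  have "len (inv x \<otimes> inv w) = len (inv x) + len (inv w)"
    using assms by (intro min_coset_add gen_inv) auto
  then show ?thesis using x gen_sub[OF J w] len_inv[of "w \<otimes> x"] by (simp add: inv_mult_group len_inv)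
qed

text \<open>Let k be the last letter on the left hand side. Then \<open>w'\<close> makes the
  positive root \<open>act d2 (sr k)\<close> negative, which forces this root into the subsystem of
  \<open>J'\<close>; it is even simple there. So k passes through \<open>d2\<close> as a letter of
  \<open>J'\<close> and is absorbed into \<open>w'\<close>.\<close>

lemma double_coset_unique:
  assumes J: "J \<subseteq> S" "J' \<subseteq> S"
    and d: "d \<in> carrier W" "\<And>k. k \<in> J \<Longrightarrow> pos (act d (sr k))" "\<And>k. k \<in> J' \<Longrightarrow> pos (act (inv d) (sr k))"
    and d2: "d2 \<in> carrier W" "\<And>k. k \<in> J \<Longrightarrow> pos (act d2 (sr k))" "\<And>k. k \<in> J' \<Longrightarrow> pos (act (inv d2) (sr k))"
    and w: "w \<in> generate W J" and w': "w' \<in> generate W J'" and e: "d \<otimes> w = w' \<otimes> d2"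
  shows "d = d2"
  using J(1) w w' e
proof (induction arbitrary: w' rule: gen_induct)
  case one
  have w'c: "w' \<in> carrier W" using gen_sub J one by blast
  have "d = w' \<otimes> d2" "d2 = inv w' \<otimes> d" using one d d2 w'c by (auto simp: cancel_inv)
  then have "len d = len w' + len d2" "len d2 = len (inv w') + len d"
    using min_coset_add_left[OF J(2) d2(1,3) one(1)] min_coset_add_left[OF J(2) d(1,3) gen_inv[OF J(2) one(1)]] by auto
  then have "w' = \<one>" using len_0 w'c by auto
  then show ?case using \<open>d = w' \<otimes> d2\<close> d2 by simp
next
  case (mult w k)
  have C: "w \<in> carrier W" "k \<in> S" "k \<in> carrier W" "w' \<in> carrier W"
    using mult gen_sub[OF J(1)] gen_sub[OF J(2)] J S_carrier by auto
  let ?b = "act d2 (sr k)"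
  have br: "?b \<in> roots" "pos ?b" using root_hs[OF d2(1) C(2)] d2(2) mult by auto
  have "act (d \<otimes> (w \<otimes> k)) (sr k) = - act d (act w (sr k))"
    using C d by (simp add: act_mult_s act_mult act_S_sr act_uminus)
  then have nb: "act w' ?b = - act d (act w (sr k))" using mult.prems(2) C d2 by (simp add: act_mult)
  have "pos (act w (sr k))" "act w (sr k) \<in> PhiK J"
    using pos_iff_len[OF C(1,2)] mult act_gen_outside[OF J(1) mult(1)] root_hs[OF C(1,2)]
    by (auto simp: PhiK_def sr_apply)
  then have "pos (act d (act w (sr k)))" using PhiK_pos[OF J(1) d(1,2)] by simp
  then have np: "\<not> pos (act w' ?b)" unfolding nb using not_pos_neg by blast
  have "?b x = 0" if "x \<notin> J'" for x
  proof -
    have "\<not> ?b x > 0"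
      using np root_nonneg[OF roots_act[OF C(4) br(1)], of x] act_gen_outside[OF J(2) mult.prems(1) that] by auto
    then show ?thesis using root_pos_nonneg[OF br(2), of x] by simp
  qed
  then have "?b \<in> PhiK J'" using br by (simp add: PhiK_def)
  then obtain j where j: "j \<in> J'" "?b = sr j"
    using PhiK_simple[OF J(2) _ d2(3), of ?b k] d2(1) C by auto
  then have jc: "j \<in> S" "j \<in> carrier W" using J S_carrier by auto
  have kj: "d2 \<otimes> k = j \<otimes> d2" using simple_conj[OF d2(1) C(2) jc(1) j(2)] .
  have "d \<otimes> w = d \<otimes> (w \<otimes> k) \<otimes> k" using C d by (simp add: m_assoc S_sq)
  also have "\<dots> = w' \<otimes> (d2 \<otimes> k)" unfolding mult.prems(2) using C d2 by (simp add: m_assoc)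
  also have "\<dots> = (w' \<otimes> j) \<otimes> d2" unfolding kj using C d2 jc by (simp add: m_assoc)
  finally show ?case using mult.IH[of "w' \<otimes> j"] mult.prems(1) j(1) by (simp add: gen_mult gen_S)
qed

end

context twisted_parabolic
begin

section \<open>Twisted conjugacy and twisted traces for the finite group\<close>

definition cj :: "'w \<Rightarrow> 'w" where "cj h = inv a0 \<otimes> h \<otimes> a0"
definition ci :: "'w \<Rightarrow> 'w" where "ci h = a0 \<otimes> h \<otimes> inv a0"

text \<open>Twisted conjugacy in \<open>W_K\<close>, written as ordinary conjugacy on the coset
  \<open>W_K a0\<close> so that no automorphism appears.\<close>

definition tconj :: "'w \<Rightarrow> 'w \<Rightarrow> bool" where
  "tconj u w \<longleftrightarrow> (\<exists>j\<in>WK. w \<otimes> a0 = inv j \<otimes> (u \<otimes> a0) \<otimes> j)"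

definition tt :: "('w \<Rightarrow> laurent) \<Rightarrow> bool" where
  "tt f \<longleftrightarrow> (\<forall>k\<in>K. \<forall>w\<in>WK. lact f k w = ract f (\<sigma> k) w)"

lemma cjci_c [simp]: "h \<in> carrier W \<Longrightarrow> cj h \<in> carrier W" "h \<in> carrier W \<Longrightarrow> ci h \<in> carrier W"
  using a0 by (simp_all add: cj_def ci_def)

lemma cjci [simp]: "h \<in> carrier W \<Longrightarrow> cj (ci h) = h" "h \<in> carrier W \<Longrightarrow> ci (cj h) = h"
  using a0 by (simp_all add: cj_def ci_def m_assoc cancel_inv)

lemma cjci_mult: "\<lbrakk>x \<in> carrier W; y \<in> carrier W\<rbrakk> \<Longrightarrow> ci (x \<otimes> y) = ci x \<otimes> ci y"
  "\<lbrakk>x \<in> carrier W; y \<in> carrier W\<rbrakk> \<Longrightarrow> cj (x \<otimes> y) = cj x \<otimes> cj y"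
  using a0 by (simp_all add: cj_def ci_def m_assoc cancel_inv)

lemma cjci_one [simp]: "ci \<one> = \<one>" "cj \<one> = \<one>"
  using a0 by (simp_all add: cj_def ci_def)

lemma ci_inv: "x \<in> carrier W \<Longrightarrow> ci (inv x) = inv (ci x)"
  using a0 by (simp add: ci_def inv_mult_group m_assoc)

lemma K_S: "k \<in> K \<Longrightarrow> k \<in> S" "k \<in> K \<Longrightarrow> k \<in> carrier W" using K S_carrier by auto

lemma \<sigma>_K: "k \<in> K \<Longrightarrow> \<sigma> k \<in> K" using bij_betwE[OF \<sigma>(1)] by blast

lemma a0_k: "k \<in> K \<Longrightarrow> a0 \<otimes> k = \<sigma> k \<otimes> a0"
  using simple_conj[OF a0 _ _ \<sigma>(2)] K_S \<sigma>_K by simp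

lemma ci_k: "k \<in> K \<Longrightarrow> ci k = \<sigma> k"
  using a0_k[of k] a0 K_S \<sigma>_K by (simp add: ci_def m_assoc)

lemma cj_k: "k \<in> K \<Longrightarrow> cj (\<sigma> k) = k"
  using ci_k[of k] K_S by (metis cjci(1))

lemma ci_gen:
  assumes J: "J \<subseteq> K" "\<sigma> ` J \<subseteq> J" and w: "w \<in> generate W J" shows "ci w \<in> generate W J"
proof -
  have JS: "J \<subseteq> S" using J K by auto
  obtain ks where ks: "ks \<in> lists J" "word_prod W ks = w" using generate_word[OF JS w] by blast
  have "ci (word_prod W ks) \<in> generate W J" using ks(1)
  proof (induction ks)
    case (Cons k ks)
    have "ks \<in> lists S" using Cons JS by auto
    then have "ci (word_prod W (k # ks)) = \<sigma> k \<otimes> ci (word_prod W ks)"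
      using Cons J K_S by (simp add: cjci_mult ci_k subset_iff)
    moreover have "\<sigma> k \<in> J" using Cons J by auto
    ultimately show ?case using Cons by (simp add: gen_mult gen_S)
  qed (simp add: gen_one)
  then show ?thesis using ks by simp
qed

lemma ci_WK: "w \<in> WK \<Longrightarrow> ci w \<in> WK"
  using ci_gen[of K w] \<sigma>_K by auto

lemma cj_WK: "w \<in> WK \<Longrightarrow> cj w \<in> WK"
proof -
  assume w: "w \<in> WK"
  have "inj_on ci WK" using WK_c by (metis cjci(1) inj_onI)
  moreover have "ci ` WK \<subseteq> WK" using ci_WK by blast
  ultimately have "ci ` WK = WK" using fin_K by (simp add: endo_inj_surj)
  then obtain v where "v \<in> WK" "w = ci v" using w by blast
  then show ?thesis using WK_c by simp
qed

lemma a0_pos': "\<gamma> \<in> PhiK K \<Longrightarrow> pos (act a0 \<gamma>) = pos \<gamma>"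
  using a0_pos[OF PhiK_a0(1)] a0 by simp

lemma act_cj: "h \<in> carrier W \<Longrightarrow> k \<in> K \<Longrightarrow> act (cj h) (sr k) = act (inv a0) (act h (sr (\<sigma> k)))"
  using a0 by (simp add: cj_def act_mult \<sigma>)

lemma pos_cj: "h \<in> WK \<Longrightarrow> k \<in> K \<Longrightarrow> pos (act (cj h) (sr k)) = pos (act h (sr (\<sigma> k)))"
  using act_cj WK_c a0_pos PhiK_gen PhiK_sr \<sigma>_K by simp

text \<open>The trace of the map sending \<open>T_h\<close> to the product of \<open>T_ys\<close>,
  \<open>T_(cj h)\<close> and \<open>T_v\<close> on the Hecke algebra of \<open>W_K\<close>. The
  twist by conjugation with \<open>a0\<close> turns the ordinary trace identity into the
  \<sigma>-twisted one.\<close>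

definition trF :: "'w list \<Rightarrow> 'w list \<Rightarrow> laurent" where
  "trF ys v = (\<Sum>h\<in>WK. Lword ys (coef pos v (cj h)) h)"

lemma trF_lin:
  assumes ys: "ys \<in> lists S"
    and e: "\<And>h. h \<in> carrier W \<Longrightarrow> coef pos w h \<doteq> (\<lambda>x. a * coef pos u h x + b * coef pos v h x)"
  shows "trF ys w = a * trF ys u + b * trF ys v"
proof -
  have "Lword ys (coef pos w (cj h)) h = a * Lword ys (coef pos u (cj h)) h + b * Lword ys (coef pos v (cj h)) h"
    if "h \<in> WK" for h
    using Lword_ceq[OF ys e[of "cj h"]] WK_c[OF that] by (simp add: ceq_def Lword_lin)
  then show ?thesis by (simp add: trF_def sum.distrib sum_distrib_left)
qed

lemma trF_cong:
  assumes "ys \<in> lists S" "\<And>h. h \<in> carrier W \<Longrightarrow> coef pos u h \<doteq> coef pos v h"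
  shows "trF ys u = trF ys v"
  using trF_lin[OF assms(1), of u 1 v 0 v] assms(2) by simp

lemma trF_rotate:
  assumes ys: "ys \<in> lists S" and k: "k \<in> K" and v: "v \<in> lists S"
  shows "trF ys (k # v) = trF ys (v @ [\<sigma> k])"
proof -
  let ?s = "\<sigma> k"
  have s: "?s \<in> K" "?s \<in> S" "?s \<in> carrier W" using \<sigma>_K[OF k] K_S by auto
  define M where "M h = Lword ys (coef pos v (cj h))" for h
  have 1: "Lword ys (coef pos (k # v) (cj h)) h =
      (if pos (act h (sr ?s)) then M (h \<otimes> ?s) h else qq * M (h \<otimes> ?s) h + (qq - 1) * M h h)" if h: "h \<in> WK" for h
  proof -
    have "cj (h \<otimes> ?s) = cj h \<otimes> k" using WK_c[OF h] s k by (simp add: cjci_mult cj_k)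
    moreover have "coef pos (k # v) (cj h) = (if pos (act h (sr ?s)) then coef pos v (cj h \<otimes> k)
      else (\<lambda>x. qq * coef pos v (cj h \<otimes> k) x + (qq - 1) * coef pos v (cj h) x))"
      using pos_cj[OF h k] by (auto simp: fun_eq_iff)
    ultimately show ?thesis by (simp add: M_def Lword_lin)
  qed
  have 2: "Lword ys (coef pos (v @ [?s]) (cj h)) h =
      (if pos (act h (sr ?s)) then qq * M h (h \<otimes> ?s) else M h (h \<otimes> ?s) + (qq - 1) * M h h)" if h: "h \<in> WK" for h
  proof -
    have c: "h \<in> carrier W" "cj h \<in> carrier W" using WK_c[OF h] by auto
    have "Lword ys (coef pos (v @ [?s]) (cj h)) \<doteq> Lword ys (Rop ?s (coef pos v (cj h)))"
      by (rule Lword_ceq[OF ys coef_Rop[OF v c(2) s(2)]])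
    also have "\<dots> \<doteq> Rop ?s (M h)" unfolding M_def by (rule LwordR_commute[OF ys s(2)])
    finally show ?thesis using c by (simp add: ceq_def Rop_def)
  qed
  \<comment> \<open>As for the infinite trace, the defect of a rotation changes sign under the
    involution taking \<open>h\<close> to \<open>h \<otimes> \<sigma> k\<close>.\<close>
  define D where "D h = Lword ys (coef pos (k # v) (cj h)) h - Lword ys (coef pos (v @ [?s]) (cj h)) h" for h
  have hs: "h \<otimes> ?s \<in> WK" if "h \<in> WK" for h using that s by (simp add: gen_mult gen_S)
  have D: "D (h \<otimes> ?s) = - D h" if h: "h \<in> WK" for h
    using orient_flip[OF orient_pos WK_c[OF h] s(2)] WK_c[OF h] s
    unfolding D_def 1[OF h] 2[OF h] 1[OF hs[OF h]] 2[OF hs[OF h]] by simp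
  have "(\<Sum>h\<in>WK. D h) = (\<Sum>h\<in>WK. D (h \<otimes> ?s))"
    by (rule sum.reindex_bij_witness[of _ "\<lambda>h. h \<otimes> ?s" "\<lambda>h. h \<otimes> ?s"]) (use hs s WK_c in auto)
  also have "\<dots> = - (\<Sum>h\<in>WK. D h)" by (simp add: D sum_negf)
  finally have "2 * (\<Sum>h\<in>WK. D h) = 0" by simp
  then show ?thesis by (simp add: D_def trF_def sum_subtractf)
qed

definition rw :: "'w \<Rightarrow> 'w list" where
  "rw w = (SOME ss. ss \<in> lists K \<and> length ss = len w \<and> word_prod W ss = w)"

lemma rw:
  assumes "w \<in> WK" shows "rw w \<in> lists K" "length (rw w) = len w" "word_prod W (rw w) = w" "rw w \<in> lists S"
proof -
  have "\<exists>ss. ss \<in> lists K \<and> length ss = len w \<and> word_prod W ss = w" using gen_reduced[OF K assms] by blast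
  from someI_ex[OF this] show "rw w \<in> lists K" "length (rw w) = len w" "word_prod W (rw w) = w"
    unfolding rw_def by auto
  then show "rw w \<in> lists S" using K by auto
qed

text \<open>A reduced word takes \<one> to a single basis vector, so two reduced words of one
  element agree at \<one> and then everywhere by \<open>coef_pos_eq\<close>.\<close>

lemma coef_reduced_eq:
  assumes u: "u \<in> lists S" "len (word_prod W u) = length u" and v: "v \<in> lists S" "len (word_prod W v) = length v"
    and e: "word_prod W u = word_prod W v" and h: "h \<in> carrier W"
  shows "coef pos u h \<doteq> coef pos v h"
  unfolding ceq_def
proof
  fix x assume x: "x \<in> carrier W"
  show "coef pos u h x = coef pos v h x"
    by (rule coef_pos_eq[OF u(1) v(1) _ h x])
      (use coef_reduced[OF u(1) one_closed] coef_reduced[OF v(1) one_closed] u v e in simp)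
qed

lemma coef_cons_ceq:
  assumes "k \<in> S" "\<And>h. h \<in> carrier W \<Longrightarrow> coef pos u h \<doteq> coef pos v h" "h \<in> carrier W"
  shows "coef pos (k # u) h \<doteq> coef pos (k # v) h"
  using assms(2)[of h] assms(2)[of "h \<otimes> k"] assms(1,3) S_carrier by (simp add: ceq_def)

lemma coef_quadratic: "s \<in> S \<Longrightarrow> h \<in> carrier W \<Longrightarrow>
    coef pos (s # s # v) h \<doteq> (\<lambda>x. (qq - 1) * coef pos (s # v) h x + qq * coef pos v h x)"
  using orient_flip[OF orient_pos, of h s] by (simp add: ceq_def algebra_simps)

lemma coef_quadratic_snoc: "s \<in> S \<Longrightarrow> h \<in> carrier W \<Longrightarrow> v \<in> lists S \<Longrightarrow>
    coef pos (v @ [s, s]) h \<doteq> (\<lambda>x. (qq - 1) * coef pos (v @ [s]) h x + qq * coef pos v h x)"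
  using coef_Rop[of "v @ [s]" h s] coef_Rop[of v h s] Rop_quadratic[of s "coef pos v h"]
    Rop_ceq[OF _ coef_Rop[of v h s], of s]
  by (simp add: ceq_def)

text \<open>The inverse of \<open>u\<close> is taken because a left factor contributes its inverse
  at q = 1: the value there counts the \<open>h\<close> in \<open>W_K\<close> with
  \<open>u \<otimes> h = cj h \<otimes> w\<close>.\<close>

definition trphi :: "'w \<Rightarrow> 'w \<Rightarrow> laurent" where "trphi u w = trF (rw (inv u)) (rw w)"

lemma trF_lact:
  assumes u: "u \<in> WK" and k: "k \<in> K" and w: "w \<in> WK"
  shows "trF (rw (inv u)) (k # rw w) = lact (trphi u) k w"
proof -
  have ys: "rw (inv u) \<in> lists S" using rw gen_inv[OF K u] by blast
  note c = K_S[OF k] WK_c[OF w] rw[OF w]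
  have kw: "k \<otimes> w \<in> WK" using k w by (simp add: gen_mult gen_S)
  note ckw = WK_c[OF kw] rw[OF kw]
  show ?thesis
  proof (cases "pos (act (inv w) (sr k))")
    case True
    then have l: "len (k \<otimes> w) = Suc (len w)" using len_left[OF c(3,1)] by auto
    have "coef pos (k # rw w) h \<doteq> coef pos (rw (k \<otimes> w)) h" if "h \<in> carrier W" for h
      using that c ckw l by (intro coef_reduced_eq) auto
    then show ?thesis using True trF_cong[OF ys] by (simp add: lact_def trphi_def)
  next
    case False
    then have l: "Suc (len (k \<otimes> w)) = len w" using len_left[OF c(3,1)] by auto
    have e: "coef pos (rw w) h \<doteq> coef pos (k # rw (k \<otimes> w)) h" if "h \<in> carrier W" for h
      using that c ckw l by (intro coef_reduced_eq) auto
    have "trF (rw (inv u)) (k # rw w) = trF (rw (inv u)) (k # k # rw (k \<otimes> w))"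
      by (rule trF_cong[OF ys coef_cons_ceq[OF c(1) e]])
    also have "\<dots> = (qq - 1) * trF (rw (inv u)) (k # rw (k \<otimes> w)) + qq * trF (rw (inv u)) (rw (k \<otimes> w))"
      by (rule trF_lin[OF ys coef_quadratic[OF c(1)]])
    also have "trF (rw (inv u)) (k # rw (k \<otimes> w)) = trF (rw (inv u)) (rw w)"
      by (rule trF_cong[OF ys ceq_sym[OF e]])
    finally show ?thesis using False by (simp add: lact_def trphi_def)
  qed
qed

lemma trF_ract:
  assumes u: "u \<in> WK" and k: "k \<in> K" and w: "w \<in> WK"
  shows "trF (rw (inv u)) (rw w @ [k]) = ract (trphi u) k w"
proof -
  have ys: "rw (inv u) \<in> lists S" using rw gen_inv[OF K u] by blast
  note c = K_S[OF k] WK_c[OF w] rw[OF w]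
  have kw: "w \<otimes> k \<in> WK" using k w by (simp add: gen_mult gen_S)
  note ckw = WK_c[OF kw] rw[OF kw]
  have wp: "word_prod W (rw x @ [k]) = x \<otimes> k" if "x \<in> WK" for x
    using rw[OF that] c by (simp add: word_prod_append)
  show ?thesis
  proof (cases "pos (act w (sr k))")
    case True
    then have l: "len (w \<otimes> k) = Suc (len w)" using pos_iff_len[OF c(3,1)] len_right[OF c(3,1)] by auto
    have "coef pos (rw w @ [k]) h \<doteq> coef pos (rw (w \<otimes> k)) h" if "h \<in> carrier W" for h
      by (rule coef_reduced_eq) (use that c ckw l wp[OF w] in auto)
    then show ?thesis using True trF_cong[OF ys] by (simp add: ract_def trphi_def)
  next
    case False
    then have l: "Suc (len (w \<otimes> k)) = len w" using pos_iff_len[OF c(3,1)] len_right[OF c(3,1)] by auto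
    have e: "coef pos (rw w) h \<doteq> coef pos (rw (w \<otimes> k) @ [k]) h" if "h \<in> carrier W" for h
      by (rule coef_reduced_eq) (use that c ckw l wp[OF kw] in auto)
    have e2: "coef pos (rw w @ [k]) h \<doteq> coef pos (rw (w \<otimes> k) @ [k, k]) h" if h: "h \<in> carrier W" for h
      using coef_append_eq[OF orient_pos c(7) _ h, of "rw (w \<otimes> k) @ [k]" "[k]"] e[OF h] c ckw
      by (simp add: ceq_def)
    have "trF (rw (inv u)) (rw w @ [k]) = trF (rw (inv u)) (rw (w \<otimes> k) @ [k, k])"
      by (rule trF_cong[OF ys e2])
    also have "\<dots> = (qq - 1) * trF (rw (inv u)) (rw (w \<otimes> k) @ [k]) + qq * trF (rw (inv u)) (rw (w \<otimes> k))"
      by (rule trF_lin[OF ys coef_quadratic_snoc[OF c(1) _ ckw(5)]])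
    also have "trF (rw (inv u)) (rw (w \<otimes> k) @ [k]) = trF (rw (inv u)) (rw w)"
      by (rule trF_cong[OF ys ceq_sym[OF e]])
    finally show ?thesis using False by (simp add: ract_def trphi_def)
  qed
qed

lemma tt_trphi: "u \<in> WK \<Longrightarrow> tt (trphi u)"
  unfolding tt_def
proof (intro ballI)
  fix k w assume a: "u \<in> WK" "k \<in> K" "w \<in> WK"
  have "rw (inv u) \<in> lists S" using rw gen_inv[OF K a(1)] by blast
  then show "lact (trphi u) k w = ract (trphi u) (\<sigma> k) w"
    using trF_rotate[of "rw (inv u)" k "rw w"] trF_lact[OF a] trF_ract[OF a(1) \<sigma>_K[OF a(2)] a(3)] rw[OF a(3)] a by simp
qed

lemma ev1_trphi:
  assumes u: "u \<in> WK" and w: "w \<in> WK"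
  shows "ev1 (trphi u w) \<ge> 0" "ev1 (trphi u w) > 0 \<longleftrightarrow> tconj u w"
proof -
  note c = WK_c[OF u] WK_c[OF w]
  have ys: "rw (inv u) \<in> lists S" "word_prod W (rw (inv u)) = inv u" using rw gen_inv[OF K u] by blast+
  have e: "ev1 (trphi u w) = (\<Sum>h\<in>WK. if u \<otimes> h = cj h \<otimes> w then 1 else 0)"
    unfolding trphi_def trF_def ev1_sum
    by (rule sum.cong) (use ys rw[OF w] c WK_c in \<open>auto simp: ev1_Lword ev1_coef\<close>)
  then have e': "ev1 (trphi u w) = int (card {h \<in> WK. u \<otimes> h = cj h \<otimes> w})"
    using fin_K by (simp add: sum.If_cases Int_def)
  then show "ev1 (trphi u w) \<ge> 0" by simp
  \<comment> \<open>The counted elements h and the conjugators j correspond through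
    \<open>j = cj h\<close>.\<close>
  have A: "w \<otimes> a0 = inv (cj h) \<otimes> (u \<otimes> a0) \<otimes> cj h" if "h \<in> WK" "u \<otimes> h = cj h \<otimes> w" for h
  proof -
    have hc: "h \<in> carrier W" using WK_c that by simp
    have "inv (cj h) \<otimes> (u \<otimes> a0) \<otimes> cj h = inv (cj h) \<otimes> (u \<otimes> h) \<otimes> a0"
      using hc c a0 by (simp add: cj_def m_assoc cancel_inv)
    also have "\<dots> = w \<otimes> a0" unfolding that(2) using hc c a0 by (simp add: m_assoc cancel_inv)
    finally show ?thesis by simp
  qed
  have B: "u \<otimes> ci j = cj (ci j) \<otimes> w" if "j \<in> WK" "w \<otimes> a0 = inv j \<otimes> (u \<otimes> a0) \<otimes> j" for j
  proof -
    have jc: "j \<in> carrier W" using WK_c that by simp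
    have "j \<otimes> w = j \<otimes> (w \<otimes> a0) \<otimes> inv a0" using jc c a0 by (simp add: m_assoc)
    also have "\<dots> = u \<otimes> ci j" unfolding that(2) using jc c a0 by (simp add: m_assoc cancel_inv ci_def)
    finally show ?thesis using jc by simp
  qed
  have "{h \<in> WK. u \<otimes> h = cj h \<otimes> w} \<noteq> {} \<longleftrightarrow> tconj u w"
    unfolding tconj_def using A B cj_WK ci_WK by fastforce
  moreover have "card {h \<in> WK. u \<otimes> h = cj h \<otimes> w} > 0 \<longleftrightarrow> {h \<in> WK. u \<otimes> h = cj h \<otimes> w} \<noteq> {}"
    using fin_K by (simp add: card_gt_0_iff)
  ultimately show "ev1 (trphi u w) > 0 \<longleftrightarrow> tconj u w" unfolding e' by simp
qed

lemma tconj_refl: "u \<in> WK \<Longrightarrow> tconj u u"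
  unfolding tconj_def using WK_c a0 by (intro bexI[of _ \<one>]) (auto simp: gen_one)

lemma tconj_sym:
  assumes "u \<in> WK" "w \<in> WK" "tconj u w" shows "tconj w u"
proof -
  obtain j where j: "j \<in> WK" "w \<otimes> a0 = inv j \<otimes> (u \<otimes> a0) \<otimes> j" using assms by (auto simp: tconj_def)
  have "inv (inv j) \<otimes> (w \<otimes> a0) \<otimes> inv j = u \<otimes> a0"
    unfolding j(2) using WK_c j assms a0 by (simp add: m_assoc cancel_inv)
  then show ?thesis unfolding tconj_def using gen_inv[OF K j(1)] by metis
qed

lemma tconj_trans:
  assumes "u \<in> WK" "w \<in> WK" "x \<in> WK" "tconj u w" "tconj w x" shows "tconj u x"
proof -
  obtain j where j: "j \<in> WK" "w \<otimes> a0 = inv j \<otimes> (u \<otimes> a0) \<otimes> j" using assms by (auto simp: tconj_def)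
  obtain i where i: "i \<in> WK" "x \<otimes> a0 = inv i \<otimes> (w \<otimes> a0) \<otimes> i" using assms by (auto simp: tconj_def)
  have "x \<otimes> a0 = inv (j \<otimes> i) \<otimes> (u \<otimes> a0) \<otimes> (j \<otimes> i)"
    unfolding i(2) j(2) using WK_c i j assms a0 by (simp add: m_assoc inv_mult_group)
  then show ?thesis unfolding tconj_def using gen_mult i j by blast
qed

text \<open>Exact vanishing at finitely many pairwise non-conjugate elements, by Gaussian elimination.\<close>

lemma tt_eliminate:
  assumes "finite I" "I \<subseteq> WK" "\<And>x y. x \<in> I \<Longrightarrow> y \<in> I \<Longrightarrow> tconj x y \<Longrightarrow> x = y"
    "u \<in> WK" "\<And>x. x \<in> I \<Longrightarrow> \<not> tconj u x"
  shows "\<exists>f. tt f \<and> (\<forall>w\<in>WK. ev1 (f w) \<ge> 0 \<and> (ev1 (f w) > 0 \<longleftrightarrow> tconj u w)) \<and> (\<forall>x\<in>I. f x = 0)"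
  using assms
proof (induction I arbitrary: u rule: finite_induct)
  case empty
  then have u: "u \<in> WK" by blast
  show ?case
  proof (intro exI[of _ "trphi u"] conjI ballI)
    show "tt (trphi u)" by (rule tt_trphi[OF u])
  qed (use ev1_trphi[OF u] in auto)
next
  case (insert y I)
  have yI: "y \<in> WK" "I \<subseteq> WK" using insert.prems(1) by blast+
  have yI3: "\<not> tconj y x" if "x \<in> I" for x using insert.prems(2)[of y x] insert.hyps(2) that by blast
  have I: "\<And>x z. x \<in> I \<Longrightarrow> z \<in> I \<Longrightarrow> tconj x z \<Longrightarrow> x = z" using insert.prems(2) by blast
  have u: "u \<in> WK" "\<And>x. x \<in> I \<Longrightarrow> \<not> tconj u x" using insert.prems(3,4) by blast+
  let ?Q = "\<lambda>u. \<exists>f. tt f \<and> (\<forall>w\<in>WK. ev1 (f w) \<ge> 0 \<and> (ev1 (f w) > 0 \<longleftrightarrow> tconj u w)) \<and> (\<forall>x\<in>I. f x = 0)"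
  have IHu: "?Q u" by (rule insert.IH) (fact yI(2) I u)+
  have IHy: "?Q y" by (rule insert.IH) (fact yI(2) I yI(1) yI3)+
  obtain f where f0: "tt f" "\<forall>w\<in>WK. ev1 (f w) \<ge> 0 \<and> (ev1 (f w) > 0 \<longleftrightarrow> tconj u w)" "\<forall>x\<in>I. f x = 0"
    using IHu by (elim exE conjE)
  have f: "tt f" "\<And>w. w \<in> WK \<Longrightarrow> ev1 (f w) \<ge> 0" "\<And>w. w \<in> WK \<Longrightarrow> ev1 (f w) > 0 \<longleftrightarrow> tconj u w"
    "\<And>x. x \<in> I \<Longrightarrow> f x = 0" using f0 by simp_all
  obtain g where g0: "tt g" "\<forall>w\<in>WK. ev1 (g w) \<ge> 0 \<and> (ev1 (g w) > 0 \<longleftrightarrow> tconj y w)" "\<forall>x\<in>I. g x = 0"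
    using IHy by (elim exE conjE)
  have g: "tt g" "\<And>w. w \<in> WK \<Longrightarrow> ev1 (g w) \<ge> 0" "\<And>w. w \<in> WK \<Longrightarrow> ev1 (g w) > 0 \<longleftrightarrow> tconj y w"
    "\<And>x. x \<in> I \<Longrightarrow> g x = 0" using g0 by simp_all
  have fy: "ev1 (f y) = 0" using f(2,3)[OF yI(1)] insert.prems(4)[of y] by auto
  have gy: "ev1 (g y) > 0" using g(3)[OF yI(1)] tconj_refl[OF yI(1)] by auto
  \<comment> \<open>The combination vanishes at y. As \<open>f y\<close> is 0 at q = 1, the value of
    \<open>h\<close> there is that of \<open>f\<close> times the positive integer
    \<open>ev1 (g y)\<close>, so signs and support survive.\<close>
  define h where "h w = g y * f w - f y * g w" for w
  have hl: "lact h k w = g y * lact f k w - f y * lact g k w" for k w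
    unfolding lact_def h_def by (simp add: right_diff_distrib distrib_left mult.left_commute)
  have hr: "ract h k w = g y * ract f k w - f y * ract g k w" for k w
    unfolding ract_def h_def by (simp add: right_diff_distrib distrib_left mult.left_commute)
  have th: "tt h" using f(1) g(1) by (simp add: tt_def hl hr)
  have "ev1 (h w) = ev1 (g y) * ev1 (f w)" for w by (simp add: h_def ev1_diff ev1_mult fy)
  then have hw: "ev1 (h w) \<ge> 0" "ev1 (h w) > 0 \<longleftrightarrow> tconj u w" if "w \<in> WK" for w
    using f(2,3)[OF that] gy by (simp_all add: zero_less_mult_iff)
  have h0: "h x = 0" if "x \<in> insert y I" for x using that f(4) g(4) by (auto simp: h_def)
  show ?case
  proof (intro exI[of _ h] conjI ballI)
    show "tt h" by (rule th)
  next
    fix x assume "x \<in> insert y I" then show "h x = 0" by (rule h0)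
  qed (use hw in auto)
qed

section \<open>Vanishing of twisted traces on non-elliptic elements\<close>

lemma tt_pairing:
  assumes f: "tt f" and k: "k \<in> K"
  shows "(\<Sum>w\<in>WK. f w * Lop k m w) = (\<Sum>w\<in>WK. f w * Rop (\<sigma> k) m w)"
proof -
  have "(\<Sum>w\<in>WK. f w * Lop k m w) = (\<Sum>w\<in>WK. m w * lact f k w)"
    unfolding sum_lact[OF K k, symmetric] Lop_def ..
  also have "\<dots> = (\<Sum>w\<in>WK. m w * ract f (\<sigma> k) w)" using f k by (simp add: tt_def)
  also have "\<dots> = (\<Sum>w\<in>WK. f w * Rop (\<sigma> k) m w)"
    unfolding sum_ract[OF K \<sigma>_K[OF k], symmetric] Rop_def ..
  finally show ?thesis .
qed

lemma tt_pairing_word: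
  assumes f: "tt f"
  shows "ks \<in> lists K \<Longrightarrow> (\<Sum>w\<in>WK. f w * Lword ks m w) = (\<Sum>w\<in>WK. f w * Rword (map \<sigma> ks) m w)"
proof (induction ks arbitrary: m)
  case (Cons k ks)
  have k: "k \<in> K" "ks \<in> lists K" "ks \<in> lists S" "\<sigma> k \<in> S" using Cons.prems K \<sigma>_K K_S by auto
  have "(\<Sum>w\<in>WK. f w * Lword (k # ks) m w) = (\<Sum>w\<in>WK. f w * Rop (\<sigma> k) (Lword ks m) w)"
    using tt_pairing[OF f k(1)] by simp
  also have "\<dots> = (\<Sum>w\<in>WK. f w * Lword ks (Rop (\<sigma> k) m) w)"
    using LwordR_commute[OF k(3,4), of m] WK_c by (intro sum.cong) (auto simp: ceq_def)
  also have "\<dots> = (\<Sum>w\<in>WK. f w * Rword (map \<sigma> (k # ks)) m w)" using Cons.IH[OF k(2)] by simp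
  finally show ?case .
qed simp

lemma sum_delta_WK: "w \<in> WK \<Longrightarrow> m \<doteq> coef pos [] w \<Longrightarrow> (\<Sum>x\<in>WK. f x * m x) = f w"
proof -
  assume w: "w \<in> WK" and m: "m \<doteq> coef pos [] w"
  have "(\<Sum>x\<in>WK. f x * m x) = (\<Sum>x\<in>WK. if x = w then f x else 0)"
    using m WK_c by (intro sum.cong) (auto simp: ceq_def)
  then show ?thesis using w fin_K by simp
qed

text \<open>Here \<open>T\<^sub>d T\<^sub>w = T\<^sub>w\<^sub>' T\<^sub>d\<close> with \<open>T\<^sub>d\<close> invertible.\<close>

lemma tt_intertwine:
  assumes f: "tt f" and d: "d \<in> WK" "ci d = d" and w: "w \<in> WK" "w' \<in> WK" and e: "d \<otimes> w = w' \<otimes> d"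
    and l: "len (d \<otimes> w) = len d + len w" "len (w' \<otimes> d) = len w' + len d"
  shows "f w = f w'"
proof -
  let ?ks = "rw d" and ?rs = "map \<sigma> (rw d)"
  note ks = rw[OF d(1)] and c = WK_c[OF d(1)] WK_c[OF w(1)] WK_c[OF w(2)]
  have rsK: "?rs \<in> lists K" using ks(1) \<sigma>_K by auto
  then have rs: "?rs \<in> lists S" using K by auto
  have "word_prod W (map \<sigma> xs) = ci (word_prod W xs)" if "xs \<in> lists K" for xs
    using that
  proof (induction xs)
    case (Cons k xs)
    then have "xs \<in> lists S" using K by auto
    then show ?case using Cons K_S by (simp add: cjci_mult ci_k)
  qed simp
  then have wr: "word_prod W ?rs = d" using ks d by simp
  \<comment> \<open>\<open>m\<close> is \<open>T_w\<close> times the inverse of \<open>T_d\<close>.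
    Multiplication by \<open>T_d\<close> gives \<open>T_w'\<close> on the left and
    \<open>T_w\<close> on the right. The trace property exchanges the two sides, because the letters
    of d, twisted by \<sigma>, again spell d.\<close>
  define m where "m = Rinvword ?rs (coef pos [] w)"
  have 1: "Lword ?ks m \<doteq> coef pos [] w'"
  proof -
    have "Lword ?ks m \<doteq> Rinvword ?rs (Lword ?ks (coef pos [] w))"
      unfolding m_def by (rule Lword_Rinvword[OF ks(4) rs])
    also have "\<dots> \<doteq> Rinvword ?rs (coef pos [] (d \<otimes> w))"
    proof (rule Rinvword_ceq[OF rs])
      show "Lword ?ks (coef pos [] w) \<doteq> coef pos [] (d \<otimes> w)"
        using Lword_delta[OF ks(4) c(2)] l ks by (simp only:)
    qed
    also have "\<dots> \<doteq> Rinvword ?rs (Rword ?rs (coef pos [] w'))"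
    proof (rule Rinvword_ceq[OF rs])
      have "coef pos ?rs w' \<doteq> coef pos [] (d \<otimes> w)"
        using coef_reduced[OF rs c(3)] l(2) wr ks(2) e by (simp add: ceq_def)
      then show "coef pos [] (d \<otimes> w) \<doteq> Rword ?rs (coef pos [] w')"
        using coef_Rword[OF rs c(3)] ceq_trans ceq_sym by blast
    qed
    also have "\<dots> \<doteq> coef pos [] w'" by (rule Rinvword_left[OF rs])
    finally show ?thesis .
  qed
  have 2: "Rword ?rs m \<doteq> coef pos [] w" unfolding m_def by (rule Rinvword_right[OF rs])
  have "f w' = (\<Sum>x\<in>WK. f x * Lword ?ks m x)" using sum_delta_WK[OF w(2) 1] by simp
  also have "\<dots> = (\<Sum>x\<in>WK. f x * Rword ?rs m x)" by (rule tt_pairing_word[OF f ks(1)])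
  also have "\<dots> = f w" by (rule sum_delta_WK[OF w(1) 2])
  finally show ?thesis by simp
qed

text \<open>The non-elliptic twisted classes of \<open>W_K\<close> are those that meet this union of
  proper \<sigma>-stable standard parabolic subgroups.\<close>

definition nonell :: "'w set" where
  "nonell = (\<Union>J\<in>{J. J \<subset> K \<and> \<sigma> ` J = J}. generate W J)"

lemma nonellI: "J \<subset> K \<Longrightarrow> \<sigma> ` J = J \<Longrightarrow> x \<in> generate W J \<Longrightarrow> x \<in> nonell"
  unfolding nonell_def by blast

lemma nonell_WK: "nonell \<subseteq> WK"
  unfolding nonell_def using mono_generate by blast

text \<open>Decompose the conjugating element as \<open>z \<otimes> d \<otimes> y\<close> with
  \<open>d\<close> as short as possible. By \<sigma>-stability \<open>d\<close> and
  \<open>ci d\<close> are both minimal in the same double coset, so they coincide, and minimality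
  makes the lengths additive.\<close>

lemma tconj_double_coset:
  assumes J: "J \<subset> K" "\<sigma> ` J = J" "J' \<subset> K" "\<sigma> ` J' = J'"
    and w: "w \<in> generate W J" "w' \<in> generate W J'" and t: "tconj w w'"
  obtains y y' d where "y \<in> generate W J" "y' \<in> generate W J'" "d \<in> WK" "ci d = d"
    "d \<otimes> (y \<otimes> w \<otimes> ci (inv y)) = (y' \<otimes> w' \<otimes> ci (inv y')) \<otimes> d"
    "len (d \<otimes> (y \<otimes> w \<otimes> ci (inv y))) = len d + len (y \<otimes> w \<otimes> ci (inv y))"
    "len ((y' \<otimes> w' \<otimes> ci (inv y')) \<otimes> d) = len (y' \<otimes> w' \<otimes> ci (inv y')) + len d"
proof -
  have JS: "J \<subseteq> S" "J' \<subseteq> S" using J K by auto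
  have mono: "x \<in> WK" if "x \<in> generate W J \<or> x \<in> generate W J'" for x
    using that J mono_generate[of J K] mono_generate[of J' K] by blast
  have wK: "w \<in> WK" "w' \<in> WK" using w mono by auto
  obtain j where j: "j \<in> WK" "w' \<otimes> a0 = inv j \<otimes> (w \<otimes> a0) \<otimes> j" using t by (auto simp: tconj_def)
  define g where "g = inv j"
  have gK: "g \<in> WK" unfolding g_def using j gen_inv[OF K] by blast
  note c = WK_c[OF gK] WK_c[OF wK(1)] WK_c[OF wK(2)] WK_c[OF j(1)]
  have gw: "g \<otimes> w = w' \<otimes> ci g"
  proof -
    have "w' \<otimes> ci g = (w' \<otimes> a0) \<otimes> g \<otimes> inv a0" using c a0 by (simp add: ci_def m_assoc)
    also have "\<dots> = g \<otimes> w" unfolding j(2) g_def using c(2-4) a0 by (simp add: m_assoc cancel_inv)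
    finally show ?thesis by simp
  qed
  define P where "P n \<longleftrightarrow> (\<exists>d y z. d \<in> WK \<and> y \<in> generate W J \<and> z \<in> generate W J' \<and> g = z \<otimes> d \<otimes> y \<and> len d = n)" for n
  have "P (len g)" unfolding P_def using gK c by (intro exI[of _ g] exI[of _ \<one>]) (simp add: gen_one)
  then have PL: "P (LEAST n. P n)" by (rule LeastI)
  then obtain d y z where d: "d \<in> WK" "y \<in> generate W J" "z \<in> generate W J'" "g = z \<otimes> d \<otimes> y"
    "len d = (LEAST n. P n)" unfolding P_def by blast
  have mn: "len d \<le> len x" if "x \<in> WK" "v \<in> generate W J" "u \<in> generate W J'" "g = u \<otimes> x \<otimes> v" for x u v
    using d(5) Least_le[of P "len x"] that unfolding P_def by auto
  note dc = WK_c[OF d(1)] gen_sub[OF JS(1) d(2)] gen_sub[OF JS(2) d(3)]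
  have dJ: "pos (act d (sr k))" if k: "k \<in> J" for k
  proof (rule ccontr)
    assume np: "\<not> ?thesis"
    have kc: "k \<in> K" "k \<in> S" "k \<in> carrier W" using k J K_S by auto
    have "Suc (len (d \<otimes> k)) = len d" using np pos_iff_len[OF dc(1) kc(2)] len_right[OF dc(1) kc(2)] by auto
    moreover have "len d \<le> len (d \<otimes> k)"
    proof (rule mn[of _ "k \<otimes> y" z])
      show "g = z \<otimes> (d \<otimes> k) \<otimes> (k \<otimes> y)" using d(4) dc kc by (simp add: m_assoc)
    qed (use d kc k in \<open>simp_all add: gen_mult gen_S\<close>)
    ultimately show False by simp
  qed
  have dJ': "pos (act (inv d) (sr k))" if k: "k \<in> J'" for k
  proof (rule ccontr)
    assume np: "\<not> ?thesis"
    have kc: "k \<in> K" "k \<in> S" "k \<in> carrier W" using k J K_S by auto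
    have "Suc (len (k \<otimes> d)) = len d" using np len_left[OF dc(1) kc(2)] by auto
    moreover have "len d \<le> len (k \<otimes> d)"
    proof (rule mn[of _ y "z \<otimes> k"])
      show "g = (z \<otimes> k) \<otimes> (k \<otimes> d) \<otimes> y" using d(4) dc kc by (simp add: m_assoc)
    qed (use d kc k in \<open>simp_all add: gen_mult gen_S\<close>)
    ultimately show False by simp
  qed
  define y' where "y' = inv z"
  have y': "y' \<in> generate W J'" unfolding y'_def using d gen_inv[OF JS(2)] by blast
  let ?v = "y \<otimes> w \<otimes> ci (inv y)" and ?v' = "y' \<otimes> w' \<otimes> ci (inv y')"
  have v: "?v \<in> generate W J" using d(2) w(1) J(1,2) by (simp add: gen_mult ci_gen gen_inv[OF JS(1)])
  have v': "?v' \<in> generate W J'" using y' w(2) J(3,4) by (simp add: gen_mult ci_gen gen_inv[OF JS(2)])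
  have E: "d \<otimes> ?v = ?v' \<otimes> ci d"
  proof -
    have "ci g = ci z \<otimes> ci d \<otimes> ci y" unfolding d(4) using dc by (simp add: cjci_mult)
    then have "z \<otimes> d \<otimes> y \<otimes> w = w' \<otimes> (ci z \<otimes> ci d \<otimes> ci y)" using gw d(4) by simp
    then have "inv z \<otimes> (z \<otimes> d \<otimes> y \<otimes> w) \<otimes> inv (ci y) = inv z \<otimes> (w' \<otimes> (ci z \<otimes> ci d \<otimes> ci y)) \<otimes> inv (ci y)" by simp
    then show ?thesis using dc c by (simp add: m_assoc cancel_inv ci_inv y'_def)
  qed
  have \<sigma>i: "\<exists>k'\<in>J. \<sigma> k' = k" if "k \<in> J" for k using J(2) that by (metis imageE)
  have \<sigma>i': "\<exists>k'\<in>J'. \<sigma> k' = k" if "k \<in> J'" for k using J(4) that by (metis imageE)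
  have a0i: "act (inv a0) (sr (\<sigma> k)) = sr k" if "k \<in> K" for k using \<sigma>(2)[OF that] a0 by (metis act_inv(2))
  have cd: "act (ci d) (sr (\<sigma> k)) = act a0 (act d (sr k))" if "k \<in> K" for k
    using dc a0 a0i[OF that] by (simp add: ci_def act_mult)
  have cdi: "act (inv (ci d)) (sr (\<sigma> k)) = act a0 (act (inv d) (sr k))" if "k \<in> K" for k
    using dc a0 a0i[OF that] by (simp add: ci_def act_mult inv_mult_group)
  have cdJ: "pos (act (ci d) (sr k))" if kJ: "k \<in> J" for k
  proof -
    obtain k' where k': "k' \<in> J" "\<sigma> k' = k" "k' \<in> K" using \<sigma>i[OF kJ] J(1) by blast
    have "pos (act (ci d) (sr (\<sigma> k')))"
      unfolding cd[OF k'(3)] a0_pos'[OF PhiK_gen[OF d(1) PhiK_sr[OF k'(3)]]] by (rule dJ[OF k'(1)])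
    then show ?thesis unfolding k'(2) .
  qed
  have cdJ': "pos (act (inv (ci d)) (sr k))" if kJ: "k \<in> J'" for k
  proof -
    obtain k' where k': "k' \<in> J'" "\<sigma> k' = k" "k' \<in> K" using \<sigma>i'[OF kJ] J(3) by blast
    have "pos (act (inv (ci d)) (sr (\<sigma> k')))"
      unfolding cdi[OF k'(3)] a0_pos'[OF PhiK_gen[OF gen_inv[OF K d(1)] PhiK_sr[OF k'(3)]]] by (rule dJ'[OF k'(1)])
    then show ?thesis unfolding k'(2) .
  qed
  have "d = ci d"
    by (rule double_coset_unique[of J J' d "ci d" ?v ?v'])
      (fact JS dc(1) dJ dJ' cjci_c(2)[OF dc(1)] cdJ cdJ' v v' E)+
  then have cid: "ci d = d" by simp
  show ?thesis
    by (rule that[OF d(2) y' d(1) cid E[unfolded cid] min_coset_add[OF JS(1) dc(1) dJ v]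
          min_coset_add_left[OF JS(2) dc(1) dJ' v']])
qed

lemma ev1_lact: "ev1 (lact g k x) = ev1 (g (k \<otimes> x))"
  by (simp add: lact_def ev1_add ev1_mult ev1_diff)

lemma ev1_ract: "ev1 (ract g k x) = ev1 (g (x \<otimes> k))"
  by (simp add: ract_def ev1_add ev1_mult ev1_diff)

text \<open>Divide f by the power of q - 1 reached so far. At q = 1 the quotient is a twisted class
  function on each stable \<open>W_J\<close>, and \<open>tt_intertwine\<close> links different
  parabolics. So vanishing at representatives spreads over whole classes and yields one more factor
  q - 1. Only 0 is divisible by all powers.\<close>

lemma tt_nonell_zero:
  assumes f: "tt f" and I: "I \<subseteq> nonell" "\<And>w. w \<in> nonell \<Longrightarrow> \<exists>i\<in>I. tconj i w" and fI: "\<And>i. i \<in> I \<Longrightarrow> f i = 0"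
    and w: "w \<in> nonell"
  shows "f w = 0"
proof -
  have "\<forall>w\<in>nonell. (qq - 1) ^ n dvd f w" for n
  proof (induction n)
    case (Suc n)
    define c where "c = (qq - 1) ^ n"
    have c0: "c \<noteq> 0" using qq_minus_1_nonzero by (simp add: c_def)
    from Suc have "\<forall>w\<in>nonell. \<exists>y. f w = c * y" by (auto simp: c_def dvd_def)
    then obtain g where g: "\<And>w. w \<in> nonell \<Longrightarrow> f w = c * g w" by metis
    have step: "ev1 (g (k \<otimes> x)) = ev1 (g (x \<otimes> \<sigma> k))"
      if J: "J \<subset> K" "\<sigma> ` J = J" and k: "k \<in> J" and x: "x \<in> generate W J" for J k x
    proof -
      have sk: "\<sigma> k \<in> J" using J k by blast
      have nl: "y \<in> nonell" if "y \<in> generate W J" for y unfolding nonell_def using J that by blast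
      have m: "x \<in> nonell" "k \<otimes> x \<in> nonell" "x \<otimes> \<sigma> k \<in> nonell"
        using nl x gen_mult[OF gen_S[OF k] x] gen_mult[OF x gen_S[OF sk]] by blast+
      have "c * lact g k x = lact f k x"
        unfolding lact_def g[OF m(1)] g[OF m(2)] by (simp add: distrib_left mult.left_commute)
      moreover have "c * ract g (\<sigma> k) x = ract f (\<sigma> k) x"
        unfolding ract_def g[OF m(1)] g[OF m(3)] by (simp add: distrib_left mult.left_commute)
      moreover have "lact f k x = ract f (\<sigma> k) x"
        using f subsetD[OF nonell_WK m(1)] subsetD[OF psubset_imp_subset[OF J(1)] k] unfolding tt_def by blast
      ultimately have "c * lact g k x = c * ract g (\<sigma> k) x" by simp
      then have "lact g k x = ract g (\<sigma> k) x" using c0 by simp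
      then have "ev1 (lact g k x) = ev1 (ract g (\<sigma> k) x)" by (rule arg_cong)
      then show ?thesis by (simp add: ev1_lact ev1_ract)
    qed
    have conj: "ev1 (g (y \<otimes> x \<otimes> ci (inv y))) = ev1 (g x) \<and> y \<otimes> x \<otimes> ci (inv y) \<in> generate W J"
      if J: "J \<subset> K" "\<sigma> ` J = J" and y: "y \<in> generate W J" and x: "x \<in> generate W J" for J y x
    proof -
      have JS: "J \<subseteq> S" using J K by auto
      have xc: "x \<in> carrier W" using gen_sub[OF JS x] .
      obtain ks where ks: "ks \<in> lists J" "word_prod W ks = y" using generate_word[OF JS y] by blast
      let ?c = "\<lambda>y. y \<otimes> x \<otimes> ci (inv y)"
      have "ev1 (g (?c (word_prod W ks))) = ev1 (g x) \<and> ?c (word_prod W ks) \<in> generate W J" using ks(1)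
      proof (induction ks)
        case Nil then show ?case using xc x by simp
      next
        case (Cons k ks)
        let ?y = "word_prod W ks"
        have k: "k \<in> J" "k \<in> K" "\<sigma> k \<in> J" "ks \<in> lists S" using Cons J JS by auto
        have kc: "k \<in> carrier W" "k \<in> S" "\<sigma> k \<in> carrier W" "\<sigma> k \<in> S" "?y \<in> carrier W" using K_S k J by auto
        have IH: "ev1 (g (?c ?y)) = ev1 (g x)" "?c ?y \<in> generate W J" using Cons by auto
        have cc: "?c ?y \<in> carrier W" using gen_sub[OF JS IH(2)] .
        have e: "?c (word_prod W (k # ks)) = k \<otimes> (?c ?y \<otimes> \<sigma> k)"
          using kc xc k by (simp add: inv_mult_group cjci_mult inv_S ci_k m_assoc)
        have "ev1 (g (k \<otimes> (?c ?y \<otimes> \<sigma> k))) = ev1 (g (?c ?y \<otimes> \<sigma> k \<otimes> \<sigma> k))"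
          using step[OF J k(1), of "?c ?y \<otimes> \<sigma> k"] IH k by (simp add: gen_mult gen_S)
        also have "?c ?y \<otimes> \<sigma> k \<otimes> \<sigma> k = ?c ?y" using cc kc by simp
        finally show ?case unfolding e using IH k by (simp add: gen_mult gen_S)
      qed
      then show ?thesis using ks by simp
    qed
    have cls: "ev1 (g x) = ev1 (g x')" if x: "x \<in> nonell" "x' \<in> nonell" "tconj x x'" for x x'
    proof -
      obtain J where J1: "J \<subset> K" "\<sigma> ` J = J" "x \<in> generate W J"
        using x(1) by (auto simp: nonell_def)
      obtain J' where J2: "J' \<subset> K" "\<sigma> ` J' = J'" "x' \<in> generate W J'"
        using x(2) by (auto simp: nonell_def)
      note J = J1(1,2) J2(1,2) J1(3) J2(3)
      show ?thesis
      proof (rule tconj_double_coset[OF J x(3)])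
      fix y y' d assume d: "y \<in> generate W J" "y' \<in> generate W J'" "d \<in> WK" "ci d = d"
        "d \<otimes> (y \<otimes> x \<otimes> ci (inv y)) = (y' \<otimes> x' \<otimes> ci (inv y')) \<otimes> d"
        "len (d \<otimes> (y \<otimes> x \<otimes> ci (inv y))) = len d + len (y \<otimes> x \<otimes> ci (inv y))"
        "len ((y' \<otimes> x' \<otimes> ci (inv y')) \<otimes> d) = len (y' \<otimes> x' \<otimes> ci (inv y')) + len d"
      let ?v = "y \<otimes> x \<otimes> ci (inv y)" and ?v' = "y' \<otimes> x' \<otimes> ci (inv y')"
      have v: "ev1 (g ?v) = ev1 (g x)" "?v \<in> generate W J" using conj[OF J(1,2) d(1) J(5)] by auto
      have v': "ev1 (g ?v') = ev1 (g x')" "?v' \<in> generate W J'" using conj[OF J(3,4) d(2) J(6)] by auto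
      have N: "?v \<in> nonell" "?v' \<in> nonell"
        using nonellI[OF J(1,2) v(2)] nonellI[OF J(3,4) v'(2)] .
      have "f ?v = f ?v'"
        by (rule tt_intertwine[OF f d(3,4) subsetD[OF nonell_WK N(1)] subsetD[OF nonell_WK N(2)] d(5-7)])
      then have "g ?v = g ?v'" unfolding g[OF N(1)] g[OF N(2)] using c0 by simp
      then show ?thesis using v(1) v'(1) by simp
      qed
    qed
    show ?case
    proof
      fix x assume x: "x \<in> nonell"
      obtain i where i: "i \<in> I" "tconj i x" using I(2)[OF x] by blast
      have iN: "i \<in> nonell" using I(1) i(1) by blast
      have "g i = 0" using g[OF iN] fI[OF i(1)] c0 by simp
      then have "ev1 (g x) = 0" using cls[OF iN x i(2)] by simp
      then have "(qq - 1) dvd g x" by (simp add: dvd_iff_ev1)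
      then show "(qq - 1) ^ Suc n dvd f x" unfolding g[OF x] power_Suc2 c_def by (rule mult_dvd_mono[OF dvd_refl])
    qed
  qed simp
  then show ?thesis using power_dvd_zero w by blast
qed

text \<open>Elimination at one representative of each non-elliptic class, after which
  \<open>tt_nonell_zero\<close> reaches the remaining elements.\<close>

theorem elliptic_phi:
  assumes u: "u \<in> WK" and ell: "\<And>w. w \<in> nonell \<Longrightarrow> \<not> tconj u w"
  shows "\<exists>f. tt f \<and> (\<forall>w\<in>WK. ev1 (f w) \<ge> 0 \<and> (ev1 (f w) > 0 \<longleftrightarrow> tconj u w)) \<and> (\<forall>w\<in>nonell. f w = 0)"
proof -
  note N = nonell_WK
  define r where "r w = (SOME x. x \<in> nonell \<and> tconj x w)" for w
  have r: "r w \<in> nonell" "tconj (r w) w" if "w \<in> nonell" for w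
  proof -
    have "\<exists>x. x \<in> nonell \<and> tconj x w" using that tconj_refl N by blast
    from someI_ex[OF this] show "r w \<in> nonell" "tconj (r w) w" unfolding r_def by auto
  qed
  note T = tconj_trans[OF subsetD[OF N] subsetD[OF N] subsetD[OF N]] and Sy = tconj_sym[OF subsetD[OF N] subsetD[OF N]]
  have req: "r w = r w'" if "w \<in> nonell" "w' \<in> nonell" "tconj w w'" for w w'
  proof -
    have "x \<in> nonell \<and> tconj x w \<longleftrightarrow> x \<in> nonell \<and> tconj x w'" for x
      using T[OF _ that(1,2) _ that(3), of x] T[OF _ that(2,1) _ Sy[OF that], of x] by blast
    then show ?thesis by (simp add: r_def)
  qed
  let ?I = "r ` nonell"
  have IN: "?I \<subseteq> nonell" using r by auto
  have pw: "x = y" if xy: "x \<in> ?I" "y \<in> ?I" "tconj x y" for x y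
  proof -
    obtain a b where ab: "a \<in> nonell" "x = r a" "b \<in> nonell" "y = r b" using xy(1,2) by blast
    note ra = r[OF ab(1)] and rb = r[OF ab(3)]
    have "tconj a x" using Sy[OF ra(1) ab(1) ra(2)] ab(2) by simp
    then have "tconj a y" using T[of a x y] ab ra rb xy(3) by simp
    then have "tconj a b" using T[of a y b] ab rb by simp
    then show ?thesis using req[OF ab(1,3)] ab by simp
  qed
  have fI: "finite ?I" "?I \<subseteq> WK" using finite_subset[OF N fin_K] IN N by auto
  have uI: "\<not> tconj u x" if "x \<in> ?I" for x using ell IN that by blast
  have ex: "\<exists>f. tt f \<and> (\<forall>w\<in>WK. ev1 (f w) \<ge> 0 \<and> (ev1 (f w) > 0 \<longleftrightarrow> tconj u w)) \<and> (\<forall>x\<in>?I. f x = 0)"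
    by (rule tt_eliminate) (fact fI pw u uI)+
  obtain f where f: "tt f" "\<forall>w\<in>WK. ev1 (f w) \<ge> 0 \<and> (ev1 (f w) > 0 \<longleftrightarrow> tconj u w)" "\<forall>x\<in>?I. f x = 0"
    using ex by (elim exE conjE)
  have z: "f w = 0" if "w \<in> nonell" for w
  proof (rule tt_nonell_zero[OF f(1) IN _ _ that])
    fix v assume "v \<in> nonell" then show "\<exists>i\<in>?I. tconj i v" using r by blast
  qed (use f(3) in blast)
  show ?thesis by (intro exI[of _ f] conjI f(1,2) ballI z)
qed

end

context coxeter_gcm
begin

section \<open>Orientations at infinity\<close>

definition ori_lim :: "'w \<Rightarrow> ('w \<Rightarrow> int) \<Rightarrow> bool" where
  "ori_lim g \<beta> \<longleftrightarrow> (\<forall>\<^sub>F n in sequentially. pos (act (g [^] (n::nat)) \<beta>))"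

text \<open>Every root then has either a constant orbit or one that leaves all finite sets; in both
  cases the sign along the orbit stabilises.\<close>

definition isolated :: "'w \<Rightarrow> bool" where
  "isolated g \<longleftrightarrow> (\<forall>\<beta>\<in>roots. finite (range (\<lambda>n::nat. act (g [^] n) \<beta>)) \<longrightarrow> act g \<beta> = \<beta>)"

lemma pow_c: "g \<in> carrier W \<Longrightarrow> g [^] (n::nat) \<in> carrier W" by simp

lemma act_pow_Suc:
  assumes "g \<in> carrier W"
  shows "act (g [^] Suc n) v = act (g [^] n) (act g v)" "act (g [^] Suc n) v = act g (act (g [^] n) v)"
  using act_mult[OF pow_c assms, OF assms, of n v] act_mult[OF assms pow_c[OF assms], of n v]
    nat_pow_Suc2[OF assms, of n] by (simp_all only: nat_pow_Suc)

lemma act_pow_fix: "g \<in> carrier W \<Longrightarrow> act g v = v \<Longrightarrow> act (g [^] (n::nat)) v = v"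
  by (induction n) (simp_all only: nat_pow_0 act_one act_pow_Suc)

lemma act_pow_add: "g \<in> carrier W \<Longrightarrow> act (g [^] (m + n :: nat)) v = act (g [^] m) (act (g [^] n) v)"
  by (simp add: nat_pow_mult[symmetric] act_mult)

lemma pow_periodic_finite:
  assumes g: "g \<in> carrier W" and d: "d > 0" "act (g [^] (d::nat)) \<beta> = \<beta>"
  shows "finite (range (\<lambda>n::nat. act (g [^] n) \<beta>))"
proof -
  have "act (g [^] n) \<beta> \<in> (\<lambda>n. act (g [^] n) \<beta>) ` {..<d}" for n :: nat
  proof (induction n rule: less_induct)
    case (less n)
    show ?case
    proof (cases "n < d")
      case False
      then have "act (g [^] n) \<beta> = act (g [^] (n - d)) (act (g [^] d) \<beta>)"
        using act_pow_add[OF g, of "n - d" d \<beta>] by simp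
      then have e: "act (g [^] n) \<beta> = act (g [^] (n - d)) \<beta>" unfolding d(2) .
      show ?thesis unfolding e using less.IH[of "n - d"] False d(1) by linarith
    qed blast
  qed
  then have "range (\<lambda>n::nat. act (g [^] n) \<beta>) \<subseteq> (\<lambda>n. act (g [^] n) \<beta>) ` {..<d}" by (rule image_subsetI)
  then show ?thesis by (rule finite_subset) simp
qed

lemma pow_inj:
  assumes g: "g \<in> carrier W" and inf: "infinite (range (\<lambda>n::nat. act (g [^] n) \<beta>))"
  shows "inj (\<lambda>n::nat. act (g [^] n) \<beta>)"
proof -
  have "False" if "act (g [^] m) \<beta> = act (g [^] n) \<beta>" "m < n" for m n :: nat
  proof -
    have "act (g [^] m) (act (g [^] (n - m)) \<beta>) = act (g [^] m) \<beta>"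
      using act_pow_add[OF g, of m "n - m" \<beta>] that by simp
    then have "act (g [^] (n - m)) \<beta> = \<beta>" using g by simp
    then show False using pow_periodic_finite[OF g, of "n - m" \<beta>] that inf by simp
  qed
  then show ?thesis by (metis (mono_tags, lifting) injI nat_neq_iff)
qed

lemma eventually_avoid:
  assumes g: "g \<in> carrier W" and inf: "infinite (range (\<lambda>n::nat. act (g [^] n) \<beta>))" and X: "finite X"
  shows "\<forall>\<^sub>F n in sequentially. act (g [^] (n::nat)) \<beta> \<notin> X"
proof -
  have "finite ((\<lambda>n::nat. act (g [^] n) \<beta>) -` X)" using finite_vimageI[OF X pow_inj[OF g inf]] .
  then obtain N where N: "\<forall>n\<in>(\<lambda>n::nat. act (g [^] n) \<beta>) -` X. n < N"
    unfolding finite_nat_set_iff_bounded by blast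
  have "act (g [^] n) \<beta> \<notin> X" if "N \<le> n" for n
    using bspec[OF N, of n] that by (auto simp: vimage_def)
  then show ?thesis unfolding eventually_sequentially by blast
qed

lemma pos_act_iff:
  assumes "\<beta> \<in> roots" "\<beta> \<notin> Inv z" "- \<beta> \<notin> Inv z" "z \<in> carrier W"
  shows "pos (act z \<beta>) = pos \<beta>"
  using assms root_neg_iff[OF assms(1)] root_neg_iff[OF roots_act[OF assms(4,1)]] roots_uminus[OF assms(1)]
  by (auto simp: Inv_def act_uminus)

text \<open>The roots whose sign \<open>z\<close> changes form the finite set \<open>Inv z\<close>
  up to sign, and an infinite orbit eventually leaves it.\<close>

lemma eventually_pos_act:
  assumes g: "g \<in> carrier W" and b: "\<beta> \<in> roots" and inf: "infinite (range (\<lambda>n::nat. act (g [^] n) \<beta>))"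
    and z: "z \<in> carrier W"
  shows "\<forall>\<^sub>F n in sequentially. pos (act z (act (g [^] (n::nat)) \<beta>)) = pos (act (g [^] n) \<beta>)"
proof -
  have fin: "finite (Inv z \<union> uminus ` Inv z)" using finite_Inv[OF z] by simp
  show ?thesis
    using eventually_avoid[OF g inf fin]
  proof (rule eventually_mono)
    fix n :: nat assume a: "act (g [^] n) \<beta> \<notin> Inv z \<union> uminus ` Inv z"
    have "- act (g [^] n) \<beta> \<notin> Inv z"
    proof
      assume "- act (g [^] n) \<beta> \<in> Inv z"
      then have "- (- act (g [^] n) \<beta>) \<in> uminus ` Inv z" by (rule imageI)
      then show False using a by simp
    qed
    then show "pos (act z (act (g [^] n) \<beta>)) = pos (act (g [^] n) \<beta>)"
      using a roots_act[OF pow_c[OF g] b] z by (intro pos_act_iff) auto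
  qed
qed

context
  fixes g assumes g: "g \<in> carrier W" and iso: "isolated g"
begin

lemma ori_lim_dichotomy:
  assumes b: "\<beta> \<in> roots"
  shows "\<forall>\<^sub>F n in sequentially. pos (act (g [^] (n::nat)) \<beta>) = ori_lim g \<beta>"
proof -
  have "(\<forall>\<^sub>F n in sequentially. pos (act (g [^] (n::nat)) \<beta>)) \<or> (\<forall>\<^sub>F n in sequentially. \<not> pos (act (g [^] (n::nat)) \<beta>))"
  proof (cases "act g \<beta> = \<beta>")
    case True
    then show ?thesis using act_pow_fix[OF g] by simp
  next
    case False
    then have inf: "infinite (range (\<lambda>n::nat. act (g [^] n) \<beta>))" using iso b by (auto simp: isolated_def)
    obtain N where N: "\<And>n. n \<ge> N \<Longrightarrow> pos (act g (act (g [^] (n::nat)) \<beta>)) = pos (act (g [^] n) \<beta>)"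
      using eventually_pos_act[OF g b inf g] unfolding eventually_sequentially by blast
    have "pos (act (g [^] n) \<beta>) = pos (act (g [^] N) \<beta>)" if "n \<ge> N" for n
      using that
    proof (induction n rule: dec_induct)
      case (step n) then show ?case using N[of n] by (simp only: act_pow_Suc(2)[OF g])
    qed simp
    then show ?thesis unfolding eventually_sequentially by metis
  qed
  then show ?thesis
  proof
    assume "\<forall>\<^sub>F n in sequentially. pos (act (g [^] (n::nat)) \<beta>)"
    then show ?thesis by (simp add: ori_lim_def)
  next
    assume n: "\<forall>\<^sub>F n in sequentially. \<not> pos (act (g [^] (n::nat)) \<beta>)"
    have "\<not> ori_lim g \<beta>"
    proof
      assume "ori_lim g \<beta>"
      then have "\<forall>\<^sub>F n::nat in sequentially. False" unfolding ori_lim_def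
        using n by (rule eventually_elim2) blast
      then show False by simp
    qed
    then show ?thesis using n by simp
  qed
qed

lemma ori_limI:
  assumes "\<beta> \<in> roots" "\<forall>\<^sub>F n in sequentially. pos (act (g [^] (n::nat)) \<beta>) = P"
  shows "ori_lim g \<beta> = P"
proof -
  have "\<forall>\<^sub>F n::nat in sequentially. ori_lim g \<beta> = P"
    using ori_lim_dichotomy[OF assms(1)] assms(2) by (rule eventually_elim2) blast
  then show ?thesis by simp
qed

lemma orient_ori_lim: "orient (ori_lim g)"
  unfolding orient_def
proof
  fix \<beta> assume b: "\<beta> \<in> roots"
  show "ori_lim g (- \<beta>) = (\<not> ori_lim g \<beta>)"
  proof (rule ori_limI[OF roots_uminus[OF b]])
    show "\<forall>\<^sub>F n in sequentially. pos (act (g [^] (n::nat)) (- \<beta>)) = (\<not> ori_lim g \<beta>)"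
      using ori_lim_dichotomy[OF b]
      by (rule eventually_mono) (use b g in \<open>simp add: act_uminus root_neg_iff roots_act\<close>)
  qed
qed

lemma ori_lim_fixed: "\<beta> \<in> roots \<Longrightarrow> act g \<beta> = \<beta> \<Longrightarrow> ori_lim g \<beta> = pos \<beta>"
  by (rule ori_limI) (simp_all add: act_pow_fix[OF g])

lemma pow_commute: "z \<in> carrier W \<Longrightarrow> z \<otimes> g = g \<otimes> z \<Longrightarrow> z \<otimes> g [^] (n::nat) = g [^] n \<otimes> z"
proof (induction n)
  case (Suc n)
  have "z \<otimes> g [^] Suc n = (z \<otimes> g [^] n) \<otimes> g" using Suc.prems g by (simp add: m_assoc)
  also have "\<dots> = g [^] n \<otimes> (z \<otimes> g)" unfolding Suc.IH[OF Suc.prems] using Suc.prems g by (simp add: m_assoc)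
  also have "\<dots> = g [^] Suc n \<otimes> z" unfolding Suc.prems(2) using Suc.prems g by (simp add: m_assoc)
  finally show ?case .
qed simp

text \<open>On roots fixed by g the orientation is ordinary positivity, so preservation has to be
  assumed there. On all others it is automatic, because z changes the sign of finitely many roots
  only.\<close>

lemma ori_lim_commute:
  assumes b: "\<beta> \<in> roots" and z: "z \<in> carrier W" "z \<otimes> g = g \<otimes> z" and f: "act g \<beta> = \<beta> \<Longrightarrow> pos (act z \<beta>) = pos \<beta>"
  shows "ori_lim g (act z \<beta>) = ori_lim g \<beta>"
proof (cases "act g \<beta> = \<beta>")
  case True
  have "act g (act z \<beta>) = act z \<beta>" using True z g by (metis act_mult)
  then show ?thesis using True f ori_lim_fixed b roots_act[OF z(1) b] by simp
next
  case False
  then have inf: "infinite (range (\<lambda>n::nat. act (g [^] n) \<beta>))" using iso b by (auto simp: isolated_def)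
  have e: "act (g [^] n) (act z \<beta>) = act z (act (g [^] n) \<beta>)" for n :: nat
    using pow_commute[OF z, of n] z g by (metis act_mult pow_c)
  show ?thesis
  proof (rule ori_limI[OF roots_act[OF z(1) b]])
    show "\<forall>\<^sub>F n in sequentially. pos (act (g [^] (n::nat)) (act z \<beta>)) = ori_lim g \<beta>"
      using eventually_pos_act[OF g b inf z(1)] ori_lim_dichotomy[OF b]
      by (rule eventually_elim2) (simp add: e)
  qed
qed

text \<open>The two braid words test finitely many roots, so one power of g can replace the limit
  for all of them at once, and \<open>coef_transport\<close> reduces to the ordinary module.\<close>

lemma ori_lim_braid:
  assumes st: "s \<in> S" "t \<in> S" "s \<noteq> t" "cox_m W s t \<noteq> 0" and h: "h \<in> carrier W" and x: "x \<in> carrier W"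
  shows "coef (ori_lim g) (alt_word (cox_m W s t) s t) h x = coef (ori_lim g) (alt_word (cox_m W s t) t s) h x"
proof -
  let ?m = "cox_m W s t"
  let ?U = "{u. set u \<subseteq> {s,t} \<and> length u \<le> ?m} \<times> {s,t}"
  have fU: "finite ?U" using finite_lists_length_le[of "{s,t}" ?m] by simp
  have r: "act (h \<otimes> word_prod W (fst p)) (sr (snd p)) \<in> roots" if "p \<in> ?U" for p
  proof -
    have "fst p \<in> lists S" "snd p \<in> S" using that st by (auto simp: in_lists_conv_set)
    then show ?thesis using h by (intro root_hs) auto
  qed
  have "\<forall>\<^sub>F n in sequentially. \<forall>p\<in>?U. pos (act (g [^] (n::nat)) (act (h \<otimes> word_prod W (fst p)) (sr (snd p))))
      = ori_lim g (act (h \<otimes> word_prod W (fst p)) (sr (snd p)))"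
    using fU ori_lim_dichotomy[OF r] by (intro eventually_ball_finite) auto
  then obtain n :: nat where n: "\<And>p. p \<in> ?U \<Longrightarrow> pos (act (g [^] n) (act (h \<otimes> word_prod W (fst p)) (sr (snd p))))
      = ori_lim g (act (h \<otimes> word_prod W (fst p)) (sr (snd p)))"
    using eventually_happens'[OF sequentially_bot] by blast
  let ?z = "g [^] n"
  have z: "?z \<in> carrier W" using g by simp
  have e: "ori_lim g (act (h \<otimes> word_prod W u) (sr c)) = pos (act (?z \<otimes> h \<otimes> word_prod W u) (sr c))"
    if u: "u \<in> lists {s,t}" "length u \<le> ?m" "c \<in> {s,t}" for u c
  proof -
    have "u \<in> lists S" using u st by auto
    then show ?thesis using n[of "(u, c)"] u z h by (simp add: in_lists_conv_set subset_iff m_assoc act_mult)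
  qed
  have T: "coef (ori_lim g) ss h x = coef pos ss (?z \<otimes> h) (?z \<otimes> x)" if "ss \<in> lists {s,t}" "length ss \<le> ?m" for ss
    using coef_transport[OF z h st(1,2) x e that(1), where u = "[]"] that z h by simp
  have "alt_word ?m s t \<in> lists {s,t}" "alt_word ?m t s \<in> lists {s,t}" by (auto simp: alt_word_def)
  then show ?thesis using T coef_pos_braid[OF st, of "?z \<otimes> h" "?z \<otimes> x"] z h x by simp
qed

end

text \<open>What a function on words must satisfy to induce the required functional: the first three
  clauses let it factor through the cocenter, the last prescribes its values at q = 1.\<close>

definition class_trace :: "'w set \<Rightarrow> ('w list \<Rightarrow> laurent) \<Rightarrow> bool" where
  "class_trace Q f \<longleftrightarrow>
     (\<forall>u\<in>lists S. \<forall>v\<in>lists S. f (u @ v) = f (v @ u)) \<and>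
     (\<forall>s\<in>S. \<forall>v\<in>lists S. f (s # s # v) = (qq - 1) * f (s # v) + qq * f v) \<and>
     (\<forall>s\<in>S. \<forall>t\<in>S. \<forall>v\<in>lists S. s \<noteq> t \<longrightarrow> cox_m W s t \<noteq> 0 \<longrightarrow>
        f (alt_word (cox_m W s t) s t @ v) = f (alt_word (cox_m W s t) t s @ v)) \<and>
     (\<exists>z>0. \<forall>v\<in>lists S. ev1 (f v) = (if word_prod W v \<in> Q then z else 0))"

definition cls :: "'w \<Rightarrow> 'w set" where
  "cls a = {g \<otimes> a \<otimes> inv g | g. g \<in> carrier W}"

end

context twisted_parabolic
begin

theorem class_trace_exists:
  assumes g: "g \<in> carrier W" "isolated g" "\<And>k. k \<in> K \<Longrightarrow> act g (sr k) = sr k"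
    and a0g: "a0 \<otimes> g = g \<otimes> a0" "\<And>\<beta>. \<beta> \<in> roots \<Longrightarrow> act g \<beta> = \<beta> \<Longrightarrow> pos (act a0 \<beta>) = pos \<beta>"
    and u: "u \<in> WK"
    and G: "subgroup \<Gamma> W" "\<And>z. z \<in> \<Gamma> \<Longrightarrow> z \<otimes> a0 = a0 \<otimes> z" "\<And>z. z \<in> \<Gamma> \<Longrightarrow> z \<otimes> g = g \<otimes> z"
      "\<And>z k. z \<in> \<Gamma> \<Longrightarrow> k \<in> K \<Longrightarrow> act z (sr k) = sr k"
      "\<And>z \<beta>. z \<in> \<Gamma> \<Longrightarrow> \<beta> \<in> roots \<Longrightarrow> act g \<beta> = \<beta> \<Longrightarrow> pos (act z \<beta>) = pos \<beta>"
    and f: "tt f" "\<And>w. w \<in> WK \<Longrightarrow> ev1 (f w) \<ge> 0"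
      "\<And>w. w \<in> WK \<Longrightarrow> ev1 (f w) > 0 \<longleftrightarrow> tconj u w"
    and fin_orb: "\<And>w v. \<lbrakk>w \<in> WK; f w \<noteq> 0; v \<in> carrier W\<rbrakk> \<Longrightarrow>
      \<exists>F. finite F \<and> F \<subseteq> carrier W \<and>
        (\<forall>h\<in>carrier W. (\<forall>k\<in>K. pos (act (inv h) (sr k))) \<longrightarrow> w \<otimes> a0 \<otimes> h = h \<otimes> v \<longrightarrow>
           (\<exists>z\<in>\<Gamma>. \<exists>h'\<in>F. h = z \<otimes> h'))"
  shows "\<exists>f. class_trace (cls (u \<otimes> a0)) f"
proof -
  have Gc: "z \<in> carrier W" if "z \<in> \<Gamma>" for z using subgroup.mem_carrier[OF G(1) that] .
  have PhiK_fix: "act g \<gamma> = \<gamma>" if "\<gamma> \<in> PhiK K" for \<gamma>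
  proof -
    have K0: "finite K" "\<And>x. x \<notin> K \<Longrightarrow> \<gamma> x = 0" using finite_subset[OF K fin] that by (auto simp: PhiK_def)
    have "act g \<gamma> = (\<Sum>k\<in>K. \<gamma> k \<cdot> sr k)" using act_expand[OF K0 g(1)] g(3) by simp
    then show ?thesis using support_expand[OF K0] by simp
  qed
  note O = g(1,2)
  interpret D: coxeter_datum W S A K a0 \<sigma> "ori_lim g" \<Gamma> f
  proof (intro coxeter_datum.intro[OF twisted_parabolic_axioms] coxeter_datum_axioms.intro)
    show "orient (ori_lim g)" by (rule orient_ori_lim[OF O])
    fix \<gamma> assume "\<gamma> \<in> PhiK K"
    then show "ori_lim g \<gamma> = pos \<gamma>" using PhiK_fix by (intro ori_lim_fixed[OF O]) (auto simp: PhiK_def)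
  next
    fix k \<beta> assume k: "k \<in> K" and b: "\<beta> \<in> roots" "\<beta> \<notin> PhiK K"
    have "g \<otimes> k = k \<otimes> g" using simple_conj[OF g(1) _ _ g(3)[OF k]] K_S k by simp
    moreover have "\<beta> \<noteq> sr k" "\<beta> \<noteq> - sr k" using b k PhiK_sr[OF k] roots_uminus by (auto simp: PhiK_def pw_simps)
    ultimately show "ori_lim g (act k \<beta>) = ori_lim g \<beta>"
      using K_S k by (intro ori_lim_commute[OF O b(1)]) (auto simp: pos_flip[OF b(1)])
  next
    fix \<beta> assume "\<beta> \<in> roots"
    then show "ori_lim g (act a0 \<beta>) = ori_lim g \<beta>" using a0 a0g by (intro ori_lim_commute[OF O]) auto
  next
    fix z \<beta> assume "z \<in> \<Gamma>" "\<beta> \<in> roots"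
    then show "ori_lim g (act z \<beta>) = ori_lim g \<beta>" using Gc G by (intro ori_lim_commute[OF O]) auto
  next
    fix k w assume "k \<in> K" "w \<in> WK"
    then show "lact f k w = ract f (\<sigma> k) w" using f(1) by (auto simp: tt_def)
  qed (fact ori_lim_braid[OF O] G fin_orb)+
  let ?a = "u \<otimes> a0"
  have uc: "u \<in> carrier W" "?a \<in> carrier W" using WK_c[OF u] a0 by auto
  obtain a where a: "a \<in> lists S" "word_prod W a = ?a" using ex_word[OF uc(2)] by blast
  have z: "ev1 (D.tr v) = 0" if v: "v \<in> lists S" "word_prod W v \<notin> cls ?a" for v
  proof (rule D.ev1_tr_zero[OF v(1)])
    fix h w assume h: "h \<in> carrier W" and w: "w \<in> WK" "ev1 (f w) \<noteq> 0"
    have "tconj u w" using f(2,3)[OF w(1)] w(2) by fastforce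
    then obtain j where j: "j \<in> WK" "w \<otimes> a0 = inv j \<otimes> ?a \<otimes> j" by (auto simp: tconj_def)
    have jc: "j \<in> carrier W" "w \<in> carrier W" using WK_c j w by auto
    show "w \<otimes> a0 \<otimes> h \<noteq> h \<otimes> word_prod W v"
    proof
      assume e: "w \<otimes> a0 \<otimes> h = h \<otimes> word_prod W v"
      have "word_prod W v = inv h \<otimes> (h \<otimes> word_prod W v)" using h v by (simp add: cancel_inv)
      also have "\<dots> = inv h \<otimes> (inv j \<otimes> ?a \<otimes> j \<otimes> h)" by (simp only: e[symmetric] j(2))
      also have "\<dots> = inv (j \<otimes> h) \<otimes> ?a \<otimes> inv (inv (j \<otimes> h))"
        using h jc uc by (simp add: inv_mult_group m_assoc)
      finally show False using v(2) h jc unfolding cls_def by blast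
    qed
  qed
  have p: "ev1 (D.tr a) > 0"
    using D.ev1_tr_pos[OF a(1) f(2) u _ a(2)] f(3)[OF u] tconj_refl[OF u] by simp
  \<comment> \<open>The common value on the class is never computed. At q = 1 the trace depends only
    on the product of the word, and rotating a spelling of
    \<open>x \<otimes> u \<otimes> a0 \<otimes> inv x\<close> shows that conjugates have equal
    values.\<close>
  have c: "ev1 (D.tr v) = ev1 (D.tr a)" if v: "v \<in> lists S" "word_prod W v \<in> cls ?a" for v
  proof -
    obtain x where x: "x \<in> carrier W" "word_prod W v = x \<otimes> ?a \<otimes> inv x" using v(2) by (auto simp: cls_def)
    obtain r where r: "r \<in> lists S" "word_prod W r = x" using ex_word[OF x(1)] by blast
    have rr: "rev r \<in> lists S" "word_prod W (rev r) = inv x" using r word_prod_rev by (auto simp: rev_lists)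
    have L: "r @ a @ rev r \<in> lists S" "a @ rev r \<in> lists S" "a @ rev r @ r \<in> lists S" using r rr a by auto
    have "ev1 (D.tr v) = ev1 (D.tr (r @ (a @ rev r)))"
      using D.ev1_tr_cong[OF v(1) L(1)] x r rr a uc by (simp add: word_prod_append m_assoc)
    also have "\<dots> = ev1 (D.tr ((a @ rev r) @ r))" using D.tr_rotate[OF r(1) L(2)] by simp
    also have "\<dots> = ev1 (D.tr a)"
      using D.ev1_tr_cong[OF L(3) a(1)] x r rr a uc by (simp add: word_prod_append)
    finally show ?thesis .
  qed
  have "class_trace (cls ?a) D.tr"
    unfolding class_trace_def
  proof (intro conjI ballI impI exI[of _ "ev1 (D.tr a)"])
    fix v assume "v \<in> lists S"
    then show "ev1 (D.tr v) = (if word_prod W v \<in> cls ?a then ev1 (D.tr a) else 0)" using z c by simp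
  qed (fact p | rule D.tr_rotate D.tr_quadratic D.tr_braid; assumption)+
  then show ?thesis by blast
qed

end

context coxeter_gcm
begin

section \<open>Periodic roots and imaginary vectors\<close>

text \<open>A vector whose whole orbit is nonnegative: the property that positive imaginary roots of
  a Kac-Moody algebra have and real roots lack.\<close>

definition imag :: "('w \<Rightarrow> int) \<Rightarrow> bool" where
  "imag v \<longleftrightarrow> v \<noteq> 0 \<and> (\<forall>x. x \<notin> S \<longrightarrow> v x = 0) \<and> (\<forall>w\<in>carrier W. nonneg (act w v))"

lemma act_outside: "w \<in> carrier W \<Longrightarrow> x \<notin> S \<Longrightarrow> act w v x = v x"
  using act_gen_outside[OF subset_refl, of w x v] cox by (simp add: coxeter_system_def)

lemma inf_avoid:
  fixes X :: "nat \<Rightarrow> 'w \<Rightarrow> int"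
  assumes "inj X" "infinite K" "finite F"
  shows "infinite {k \<in> K. X k \<notin> F}"
proof -
  have "finite (X -` F)" using finite_vimageI[OF assms(3,1)] .
  then have "infinite (K - X -` F)" using assms(2) by simp
  moreover have "{k \<in> K. X k \<notin> F} = K - X -` F" by auto
  ultimately show ?thesis by simp
qed

text \<open>A fixed \<open>w\<close> changes the sign of finitely many roots only. So some pair
  \<open>X k\<close>, \<open>Y k\<close> of equal sign keeps it, and the sum of its images is a
  multiple of \<open>act w v\<close> with a multiplier of known sign.\<close>

lemma imag_one_sided:
  assumes X: "inj X" "\<And>k::nat. X k \<in> roots" and Y: "inj Y" "\<And>k::nat. Y k \<in> roots"
    and v: "v \<noteq> 0" and m: "\<And>k. m k \<cdot> v = X k + Y k"
    and inf: "infinite {k. pos (X k) = pos (Y k) \<and> pos (X k) = (m k > (0::int)) \<and> m k \<noteq> 0}"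
  shows "imag v"
  unfolding imag_def
proof (intro conjI v ballI allI impI)
  fix x assume x: "x \<notin> S"
  obtain k where k: "m k \<noteq> 0" using infinite_imp_nonempty[OF inf] by blast
  have "m k * v x = X k x + Y k x" using fun_cong[OF m[of k], of x] by (simp add: pw_simps)
  then show "v x = 0" using k root_support[OF X(2) x] root_support[OF Y(2) x] by simp
next
  fix w assume w: "w \<in> carrier W"
  let ?F = "Inv w \<union> uminus ` Inv w"
  have fin: "finite ?F" using finite_Inv[OF w] by simp
  let ?I = "{k. pos (X k) = pos (Y k) \<and> pos (X k) = (m k > 0) \<and> m k \<noteq> 0}"
  have "infinite {k \<in> {k \<in> ?I. X k \<notin> ?F}. Y k \<notin> ?F}"
    by (intro inf_avoid[OF Y(1)] inf_avoid[OF X(1)] inf fin)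
  then have "{k \<in> {k \<in> ?I. X k \<notin> ?F}. Y k \<notin> ?F} \<noteq> {}" by (rule infinite_imp_nonempty)
  then obtain k where k: "pos (X k) = pos (Y k)" "pos (X k) = (m k > 0)" "m k \<noteq> 0" "X k \<notin> ?F" "Y k \<notin> ?F"
    by blast
  have neg: "- z \<notin> Inv w" if "z \<notin> ?F" for z
  proof
    assume "- z \<in> Inv w"
    then have "- (- z) \<in> uminus ` Inv w" by (rule imageI)
    then show False using that by simp
  qed
  have nX: "- X k \<notin> Inv w" "- Y k \<notin> Inv w" using k(4,5) neg by blast+
  have s: "pos (act w (X k)) = pos (X k)" "pos (act w (Y k)) = pos (Y k)"
    using pos_act_iff[OF X(2) _ nX(1) w] pos_act_iff[OF Y(2) _ nX(2) w] k by auto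
  have e: "m k \<cdot> act w v = act w (X k) + act w (Y k)"
    unfolding act_smul[OF w, symmetric] m act_add[OF w] ..
  show "nonneg (act w v)"
    unfolding nonneg_def
  proof
    fix x
    have ex: "m k * act w v x = act w (X k) x + act w (Y k) x"
      using fun_cong[OF e, of x] by (simp add: pw_simps)
    show "act w v x \<ge> 0"
    proof (cases "m k > 0")
      case True
      then have "act w (X k) x \<ge> 0" "act w (Y k) x \<ge> 0" using s k root_pos_nonneg by auto
      then show ?thesis using ex True by (smt (verit) mult_pos_neg)
    next
      case False
      then have "pos (- act w (X k))" "pos (- act w (Y k))"
        using s k(1,2) False root_sign[OF roots_act[OF w X(2)], of k] root_sign[OF roots_act[OF w Y(2)], of k] by auto
      then have "(- act w (X k)) x \<ge> 0" "(- act w (Y k)) x \<ge> 0" by (auto intro: root_pos_nonneg)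
      then have "m k * act w v x \<le> 0" using ex by (simp add: pw_simps)
      then show ?thesis using False k(3) by (simp add: mult_le_0_iff)
    qed
  qed
qed

lemma imag_seq:
  assumes X: "inj X" "\<And>k::nat. X k \<in> roots" and Y: "inj Y" "\<And>k::nat. Y k \<in> roots"
    and v: "v \<noteq> 0" and m: "\<And>k. m k \<cdot> v = X k + Y k" "\<And>k. m k \<noteq> 0"
    and s: "finite {k. pos (X k) \<noteq> pos (Y k)}"
  shows "imag v \<or> imag (- v)"
proof -
  let ?A = "{k. pos (X k) = pos (Y k) \<and> pos (X k) = (m k > 0) \<and> m k \<noteq> 0}"
  let ?B = "{k. pos (X k) = pos (Y k) \<and> pos (X k) = (- m k > 0) \<and> - m k \<noteq> 0}"
  have "k \<in> {k. pos (X k) \<noteq> pos (Y k)} \<union> (?A \<union> ?B)" for k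
    using m(2)[of k] by (cases "pos (X k)"; cases "pos (Y k)"; cases "m k > 0") simp_all
  then have U: "UNIV = {k. pos (X k) \<noteq> pos (Y k)} \<union> (?A \<union> ?B)" by (rule UNIV_eq_I)
  have "infinite ?A \<or> infinite ?B"
  proof (rule ccontr)
    assume "\<not> ?thesis"
    then have "finite ({k. pos (X k) \<noteq> pos (Y k)} \<union> (?A \<union> ?B))" using s by (intro finite_UnI) simp_all
    then show False unfolding U[symmetric] by simp
  qed
  then show ?thesis
  proof
    assume A: "infinite ?A"
    have "imag v" by (rule imag_one_sided[where X = X and Y = Y and m = m]) (fact X Y v m A)+
    then show ?thesis ..
  next
    have m': "- m k \<cdot> - v = X k + Y k" for k using m(1)[of k] by (auto simp: pw)
    have v': "- v \<noteq> 0" using v by simp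
    assume B: "infinite ?B"
    have "imag (- v)" by (rule imag_one_sided[where X = X and Y = Y and m = "\<lambda>k. - m k"]) (fact X Y v' m' B)+
    then show ?thesis ..
  qed
qed

section \<open>Pairs of roots and their strings\<close>

lemma root_not_double: "\<beta> \<in> roots \<Longrightarrow> \<gamma> \<in> roots \<Longrightarrow> \<beta> \<noteq> (2 * c) \<cdot> \<gamma>"
proof
  assume b: "\<beta> \<in> roots" and g: "\<gamma> \<in> roots" and e: "\<beta> = (2 * c) \<cdot> \<gamma>"
  obtain w s where w: "w \<in> carrier W" "s \<in> S" "\<beta> = act w (sr s)" using b unfolding roots_def by blast
  have "sr s = act (inv w) \<beta>" using w by simp
  also have "\<dots> = (2 * c) \<cdot> act (inv w) \<gamma>" unfolding e using w by (intro act_smul) auto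
  finally have "sr s s = ((2 * c) \<cdot> act (inv w) \<gamma>) s" by (rule fun_cong)
  then have "1 = 2 * (c * act (inv w) \<gamma> s)" by (simp add: pw_simps)
  then show False by presburger
qed

text \<open>In place of an invariant form, the group gives the symmetry: if one reflection fixes the
  root of the other, the two reflections commute.\<close>

lemma npair_zero_sym:
  assumes b: "\<beta> \<in> roots" and g: "\<gamma> \<in> roots" and z: "npair \<beta> \<gamma> = 0"
  shows "npair \<gamma> \<beta> = 0"
proof -
  let ?rb = "rfl \<beta>" and ?rg = "rfl \<gamma>"
  have c: "?rb \<in> carrier W" "?rg \<in> carrier W" using b g by auto
  have "act ?rg \<beta> = \<beta>" using act_rfl[OF g] z by simp
  then have "?rb = ?rg \<otimes> ?rb \<otimes> inv ?rg" using rfl_act(1)[OF c(2) b] by simp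
  then have comm: "?rb \<otimes> ?rg = ?rg \<otimes> ?rb" using c by (metis inv_solve_right m_closed)
  let ?n = "npair \<gamma> \<beta>"
  have "act ?rg (act ?rb \<gamma>) = - act ?rb \<gamma>"
    using comm c g by (metis act_mult act_rfl_self act_uminus)
  moreover have "act ?rb \<gamma> = \<gamma> - ?n \<cdot> \<beta>" by (rule act_rfl[OF b])
  moreover have "act ?rg (\<gamma> - ?n \<cdot> \<beta>) = - \<gamma> - ?n \<cdot> \<beta>"
    using c g \<open>act ?rg \<beta> = \<beta>\<close> by (simp add: act_diff act_smul act_rfl_self)
  ultimately have "- \<gamma> - ?n \<cdot> \<beta> = - (\<gamma> - ?n \<cdot> \<beta>)" by simp
  then have "\<forall>x. ?n * \<beta> x = 0" by (auto simp: pw)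
  then show ?thesis using root_nonzero[OF b] by (auto simp: pw)
qed

lemma npair_le_product:
  assumes "\<beta> \<in> roots" "\<gamma> \<in> roots" "0 \<le> npair \<beta> \<gamma> * npair \<gamma> \<beta>"
  shows "\<bar>npair \<beta> \<gamma>\<bar> \<le> npair \<beta> \<gamma> * npair \<gamma> \<beta>"
proof (cases "npair \<beta> \<gamma> = 0")
  case False
  then have "\<bar>npair \<gamma> \<beta>\<bar> \<ge> 1" using npair_zero_sym[OF assms(2,1)] by linarith
  then have "\<bar>npair \<beta> \<gamma>\<bar> * 1 \<le> \<bar>npair \<beta> \<gamma>\<bar> * \<bar>npair \<gamma> \<beta>\<bar>" by (intro mult_left_mono) auto
  then show ?thesis using assms(3) by (simp add: abs_mult[symmetric])
qed simp

text \<open>Root strings of a dihedral pair: \<open>p \<gamma> + q \<beta>\<close> is the \<open>k\<close>-th image of \<open>\<gamma>\<close> under \<open>rfl \<gamma> \<otimes> rfl \<beta>\<close>.\<close>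

primrec pqs :: "int \<Rightarrow> int \<Rightarrow> nat \<Rightarrow> int \<times> int" where
  "pqs m n 0 = (1, 0)"
| "pqs m n (Suc k) = (case pqs m n k of (p, q) \<Rightarrow> ((m * n - 1) * p + m * q, - n * p - q))"

text \<open>The second coordinates satisfy a linear recurrence whose leading coefficient
  \<open>m * n - 2\<close> has absolute value at least 2 in either case.\<close>

lemma pqs_growth:
  assumes "m * n < 0 \<or> m * n \<ge> 4"
  shows "\<bar>snd (pqs m n k)\<bar> < \<bar>snd (pqs m n (Suc k))\<bar>"
proof (induction k)
  case 0
  have "n \<noteq> 0" using assms by auto
  then show ?case by simp
next
  case (Suc k)
  obtain p q where pq: "pqs m n k = (p, q)" by fastforce
  define q1 where "q1 = - n * p - q"
  define q2 where "q2 = - n * ((m * n - 1) * p + m * q) - q1"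
  have e: "q2 = (m * n - 2) * q1 - q" by (simp add: q1_def q2_def algebra_simps)
  have "\<bar>m * n - 2\<bar> \<ge> 2" using assms by linarith
  then have "\<bar>(m * n - 2) * q1\<bar> \<ge> 2 * \<bar>q1\<bar>" unfolding abs_mult by (intro mult_right_mono) auto
  moreover have "\<bar>q\<bar> < \<bar>q1\<bar>" using Suc pq by (simp add: q1_def)
  ultimately have "\<bar>q1\<bar> < \<bar>q2\<bar>" unfolding e by linarith
  then show ?case using pq by (simp add: q1_def q2_def)
qed

text \<open>The images X of \<gamma> under powers of
  \<open>rfl \<gamma> \<otimes> rfl \<beta>\<close> and their mirror images Y under
  \<open>rfl \<gamma>\<close> add up to multiples of one vector, with multipliers growing in
  absolute value. The signs of X and Y differ only if X or its negative lies in the finite inversion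
  set of \<open>rfl \<gamma>\<close>.\<close>

lemma imaginary_pair:
  assumes b: "\<beta> \<in> roots" and g: "\<gamma> \<in> roots" and ne: "\<beta> \<noteq> \<gamma>" "\<beta> \<noteq> - \<gamma>"
    and mn: "npair \<beta> \<gamma> * npair \<gamma> \<beta> < 0 \<or> npair \<beta> \<gamma> * npair \<gamma> \<beta> \<ge> 4"
  shows "imag (2 \<cdot> \<beta> - npair \<beta> \<gamma> \<cdot> \<gamma>) \<or> imag (- (2 \<cdot> \<beta> - npair \<beta> \<gamma> \<cdot> \<gamma>))"
proof -
  define m where "m = npair \<beta> \<gamma>"
  define n where "n = npair \<gamma> \<beta>"
  have mn': "m * n < 0 \<or> m * n \<ge> 4" using mn by (simp add: m_def n_def)
  let ?c = "rfl \<gamma> \<otimes> rfl \<beta>"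
  have c: "rfl \<gamma> \<in> carrier W" "rfl \<beta> \<in> carrier W" "?c \<in> carrier W" using b g by auto
  define v where "v = 2 \<cdot> \<beta> - m \<cdot> \<gamma>"
  define p where "p k = fst (pqs m n k)" for k
  define q where "q k = snd (pqs m n k)" for k
  define X where "X k = act (?c [^] k) \<gamma>" for k :: nat
  define Y where "Y k = act (rfl \<gamma>) (X k)" for k :: nat
  have np: "npair \<gamma> \<gamma> = 2" "npair \<beta> \<beta> = 2" using npair_self b g by auto
  have cp: "act ?c (x \<cdot> \<gamma> + y \<cdot> \<beta>) = ((m * n - 1) * x + m * y) \<cdot> \<gamma> + (- n * x - y) \<cdot> \<beta>" for x y
    using b g np by (simp add: act_mult[OF c(1,2)] act_rfl npair_lin m_def[symmetric] n_def[symmetric])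
      (auto simp: pw algebra_simps)
  have Xpq: "X k = p k \<cdot> \<gamma> + q k \<cdot> \<beta>" for k
  proof (induction k)
    case 0 then show ?case by (auto simp: X_def p_def q_def pw)
  next
    case (Suc k)
    have "X (Suc k) = act ?c (X k)" unfolding X_def by (rule act_pow_Suc(2)[OF c(3)])
    then show ?case unfolding Suc cp by (simp add: p_def q_def split: prod.splits)
  qed
  have XY: "q k \<cdot> v = X k + Y k" for k
    unfolding Y_def Xpq using g np by (simp add: act_rfl npair_lin m_def[symmetric] v_def) (auto simp: pw algebra_simps)
  \<comment> \<open>Proportional roots would give m n = 4. Among the divisors of 4, m = 2 and m = -2
    mean equal or opposite roots, and the others make one root an even multiple of the
    other.\<close>
  have v0: "v \<noteq> 0"
  proof
    assume "v = 0"
    then have e: "2 \<cdot> \<beta> = m \<cdot> \<gamma>" by (simp add: v_def)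
    have "npair (2 \<cdot> \<beta>) \<beta> = npair (m \<cdot> \<gamma>) \<beta>" using e by simp
    then have "m * n = 4" using npair_lin[OF b] np by (simp add: n_def)
    then have "m dvd 4" by (metis dvd_triv_left)
    then have "\<bar>m\<bar> \<le> 4" "m \<noteq> 0" using dvd_imp_le_int[of 4 m] by auto
    then have "m \<in> {1,2,3,4,-1,-2,-3,-4}" by auto
    moreover have "m \<noteq> 3" "m \<noteq> -3" using \<open>m dvd 4\<close> by auto
    moreover have "m \<noteq> 2" "m \<noteq> -2" using e ne by (auto simp: pw)
    moreover have "m \<noteq> 4" using e root_not_double[OF b g, of 1] by (auto simp: pw)
    moreover have "m \<noteq> -4" using e root_not_double[OF b g, of "-1"] by (auto simp: pw)
    moreover have "m \<noteq> 1" using e root_not_double[OF g b, of 1] by (auto simp: pw)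
    moreover have "m \<noteq> -1" using e root_not_double[OF g b, of "-1"] by (auto simp: pw)
    ultimately show False by auto
  qed
  have gr: "\<bar>q k\<bar> < \<bar>q (Suc k)\<bar>" for k unfolding q_def by (rule pqs_growth[OF mn'])
  then have "strict_mono (\<lambda>k. \<bar>q k\<bar>)" by (simp add: strict_mono_Suc_iff)
  then have qi: "q i = q j \<Longrightarrow> i = j" for i j by (metis strict_mono_eq)
  have iX: "inj X"
  proof (rule injI)
    fix i j assume "X i = X j"
    then have "q i \<cdot> v = q j \<cdot> v" unfolding XY Y_def by simp
    then show "i = j" using smul_eq_iff[OF v0] qi by blast
  qed
  have iY: "inj Y" unfolding Y_def using iX c(1) by (auto simp: inj_def)
  have rX: "X k \<in> roots" "Y k \<in> roots" for k unfolding X_def Y_def using c g by (auto intro!: roots_act)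
  let ?F = "Inv (rfl \<gamma>) \<union> uminus ` Inv (rfl \<gamma>)"
  have "{k. pos (X k) \<noteq> pos (Y k)} \<subseteq> X -` ?F"
  proof
    fix k assume k: "k \<in> {k. pos (X k) \<noteq> pos (Y k)}"
    show "k \<in> X -` ?F"
    proof (rule ccontr)
      assume "k \<notin> X -` ?F"
      then have "X k \<notin> Inv (rfl \<gamma>)" "- X k \<notin> Inv (rfl \<gamma>)" by (auto, metis image_eqI minus_minus)
      then show False using pos_act_iff[OF rX(1) _ _ c(1)] k by (auto simp: Y_def)
    qed
  qed
  moreover have "finite (X -` ?F)" using finite_Inv[OF c(1)] iX by (intro finite_vimageI) auto
  ultimately have fs: "finite {k. pos (X k) \<noteq> pos (Y k)}" by (rule finite_subset)
  have q0: "q (Suc k) \<noteq> 0" for k using gr[of k] by auto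
  have "imag v \<or> imag (- v)"
  proof (rule imag_seq[of "X \<circ> Suc" "Y \<circ> Suc" v "q \<circ> Suc"])
    show "inj (X \<circ> Suc)" "inj (Y \<circ> Suc)" using iX iY by (auto intro: inj_compose)
    have "{k. pos ((X \<circ> Suc) k) \<noteq> pos ((Y \<circ> Suc) k)} = Suc -` {k. pos (X k) \<noteq> pos (Y k)}" by auto
    then show "finite {k. pos ((X \<circ> Suc) k) \<noteq> pos ((Y \<circ> Suc) k)}"
      by (metis finite_vimageI[OF fs] inj_Suc)
  qed (use rX XY v0 q0 in auto)
  then show ?thesis by (simp add: v_def m_def)
qed

section \<open>Infinitely many periodic roots and the stabiliser of an imaginary vector\<close>

definition lin :: "(('w \<Rightarrow> int) \<Rightarrow> int) \<Rightarrow> bool" where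
  "lin L \<longleftrightarrow> (\<forall>u v. L (u + v) = L u + L v) \<and> (\<forall>c v. L (c \<cdot> v) = c * L v)"

text \<open>Gaussian elimination without division: a pivot \<open>x0\<close> is cleared from the
  other vectors by cross multiplication. The finite subset replaces a basis in that it detects the
  vanishing of linear functions on X.\<close>

lemma finite_basis:
  assumes "finite B" "\<And>x a. x \<in> X \<Longrightarrow> a \<notin> B \<Longrightarrow> x a = 0"
  shows "\<exists>F\<subseteq>X. finite F \<and> (\<forall>L. lin L \<longrightarrow> (\<forall>f\<in>F. L f = 0) \<longrightarrow> (\<forall>x\<in>X. L x = 0))"
  using assms
proof (induction B arbitrary: X rule: finite_induct)
  case empty
  then have "x = 0 \<cdot> x" if "x \<in> X" for x using that by (auto simp: pw)
  then have "L x = 0" if "lin L" "x \<in> X" for L x using that by (metis lin_def mult_zero_left)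
  then show ?case by (intro exI[of _ "{}"]) auto
next
  case (insert s B)
  show ?case
  proof (cases "\<forall>x\<in>X. x s = 0")
    case True
    then show ?thesis using insert.prems(1) by (intro insert.IH) (metis insert_iff)
  next
    case False
    then obtain x0 where x0: "x0 \<in> X" "x0 s \<noteq> 0" by blast
    let ?h = "\<lambda>x. x0 s \<cdot> x - x s \<cdot> x0"
    have supp: "y a = 0" if ya: "y \<in> ?h ` X" "a \<notin> B" for y a
    proof -
      obtain x where x: "x \<in> X" "y = ?h x" using ya(1) by blast
      have "a \<noteq> s \<Longrightarrow> x a = 0 \<and> x0 a = 0" using insert.prems(1) x(1) x0(1) ya(2) by blast
      then show ?thesis unfolding x(2) by (cases "a = s") (simp_all add: pw_simps)
    qed
    obtain F' where F': "F' \<subseteq> ?h ` X" "finite F'" "\<And>L. lin L \<Longrightarrow> \<forall>f\<in>F'. L f = 0 \<Longrightarrow> \<forall>x\<in>?h ` X. L x = 0"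
    proof -
      have "\<exists>F\<subseteq>?h ` X. finite F \<and> (\<forall>L. lin L \<longrightarrow> (\<forall>f\<in>F. L f = 0) \<longrightarrow> (\<forall>x\<in>?h ` X. L x = 0))"
        by (rule insert.IH) (fact supp)
      then show ?thesis using that by blast
    qed
    obtain F'' where F'': "F'' \<subseteq> X" "finite F''" "F' = ?h ` F''"
      using finite_subset_image[OF F'(2,1)] by blast
    show ?thesis
    proof (intro exI[of _ "insert x0 F''"] conjI allI impI ballI)
      fix L x assume L: "lin L" "\<forall>f\<in>insert x0 F''. L f = 0" and x: "x \<in> X"
      have hL: "L (?h y) = x0 s * L y - y s * L x0" for y
      proof -
        have e: "x0 s \<cdot> y - y s \<cdot> x0 = x0 s \<cdot> y + (- y s) \<cdot> x0" by (auto simp: pw)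
        have "L (x0 s \<cdot> y + (- y s) \<cdot> x0) = L (x0 s \<cdot> y) + L ((- y s) \<cdot> x0)"
          "L (x0 s \<cdot> y) = x0 s * L y" "L ((- y s) \<cdot> x0) = (- y s) * L x0"
          using L(1) unfolding lin_def by blast+
        then show ?thesis unfolding e by linarith
      qed
      have "\<forall>f\<in>F'. L f = 0" unfolding F''(3) using L(2) by (auto simp: hL)
      then have "L (?h x) = 0" using F'(3)[OF L(1)] x by blast
      then show "L x = 0" using L(2) x0 by (simp add: hL)
    qed (use F'' x0 in auto)
  qed
qed

definition Per :: "'w \<Rightarrow> ('w \<Rightarrow> int) set" where
  "Per a = {\<beta> \<in> roots. finite (range (\<lambda>n::nat. act (a [^] n) \<beta>))}"

lemma PerE:
  assumes "a \<in> carrier W" "\<beta> \<in> Per a"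
  obtains d :: nat where "d > 0" "act (a [^] d) \<beta> = \<beta>"
proof -
  have "\<not> inj (\<lambda>n::nat. act (a [^] n) \<beta>)" using assms(2) by (auto simp: Per_def dest: range_inj_infinite)
  then obtain m n :: nat where "act (a [^] m) \<beta> = act (a [^] n) \<beta>" "m < n"
    by (metis (mono_tags, lifting) injI nat_neq_iff)
  then have "act (a [^] m) (act (a [^] (n - m)) \<beta>) = act (a [^] m) \<beta>"
    using act_pow_add[OF assms(1), of m "n - m" \<beta>] by simp
  then have "act (a [^] (n - m)) \<beta> = \<beta>" using assms by simp
  then show ?thesis using that[of "n - m"] \<open>m < n\<close> by simp
qed

lemma PerI: "a \<in> carrier W \<Longrightarrow> \<beta> \<in> roots \<Longrightarrow> d > 0 \<Longrightarrow> act (a [^] (d::nat)) \<beta> = \<beta> \<Longrightarrow> \<beta> \<in> Per a"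
  using pow_periodic_finite by (auto simp: Per_def)

lemma act_pow_multiple: "a \<in> carrier W \<Longrightarrow> act (a [^] (d::nat)) v = v \<Longrightarrow> act (a [^] (d * k)) v = v"
  using act_pow_fix[of "a [^] d" v k] by (simp add: nat_pow_pow)

text \<open>Sum over one period. All terms are nonnegative and \<open>v\<close> is among them, so
  nothing cancels.\<close>

lemma imag_sum_fixed:
  assumes a: "a \<in> carrier W" and v: "imag v" and N: "(N::nat) > 0" "act (a [^] N) v = v"
  shows "\<exists>\<delta>. imag \<delta> \<and> act a \<delta> = \<delta>"
proof -
  let ?d = "\<Sum>i<N. act (a [^] i) v"
  have c: "imag (act (a [^] i) v)" for i :: nat
    using v a act_eq_iff[of "a [^] i" v 0] by (auto simp: imag_def act_mult[symmetric] act_outside)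
  have nn: "act (a [^] i) v x \<ge> 0" for i :: nat and x
    using v a by (auto simp: imag_def nonneg_def)
  have "act a ?d = (\<Sum>i<N. act (a [^] Suc i) v)"
    unfolding act_sum[OF a] by (simp only: act_pow_Suc(2)[OF a])
  moreover have "(\<Sum>i<N. act (a [^] Suc i) v) + v = ?d + v"
    using sum.lessThan_Suc_shift[of "\<lambda>i. act (a [^] i) v" N] N(2) by (simp add: add.commute)
  ultimately have fixd: "act a ?d = ?d" by simp
  have "nonneg (act w ?d)" if w: "w \<in> carrier W" for w
    using c w unfolding act_sum[OF w] by (auto simp: imag_def nonneg_def sum_fun_apply intro!: sum_nonneg)
  moreover have "?d x = 0" if "x \<notin> S" for x using c that unfolding sum_fun_apply by (auto simp: imag_def)
  moreover have "?d \<noteq> 0"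
  proof
    assume "?d = 0"
    obtain x where x: "v x \<noteq> 0" using v by (auto simp: imag_def pw)
    have "(\<Sum>i<N. act (a [^] i) v x) = 0" using fun_cong[OF \<open>?d = 0\<close>, of x] by (simp add: sum_fun_apply pw_simps)
    then have "\<forall>i\<in>{..<N}. act (a [^] i) v x = 0" using nn by (subst (asm) sum_nonneg_eq_0_iff) auto
    then have "act (a [^] (0::nat)) v x = 0" using N(1) by blast
    then show False using x by simp
  qed
  ultimately show ?thesis using fixd by (auto simp: imag_def)
qed

text \<open>If no two periodic roots formed an imaginary pair, their pairings would be bounded by 3,
  and a periodic root would be determined by the values of its coroot on a finite set: two distinct
  roots with the same values have both pairings equal to 2, hence product 4. So infinitely many
  periodic roots contain an imaginary pair, and its vector is periodic as well.\<close>

theorem infinite_Per: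
  assumes a: "a \<in> carrier W" and inf: "infinite (Per a)"
  shows "\<exists>\<delta>. imag \<delta> \<and> act a \<delta> = \<delta>"
proof -
  have PR: "\<beta> \<in> roots" if "\<beta> \<in> Per a" for \<beta> using that by (simp add: Per_def)
  have "\<exists>\<beta>\<in>Per a. \<exists>\<gamma>\<in>Per a. \<beta> \<noteq> \<gamma> \<and> \<beta> \<noteq> - \<gamma> \<and> (npair \<beta> \<gamma> * npair \<gamma> \<beta> < 0 \<or> npair \<beta> \<gamma> * npair \<gamma> \<beta> \<ge> 4)"
  proof (rule ccontr)
    assume H: "\<not> ?thesis"
    have bd: "npair \<beta> \<gamma> \<in> {-3..3}" if bg: "\<beta> \<in> Per a" "\<gamma> \<in> Per a" for \<beta> \<gamma>
    proof (cases "\<beta> = \<gamma> \<or> \<beta> = - \<gamma>")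
      case True
      then show ?thesis using PR bg npair_self npair_lin(4) by auto
    next
      case False
      have r: "0 \<le> npair \<beta> \<gamma> * npair \<gamma> \<beta>" "npair \<beta> \<gamma> * npair \<gamma> \<beta> < 4" using H bg False by force+
      have "\<bar>npair \<beta> \<gamma>\<bar> \<le> 3" using npair_le_product[OF PR PR r(1), OF bg] r(2) by linarith
      then show ?thesis by auto
    qed
    obtain F where F: "F \<subseteq> Per a" "finite F" "\<And>L. lin L \<Longrightarrow> \<forall>f\<in>F. L f = 0 \<Longrightarrow> \<forall>x\<in>Per a. L x = 0"
      using finite_basis[OF fin, of "Per a"] root_support PR by metis
    let ?e = "\<lambda>\<beta>. restrict (\<lambda>f. npair f \<beta>) F"
    have "?e ` Per a \<subseteq> F \<rightarrow>\<^sub>E {-3..3}" using bd F(1) by fastforce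
    moreover have "finite (F \<rightarrow>\<^sub>E {-3..3::int})" using F(2) by (intro finite_PiE) auto
    ultimately have "finite (?e ` Per a)" by (rule finite_subset)
    then have "\<not> inj_on ?e (Per a)" using inf finite_imageD by blast
    then obtain \<beta> \<gamma> where bg: "\<beta> \<in> Per a" "\<gamma> \<in> Per a" "?e \<beta> = ?e \<gamma>" "\<beta> \<noteq> \<gamma>" by (auto simp: inj_on_def)
    let ?L = "\<lambda>v. npair v \<beta> - npair v \<gamma>"
    have "lin ?L" using npair_lin PR bg(1,2) by (simp add: lin_def algebra_simps)
    moreover have "\<forall>f\<in>F. ?L f = 0" using fun_cong[OF bg(3)] by (metis diff_self restrict_apply')
    ultimately have "?L \<beta> = 0" "?L \<gamma> = 0" using F(3) bg by blast+
    then have e: "npair \<beta> \<gamma> = 2" "npair \<gamma> \<beta> = 2" using npair_self PR bg by auto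
    have "\<beta> \<noteq> - \<gamma>" using e npair_lin(4)[OF PR[OF bg(2)], of \<gamma>] npair_self[OF PR[OF bg(2)]] by auto
    then show False using H bg e by force
  qed
  then obtain \<beta> \<gamma> where bg: "\<beta> \<in> Per a" "\<gamma> \<in> Per a" and i: "\<beta> \<noteq> \<gamma>" "\<beta> \<noteq> - \<gamma>"
    "npair \<beta> \<gamma> * npair \<gamma> \<beta> < 0 \<or> npair \<beta> \<gamma> * npair \<gamma> \<beta> \<ge> 4" by blast
  let ?v = "2 \<cdot> \<beta> - npair \<beta> \<gamma> \<cdot> \<gamma>"
  obtain v where v: "imag v" "v = ?v \<or> v = - ?v"
    using imaginary_pair[OF PR[OF bg(1)] PR[OF bg(2)] i] by blast
  obtain d :: nat where d: "d > 0" "act (a [^] d) \<beta> = \<beta>" using PerE[OF a bg(1)] .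
  obtain d' :: nat where d': "d' > 0" "act (a [^] d') \<gamma> = \<gamma>" using PerE[OF a bg(2)] .
  have "act (a [^] (d * d')) \<beta> = \<beta>" "act (a [^] (d' * d)) \<gamma> = \<gamma>"
    using act_pow_multiple[OF a] d d' by auto
  then have "act (a [^] (d * d')) v = v"
    using v(2) a by (auto simp: act_diff act_smul act_uminus mult.commute)
  then show ?thesis using imag_sum_fixed[OF a v(1), of "d * d'"] d d' by simp
qed

text \<open>Along a reduced word each letter adds a nonnegative multiple of a positive root. So
  \<open>v\<close> is the lowest point of its orbit, and it is reached again only through letters
  whose coroot vanishes on it.\<close>

lemma antidominant_stabilizer:
  assumes v: "\<And>s. s \<in> S \<Longrightarrow> coroot s v \<le> 0" and x: "x \<in> carrier W"
  shows "nonneg (act x v - v) \<and> (act x v = v \<longrightarrow> x \<in> generate W {s \<in> S. coroot s v = 0})"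
proof -
  have "x \<in> generate W S" using x cox by (simp add: coxeter_system_def)
  with subset_refl show ?thesis
  proof (induction rule: gen_induct)
    case one then show ?case by (simp add: nonneg_def pw_simps gen_one)
  next
    case (mult w k)
    have C: "w \<in> carrier W" "k \<in> carrier W" using gen_sub[OF subset_refl mult(1)] S_carrier mult by auto
    have p: "pos (act w (sr k))" using pos_iff_len[OF C(1) mult(2)] mult(3) by simp
    have e: "act (w \<otimes> k) v = act w v - coroot k v \<cdot> act w (sr k)"
      using C mult(2) by (simp add: act_mult act_S rf_def act_diff act_smul)
    have t: "0 \<le> - (coroot k v * act w (sr k) x)" for x
      using v[OF mult(2)] root_pos_nonneg[OF p, of x] by (simp add: mult_le_0_iff)
    have n: "0 \<le> act w v x - v x" for x using mult(4) by (simp add: nonneg_def pw_simps)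
    have "nonneg (act (w \<otimes> k) v - v)" unfolding e nonneg_def
    proof
      fix x show "0 \<le> (act w v - coroot k v \<cdot> act w (sr k) - v) x" using t[of x] n[of x] by (simp add: pw_simps)
    qed
    moreover have "w \<otimes> k \<in> generate W {s \<in> S. coroot s v = 0}" if f: "act (w \<otimes> k) v = v"
    proof -
      have z: "act w v x - v x = 0 \<and> coroot k v * act w (sr k) x = 0" for x
      proof -
        have "act w v x - coroot k v * act w (sr k) x = v x"
          using fun_cong[OF f[unfolded e], of x] by (simp add: pw_simps)
        then show ?thesis using t[of x] n[of x] by (intro conjI; linarith)
      qed
      then have "act w v = v" by (auto simp: pw)
      moreover have "coroot k v = 0" using z root_nonzero[OF root_hs[OF C(1) mult(2)]] by (auto simp: pw)
      ultimately show ?thesis using mult by (auto intro: gen_mult gen_S)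
    qed
    ultimately show ?case by blast
  qed
qed

text \<open>Heights on the orbit are nonnegative, so one of them is least; a positive coroot value
  at that point would allow a further descent.\<close>

lemma imag_antidominant_conj:
  assumes d: "imag \<delta>"
  obtains x where "x \<in> carrier W" "\<And>s. s \<in> S \<Longrightarrow> coroot s (act x \<delta>) \<le> 0"
proof -
  define x where "x = (ARG_MIN (\<lambda>x. nat (ht (act x \<delta>))) x. x \<in> carrier W)"
  have x: "x \<in> carrier W" "\<And>y. y \<in> carrier W \<Longrightarrow> nat (ht (act x \<delta>)) \<le> nat (ht (act y \<delta>))"
    using arg_min_nat_lemma[of "\<lambda>x. x \<in> carrier W" \<one> "\<lambda>x. nat (ht (act x \<delta>))"] by (auto simp: x_def)
  let ?d = "act x \<delta>"
  have h0: "0 \<le> ht (act y \<delta>)" if "y \<in> carrier W" for y using d that by (auto simp: imag_def intro: ht_nonneg)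
  have "coroot s ?d \<le> 0" if s: "s \<in> S" for s
  proof -
    have sc: "s \<in> carrier W" using s S_carrier by blast
    have "act (s \<otimes> x) \<delta> + coroot s ?d \<cdot> sr s = ?d"
      using x s sc by (simp add: act_mult act_S rf_def)
    then have "ht (act (s \<otimes> x) \<delta>) + coroot s ?d = ht ?d" using s by (metis ht_add ht_smul ht_sr mult.right_neutral)
    moreover have "ht ?d \<le> ht (act (s \<otimes> x) \<delta>)"
      using x(2)[of "s \<otimes> x"] h0[of "s \<otimes> x"] h0[OF x(1)] sc x(1) by simp
    ultimately show ?thesis by linarith
  qed
  then show ?thesis using that x(1) by blast
qed

lemma fixed_of_coroot_zero:
  assumes "\<And>s. s \<in> S \<Longrightarrow> coroot s v = 0" and y: "y \<in> carrier W"
  shows "act y v = v"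
proof -
  have "actw ss v = v" if "ss \<in> lists S" for ss
    using that by (induction ss) (simp_all add: rf_def assms(1))
  then show ?thesis using ex_word[OF y] act_word by metis
qed

text \<open>Moving \<delta> to its antidominant conjugate puts a conjugate of a into the standard
  parabolic subgroup stabilising that conjugate. Ellipticity then makes all simple coroots vanish on
  it.\<close>

theorem elliptic_imag_fixed:
  assumes a: "a \<in> carrier W" and ell: "\<And>J. J \<subset> S \<Longrightarrow> cls a \<inter> generate W J = {}"
    and d: "imag \<delta>" "act a \<delta> = \<delta>" and w: "w \<in> carrier W"
  shows "act w \<delta> = \<delta>"
proof -
  obtain x where x: "x \<in> carrier W" and cd: "\<And>s. s \<in> S \<Longrightarrow> coroot s (act x \<delta>) \<le> 0"
    using imag_antidominant_conj[OF d(1)] by blast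
  let ?d = "act x \<delta>" and ?a = "x \<otimes> a \<otimes> inv x"
  let ?J = "{s \<in> S. coroot s ?d = 0}"
  have "act ?a ?d = ?d" using x a d by (simp add: act_mult)
  then have "?a \<in> generate W ?J" using antidominant_stabilizer[OF cd, of ?a] x a by auto
  moreover have "?a \<in> cls a" using x by (auto simp: cls_def)
  ultimately have "\<not> ?J \<subset> S" using ell by blast
  then have J: "coroot s ?d = 0" if "s \<in> S" for s using that by blast
  have "\<delta> = act (inv x) ?d" using x by simp
  then have "\<delta> = ?d" using fixed_of_coroot_zero[OF J, of "inv x"] x by simp
  then show ?thesis using fixed_of_coroot_zero[OF J w] by simp
qed

section \<open>Facets of the Tits cone\<close>

lemma lin_zero: "lin L \<Longrightarrow> L 0 = 0"
proof -
  assume L: "lin L"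
  have "L (0 \<cdot> 0) = 0 * L 0" using L unfolding lin_def by blast
  then show ?thesis by (simp add: pw)
qed

lemma lin_uminus: "lin L \<Longrightarrow> L (- v) = - L v"
proof -
  assume L: "lin L"
  have e: "- v = (- 1) \<cdot> v" by (auto simp: pw)
  have "L ((- 1) \<cdot> v) = (- 1) * L v" using L unfolding lin_def by blast
  then show ?thesis unfolding e by simp
qed

lemma lin_diff: "lin L \<Longrightarrow> L (u - v) = L u - L v"
proof -
  assume L: "lin L"
  have e: "u - v = u + (- v)" by simp
  have "L (u + (- v)) = L u + L (- v)" using L unfolding lin_def by blast
  then show ?thesis unfolding e lin_uminus[OF L] by simp
qed

lemma lin_sum: "lin L \<Longrightarrow> finite I \<Longrightarrow> L (\<Sum>i\<in>I. f i) = (\<Sum>i\<in>I. L (f i))"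
proof -
  assume L: "lin L"
  show "finite I \<Longrightarrow> ?thesis"
  proof (induction I rule: finite_induct)
    case empty then show ?case using lin_zero[OF L] by simp
  next
    case (insert x I)
    then show ?case using L by (simp add: lin_def)
  qed
qed

lemma lin_act: "lin L \<Longrightarrow> w \<in> carrier W \<Longrightarrow> lin (\<lambda>v. L (act w v))"
  by (simp add: lin_def act_add act_smul)

lemma lin_root:
  assumes "lin L" "\<beta> \<in> roots"
  shows "L \<beta> = (\<Sum>s\<in>S. \<beta> s * L (sr s))"
proof -
  have "\<beta> = (\<Sum>s\<in>S. \<beta> s \<cdot> sr s)" by (rule support_expand[OF fin]) (rule root_support[OF assms(2)])
  then have "L \<beta> = L (\<Sum>s\<in>S. \<beta> s \<cdot> sr s)" by (rule arg_cong)
  then show ?thesis using assms(1) by (simp add: lin_sum[OF assms(1) fin] lin_def)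
qed

text \<open>A linear form negative on finitely many positive roots lies in the Tits cone. A
  conjugate with the fewest such roots is dominant, since a simple reflection permutes the positive
  roots other than its own.\<close>

lemma dominant_conjugate:
  assumes L: "lin L" and fn: "finite {\<beta> \<in> roots. pos \<beta> \<and> L \<beta> < 0}"
  shows "\<exists>w\<in>carrier W. \<forall>s\<in>S. L (act (inv w) (sr s)) \<ge> 0"
proof -
  let ?N = "\<lambda>w. {\<beta> \<in> roots. pos \<beta> \<and> L (act (inv w) \<beta>) < 0}"
  have fN: "finite (?N w)" if w: "w \<in> carrier W" for w
  proof -
    have "act (inv w) ` ?N w \<subseteq> {\<beta> \<in> roots. pos \<beta> \<and> L \<beta> < 0} \<union> uminus ` Inv w"
    proof
      fix \<gamma> assume "\<gamma> \<in> act (inv w) ` ?N w"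
      then obtain \<beta> where b: "\<beta> \<in> roots" "pos \<beta>" "L (act (inv w) \<beta>) < 0" "\<gamma> = act (inv w) \<beta>" by blast
      have g: "\<gamma> \<in> roots" using b w roots_act by simp
      show "\<gamma> \<in> {\<beta> \<in> roots. pos \<beta> \<and> L \<beta> < 0} \<union> uminus ` Inv w"
      proof (cases "pos \<gamma>")
        case True then show ?thesis using b g by simp
      next
        case False
        have "- \<gamma> \<in> Inv w" using g False root_sign[OF g] roots_uminus[OF g] root_neg_iff[OF b(1)] b w
          by (simp add: Inv_def act_uminus)
        then have "- (- \<gamma>) \<in> uminus ` Inv w" by (rule imageI)
        then show ?thesis by simp
      qed
    qed
    moreover have "finite ({\<beta> \<in> roots. pos \<beta> \<and> L \<beta> < 0} \<union> uminus ` Inv w)" using fn finite_Inv[OF w] by simp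
    ultimately have "finite (act (inv w) ` ?N w)" by (rule finite_subset)
    then show ?thesis by (rule finite_imageD) (use w in \<open>auto simp: inj_on_def\<close>)
  qed
  obtain w where w: "w \<in> carrier W" "\<And>y. y \<in> carrier W \<Longrightarrow> card (?N w) \<le> card (?N y)"
    using ex_has_least_nat[of "\<lambda>x. x \<in> carrier W" \<one> "\<lambda>w. card (?N w)"] one_closed by blast
  have "L (act (inv w) (sr s)) \<ge> 0" if s: "s \<in> S" for s
  proof (rule ccontr)
    assume neg: "\<not> ?thesis"
    have sc: "s \<in> carrier W" using s S_carrier by blast
    have sw: "s \<otimes> w \<in> carrier W" using sc w by simp
    have ss: "act s (act s v) = v" for v using act_mult[OF sc sc, of v] S_sq[OF s] by simp
    have "inv (s \<otimes> w) = inv w \<otimes> s"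
      using inv_mult_group[OF sc w(1)] inv_equality[OF S_sq[OF s] sc sc] by metis
    then have e: "act (inv (s \<otimes> w)) v = act (inv w) (act s v)" for v
      using act_mult[OF _ sc, of "inv w" v] w(1) by (metis inv_closed)
    have sub: "act s ` ?N (s \<otimes> w) \<subseteq> ?N w - {sr s}"
    proof
      fix \<gamma> assume "\<gamma> \<in> act s ` ?N (s \<otimes> w)"
      then obtain \<beta> where b: "\<beta> \<in> roots" "pos \<beta>" "L (act (inv w) (act s \<beta>)) < 0" "\<gamma> = act s \<beta>"
        using e by auto
      have "act s (sr s) = - sr s" by (rule act_S_sr[OF s])
      then have "L (act (inv w) (act s (sr s))) > 0" using neg w lin_uminus[OF L] by (simp add: act_uminus)
      then have ns: "\<beta> \<noteq> sr s" using b(3) by auto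
      then have "pos \<gamma>" using simple_flip[OF b(1,2) s] b(4) by blast
      moreover have "\<gamma> \<noteq> sr s"
      proof
        assume "\<gamma> = sr s"
        then have "\<beta> = - sr s" using b(4) ss[of \<beta>] \<open>act s (sr s) = - sr s\<close> by simp
        then show False using b(2) root_neg_iff[OF roots_sr[OF s]] pos_sr by simp
      qed
      ultimately show "\<gamma> \<in> ?N w - {sr s}" using b sc roots_act by simp
    qed
    have "sr s \<in> ?N w" using s neg roots_sr pos_sr by simp
    then have "card (?N w - {sr s}) < card (?N w)" by (rule card_Diff1_less[OF fN[OF w(1)]])
    moreover have "card (act s ` ?N (s \<otimes> w)) \<le> card (?N w - {sr s})"
      by (rule card_mono[OF finite_Diff[OF fN[OF w(1)]] sub])
    moreover have "inj_on (act s) (?N (s \<otimes> w))" by (rule inj_onI) (simp only: act_eq_iff[OF sc])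
    then have "card (act s ` ?N (s \<otimes> w)) = card (?N (s \<otimes> w))" by (rule card_image)
    ultimately show False using w(2)[OF sw] by linarith
  qed
  then show ?thesis using w by blast
qed

lemma lin_dominant_root:
  assumes L: "lin L" and d: "\<And>s. s \<in> S \<Longrightarrow> L (sr s) \<ge> 0" and b: "\<beta> \<in> roots"
  shows "pos \<beta> \<Longrightarrow> L \<beta> \<ge> 0" "L \<beta> > 0 \<Longrightarrow> pos \<beta>" "L \<beta> = 0 \<longleftrightarrow> \<beta> \<in> PhiK {s \<in> S. L (sr s) = 0}"
proof -
  have *: "L \<beta> \<ge> 0 \<and> (L \<beta> = 0 \<longleftrightarrow> \<beta> \<in> PhiK {s \<in> S. L (sr s) = 0})" if b: "\<beta> \<in> roots" "pos \<beta>" for \<beta>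
  proof -
    have t: "0 \<le> \<beta> s * L (sr s)" if "s \<in> S" for s using root_pos_nonneg[OF b(2)] d[OF that] by simp
    have "L \<beta> = 0 \<longleftrightarrow> (\<forall>s\<in>S. \<beta> s * L (sr s) = 0)"
      unfolding lin_root[OF L b(1)] by (rule sum_nonneg_eq_0_iff[OF fin t])
    also have "\<dots> \<longleftrightarrow> \<beta> \<in> PhiK {s \<in> S. L (sr s) = 0}" using b(1) root_support[OF b(1)] by (auto simp: PhiK_def)
    finally show ?thesis unfolding lin_root[OF L b(1)] using t by (auto intro: sum_nonneg)
  qed
  show "pos \<beta> \<Longrightarrow> L \<beta> \<ge> 0" using * b by blast
  note u = roots_uminus[OF b] lin_uminus[OF L, of \<beta>] root_sign[OF b]
  show "L \<beta> > 0 \<Longrightarrow> pos \<beta>" using *[OF u(1)] u by auto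
  have "- \<beta> \<in> PhiK J \<longleftrightarrow> \<beta> \<in> PhiK J" for J using b u(1) by (auto simp: PhiK_def pw_simps)
  then show "L \<beta> = 0 \<longleftrightarrow> \<beta> \<in> PhiK {s \<in> S. L (sr s) = 0}"
    using *[OF b] *[OF u(1)] u by auto
qed

lemma finite_parabolic:
  assumes K: "K \<subseteq> S" and f: "finite (PhiK K)"
  shows "finite (generate W K)"
proof -
  let ?r = "\<lambda>w. restrict (\<lambda>k. act w (sr k)) K"
  note c = gen_sub[OF K]
  have fK: "finite K" using finite_subset[OF K fin] .
  have P: "act w (sr k) \<in> PhiK K" if "w \<in> generate W K" "k \<in> K" for w k
  proof -
    have "act w (sr k) x = 0" if "x \<notin> K" for x
      using act_gen_outside[OF K \<open>w \<in> generate W K\<close> that, of "sr k"] that \<open>k \<in> K\<close> by (auto simp: sr_apply)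
    then show ?thesis using that K c by (auto simp: PhiK_def intro!: roots_act roots_sr)
  qed
  have "?r ` generate W K \<subseteq> K \<rightarrow>\<^sub>E PhiK K" using P by auto
  then have "finite (?r ` generate W K)" using finite_PiE[OF fK, of "\<lambda>_. PhiK K"] f finite_subset by blast
  moreover have "inj_on ?r (generate W K)"
  proof (rule inj_onI)
    fix w v assume w: "w \<in> generate W K" and v: "v \<in> generate W K" and e: "?r w = ?r v"
    have a: "act (inv v \<otimes> w) (sr k) = sr k" if "k \<in> K" for k
      using fun_cong[OF e, of k] that c[OF w] c[OF v] by (simp add: act_mult)
    have "inv v \<otimes> w = \<one>"
    proof (rule pos_gen_one[OF K])
      show "inv v \<otimes> w \<in> generate W K" using w v gen_mult gen_inv K by metis
      show "pos (act (inv v \<otimes> w) (sr k))" if "k \<in> K" for k using a[OF that] pos_sr that K by auto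
    qed
    then show "w = v" using c[OF w] c[OF v] by (metis inv_equality inv_inv inv_closed)
  qed
  ultimately show ?thesis by (rule finite_imageD)
qed

lemma lin_gen_invariant:
  assumes J: "J \<subseteq> S" and L: "lin L" and z: "\<And>k. k \<in> J \<Longrightarrow> L (sr k) = 0" and j: "j \<in> generate W J"
  shows "L (act j v) = L v"
proof -
  obtain ss where ss: "ss \<in> lists J" "word_prod W ss = j" using generate_word[OF J j] by blast
  have "L (actw ss v) = L v" using ss(1)
  proof (induction ss)
    case (Cons k ss)
    then have "L (rf k (actw ss v)) = L (actw ss v)"
      using L unfolding rf_def lin_diff[OF L] by (simp add: lin_def z)
    then show ?case using Cons by simp
  qed simp
  moreover have "ss \<in> lists S" using ss(1) J by auto
  ultimately show ?thesis using ss(2) act_word by metis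
qed

lemma fix_simple_commute:
  assumes K: "K \<subseteq> S" and z: "z \<in> carrier W" "\<And>k. k \<in> K \<Longrightarrow> act z (sr k) = sr k" and j: "j \<in> generate W K"
  shows "z \<otimes> j = j \<otimes> z"
  using K j
proof (induction rule: gen_induct)
  case (mult w k)
  have kS: "k \<in> S" using K mult(2) by blast
  have "z \<otimes> k = k \<otimes> z" by (rule simple_conj[OF z(1) kS kS z(2)[OF mult(2)]])
  then show ?case using mult(4) S_carrier[OF kS] gen_sub[OF K mult(1)] z(1) by (metis m_assoc)
qed (use z in simp)

text \<open>\<open>L\<close> is a point of the closed fundamental chamber and K is the type of its
  facet. As a preserves the zeros of L among the roots, the shortest element \<open>a0\<close> of
  \<open>W_K a\<close> permutes the simple roots of K. On roots fixed by g positive values of L stay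
  positive, so \<open>a0\<close> keeps their signs too.\<close>

theorem facet:
  assumes a: "a \<in> carrier W" and g: "g \<in> carrier W" "a \<otimes> g = g \<otimes> a"
    and L: "lin L" "\<And>s. s \<in> S \<Longrightarrow> L (sr s) \<ge> 0"
    and fz: "finite {\<beta> \<in> roots. L \<beta> = 0}" and gz: "\<And>\<beta>. \<beta> \<in> roots \<Longrightarrow> L \<beta> = 0 \<Longrightarrow> act g \<beta> = \<beta>"
    and aL: "\<And>\<beta>. \<beta> \<in> roots \<Longrightarrow> L \<beta> = 0 \<Longrightarrow> L (act a \<beta>) = 0"
      "\<And>\<beta>. \<beta> \<in> roots \<Longrightarrow> act g \<beta> = \<beta> \<Longrightarrow> L \<beta> > 0 \<Longrightarrow> L (act a \<beta>) > 0"
  obtains K a0 \<sigma> u where "twisted_parabolic W S A K a0 \<sigma>" "K = {s \<in> S. L (sr s) = 0}"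
    "u \<in> generate W K" "a = u \<otimes> a0" "a0 \<otimes> g = g \<otimes> a0"
    "\<And>\<beta>. \<beta> \<in> roots \<Longrightarrow> act g \<beta> = \<beta> \<Longrightarrow> pos (act a0 \<beta>) = pos \<beta>"
    "\<And>k. k \<in> K \<Longrightarrow> act g (sr k) = sr k"
proof -
  define K where "K = {s \<in> S. L (sr s) = 0}"
  have K: "K \<subseteq> S" by (auto simp: K_def)
  have PK: "\<beta> \<in> PhiK K \<longleftrightarrow> L \<beta> = 0" if "\<beta> \<in> roots" for \<beta>
    unfolding K_def using lin_dominant_root(3)[of L, OF L that] by simp
  have PR: "\<beta> \<in> roots" if "\<beta> \<in> PhiK K" for \<beta> using that by (simp add: PhiK_def)
  have "PhiK K = {\<beta> \<in> roots. L \<beta> = 0}" using PK PR by blast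
  then have fP: "finite (PhiK K)" using fz by simp
  then have fK: "finite (generate W K)" by (rule finite_parabolic[OF K])
  note c = gen_sub[OF K]
  have kc: "k \<in> carrier W" if "k \<in> K" for k using that K S_carrier by blast
  have gk: "act g (sr k) = sr k" if "k \<in> K" for k using that gz roots_sr by (auto simp: K_def)
  have Lk: "L (act j v) = L v" if "j \<in> generate W K" for j v
    by (rule lin_gen_invariant[OF K L(1) _ that]) (simp add: K_def)
  define j where "j = (ARG_MIN (\<lambda>j. len (j \<otimes> a)) j. j \<in> generate W K)"
  have j: "j \<in> generate W K" "\<And>y. y \<in> generate W K \<Longrightarrow> len (j \<otimes> a) \<le> len (y \<otimes> a)"
    using arg_min_nat_lemma[of "\<lambda>j. j \<in> generate W K" \<one> "\<lambda>j. len (j \<otimes> a)"] gen_one by (auto simp: j_def)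
  define a0 where "a0 = j \<otimes> a"
  have a0: "a0 \<in> carrier W" using a c[OF j(1)] by (simp add: a0_def)
  have pk: "pos (act (inv a0) (sr k))" if k: "k \<in> K" for k
  proof -
    have kS: "k \<in> S" using k K by blast
    have "len a0 \<le> len ((k \<otimes> j) \<otimes> a)" unfolding a0_def using j k by (intro j(2)) (simp add: gen_mult gen_S)
    then have "len a0 \<le> len (k \<otimes> a0)" using c[OF j(1)] kc[OF k] a by (simp add: a0_def m_assoc)
    then have "len (k \<otimes> a0) = Suc (len a0)" using len_left[of a0 k] a0 kS by auto
    moreover have "len (inv a0 \<otimes> k) = len (k \<otimes> a0)"
      using len_inv[of "k \<otimes> a0"] a0 kc[OF k] inv_equality[OF S_sq[OF kS] kc[OF k] kc[OF k]]
      by (simp add: inv_mult_group)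
    ultimately show ?thesis using pos_iff_len[of "inv a0" k] a0 kS by (simp add: len_inv)
  qed
  have aP: "act a0 \<beta> \<in> PhiK K" if "\<beta> \<in> PhiK K" for \<beta>
  proof -
    have "L (act a0 \<beta>) = L (act a \<beta>)" unfolding a0_def using a c[OF j(1)] by (simp add: act_mult Lk[OF j(1)])
    moreover have "L (act a \<beta>) = 0" using aL(1)[OF PR[OF that]] PK[OF PR[OF that]] that by blast
    ultimately have "L (act a0 \<beta>) = 0" by simp
    then show ?thesis using PK roots_act[OF a0 PR[OF that]] by simp
  qed
  have "\<exists>k'\<in>K. act a0 (sr k) = sr k'" if k: "k \<in> K" for k
  proof (rule PhiK_simple[OF K _ pk, of "act a0 (sr k)" k])
    have "sr k \<in> PhiK K" using k K roots_sr by (auto simp: PhiK_def sr_apply)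
    then show "act a0 (sr k) \<in> PhiK K" by (rule aP)
  qed (use a0 k K in auto)
  then obtain \<sigma> where s: "\<And>k. k \<in> K \<Longrightarrow> \<sigma> k \<in> K \<and> act a0 (sr k) = sr (\<sigma> k)" by metis
  have "inj_on \<sigma> K"
  proof (rule inj_onI)
    fix k l assume "k \<in> K" "l \<in> K" "\<sigma> k = \<sigma> l"
    then have "act a0 (sr k) = act a0 (sr l)" using s by simp
    then have "sr k = sr l" using a0 by simp
    then show "k = l" by (metis sr_apply zero_neq_one)
  qed
  moreover have "\<sigma> ` K \<subseteq> K" using s by blast
  ultimately have "bij_betw \<sigma> K K" using endo_inj_surj[of K \<sigma>] finite_subset[OF K fin] by (auto simp: bij_betw_def)
  then have tp: "twisted_parabolic W S A K a0 \<sigma>"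
    using K fK a0 s by (intro twisted_parabolic.intro twisted_parabolic_axioms.intro coxeter_gcm_axioms) auto
  \<comment> \<open>g fixes the simple roots of K and so commutes with \<open>W_K\<close>; splitting
    off j keeps the commutation with g.\<close>
  have comm: "j \<otimes> g = g \<otimes> j" by (rule fix_simple_commute[OF K g(1) gk j(1), symmetric])
  have "a0 \<otimes> g = j \<otimes> (g \<otimes> a)" unfolding a0_def using a g c[OF j(1)] by (simp add: m_assoc)
  also have "\<dots> = g \<otimes> a0" unfolding a0_def using a g c[OF j(1)] comm by (simp add: m_assoc[symmetric])
  finally have ag: "a0 \<otimes> g = g \<otimes> a0" .
  have au: "a = inv j \<otimes> a0" unfolding a0_def using a c[OF j(1)] by (simp add: m_assoc[symmetric])
  have pp: "pos (act a0 \<beta>) = pos \<beta>" if b: "\<beta> \<in> roots" "act g \<beta> = \<beta>" for \<beta>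
  proof -
    have up: "pos (act a0 \<beta>) \<and> pos \<beta>" if b: "\<beta> \<in> roots" "act g \<beta> = \<beta>" and l: "L \<beta> > 0" for \<beta>
    proof -
      have "L (act a0 \<beta>) > 0" unfolding a0_def using aL(2)[OF b l] a c[OF j(1)] by (simp add: act_mult Lk[OF j(1)])
      then show ?thesis using lin_dominant_root(2)[of L, OF L] roots_act[OF a0 b(1)] b(1) l by blast
    qed
    consider "L \<beta> > 0" | "L (- \<beta>) > 0" | "L \<beta> = 0" using lin_uminus[OF L(1), of \<beta>] by linarith
    then show ?thesis
    proof cases
      case 1 then show ?thesis using up b by blast
    next
      case 2
      then have "pos (act a0 (- \<beta>)) \<and> pos (- \<beta>)" using b g roots_uminus by (intro up) (simp_all add: act_uminus)
      then show ?thesis using a0 b roots_act root_neg_iff by (simp add: act_uminus)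
    next
      case 3
      show ?thesis
      proof (rule PhiK_pos[OF K a0])
        show "pos (act a0 (sr k))" if "k \<in> K" for k using s[OF that] K pos_sr by auto
        show "\<beta> \<in> PhiK K" using PK b 3 by simp
      qed
    qed
  qed
  show ?thesis by (rule that[OF tp K_def _ au ag pp gk]) (use j gen_inv K in auto)
qed

section \<open>Finitely many periodic roots\<close>

inductive_set span :: "('w \<Rightarrow> int) set \<Rightarrow> ('w \<Rightarrow> int) set" for P where
  zero: "0 \<in> span P"
| step: "v \<in> span P \<Longrightarrow> \<gamma> \<in> P \<Longrightarrow> v + c \<cdot> \<gamma> \<in> span P"

lemma span_add: "v \<in> span P \<Longrightarrow> u \<in> span P \<Longrightarrow> u + v \<in> span P"
proof (induction v rule: span.induct)
  case zero then show ?case by simp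
next
  case (step v \<gamma> c)
  have "(u + v) + c \<cdot> \<gamma> \<in> span P" using step by (intro span.step)
  then show ?case by (simp add: add.assoc)
qed

lemma span_smul: "v \<in> span P \<Longrightarrow> c \<cdot> v \<in> span P"
proof (induction v rule: span.induct)
  case zero
  have "c \<cdot> 0 = 0" by (auto simp: pw)
  then show ?case using span.zero by simp
next
  case (step v \<gamma> d)
  have "c \<cdot> (v + d \<cdot> \<gamma>) = c \<cdot> v + (c * d) \<cdot> \<gamma>" by (auto simp: pw algebra_simps)
  then show ?case using span.step step by simp
qed

lemma span_gen: "\<gamma> \<in> P \<Longrightarrow> c \<cdot> \<gamma> \<in> span P"
  using span.step[OF span.zero, of \<gamma> P c] by simp

lemma span_sum: "finite I \<Longrightarrow> (\<And>i. i \<in> I \<Longrightarrow> f i \<in> span P) \<Longrightarrow> (\<Sum>i\<in>I. f i) \<in> span P"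
  by (induction I rule: finite_induct) (auto intro: span_add span.zero)

lemma span_act: "w \<in> carrier W \<Longrightarrow> v \<in> span P \<Longrightarrow> (\<And>\<gamma>. \<gamma> \<in> P \<Longrightarrow> act w \<gamma> \<in> span P) \<Longrightarrow> act w v \<in> span P"
proof -
  assume w: "w \<in> carrier W" and P: "\<And>\<gamma>. \<gamma> \<in> P \<Longrightarrow> act w \<gamma> \<in> span P"
  show "v \<in> span P \<Longrightarrow> act w v \<in> span P"
  proof (induction v rule: span.induct)
    case zero
    then show ?case using span.zero act_zero[OF w] by simp
  next
    case (step v \<gamma> c)
    have "act w (v + c \<cdot> \<gamma>) = act w v + c \<cdot> act w \<gamma>" using w by (simp add: act_add act_smul)
    then show ?case using step span_add span_smul P by simp
  qed
qed

lemma span_fix: "w \<in> carrier W \<Longrightarrow> v \<in> span P \<Longrightarrow> (\<And>\<gamma>. \<gamma> \<in> P \<Longrightarrow> act w \<gamma> = \<gamma>) \<Longrightarrow> act w v = v"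
proof -
  assume w: "w \<in> carrier W" and P: "\<And>\<gamma>. \<gamma> \<in> P \<Longrightarrow> act w \<gamma> = \<gamma>"
  show "v \<in> span P \<Longrightarrow> act w v = v"
  proof (induction v rule: span.induct)
    case zero
    show ?case using act_zero[OF w] .
  next
    case (step v \<gamma> c)
    show ?case using w by (simp add: act_add act_smul step P)
  qed
qed

text \<open>The roots \<open>\<beta> + n v\<close> and the negatives of the roots
  \<open>\<beta> - n v\<close> add up to \<open>2 n v\<close>. For large n both have the sign of
  \<open>v\<close> at a coordinate where \<open>v\<close> is nonzero, so \<open>imag_seq\<close>
  applies.\<close>

lemma translation_imag:
  assumes h: "h \<in> carrier W" and b: "\<beta> \<in> roots" and v: "act h \<beta> = \<beta> + v" "act h v = v" "v \<noteq> 0"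
  shows "imag v \<or> imag (- v)"
proof -
  have hn: "act (h [^] n) \<beta> = \<beta> + int n \<cdot> v" for n :: nat
  proof (induction n)
    case 0 then show ?case by (auto simp: pw)
  next
    case (Suc n)
    have "act (h [^] Suc n) \<beta> = act h (\<beta> + int n \<cdot> v)" using act_pow_Suc(2)[OF h] Suc by simp
    then show ?case using h v by (simp add: act_add act_smul) (auto simp: pw algebra_simps)
  qed
  have vn: "act (h [^] n) v = v" for n :: nat by (rule act_pow_fix[OF h v(2)])
  have mn: "act (inv (h [^] n)) \<beta> = \<beta> - int n \<cdot> v" for n :: nat
  proof -
    have c: "h [^] n \<in> carrier W" using h by simp
    have "act (h [^] n) (\<beta> - int n \<cdot> v) = \<beta>" using c by (simp add: act_diff act_smul vn hn)
    then show ?thesis using act_inv(2)[OF c] by metis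
  qed
  define X where "X k = \<beta> + int (Suc k) \<cdot> v" for k
  define Y where "Y k = - (\<beta> - int (Suc k) \<cdot> v)" for k
  have rX: "X k \<in> roots" for k unfolding X_def hn[symmetric] using h b by (intro roots_act) auto
  have rY: "Y k \<in> roots" for k unfolding Y_def mn[symmetric] using h b by (intro roots_uminus roots_act) auto
  obtain x where x: "v x \<noteq> 0" using v(3) by (auto simp: pw)
  have iX: "inj X" by (rule injI) (use x in \<open>auto simp: X_def pw dest: fun_cong[of _ _ x]\<close>)
  have iY: "inj Y" by (rule injI) (use x in \<open>auto simp: Y_def pw dest: fun_cong[of _ _ x]\<close>)
  have XY: "(2 * int (Suc k)) \<cdot> v = X k + Y k" for k by (auto simp: X_def Y_def pw algebra_simps)
  have "{k. pos (X k) \<noteq> pos (Y k)} \<subseteq> {..nat \<bar>\<beta> x\<bar>}"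
  proof
    fix k assume k: "k \<in> {k. pos (X k) \<noteq> pos (Y k)}"
    show "k \<in> {..nat \<bar>\<beta> x\<bar>}"
    proof (rule ccontr)
      assume "k \<notin> {..nat \<bar>\<beta> x\<bar>}"
      then have "int (Suc k) * 1 > \<bar>\<beta> x\<bar>" by auto
      moreover have "int (Suc k) * \<bar>v x\<bar> \<ge> int (Suc k) * 1" using x by (intro mult_left_mono) auto
      moreover have "\<bar>int (Suc k) * v x\<bar> = int (Suc k) * \<bar>v x\<bar>" by (simp add: abs_mult)
      ultimately have B: "\<bar>int (Suc k) * v x\<bar> > \<bar>\<beta> x\<bar>" by linarith
      have e: "X k x = int (Suc k) * v x + \<beta> x" "Y k x = int (Suc k) * v x - \<beta> x"
        by (simp_all add: X_def Y_def pw_simps)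
      show False
      proof (cases "int (Suc k) * v x > 0")
        case True
        then have "X k x > 0" "Y k x > 0" unfolding e using B by linarith+
        then have "pos (X k)" "pos (Y k)" using root_nonneg rX rY by blast+
        then show False using k by simp
      next
        case False
        then have "X k x < 0" "Y k x < 0" unfolding e using B by linarith+
        then have "\<not> pos (X k)" "\<not> pos (Y k)" using root_pos_nonneg by (meson not_le)+
        then show False using k by simp
      qed
    qed
  qed
  then have fs: "finite {k. pos (X k) \<noteq> pos (Y k)}" by (rule finite_subset) simp
  have m0: "2 * int (Suc k) \<noteq> 0" for k by simp
  show ?thesis by (rule imag_seq[where X = X and Y = Y and m = "\<lambda>k. 2 * int (Suc k)"]) (fact iX rX iY rY v(3) XY m0 fs)+
qed

text \<open>If the current positive coefficients annihilate the new vector, scale them by M and add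
  1 at a coordinate t where it is nonzero. M exceeds the entries of the earlier vectors at t, so
  their values stay nonzero.\<close>

lemma avoid_functional:
  assumes "finite V" "\<And>v. v \<in> V \<Longrightarrow> v \<noteq> 0" "\<And>v x. v \<in> V \<Longrightarrow> x \<notin> S \<Longrightarrow> v x = (0::int)"
  shows "\<exists>c. (\<forall>s\<in>S. c s > (0::int)) \<and> (\<forall>v\<in>V. (\<Sum>s\<in>S. c s * v s) \<noteq> 0)"
  using assms
proof (induction V rule: finite_induct)
  case empty
  show ?case by (intro exI[of _ "\<lambda>_. 1"]) simp
next
  case (insert v V)
  have "\<exists>c. (\<forall>s\<in>S. c s > (0::int)) \<and> (\<forall>v\<in>V. (\<Sum>s\<in>S. c s * v s) \<noteq> 0)"
    by (rule insert.IH) (use insert.prems in blast)+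
  then obtain c where c: "\<And>s. s \<in> S \<Longrightarrow> c s > 0" "\<And>u. u \<in> V \<Longrightarrow> (\<Sum>s\<in>S. c s * u s) \<noteq> 0" by blast
  show ?case
  proof (cases "(\<Sum>s\<in>S. c s * v s) = 0")
    case False
    then show ?thesis using c by (intro exI[of _ c]) simp
  next
    case True
    have "v \<noteq> 0" using insert.prems(1) by blast
    then obtain t where t: "v t \<noteq> 0" by (auto simp: pw)
    have tS: "t \<in> S" using insert.prems(2)[of v t] t by blast
    define M where "M = 1 + (\<Sum>u\<in>V. \<bar>u t\<bar>)"
    have Mu: "\<bar>u t\<bar> < M" if "u \<in> V" for u
      using member_le_sum[OF that, of "\<lambda>u. \<bar>u t\<bar>"] insert(1) by (simp add: M_def)
    have M1: "M \<ge> 1" unfolding M_def using sum_nonneg[of V "\<lambda>u. \<bar>u t\<bar>"] by simp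
    define d where "d s = M * c s + (if s = t then 1 else 0)" for s
    have ds: "(\<Sum>s\<in>S. d s * u s) = M * (\<Sum>s\<in>S. c s * u s) + u t" for u
    proof -
      have "d s * u s = M * (c s * u s) + (if s = t then u t else 0)" for s by (auto simp: d_def algebra_simps)
      then show ?thesis using tS fin by (simp add: sum.distrib sum_distrib_left)
    qed
    have "d s > 0" if "s \<in> S" for s
    proof -
      have "M * c s > 0" using c(1)[OF that] M1 by simp
      then show ?thesis unfolding d_def by (cases "s = t") simp_all
    qed
    moreover have "(\<Sum>s\<in>S. d s * u s) \<noteq> 0" if "u \<in> V" for u
    proof -
      have "\<bar>M * (\<Sum>s\<in>S. c s * u s)\<bar> \<ge> M * 1"
        unfolding abs_mult using c(2)[OF that] M1 by (intro mult_mono) auto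
      then show ?thesis using Mu[OF that] unfolding ds by linarith
    qed
    moreover have "(\<Sum>s\<in>S. d s * v s) \<noteq> 0" unfolding ds True using t by simp
    ultimately show ?thesis by (intro exI[of _ d]) simp
  qed
qed

end

locale finite_reflections = coxeter_gcm W S A for W :: "'w monoid" (structure) and S A +
  fixes P :: "('w \<Rightarrow> int) set"
  assumes P_roots: "P \<subseteq> roots" and P_fin: "finite P"
    and P_rfl: "\<And>\<beta> \<gamma>. \<beta> \<in> P \<Longrightarrow> \<gamma> \<in> P \<Longrightarrow> act (rfl \<gamma>) \<beta> \<in> P"
begin

definition G where "G = generate W (rfl ` P)"

lemma rP: "\<gamma> \<in> P \<Longrightarrow> rfl \<gamma> \<in> carrier W" using P_roots by auto

lemma G_sub: "subgroup G W"
  unfolding G_def using rP by (intro generate_is_subgroup) blast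

lemma G_c: "h \<in> G \<Longrightarrow> h \<in> carrier W" using subgroup.mem_carrier[OF G_sub] .

lemma G_mult: "x \<in> G \<Longrightarrow> y \<in> G \<Longrightarrow> x \<otimes> y \<in> G" using subgroup.m_closed[OF G_sub] .

lemma G_rfl: "\<gamma> \<in> P \<Longrightarrow> rfl \<gamma> \<in> G" unfolding G_def by (intro generate.incl imageI)

lemma G_induct [consumes 1, case_names one rfl mult]:
  assumes "h \<in> G" "Q \<one>" "\<And>\<gamma>. \<gamma> \<in> P \<Longrightarrow> Q (rfl \<gamma>)"
    "\<And>x y. x \<in> G \<Longrightarrow> y \<in> G \<Longrightarrow> Q x \<Longrightarrow> Q y \<Longrightarrow> Q (x \<otimes> y)"
  shows "Q h"
  using assms(1) unfolding G_def
proof (induction rule: generate.induct)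
  case one show ?case by (rule assms(2))
next
  case (incl h) then show ?case using assms(3) by blast
next
  case (inv h)
  then obtain \<gamma> where g: "\<gamma> \<in> P" "h = rfl \<gamma>" by blast
  have "rfl \<gamma> \<otimes> rfl \<gamma> = \<one>" using rfl_sq g(1) P_roots by blast
  then have "inv h = h" using inv_equality rP g by metis
  then show ?case using assms(3) g by simp
next
  case (eng x y) then show ?case using assms(4) by (simp add: G_def)
qed

lemma G_P: "h \<in> G \<Longrightarrow> \<beta> \<in> P \<Longrightarrow> act h \<beta> \<in> P"
proof (induction arbitrary: \<beta> rule: G_induct)
  case one then show ?case by simp
next
  case (rfl \<gamma>) then show ?case using P_rfl by blast
next
  case (mult x y) then show ?case by (simp add: act_mult G_c)
qed

lemma G_span: "h \<in> G \<Longrightarrow> act h v - v \<in> span P"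
proof (induction arbitrary: v rule: G_induct)
  case one then show ?case by (simp add: span.zero)
next
  case (rfl \<gamma>)
  have "\<gamma> \<in> roots" using rfl P_roots by blast
  then have "act (rfl \<gamma>) v - v = (- npair v \<gamma>) \<cdot> \<gamma>" by (simp add: act_rfl) (auto simp: pw)
  then show ?case using span_gen[OF rfl] by metis
next
  case (mult x y)
  have "act (x \<otimes> y) v - v = (act x (act y v) - act y v) + (act y v - v)" using mult G_c by (simp add: act_mult)
  then show ?case using span_add mult by metis
qed

text \<open>Summing over the reflection group kills each root of P, since composing with its
  reflection changes the sign, and so kills the span. For an imaginary vector the terms are
  nonnegative, so a vanishing sum makes the vector 0. Finiteness of the group is still to be shown,
  so the sum runs over the distinct restrictions to P.\<close>

lemma span_not_imag:
  assumes v: "v \<in> span P"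
  shows "\<not> imag v"
proof
  assume c: "imag v"
  let ?r = "\<lambda>h. restrict (act h) P"
  define F where "F = ?r ` G"
  have "F \<subseteq> P \<rightarrow>\<^sub>E P" unfolding F_def using G_P by auto
  then have fF: "finite F" using finite_PiE[OF P_fin, of "\<lambda>_. P"] P_fin finite_subset by blast
  have FP: "(\<Sum>\<phi>\<in>F. \<phi> \<gamma>) = 0" if g: "\<gamma> \<in> P" for \<gamma>
  proof -
    let ?t = "\<lambda>\<phi>. restrict (\<lambda>\<beta>. \<phi> (act (rfl \<gamma>) \<beta>)) P"
    have gr: "\<gamma> \<in> roots" using g P_roots by blast
    have t: "?t (?r h) = ?r (h \<otimes> rfl \<gamma>)" if "h \<in> G" for h
      using that g by (intro ext) (auto simp: restrict_def act_mult G_c rP P_rfl)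
    have rr: "act (rfl \<gamma>) (act (rfl \<gamma>) \<beta>) = \<beta>" for \<beta>
      using rfl_sq[OF gr] act_mult[OF rP[OF g] rP[OF g], of \<beta>] by simp
    have tF: "?t \<phi> \<in> F" if "\<phi> \<in> F" for \<phi>
      using that t G_mult[OF _ G_rfl[OF g]] unfolding F_def by force
    have tt: "?t (?t \<phi>) = \<phi>" if "\<phi> \<in> F" for \<phi>
      using that P_rfl[OF _ g] unfolding F_def by (intro ext) (auto simp: restrict_def rr)
    have m: "?t \<phi> \<gamma> = - \<phi> \<gamma>" if p: "\<phi> \<in> F" for \<phi>
    proof -
      obtain h where h: "h \<in> G" "\<phi> = ?r h" using p unfolding F_def by blast
      have "?t \<phi> \<gamma> = act h (- \<gamma>)" using h t g rP G_c by (simp add: act_mult act_rfl_self gr)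
      then show ?thesis using h g G_c by (simp add: act_uminus)
    qed
    have "(\<Sum>\<phi>\<in>F. \<phi> \<gamma>) = (\<Sum>\<phi>\<in>F. ?t \<phi> \<gamma>)"
      by (rule sum.reindex_bij_witness[where i = ?t and j = ?t]) (use tt tF in auto)
    also have "\<dots> = (\<Sum>\<phi>\<in>F. - \<phi> \<gamma>)" by (rule sum.cong) (use m in auto)
    also have "\<dots> = - (\<Sum>\<phi>\<in>F. \<phi> \<gamma>)" by (rule sum_negf)
    finally show ?thesis by (auto simp: pw)
  qed
  define r where "r \<phi> = (SOME h. h \<in> G \<and> \<phi> = ?r h)" for \<phi>
  have r: "r \<phi> \<in> G" "\<phi> = ?r (r \<phi>)" if "\<phi> \<in> F" for \<phi>
  proof -
    have "\<exists>h. h \<in> G \<and> \<phi> = ?r h" using that unfolding F_def by blast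
    from someI_ex[OF this] show "r \<phi> \<in> G" "\<phi> = ?r (r \<phi>)" unfolding r_def by blast+
  qed
  have rP': "act (r \<phi>) \<gamma> = \<phi> \<gamma>" if "\<phi> \<in> F" "\<gamma> \<in> P" for \<phi> \<gamma>
    using fun_cong[OF r(2)[OF that(1)], of \<gamma>] that(2) by simp
  have z: "(\<Sum>\<phi>\<in>F. act (r \<phi>) v) = 0"
    using v
  proof (induction v rule: span.induct)
    case zero
    have "act (r \<phi>) 0 = 0" if "\<phi> \<in> F" for \<phi>
      using act_zero[OF G_c[OF r(1)[OF that]]] .
    then show ?case by simp
  next
    case (step v \<gamma> c)
    have "(\<Sum>\<phi>\<in>F. act (r \<phi>) (v + c \<cdot> \<gamma>)) = (\<Sum>\<phi>\<in>F. act (r \<phi>) v + c \<cdot> \<phi> \<gamma>)"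
      by (rule sum.cong) (use step r G_c rP' in \<open>simp_all add: act_add act_smul\<close>)
    also have "\<dots> = (\<Sum>\<phi>\<in>F. act (r \<phi>) v) + c \<cdot> (\<Sum>\<phi>\<in>F. \<phi> \<gamma>)"
      by (auto simp: pw sum_fun_apply sum.distrib sum_distrib_left)
    also have "\<dots> = 0 + c \<cdot> 0" using step.IH FP[OF step.hyps(2)] by simp
    also have "\<dots> = 0" by (auto simp: pw)
    finally show ?case .
  qed
  have nn: "act (r \<phi>) v x \<ge> 0" if "\<phi> \<in> F" for \<phi> x
    using c G_c[OF r(1)[OF that]] by (simp add: imag_def nonneg_def)
  have "?r \<one> \<in> F" unfolding F_def using subgroup.one_closed[OF G_sub] by blast
  then obtain \<phi> where p: "\<phi> \<in> F" by blast
  have "act (r \<phi>) v x = 0" for x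
  proof -
    have "(\<Sum>\<phi>\<in>F. act (r \<phi>) v x) = 0" using fun_cong[OF z, of x] by (simp add: sum_fun_apply pw_simps)
    then show ?thesis using nn p fF by (subst (asm) sum_nonneg_eq_0_iff) auto
  qed
  then have "act (r \<phi>) v = 0" by (auto simp: fun_eq_iff pw_simps)
  then have "act (r \<phi>) v = act (r \<phi>) 0" using act_zero[OF G_c[OF r(1)[OF p]]] by (simp only:)
  then have "v = 0" using act_eq_iff[OF G_c[OF r(1)[OF p]]] by blast
  then show False using c by (simp add: imag_def)
qed

lemma span_uminus_not_imag: "v \<in> span P \<Longrightarrow> \<not> imag (- v)"
proof -
  assume "v \<in> span P"
  then have "(- 1) \<cdot> v \<in> span P" by (rule span_smul)
  moreover have "(- 1) \<cdot> v = - v" by (auto simp: pw)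
  ultimately show ?thesis using span_not_imag by metis
qed

text \<open>An element fixing P pointwise moves each simple root by a vector of the span, which it
  also fixes; if nonzero, this vector or its negative would be imaginary by
  \<open>translation_imag\<close>. So the group acts faithfully on the finite set P.\<close>

lemma G_finite: "finite G"
proof -
  let ?r = "\<lambda>h. restrict (act h) P"
  have "?r ` G \<subseteq> P \<rightarrow>\<^sub>E P" using G_P by auto
  then have "finite (?r ` G)" using finite_PiE[OF P_fin, of "\<lambda>_. P"] P_fin finite_subset by blast
  moreover have "inj_on ?r G"
  proof (rule inj_onI)
    fix x y assume x: "x \<in> G" and y: "y \<in> G" and e: "?r x = ?r y"
    let ?h = "inv y \<otimes> x"
    have h: "?h \<in> G" using x y G_mult subgroup.m_inv_closed[OF G_sub] by blast
    have hP: "act ?h \<gamma> = \<gamma>" if "\<gamma> \<in> P" for \<gamma>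
      using fun_cong[OF e, of \<gamma>] that G_c[OF x] G_c[OF y] by (simp add: act_mult)
    have "?h = \<one>"
    proof (rule act_faithful[OF G_c[OF h]])
      fix s assume s: "s \<in> S"
      let ?v = "act ?h (sr s) - sr s"
      have v: "?v \<in> span P" by (rule G_span[OF h])
      have "?v = 0"
      proof (rule ccontr)
        assume "?v \<noteq> 0"
        moreover have "act ?h ?v = ?v" by (rule span_fix[OF G_c[OF h] v hP])
        ultimately have "imag ?v \<or> imag (- ?v)" by (intro translation_imag[OF G_c[OF h] roots_sr[OF s]]) simp_all
        then show False using span_not_imag[OF v] span_uminus_not_imag[OF v] by blast
      qed
      then show "act ?h (sr s) = sr s" by simp
    qed
    then show "x = y" using G_c[OF x] G_c[OF y] by (metis inv_equality inv_inv inv_closed)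
  qed
  ultimately show ?thesis by (rule finite_imageD)
qed

text \<open>Average a strictly positive form over the finite group. The result vanishes on P and is
  positive on all positive roots outside finitely many inversions. The coefficients of the form
  avoid accidental zeros at these exceptions, so a root where it vanishes has group sum 0, and its
  multiple by the group order lies in the span.\<close>

theorem ex_functional:
  "\<exists>L. lin L \<and> finite {\<beta> \<in> roots. pos \<beta> \<and> L \<beta> < 0} \<and> (\<forall>\<beta>\<in>P. L \<beta> = 0) \<and>
    (\<forall>\<beta>\<in>roots. L \<beta> = 0 \<longrightarrow> (\<exists>c\<noteq>0. c \<cdot> \<beta> \<in> span P))"
proof -
  define sm where "sm v = (\<Sum>h\<in>G. act h v)" for v
  define I where "I = (\<Union>h\<in>G. Inv h)"
  have fI: "finite I" unfolding I_def using G_finite finite_Inv G_c by blast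
  let ?V = "sm ` I - {0}"
  have supp: "sm \<beta> x = 0" if "\<beta> \<in> roots" "x \<notin> S" for \<beta> x
    unfolding sm_def sum_fun_apply using root_support[OF roots_act[OF G_c that(1)] that(2)] by (intro sum.neutral) blast
  have IR: "\<beta> \<in> roots" if "\<beta> \<in> I" for \<beta> using that by (auto simp: I_def Inv_def)
  have "\<exists>c. (\<forall>s\<in>S. c s > (0::int)) \<and> (\<forall>v\<in>?V. (\<Sum>s\<in>S. c s * v s) \<noteq> 0)"
    by (rule avoid_functional) (use fI supp IR in auto)
  then obtain c where c: "\<And>s. s \<in> S \<Longrightarrow> c s > 0" "\<And>v. v \<in> ?V \<Longrightarrow> (\<Sum>s\<in>S. c s * v s) \<noteq> 0" by blast
  define x0 where "x0 v = (\<Sum>s\<in>S. c s * v s)" for v :: "'w \<Rightarrow> int"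
  define L where "L v = x0 (sm v)" for v
  have sm_lin: "sm (u + v) = sm u + sm v" "sm (d \<cdot> v) = d \<cdot> sm v" for u v d
    by (auto simp: sm_def act_add act_smul G_c sum.distrib pw sum_fun_apply sum_distrib_left)
  have lL: "lin L" unfolding lin_def L_def sm_lin x0_def by (simp add: pw_simps algebra_simps sum.distrib sum_distrib_left)
  have x0p: "x0 \<beta> > 0" if b: "\<beta> \<in> roots" "pos \<beta>" for \<beta>
  proof -
    obtain s where s: "s \<in> S" "\<beta> s \<noteq> 0" using root_nonzero[OF b(1)] root_support[OF b(1)] by (auto simp: pw)
    have t: "0 \<le> c s * \<beta> s" if "s \<in> S" for s using c(1)[OF that] root_pos_nonneg[OF \<open>pos \<beta>\<close>, of s] by simp
    have "0 < c s * \<beta> s" using c(1)[OF s(1)] s(2) root_pos_nonneg[OF \<open>pos \<beta>\<close>, of s] by simp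
    then show ?thesis unfolding x0_def using sum_pos2[OF fin s(1), of "\<lambda>s. c s * \<beta> s"] t by blast
  qed
  have x0s: "L v = (\<Sum>h\<in>G. x0 (act h v))" for v
    unfolding L_def x0_def sm_def sum_fun_apply sum_distrib_left by (rule sum.swap)
  have one: "\<one> \<in> G" using subgroup.one_closed[OF G_sub] .
  have Lp: "L \<beta> > 0" if b: "\<beta> \<in> roots" "pos \<beta>" "\<beta> \<notin> I" for \<beta>
  proof -
    have "x0 (act h \<beta>) > 0" if "h \<in> G" for h
    proof (rule x0p)
      show "act h \<beta> \<in> roots" using roots_act G_c that b by blast
      show "pos (act h \<beta>)" using b that by (auto simp: I_def Inv_def)
    qed
    then show ?thesis unfolding x0s using one G_finite by (intro sum_pos) auto
  qed
  have "{\<beta> \<in> roots. pos \<beta> \<and> L \<beta> < 0} \<subseteq> I" using Lp by force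
  then have fneg: "finite {\<beta> \<in> roots. pos \<beta> \<and> L \<beta> < 0}" using fI finite_subset by blast
  have zP: "L \<beta> = 0" if b: "\<beta> \<in> P" for \<beta>
  proof -
    have br: "\<beta> \<in> roots" using b P_roots by blast
    have iv: "h \<otimes> rfl \<beta> \<otimes> rfl \<beta> = h" if "h \<in> G" for h
      using that b rfl_sq[OF br] by (simp add: m_assoc G_c rP)
    have "sm \<beta> = (\<Sum>h\<in>G. act (h \<otimes> rfl \<beta>) \<beta>)" unfolding sm_def
      by (rule sum.reindex_bij_witness[where i = "\<lambda>h. h \<otimes> rfl \<beta>" and j = "\<lambda>h. h \<otimes> rfl \<beta>"])
        (use iv G_mult[OF _ G_rfl[OF b]] in auto)
    also have "\<dots> = (\<Sum>h\<in>G. - act h \<beta>)"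
      by (rule sum.cong) (use b br in \<open>simp_all add: act_mult G_c rP act_rfl_self act_uminus\<close>)
    also have "\<dots> = - sm \<beta>" unfolding sm_def by (rule sum_negf)
    finally have "sm \<beta> = 0" by (auto simp: pw)
    then show ?thesis by (simp add: L_def x0_def pw_simps)
  qed
  have zz: "\<exists>c\<noteq>0. c \<cdot> \<beta> \<in> span P" if b: "\<beta> \<in> roots" "L \<beta> = 0" for \<beta>
  proof -
    have *: "sm \<beta> = 0" if b: "\<beta> \<in> roots" "pos \<beta>" "L \<beta> = 0" for \<beta>
    proof (rule ccontr)
      assume n: "sm \<beta> \<noteq> 0"
      have "\<beta> \<in> I" using Lp[OF b(1,2)] b(3) by force
      then have "sm \<beta> \<in> ?V" using n by blast
      then show False using c(2) b(3) by (simp add: L_def x0_def)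
    qed
    have e: "sm (- \<beta>) = - sm \<beta>"
    proof -
      have "- \<beta> = (- 1) \<cdot> \<beta>" "- sm \<beta> = (- 1) \<cdot> sm \<beta>" by (auto simp: pw)
      then show ?thesis using sm_lin(2)[of "-1" \<beta>] by simp
    qed
    have z: "sm \<beta> = 0"
    proof (cases "pos \<beta>")
      case True then show ?thesis using * b by blast
    next
      case False
      then have "sm (- \<beta>) = 0" using *[of "- \<beta>"] b roots_uminus root_neg_iff lin_uminus[OF lL] by simp
      then show ?thesis unfolding e by simp
    qed
    have "(\<Sum>h\<in>G. act h \<beta> - \<beta>) \<in> span P" using G_span by (intro span_sum G_finite)
    moreover have "(\<Sum>h\<in>G. act h \<beta> - \<beta>) = sm \<beta> - (\<Sum>h\<in>G. \<beta>)" by (simp only: sm_def sum_subtractf)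
    moreover have "(\<Sum>h\<in>G. \<beta>) = int (card G) \<cdot> \<beta>" by (rule ext) (simp add: sum_fun_apply pw_simps)
    ultimately have "- (int (card G) \<cdot> \<beta>) \<in> span P" using z by simp
    moreover have "- (int (card G) \<cdot> \<beta>) = (- int (card G)) \<cdot> \<beta>" by (auto simp: pw)
    moreover have "- int (card G) \<noteq> 0" using one G_finite by auto
    ultimately show ?thesis by metis
  qed
  show ?thesis using lL fneg zP zz by blast
qed

end

context coxeter_gcm
begin

section \<open>Traces when there are finitely many periodic roots\<close>

lemma smul_one: "1 \<cdot> v = v" by (auto simp: pw)

lemma inv_comm_of:
  assumes x: "x \<in> carrier W" and a: "a \<in> carrier W" and e: "x \<otimes> a = a \<otimes> x"
  shows "inv x \<otimes> a = a \<otimes> inv x"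
proof -
  have "inv x \<otimes> a = inv x \<otimes> (a \<otimes> x) \<otimes> inv x" using x a by (simp add: m_assoc)
  also have "\<dots> = inv x \<otimes> (x \<otimes> a) \<otimes> inv x" by (simp only: e)
  also have "\<dots> = a \<otimes> inv x" using x a by (simp add: m_assoc[symmetric])
  finally show ?thesis .
qed

lemma common_period:
  assumes a: "a \<in> carrier W" and f: "finite Q" and Q: "Q \<subseteq> Per a"
  shows "\<exists>N>0. \<forall>\<beta>\<in>Q. act (a [^] (N::nat)) \<beta> = \<beta>"
  using f Q
proof (induction Q rule: finite_induct)
  case empty then show ?case by (intro exI[of _ 1]) simp
next
  case (insert \<gamma> Q)
  then obtain N :: nat where N: "N > 0" "\<And>\<beta>. \<beta> \<in> Q \<Longrightarrow> act (a [^] N) \<beta> = \<beta>" by auto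
  have "\<gamma> \<in> Per a" using insert.prems by simp
  then obtain d :: nat where d: "d > 0" "act (a [^] d) \<gamma> = \<gamma>" by (rule PerE[OF a])
  have "act (a [^] (N * d)) \<beta> = \<beta>" if "\<beta> \<in> insert \<gamma> Q" for \<beta>
    using that act_pow_multiple[OF a N(2), of \<beta> d] act_pow_multiple[OF a d(2), of N]
    by (cases "\<beta> = \<gamma>") (simp_all add: mult.commute)
  then show ?case using N d by (intro exI[of _ "N * d"]) simp
qed

lemma Per_act: "a \<in> carrier W \<Longrightarrow> \<beta> \<in> Per a \<Longrightarrow> act a \<beta> \<in> Per a"
proof -
  assume a: "a \<in> carrier W" and b: "\<beta> \<in> Per a"
  obtain d :: nat where d: "d > 0" "act (a [^] d) \<beta> = \<beta>" by (rule PerE[OF a b])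
  have "act (a [^] d) (act a \<beta>) = act a \<beta>" using act_pow_Suc[OF a, of d \<beta>] d by simp
  then show ?thesis using d b a by (intro PerI[of a _ d]) (auto simp: Per_def roots_act)
qed

lemma isolated_power:
  assumes a: "a \<in> carrier W" and N: "(N::nat) > 0" "\<And>\<beta>. \<beta> \<in> Per a \<Longrightarrow> act (a [^] N) \<beta> = \<beta>"
  shows "isolated (a [^] N)"
  unfolding isolated_def
proof (intro ballI impI)
  fix \<beta> assume b: "\<beta> \<in> roots" "finite (range (\<lambda>n::nat. act ((a [^] N) [^] n) \<beta>))"
  have c: "a [^] N \<in> carrier W" using a by simp
  have "\<beta> \<in> Per (a [^] N)" using b by (simp add: Per_def)
  then obtain d :: nat where d: "d > 0" "act ((a [^] N) [^] d) \<beta> = \<beta>" by (rule PerE[OF c])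
  have "act (a [^] (N * d)) \<beta> = \<beta>" using d(2) a by (simp add: nat_pow_pow)
  then have "\<beta> \<in> Per a" using a b d N by (intro PerI[of a \<beta> "N * d"]) auto
  then show "act (a [^] N) \<beta> = \<beta>" by (rule N(2))
qed

lemma Per_reflections:
  assumes a: "a \<in> carrier W" and f: "finite (Per a)"
  shows "finite_reflections W S A (Per a)"
proof (intro finite_reflections.intro coxeter_gcm_axioms finite_reflections_axioms.intro)
  show R: "Per a \<subseteq> roots" by (auto simp: Per_def)
  show "finite (Per a)" by (rule f)
  fix \<beta> \<gamma> assume b: "\<beta> \<in> Per a" and g: "\<gamma> \<in> Per a"
  obtain N :: nat where N: "N > 0" "\<And>\<beta>. \<beta> \<in> Per a \<Longrightarrow> act (a [^] N) \<beta> = \<beta>"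
    using common_period[OF a f subset_refl] by blast
  have r: "\<beta> \<in> roots" "\<gamma> \<in> roots" using b g R by blast+
  have "act (a [^] N) (act (rfl \<gamma>) \<beta>) = act (rfl \<gamma>) \<beta>"
    using a N b g r by (simp add: act_rfl act_diff act_smul)
  then show "act (rfl \<gamma>) \<beta> \<in> Per a" using a N r by (intro PerI[of a _ N] roots_act) auto
qed

lemma cls_conj: "a \<in> carrier W \<Longrightarrow> w \<in> carrier W \<Longrightarrow> cls (w \<otimes> a \<otimes> inv w) = cls a"
proof -
  have sub: "cls (w \<otimes> a \<otimes> inv w) \<subseteq> cls a" if a: "a \<in> carrier W" and w: "w \<in> carrier W" for a w
  proof
    fix x assume "x \<in> cls (w \<otimes> a \<otimes> inv w)"
    then obtain g where g: "g \<in> carrier W" "x = g \<otimes> (w \<otimes> a \<otimes> inv w) \<otimes> inv g" by (auto simp: cls_def)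
    then have "x = (g \<otimes> w) \<otimes> a \<otimes> inv (g \<otimes> w)" using a w by (simp add: inv_mult_group m_assoc)
    then show "x \<in> cls a" using g w by (auto simp: cls_def)
  qed
  assume a: "a \<in> carrier W" and w: "w \<in> carrier W"
  have "inv w \<otimes> (w \<otimes> a \<otimes> inv w) \<otimes> inv (inv w) = a"
    using a w by (simp add: m_assoc) (simp add: m_assoc[symmetric])
  then show ?thesis using sub[OF a w] sub[of "w \<otimes> a \<otimes> inv w" "inv w"] a w by auto
qed

lemma conj_pow: "a \<in> carrier W \<Longrightarrow> w \<in> carrier W \<Longrightarrow> (w \<otimes> a \<otimes> inv w) [^] (n::nat) = w \<otimes> a [^] n \<otimes> inv w"
proof (induction n)
  case (Suc n)
  have "w \<otimes> a [^] n \<otimes> inv w \<otimes> (w \<otimes> a \<otimes> inv w) = w \<otimes> a [^] n \<otimes> (inv w \<otimes> w) \<otimes> a \<otimes> inv w"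
    using Suc.prems by (simp only: m_assoc inv_closed m_closed nat_pow_closed)
  then show ?case using Suc by (simp add: m_assoc)
qed simp

lemma Per_conj:
  assumes a: "a \<in> carrier W" and w: "w \<in> carrier W" and b: "\<beta> \<in> roots"
  shows "\<beta> \<in> Per (w \<otimes> a \<otimes> inv w) \<longleftrightarrow> act (inv w) \<beta> \<in> Per a"
proof -
  have e: "act ((w \<otimes> a \<otimes> inv w) [^] n) \<beta> = act w (act (a [^] n) (act (inv w) \<beta>))" for n :: nat
    using a w by (simp add: conj_pow act_mult)
  have "range (\<lambda>n::nat. act ((w \<otimes> a \<otimes> inv w) [^] n) \<beta>) = act w ` range (\<lambda>n::nat. act (a [^] n) (act (inv w) \<beta>))"
    unfolding e by (simp add: image_image)
  moreover have "inj_on (act w) X" for X by (rule inj_onI) (simp only: act_eq_iff[OF w])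
  ultimately show ?thesis using b w roots_act by (simp add: Per_def finite_image_iff)
qed

lemma conj_solutions_commute:
  assumes c: "h \<in> carrier W" "i \<in> carrier W" "x \<in> carrier W" "v \<in> carrier W"
    and e: "x \<otimes> h = h \<otimes> v" "x \<otimes> i = i \<otimes> v"
  shows "(h \<otimes> inv i) \<otimes> x = x \<otimes> (h \<otimes> inv i)"
proof -
  have "inv i \<otimes> x = inv i \<otimes> (x \<otimes> i) \<otimes> inv i" using c by (simp add: m_assoc)
  also have "\<dots> = v \<otimes> inv i" unfolding e(2) using c by (simp add: m_assoc[symmetric])
  finally have "h \<otimes> (inv i \<otimes> x) = (h \<otimes> v) \<otimes> inv i" using c by (simp add: m_assoc)
  then have "h \<otimes> (inv i \<otimes> x) = (x \<otimes> h) \<otimes> inv i" unfolding e(1) .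
  then show ?thesis using c by (simp add: m_assoc)
qed

text \<open>The finiteness argument: two solutions h of \<open>x \<otimes> h = h \<otimes> v\<close>
  with \<open>x = w \<otimes> a0\<close> differ by an element of the centraliser of x, which
  permutes the finite set of periodic roots. Solutions inducing the same permutation differ by an
  element fixing these roots; it commutes with \<open>W_K\<close>, hence with a, and belongs to
  \<Gamma>.\<close>

theorem finite_Per_dominant:
  assumes a: "a \<in> carrier W" and f: "finite (Per a)" and L: "lin L" "\<And>s. s \<in> S \<Longrightarrow> L (sr s) \<ge> 0"
    and z: "\<And>\<beta>. \<beta> \<in> roots \<Longrightarrow> L \<beta> = 0 \<longleftrightarrow> \<beta> \<in> Per a"
  shows "\<exists>f. class_trace (cls a) f"
proof -
  have R: "\<beta> \<in> roots" if "\<beta> \<in> Per a" for \<beta> using that by (simp add: Per_def)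
  obtain N :: nat where N: "N > 0" "\<And>\<beta>. \<beta> \<in> Per a \<Longrightarrow> act (a [^] N) \<beta> = \<beta>"
    using common_period[OF a f subset_refl] by blast
  define g where "g = a [^] N"
  have g: "g \<in> carrier W" and ag: "a \<otimes> g = g \<otimes> a"
    using a nat_pow_Suc2[OF a, of N] by (simp_all add: g_def)
  have iso: "isolated g" unfolding g_def by (rule isolated_power[OF a N])
  have gP: "\<beta> \<in> Per a" if "\<beta> \<in> roots" "act g \<beta> = \<beta>" for \<beta> using that N a by (intro PerI[of a \<beta> N]) (auto simp: g_def)
  have eq: "{\<beta> \<in> roots. L \<beta> = 0} = Per a" using z R by blast
  have aL: "L (act a \<beta>) = 0" if "\<beta> \<in> roots" "L \<beta> = 0" for \<beta>
    using Per_act[OF a, of \<beta>] z[OF that(1)] z[OF roots_act[OF a that(1)]] that(2) by blast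
  obtain K a0 \<sigma> u where K: "twisted_parabolic W S A K a0 \<sigma>" "K = {s \<in> S. L (sr s) = 0}"
    and u: "u \<in> generate W K" "a = u \<otimes> a0" and a0g: "a0 \<otimes> g = g \<otimes> a0"
      "\<And>\<beta>. \<beta> \<in> roots \<Longrightarrow> act g \<beta> = \<beta> \<Longrightarrow> pos (act a0 \<beta>) = pos \<beta>"
    and gk: "\<And>k. k \<in> K \<Longrightarrow> act g (sr k) = sr k"
  proof (rule facet[OF a g ag L])
    show "finite {\<beta> \<in> roots. L \<beta> = 0}" unfolding eq by (rule f)
    show "act g \<beta> = \<beta>" if "\<beta> \<in> roots" "L \<beta> = 0" for \<beta> using z[OF that(1)] that(2) N(2) by (simp add: g_def)
    show "L (act a \<beta>) = 0" if "\<beta> \<in> roots" "L \<beta> = 0" for \<beta> by (rule aL[OF that])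
    show "L (act a \<beta>) > 0" if "\<beta> \<in> roots" "act g \<beta> = \<beta>" "L \<beta> > 0" for \<beta>
      using z[OF that(1)] gP[OF that(1,2)] that(3) by simp
    fix K a0 \<sigma> u
    assume A: "twisted_parabolic W S A K a0 \<sigma>" "K = {s \<in> S. L (sr s) = 0}" "u \<in> generate W K" "a = u \<otimes> a0"
      "a0 \<otimes> g = g \<otimes> a0" and B: "\<And>\<beta>. \<beta> \<in> roots \<Longrightarrow> act g \<beta> = \<beta> \<Longrightarrow> pos (act a0 \<beta>) = pos \<beta>"
      "\<And>k. k \<in> K \<Longrightarrow> act g (sr k) = sr k"
    show thesis by (rule that[OF A]) (fact B)+
  qed
  interpret T: twisted_parabolic W S A K a0 \<sigma> by (rule K(1))
  interpret R: finite_reflections W S A "Per a" by (rule Per_reflections[OF a f])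
  note a0 = T.a0 and uc = T.WK_c[OF u(1)]
  have kP: "sr k \<in> Per a" if "k \<in> K" for k using that K(2) z[of "sr k"] roots_sr by simp
  define \<Gamma> where "\<Gamma> = {z \<in> carrier W. z \<otimes> a = a \<otimes> z \<and> (\<forall>\<beta>\<in>Per a. act z \<beta> = \<beta>)}"
  have \<Gamma>D: "z \<in> carrier W" "z \<otimes> a = a \<otimes> z" "\<And>\<beta>. \<beta> \<in> Per a \<Longrightarrow> act z \<beta> = \<beta>" if "z \<in> \<Gamma>" for z
    using that by (auto simp: \<Gamma>_def)
  have sub: "subgroup \<Gamma> W"
  proof (rule subgroupI)
    show "\<Gamma> \<subseteq> carrier W" using \<Gamma>D by blast
    have "\<one> \<in> \<Gamma>" using a by (simp add: \<Gamma>_def)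
    then show "\<Gamma> \<noteq> {}" by blast
    fix x assume x: "x \<in> \<Gamma>"
    have xi: "act (inv x) \<beta> = \<beta>" if "\<beta> \<in> Per a" for \<beta>
      using act_inv(2)[OF \<Gamma>D(1)[OF x], of \<beta>] \<Gamma>D(3)[OF x that] by simp
    have "inv x \<otimes> a = a \<otimes> inv x"
      by (rule inv_comm_of[OF \<Gamma>D(1)[OF x] a \<Gamma>D(2)[OF x]])
    then show "inv x \<in> \<Gamma>" using \<Gamma>D(1)[OF x] xi by (simp add: \<Gamma>_def)
    fix y assume y: "y \<in> \<Gamma>"
    have "x \<otimes> y \<otimes> a = a \<otimes> (x \<otimes> y)"
      using \<Gamma>D(1,2)[OF x] \<Gamma>D(1,2)[OF y] a by (metis m_assoc)
    then show "x \<otimes> y \<in> \<Gamma>" using \<Gamma>D(1,3)[OF x] \<Gamma>D(1,3)[OF y] by (simp add: \<Gamma>_def act_mult)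
  qed
  note zk = fix_simple_commute[OF T.K]
  have a0e: "a0 = inv u \<otimes> a" using u(2) uc a0 by (simp add: m_assoc[symmetric])
  have \<Gamma>a0: "z \<otimes> a0 = a0 \<otimes> z" if z: "z \<in> \<Gamma>" for z
  proof -
    have "z \<otimes> inv u = inv u \<otimes> z" using zk[OF \<Gamma>D(1)[OF z]] \<Gamma>D(3)[OF z] kP gen_inv[OF T.K u(1)] by blast
    then show ?thesis unfolding a0e using \<Gamma>D(1,2)[OF z] uc a by (metis m_assoc inv_closed)
  qed
  have pc: "z \<otimes> a [^] n = a [^] n \<otimes> z" if z: "z \<in> \<Gamma>" for z and n :: nat
  proof (induction n)
    case 0 then show ?case using \<Gamma>D(1)[OF z] by simp
  next
    case (Suc n) then show ?case using \<Gamma>D(1,2)[OF z] a by (metis m_assoc nat_pow_Suc nat_pow_closed)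
  qed
  have fin_orb: "\<exists>F. finite F \<and> F \<subseteq> carrier W \<and>
        (\<forall>h\<in>carrier W. (\<forall>k\<in>K. pos (act (inv h) (sr k))) \<longrightarrow> w \<otimes> a0 \<otimes> h = h \<otimes> v \<longrightarrow>
           (\<exists>z\<in>\<Gamma>. \<exists>h'\<in>F. h = z \<otimes> h'))" if w: "w \<in> T.WK" and v: "v \<in> carrier W" for w v
  proof -
    define x where "x = w \<otimes> a0"
    have wc: "w \<in> carrier W" using T.WK_c[OF w] .
    have x: "x \<in> carrier W" using wc a0 by (simp add: x_def)
    define w' where "w' = w \<otimes> inv u"
    have w': "w' \<in> generate W K" unfolding w'_def using w u(1) gen_mult gen_inv T.K by metis
    have w'c: "w' \<in> carrier W" using T.WK_c[OF w'] .
    have xa: "x = w' \<otimes> a" unfolding x_def w'_def a0e using wc uc a by (simp add: m_assoc)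
    have w's: "act w' y - y \<in> span (Per a)" for y
    proof -
      have "act w' y - y = (\<Sum>k\<in>K. (act w' y - y) k \<cdot> sr k)"
        using act_gen_outside[OF T.K w'] finite_subset[OF T.K fin] by (intro support_expand) (simp_all add: pw_simps)
      also have "\<dots> \<in> span (Per a)"
        using finite_subset[OF T.K fin] kP by (intro span_sum span_gen)
      finally show ?thesis .
    qed
    have w'P: "act w' y \<in> span (Per a)" if "y \<in> span (Per a)" for y
      using span_add[OF w's[of y] that] by (simp add: add.commute)
    have aP: "act a y \<in> span (Per a)" if "y \<in> span (Per a)" for y
      using span_gen[OF Per_act[OF a], of _ 1] by (intro span_act[OF a that]) (simp add: smul_one)
    \<comment> \<open>x and a differ by a factor in \<open>W_K\<close>, whose roots are periodic, so
      their powers act alike modulo the span of the periodic roots.\<close>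
    have xd: "act (x [^] n) y - act (a [^] n) y \<in> span (Per a)" for n :: nat and y
    proof (induction n)
      case 0 show ?case by (simp add: span.zero)
    next
      case (Suc n)
      let ?s = "act (x [^] n) y - act (a [^] n) y"
      have xe: "act x t = act w' (act a t)" for t unfolding xa by (rule act_mult[OF w'c a])
      have "act (x [^] Suc n) y - act (a [^] Suc n) y = act w' (act a ?s) + (act w' (act (a [^] Suc n) y) - act (a [^] Suc n) y)"
        unfolding act_pow_Suc(2)[OF x] act_pow_Suc(2)[OF a] xe using a w'c by (simp add: act_diff)
      then show ?case by (simp only:) (intro span_add w's w'P aP Suc)
    qed
    have Px: "Per x = Per a"
    proof (intro equalityI subsetI)
      fix \<beta> assume b: "\<beta> \<in> Per x"
      have br: "\<beta> \<in> roots" using b by (simp add: Per_def)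
      obtain d :: nat where d: "d > 0" "act (x [^] d) \<beta> = \<beta>" by (rule PerE[OF x b])
      let ?m = "d * N"
      have "act (x [^] ?m) \<beta> = \<beta>" by (rule act_pow_multiple[OF x d(2)])
      then have "(-1) \<cdot> (act (x [^] ?m) \<beta> - act (a [^] ?m) \<beta>) = act (a [^] ?m) \<beta> - \<beta>" by (auto simp: pw)
      then have v: "act (a [^] ?m) \<beta> - \<beta> \<in> span (Per a)" (is "?v \<in> _") using span_smul[OF xd] by metis
      have c: "a [^] ?m \<in> carrier W" using a by simp
      \<comment> \<open>A root periodic for x but not for a would be translated by a vector of this
        span under a power of a, and \<open>span_not_imag\<close> excludes such
        translations.\<close>
      have "?v = 0"
      proof (rule ccontr)
        assume "?v \<noteq> 0"
        moreover have "act (a [^] ?m) ?v = ?v"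
          by (rule span_fix[OF c v]) (use act_pow_multiple[OF a N(2), of _ d] in \<open>simp add: mult.commute\<close>)
        ultimately have "imag ?v \<or> imag (- ?v)" by (intro translation_imag[OF c br]) simp_all
        then show False using R.span_not_imag[OF v] R.span_uminus_not_imag[OF v] by blast
      qed
      then show "\<beta> \<in> Per a" using a br d N by (intro PerI[of a \<beta> ?m]) auto
    next
      fix \<beta> assume b: "\<beta> \<in> Per a"
      have pa: "act x \<beta> \<in> Per a" if b: "\<beta> \<in> Per a" for \<beta>
      proof -
        have "act w' \<beta> \<in> Per a" if b: "\<beta> \<in> Per a" for \<beta>
        proof -
          have e: "Per a = PhiK K"
          proof -
            have "L \<beta> = 0 \<longleftrightarrow> \<beta> \<in> PhiK K" if "\<beta> \<in> roots" for \<beta>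
              using lin_dominant_root(3)[of L, OF L that] K(2) by simp
            then show ?thesis using z R by (auto simp: PhiK_def)
          qed
          show ?thesis using T.PhiK_gen[OF w'] b unfolding e by blast
        qed
        then show ?thesis unfolding xa using Per_act[OF a b] by (simp add: act_mult[OF w'c a])
      qed
      have "act (x [^] n) \<beta> \<in> Per a" for n :: nat
        by (induction n) (simp_all only: act_pow_Suc(2)[OF x] pa nat_pow_0 act_one b)
      then have "range (\<lambda>n::nat. act (x [^] n) \<beta>) \<subseteq> Per a" by blast
      then show "\<beta> \<in> Per x" using finite_subset f R[OF b] by (auto simp: Per_def)
    qed
    define H where "H = {h \<in> carrier W. x \<otimes> h = h \<otimes> v}"
    show ?thesis
    proof (cases "H = {}")
      case True
      then show ?thesis unfolding x_def[symmetric] by (intro exI[of _ "{}"]) (auto simp: H_def)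
    next
      case False
      then obtain hs where hs: "hs \<in> carrier W" "x \<otimes> hs = hs \<otimes> v" by (auto simp: H_def)
      let ?r = "\<lambda>h. restrict (act (h \<otimes> inv hs)) (Per a)"
      have comm: "(h \<otimes> inv i) \<otimes> x = x \<otimes> (h \<otimes> inv i)" if "h \<in> H" "i \<in> H" for h i
        using that conj_solutions_commute[OF _ _ x v, of h i] by (simp add: H_def)
      have pz: "act z \<beta> \<in> Per x" if z: "z \<in> carrier W" "z \<otimes> x = x \<otimes> z" and b: "\<beta> \<in> Per x" for z \<beta>
      proof -
        obtain d :: nat where d: "d > 0" "act (x [^] d) \<beta> = \<beta>" by (rule PerE[OF x b])
        have zp: "z \<otimes> x [^] n = x [^] n \<otimes> z" for n :: nat
        proof (induction n)
          case (Suc n) then show ?case using z x by (metis m_assoc nat_pow_Suc nat_pow_closed)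
        qed (use z in simp)
        have "act (x [^] d) (act z \<beta>) = act z (act (x [^] d) \<beta>)"
          using zp[of d] z x act_mult[of z "x [^] d" \<beta>] act_mult[of "x [^] d" z \<beta>] by simp
        then show ?thesis using d b x z by (intro PerI[of x _ d]) (auto simp: Per_def roots_act)
      qed
      have hH: "hs \<in> H" using hs by (simp add: H_def)
      have Hc: "h \<in> carrier W" if "h \<in> H" for h using that by (simp add: H_def)
      have "?r ` H \<subseteq> Per a \<rightarrow>\<^sub>E Per a"
      proof
        fix \<phi> assume "\<phi> \<in> ?r ` H"
        then obtain h where h: "h \<in> H" "\<phi> = ?r h" by blast
        have "act (h \<otimes> inv hs) \<beta> \<in> Per a" if "\<beta> \<in> Per a" for \<beta>
          using pz[OF _ comm[OF h(1) hH]] Hc[OF h(1)] hs(1) that unfolding Px by simp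
        then show "\<phi> \<in> Per a \<rightarrow>\<^sub>E Per a" unfolding h(2) by auto
      qed
      then have "finite (?r ` H)" using finite_PiE[OF f, of "\<lambda>_. Per a"] f finite_subset by blast
      then obtain F where F: "F \<subseteq> H" "finite F" "?r ` H = ?r ` F"
        using finite_subset_image[of "?r ` H" ?r H] by blast
      show ?thesis unfolding x_def[symmetric]
      proof (intro exI[of _ F] conjI ballI impI)
        show "finite F" "F \<subseteq> carrier W" using F Hc by auto
        fix h assume "h \<in> carrier W" "x \<otimes> h = h \<otimes> v"
        then have h: "h \<in> H" by (simp add: H_def)
        then have "?r h \<in> ?r ` F" using F(3) by blast
        then obtain i where i: "i \<in> F" "?r h = ?r i" by auto
        have iH: "i \<in> H" using i F by blast
        note hc = Hc[OF h] and ic = Hc[OF iH]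
        let ?z = "h \<otimes> inv i"
        have zc: "?z \<in> carrier W" using hc ic by simp
        have zP: "act ?z \<beta> = \<beta>" if b: "\<beta> \<in> Per a" for \<beta>
        proof -
          let ?t = "i \<otimes> inv hs"
          have tc: "?t \<in> carrier W" using ic hs by simp
          have "inv ?t \<otimes> x = x \<otimes> inv ?t" by (rule inv_comm_of[OF tc x comm[OF iH hH]])
          then have p: "act (inv ?t) \<beta> \<in> Per a" using pz[of "inv ?t" \<beta>] tc b unfolding Px by simp
          have "act (h \<otimes> inv hs) (act (inv ?t) \<beta>) = act ?t (act (inv ?t) \<beta>)"
            using fun_cong[OF i(2), of "act (inv ?t) \<beta>"] p by simp
          moreover have "?z = (h \<otimes> inv hs) \<otimes> inv ?t" using hc ic hs by (simp add: inv_mult_group m_assoc cancel_inv)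
          ultimately show ?thesis using hc hs tc by (simp add: act_mult)
        qed
        have "?z \<otimes> w' = w' \<otimes> ?z" using zk[OF zc _ w'] zP kP by blast
        moreover have "?z \<otimes> x = x \<otimes> ?z" by (rule comm[OF h iH])
        moreover have "a = inv w' \<otimes> x" unfolding xa using w'c a by (simp add: m_assoc[symmetric])
        moreover have "?z \<otimes> inv w' = inv w' \<otimes> ?z" using zk[OF zc _ gen_inv[OF T.K w']] zP kP by blast
        ultimately have "?z \<otimes> a = a \<otimes> ?z" using zc w'c x by (metis m_assoc inv_closed)
        then have "?z \<in> \<Gamma>" using zc zP by (simp add: \<Gamma>_def)
        moreover have "h = ?z \<otimes> i" using hc ic by (simp add: m_assoc)
        ultimately show "\<exists>z\<in>\<Gamma>. \<exists>h'\<in>F. h = z \<otimes> h'" using i by blast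
      qed
    qed
  qed
  \<comment> \<open>Finiteness holds here for every w in \<open>W_K\<close>, so the plain counting
    function \<open>trphi u\<close> can serve as \<phi>.\<close>
  show ?thesis unfolding u(2)
  proof (rule T.class_trace_exists[where g = g and \<Gamma> = \<Gamma> and f = "T.trphi u"])
    show "g \<in> carrier W" "isolated g" "\<And>k. k \<in> K \<Longrightarrow> act g (sr k) = sr k" "a0 \<otimes> g = g \<otimes> a0"
      "\<And>\<beta>. \<beta> \<in> roots \<Longrightarrow> act g \<beta> = \<beta> \<Longrightarrow> pos (act a0 \<beta>) = pos \<beta>" "u \<in> T.WK" "subgroup \<Gamma> W"
      "\<And>z. z \<in> \<Gamma> \<Longrightarrow> z \<otimes> a0 = a0 \<otimes> z"
      by (fact g iso gk a0g u(1) sub \<Gamma>a0)+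
    show "z \<otimes> g = g \<otimes> z" if "z \<in> \<Gamma>" for z unfolding g_def by (rule pc[OF that])
    show "act z (sr k) = sr k" if "z \<in> \<Gamma>" "k \<in> K" for z k using \<Gamma>D(3)[OF that(1) kP[OF that(2)]] .
    show "pos (act z \<beta>) = pos \<beta>" if "z \<in> \<Gamma>" "\<beta> \<in> roots" "act g \<beta> = \<beta>" for z \<beta>
      using \<Gamma>D(3)[OF that(1) gP[OF that(2,3)]] by simp
    show "T.tt (T.trphi u)" by (rule T.tt_trphi[OF u(1)])
    show "0 \<le> ev1 (T.trphi u w)" if "w \<in> T.WK" for w by (rule T.ev1_trphi(1)[OF u(1) that])
    show "(0 < ev1 (T.trphi u w)) = T.tconj u w" if "w \<in> T.WK" for w by (rule T.ev1_trphi(2)[OF u(1) that])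
    show "\<exists>F. finite F \<and> F \<subseteq> carrier W \<and>
        (\<forall>h\<in>carrier W. (\<forall>k\<in>K. pos (act (inv h) (sr k))) \<longrightarrow> w \<otimes> a0 \<otimes> h = h \<otimes> v \<longrightarrow>
           (\<exists>z\<in>\<Gamma>. \<exists>h'\<in>F. h = z \<otimes> h'))" if "w \<in> T.WK" "T.trphi u w \<noteq> 0" "v \<in> carrier W" for w v
      by (rule fin_orb[OF that(1,3)])
  qed
qed

theorem finite_Per:
  assumes a: "a \<in> carrier W" and f: "finite (Per a)"
  shows "\<exists>f. class_trace (cls a) f"
proof -
  interpret R: finite_reflections W S A "Per a" by (rule Per_reflections[OF a f])
  obtain L where L: "lin L" "finite {\<beta> \<in> roots. pos \<beta> \<and> L \<beta> < 0}" "\<And>\<beta>. \<beta> \<in> Per a \<Longrightarrow> L \<beta> = 0"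
    "\<And>\<beta>. \<beta> \<in> roots \<Longrightarrow> L \<beta> = 0 \<Longrightarrow> \<exists>c\<noteq>0. c \<cdot> \<beta> \<in> span (Per a)"
    using R.ex_functional by blast
  obtain N :: nat where N: "N > 0" "\<And>\<beta>. \<beta> \<in> Per a \<Longrightarrow> act (a [^] N) \<beta> = \<beta>"
    using common_period[OF a f subset_refl] by blast
  have c: "a [^] N \<in> carrier W" using a by simp
  have z: "L \<beta> = 0 \<longleftrightarrow> \<beta> \<in> Per a" if b: "\<beta> \<in> roots" for \<beta>
  proof
    assume "L \<beta> = 0"
    then obtain d where d: "d \<noteq> 0" "d \<cdot> \<beta> \<in> span (Per a)" using L(4)[OF b] by blast
    have "act (a [^] N) (d \<cdot> \<beta>) = d \<cdot> \<beta>" by (rule span_fix[OF c d(2) N(2)])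
    then have "act (a [^] N) \<beta> = \<beta>" using d(1) c by (auto simp: act_smul pw)
    then show "\<beta> \<in> Per a" using a b N(1) by (intro PerI[of a \<beta> N])
  qed (rule L(3))
  obtain w where w: "w \<in> carrier W" "\<And>s. s \<in> S \<Longrightarrow> L (act (inv w) (sr s)) \<ge> 0"
    using dominant_conjugate[OF L(1,2)] by blast
  let ?a = "w \<otimes> a \<otimes> inv w"
  have ac: "?a \<in> carrier W" using a w by simp
  have "Per ?a \<subseteq> act w ` Per a"
  proof
    fix \<beta> assume b: "\<beta> \<in> Per ?a"
    have "act (inv w) \<beta> \<in> Per a" using b Per_conj[OF a w(1), of \<beta>] by (simp add: Per_def)
    then have "act w (act (inv w) \<beta>) \<in> act w ` Per a" by (rule imageI)
    then show "\<beta> \<in> act w ` Per a" using w(1) by simp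
  qed
  then have "finite (Per ?a)" using f finite_subset by blast
  then have "\<exists>f. class_trace (cls ?a) f"
  proof (rule finite_Per_dominant[OF ac])
    show "lin (\<lambda>v. L (act (inv w) v))" by (rule lin_act[OF L(1)]) (use w in simp)
    show "0 \<le> L (act (inv w) (sr s))" if "s \<in> S" for s by (rule w(2)[OF that])
    show "(L (act (inv w) \<beta>) = 0) = (\<beta> \<in> Per ?a)" if "\<beta> \<in> roots" for \<beta>
      using z[of "act (inv w) \<beta>"] Per_conj[OF a w(1) that] roots_act[OF _ that, of "inv w"] w(1) by simp
  qed
  then show ?thesis using cls_conj[OF a w(1)] by simp
qed

section \<open>The affine case\<close>

lemma A_nonpos: "s \<in> S \<Longrightarrow> t \<in> S \<Longrightarrow> s \<noteq> t \<Longrightarrow> A s t \<le> 0"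
  using A_rel[of s t] by auto

text \<open>Off-diagonal Cartan integers are nonpositive, so at a zero of u every term of the coroot
  is nonpositive. If the sum is nonnegative all terms vanish, and the zero spreads to the
  neighbours.\<close>

lemma coroot_eq_zero_closed:
  assumes s: "s \<in> S" and u: "\<And>t. t \<in> S \<Longrightarrow> u t \<ge> 0" "u s = 0" and c: "coroot s u \<ge> 0"
    and t: "t \<in> S" "A s t \<noteq> 0"
  shows "u t = 0"
proof -
  have le: "A s r * u r \<le> 0" if "r \<in> S" for r
    using A_nonpos[OF s that] u(1)[OF that] u(2) by (cases "r = s") (auto simp: mult_le_0_iff)
  have "(\<Sum>r\<in>S. - (A s r * u r)) = 0"
  proof -
    have "(\<Sum>r\<in>S. - (A s r * u r)) = - coroot s u" by (simp add: coroot_def sum_negf)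
    moreover have "(\<Sum>r\<in>S. - (A s r * u r)) \<ge> 0" using le by (intro sum_nonneg) auto
    ultimately show ?thesis using c by linarith
  qed
  then have "\<forall>r\<in>S. - (A s r * u r) = 0" using le fin by (subst (asm) sum_nonneg_eq_0_iff) auto
  then show ?thesis using t by auto
qed

lemma diff_nonzero_at: "u \<noteq> v \<Longrightarrow> \<exists>x. (v - u) x \<noteq> 0" for u v :: "'w \<Rightarrow> int"
proof -
  assume "u \<noteq> v"
  then obtain x where "u x \<noteq> v x" by (auto simp: fun_eq_iff)
  then show ?thesis by (intro exI[of _ x]) (simp add: pw_simps)
qed

lemma finite_factor:
  assumes f: "finite (p ` X)" and e: "\<And>x y. x \<in> X \<Longrightarrow> y \<in> X \<Longrightarrow> p x = p y \<Longrightarrow> q x = q y"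
  shows "finite (q ` X)"
proof -
  define r where "r k = (SOME x. x \<in> X \<and> p x = k)" for k
  have "q ` X \<subseteq> (\<lambda>k. q (r k)) ` (p ` X)"
  proof
    fix z assume "z \<in> q ` X"
    then obtain x where x: "x \<in> X" "z = q x" by blast
    have "\<exists>y. y \<in> X \<and> p y = p x" using x by blast
    from someI_ex[OF this] have "r (p x) \<in> X" "p (r (p x)) = p x" by (auto simp: r_def)
    then have "q (r (p x)) = z" using e x by blast
    then show "z \<in> (\<lambda>k. q (r k)) ` (p ` X)" using x(1) by blast
  qed
  then show ?thesis using f finite_subset by blast
qed

definition supp :: "('w \<Rightarrow> int) \<Rightarrow> bool" where "supp v \<longleftrightarrow> (\<forall>x. x \<notin> S \<longrightarrow> v x = 0)"

lemma supp_root: "\<beta> \<in> roots \<Longrightarrow> supp \<beta>" using root_support by (simp add: supp_def)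
lemma supp_act: "supp v \<Longrightarrow> w \<in> carrier W \<Longrightarrow> supp (act w v)" using act_outside by (simp add: supp_def)
lemma supp_sum: "(\<And>i. i \<in> I \<Longrightarrow> supp (f i)) \<Longrightarrow> supp (\<Sum>i\<in>I. f i)" by (simp add: supp_def sum_fun_apply)

lemma supp_expand: "supp v \<Longrightarrow> v = (\<Sum>s\<in>S. v s \<cdot> sr s)"
  by (rule support_expand[OF fin]) (simp add: supp_def)

lemma lin_eqI:
  assumes "lin L" "lin L'" "\<And>s. s \<in> S \<Longrightarrow> L (sr s) = L' (sr s)" "supp v"
  shows "L v = L' v"
proof -
  have *: "L v = (\<Sum>s\<in>S. v s * L (sr s))" if L: "lin L" for L
  proof -
    have "L v = L (\<Sum>s\<in>S. v s \<cdot> sr s)" using supp_expand[OF assms(4)] by (rule arg_cong)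
    then show ?thesis using L by (simp add: lin_sum[OF L fin] lin_def)
  qed
  show ?thesis unfolding *[OF assms(1)] *[OF assms(2)] using assms(3) by simp
qed

lemma lin_npair: "\<gamma> \<in> roots \<Longrightarrow> lin (\<lambda>v. npair v \<gamma>)"
  by (simp add: lin_def npair_lin)

lemma npair_eq_zero: "\<gamma> \<in> roots \<Longrightarrow> act (rfl \<gamma>) v = v \<Longrightarrow> npair v \<gamma> = 0"
proof -
  assume g: "\<gamma> \<in> roots" and "act (rfl \<gamma>) v = v"
  then have "v - npair v \<gamma> \<cdot> \<gamma> = v" by (simp add: act_rfl)
  then have "npair v \<gamma> * \<gamma> x = 0" for x by (auto simp: pw dest: fun_cong[of _ _ x])
  then show ?thesis using root_nonzero[OF g] by (auto simp: pw)
qed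

end

text \<open>A strictly positive vector in the radical of an indecomposable Cartan matrix
  characterises affine type; \<open>conn\<close> expresses indecomposability through sets closed
  under neighbours. The node \<open>s0\<close> is where multiples of \<delta> are read off.\<close>

locale affine_gcm = coxeter_gcm W S A for W :: "'w monoid" (structure) and S A +
  fixes \<delta> :: "'w \<Rightarrow> int" and s0 :: 'w
  assumes \<delta>_supp: "supp \<delta>" and \<delta>_pos: "\<And>s. s \<in> S \<Longrightarrow> \<delta> s > 0"
    and \<delta>_rad: "\<And>s. s \<in> S \<Longrightarrow> coroot s \<delta> = 0" and s0: "s0 \<in> S"
    and conn: "\<And>Z. Z \<subseteq> S \<Longrightarrow> Z \<noteq> {} \<Longrightarrow> (\<And>s t. s \<in> Z \<Longrightarrow> t \<in> S \<Longrightarrow> A s t \<noteq> 0 \<Longrightarrow> t \<in> Z) \<Longrightarrow> Z = S"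
    and inf: "infinite roots"
begin

text \<open>Membership in the rational line through \<open>\<delta>\<close>, without denominators.\<close>

definition rad :: "('w \<Rightarrow> int) \<Rightarrow> bool" where "rad v \<longleftrightarrow> \<delta> s0 \<cdot> v = v s0 \<cdot> \<delta>"

lemma dlD: "rad v \<Longrightarrow> \<delta> s0 * v x = v s0 * \<delta> x"
  unfolding rad_def by (drule fun_cong[of _ _ x]) (simp add: pw_simps)

lemma dlI: "(\<And>x. \<delta> s0 * v x = v s0 * \<delta> x) \<Longrightarrow> rad v" by (auto simp: rad_def pw)

lemma \<delta>0: "\<delta> s0 > 0" using \<delta>_pos s0 .

lemma \<delta>_fix: "w \<in> carrier W \<Longrightarrow> act w \<delta> = \<delta>" by (rule fixed_of_coroot_zero[OF \<delta>_rad])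

lemma rad_add:
  assumes "rad u" "rad v"
  shows "rad (u + v)"
  using dlD[OF assms(1)] dlD[OF assms(2)] by (intro dlI) (simp add: pw_simps distrib_left distrib_right)

lemma rad_smul:
  assumes "rad v"
  shows "rad (c \<cdot> v)"
proof (rule dlI)
  fix x
  have "c * (\<delta> s0 * v x) = c * (v s0 * \<delta> x)" using dlD[OF assms, of x] by simp
  then show "\<delta> s0 * (c \<cdot> v) x = (c \<cdot> v) s0 * \<delta> x" by (simp add: pw_simps algebra_simps)
qed

lemma rad_diff:
  assumes "rad u" "rad v"
  shows "rad (u - v)"
proof -
  have "u - v = u + (-1) \<cdot> v" by (auto simp: pw)
  then show ?thesis using rad_add[OF assms(1) rad_smul[OF assms(2)]] by metis
qed

lemma rad_zero: "rad 0" by (rule dlI) (simp add: pw_simps)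
lemma rad_\<delta>: "rad \<delta>" by (rule dlI) simp
lemma rad_sum: "finite I \<Longrightarrow> (\<And>i. i \<in> I \<Longrightarrow> rad (f i)) \<Longrightarrow> rad (\<Sum>i\<in>I. f i)"
  by (induction I rule: finite_induct) (auto intro: rad_zero rad_add)

lemma rad_eq_zero: "rad v \<Longrightarrow> v s0 = 0 \<Longrightarrow> v = 0"
  using dlD[of v] \<delta>0 by (auto simp: pw)

lemma rad_smul_cancel: "c \<noteq> 0 \<Longrightarrow> rad (c \<cdot> v) \<Longrightarrow> rad v"
proof (rule dlI)
  fix x assume c: "c \<noteq> 0" "rad (c \<cdot> v)"
  have "c * (\<delta> s0 * v x) = c * (v s0 * \<delta> x)" using dlD[OF c(2), of x] by (simp add: pw_simps algebra_simps)
  then show "\<delta> s0 * v x = v s0 * \<delta> x" using c(1) by simp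
qed

lemma rad_fix: "rad v \<Longrightarrow> w \<in> carrier W \<Longrightarrow> act w v = v"
proof -
  assume v: "rad v" and w: "w \<in> carrier W"
  have "\<delta> s0 \<cdot> act w v = act w (\<delta> s0 \<cdot> v)" using w by (simp add: act_smul)
  also have "\<dots> = act w (v s0 \<cdot> \<delta>)" using v by (simp add: rad_def)
  also have "\<dots> = \<delta> s0 \<cdot> v" using v w by (simp add: act_smul \<delta>_fix rad_def)
  finally show ?thesis using \<delta>0 by (auto simp: pw)
qed

text \<open>At a node m where the ratio of v to \<delta> is largest,
  \<open>v m \<cdot> \<delta> - \<delta> m \<cdot> v\<close> is zero; elsewhere it is nonnegative.
  By \<open>coroot_eq_zero_closed\<close> the zero spreads over the connected graph.\<close>

lemma antidominant_rad:
  assumes v: "supp v" and c: "\<And>s. s \<in> S \<Longrightarrow> coroot s v \<le> 0"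
  shows "rad v"
proof -
  obtain m where m: "m \<in> S" "\<And>s. s \<in> S \<Longrightarrow> v s * \<delta> m \<le> v m * \<delta> s"
  proof -
    let ?q = "\<lambda>s. real_of_int (v s) / real_of_int (\<delta> s)"
    have "Max (?q ` S) \<in> ?q ` S" by (rule Max_in) (use fin s0 in auto)
    then obtain m where m1: "m \<in> S" "?q m = Max (?q ` S)" by auto
    then have m: "m \<in> S" "\<And>s. s \<in> S \<Longrightarrow> ?q s \<le> ?q m" using fin by simp_all
    have "v s * \<delta> m \<le> v m * \<delta> s" if s: "s \<in> S" for s
    proof -
      have "real_of_int (v s * \<delta> m) \<le> real_of_int (v m * \<delta> s)"
        using m(2)[OF s] \<delta>_pos[OF s] \<delta>_pos[OF m(1)] by (simp add: field_simps)
      then show ?thesis by (simp only: of_int_le_iff)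
    qed
    then show ?thesis using that m by blast
  qed
  define u where "u = v m \<cdot> \<delta> - \<delta> m \<cdot> v"
  have u: "u s \<ge> 0" if "s \<in> S" for s using m(2)[OF that] by (simp add: u_def pw_simps mult.commute)
  have cu: "coroot s u \<ge> 0" if "s \<in> S" for s
  proof -
    have "coroot s u = v m * coroot s \<delta> - \<delta> m * coroot s v"
      by (simp add: u_def coroot_def pw_simps sum_distrib_left sum_subtractf algebra_simps)
    moreover have "\<delta> m * coroot s v \<le> 0" using \<delta>_pos[OF m(1)] c[OF that] by (simp add: mult_le_0_iff)
    ultimately show ?thesis using \<delta>_rad[OF that] by simp
  qed
  have "{s \<in> S. u s = 0} = S"
  proof (rule conn)
    have "u m = 0" by (simp add: u_def pw_simps)
    then show "{s \<in> S. u s = 0} \<noteq> {}" using m(1) by blast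
    show "t \<in> {s \<in> S. u s = 0}" if "s \<in> {s \<in> S. u s = 0}" "t \<in> S" "A s t \<noteq> 0" for s t
      using coroot_eq_zero_closed[of s u t] u cu that by simp
  qed auto
  then have "u x = 0" for x using v \<delta>_supp by (cases "x \<in> S") (auto simp: u_def pw_simps supp_def)
  then have e: "v m * \<delta> x = \<delta> m * v x" for x by (simp add: u_def pw_simps)
  have "rad (\<delta> m \<cdot> v)"
  proof -
    have "\<delta> m \<cdot> v = v m \<cdot> \<delta>" by (auto simp: pw e)
    then show ?thesis using rad_smul[OF rad_\<delta>] by simp
  qed
  then show ?thesis using \<delta>_pos[OF m(1)] by (intro rad_smul_cancel[of "\<delta> m" v]) simp_all
qed

lemma imag_rad:
  assumes c: "imag \<theta>"
  shows "rad \<theta>"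
proof -
  obtain x where x: "x \<in> carrier W" "\<And>s. s \<in> S \<Longrightarrow> coroot s (act x \<theta>) \<le> 0" using imag_antidominant_conj[OF c] by blast
  have "supp \<theta>" using c by (simp add: imag_def supp_def)
  then have d: "rad (act x \<theta>)" using x by (intro antidominant_rad supp_act)
  have "\<theta> = act (inv x) (act x \<theta>)" using x(1) by simp
  also have "\<dots> = act x \<theta>" by (rule rad_fix[OF d]) (use x(1) in simp)
  finally show ?thesis using d by simp
qed

section \<open>Finiteness of the root system modulo \<delta>\<close>

lemma npair_rad: "rad v \<Longrightarrow> \<gamma> \<in> roots \<Longrightarrow> npair v \<gamma> = 0"
  using rad_fix by (intro npair_eq_zero) auto

lemma imaginary_rad:
  assumes "\<beta> \<in> roots" "\<gamma> \<in> roots" "\<beta> \<noteq> \<gamma>" "\<beta> \<noteq> - \<gamma>"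
    "npair \<beta> \<gamma> * npair \<gamma> \<beta> < 0 \<or> npair \<beta> \<gamma> * npair \<gamma> \<beta> \<ge> 4"
  shows "rad (2 \<cdot> \<beta> - npair \<beta> \<gamma> \<cdot> \<gamma>)"
proof -
  let ?v = "2 \<cdot> \<beta> - npair \<beta> \<gamma> \<cdot> \<gamma>"
  have "rad ?v \<or> rad (- ?v)" using imaginary_pair[OF assms] imag_rad by blast
  moreover have "(-1) \<cdot> (- ?v) = ?v" by (auto simp: pw)
  ultimately show ?thesis using rad_smul[of "- ?v" "-1"] by metis
qed

text \<open>A pair with product outside 0 to 4 would give a vector in the radical. Its pairing with
  \<beta> vanishes, and this says that the product is 4.\<close>

lemma npair_bound:
  assumes b: "\<beta> \<in> roots" and g: "\<gamma> \<in> roots"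
  shows "npair \<beta> \<gamma> \<in> {-4..4}"
proof (cases "\<beta> = \<gamma> \<or> \<beta> = - \<gamma>")
  case True
  then show ?thesis using g npair_self npair_lin(4) by auto
next
  case False
  define m where "m = npair \<beta> \<gamma>"
  define n where "n = npair \<gamma> \<beta>"
  have r: "0 \<le> m * n \<and> m * n \<le> 4"
  proof (rule ccontr)
    assume H: "\<not> ?thesis"
    then have "rad (2 \<cdot> \<beta> - m \<cdot> \<gamma>)" using False unfolding m_def n_def by (intro imaginary_rad[OF b g]) auto
    then have "npair (2 \<cdot> \<beta> - m \<cdot> \<gamma>) \<beta> = 0" by (rule npair_rad[OF _ b])
    then have "m * n = 4" using npair_lin[OF b] npair_self[OF b] by (simp add: n_def)
    then show False using H by simp
  qed
  then have r': "0 \<le> npair \<beta> \<gamma> * npair \<gamma> \<beta>" "npair \<beta> \<gamma> * npair \<gamma> \<beta> \<le> 4" by (simp_all add: m_def n_def)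
  have "\<bar>npair \<beta> \<gamma>\<bar> \<le> 4" using npair_le_product[OF b g r'(1)] r'(2) by linarith
  then show ?thesis by auto
qed

text \<open>The coroot of \<open>\<gamma>\<close> as a function on simple roots. Its values are
  bounded, so finitely many functions occur; they label the roots modulo \<delta>.\<close>

definition \<kappa> where "\<kappa> \<gamma> = restrict (\<lambda>s. npair (sr s) \<gamma>) S"

lemma \<kappa>_fin: "finite (\<kappa> ` roots)"
proof -
  have "\<kappa> ` roots \<subseteq> S \<rightarrow>\<^sub>E {-4..4}" using npair_bound roots_sr unfolding \<kappa>_def by fastforce
  moreover have "finite (S \<rightarrow>\<^sub>E {-4..4::int})" using fin by (intro finite_PiE) auto
  ultimately show ?thesis by (rule finite_subset)
qed

lemma \<kappa>_npair:
  assumes "\<beta> \<in> roots" "\<gamma> \<in> roots" "\<kappa> \<beta> = \<kappa> \<gamma>" "supp v"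
  shows "npair v \<beta> = npair v \<gamma>"
proof (rule lin_eqI[where L = "\<lambda>v. npair v \<beta>" and L' = "\<lambda>v. npair v \<gamma>"])
  show "npair (sr s) \<beta> = npair (sr s) \<gamma>" if "s \<in> S" for s
    using fun_cong[OF assms(3), of s] that by (simp add: \<kappa>_def)
qed (use assms lin_npair in auto)

lemma \<kappa>I:
  assumes "\<And>v. supp v \<Longrightarrow> npair v \<beta> = npair v \<gamma>"
  shows "\<kappa> \<beta> = \<kappa> \<gamma>"
  using assms supp_root[OF roots_sr] by (auto simp: \<kappa>_def restrict_def)

text \<open>Equal coroots make both pairings equal to 2. This is the borderline product 4, whose
  imaginary vector is twice the difference of the roots.\<close>

lemma \<kappa>_rad:
  assumes b: "\<beta> \<in> roots" and g: "\<gamma> \<in> roots" and e: "\<kappa> \<beta> = \<kappa> \<gamma>"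
  shows "rad (\<beta> - \<gamma>)"
proof (cases "\<beta> = \<gamma>")
  case True then show ?thesis using rad_zero by simp
next
  case False
  have n: "npair \<beta> \<gamma> = 2" "npair \<gamma> \<beta> = 2"
    using \<kappa>_npair[OF b g e supp_root[OF b]] \<kappa>_npair[OF b g e supp_root[OF g]] npair_self b g by auto
  have "\<beta> \<noteq> - \<gamma>" using n npair_lin(4)[OF g, of \<gamma>] npair_self[OF g] by auto
  then have "rad (2 \<cdot> \<beta> - npair \<beta> \<gamma> \<cdot> \<gamma>)" using False n by (intro imaginary_rad[OF b g]) auto
  moreover have "2 \<cdot> \<beta> - npair \<beta> \<gamma> \<cdot> \<gamma> = 2 \<cdot> (\<beta> - \<gamma>)" unfolding n by (auto simp: pw)
  ultimately show ?thesis using rad_smul_cancel[of 2 "\<beta> - \<gamma>"] by simp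
qed

lemma \<kappa>_act:
  assumes "\<beta> \<in> roots" "\<gamma> \<in> roots" "\<kappa> \<beta> = \<kappa> \<gamma>" "w \<in> carrier W"
  shows "\<kappa> (act w \<beta>) = \<kappa> (act w \<gamma>)"
proof (rule \<kappa>I)
  fix v assume v: "supp v"
  have "npair v (act w \<xi>) = npair (act (inv w) v) \<xi>" if "\<xi> \<in> roots" for \<xi>
    using rfl_act(2)[OF assms(4) that, of "act (inv w) v"] assms(4) by simp
  then show "npair v (act w \<beta>) = npair v (act w \<gamma>)"
    using \<kappa>_npair[OF assms(1-3), of "act (inv w) v"] supp_act[OF v] assms by simp
qed

text \<open>Translations are the elements acting trivially modulo \<open>\<delta>\<close>; \<open>\<tau> t v\<close> measures the multiple of \<open>\<delta>\<close> that
  \<open>t\<close> adds to \<open>v\<close>.\<close>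

definition T where "T = {t \<in> carrier W. \<forall>s\<in>S. rad (act t (sr s) - sr s)}"

lemma T_c: "t \<in> T \<Longrightarrow> t \<in> carrier W" by (simp add: T_def)

lemma T_rad: "t \<in> T \<Longrightarrow> supp v \<Longrightarrow> rad (act t v - v)"
proof -
  assume t: "t \<in> T" and v: "supp v"
  have tc: "t \<in> carrier W" using T_c[OF t] .
  have "act t v = (\<Sum>s\<in>S. v s \<cdot> act t (sr s))" by (rule act_expand[OF fin _ tc]) (use v in \<open>simp add: supp_def\<close>)
  then have "act t v - v = (\<Sum>s\<in>S. v s \<cdot> act t (sr s)) - (\<Sum>s\<in>S. v s \<cdot> sr s)"
    using supp_expand[OF v] by (simp only:)
  also have "\<dots> = (\<Sum>s\<in>S. v s \<cdot> (act t (sr s) - sr s))"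
    unfolding sum_subtractf[symmetric] by (rule sum.cong) (auto simp: pw algebra_simps)
  finally show ?thesis using t by (simp only:) (intro rad_sum fin rad_smul, simp add: T_def)
qed

lemma TI: "t \<in> carrier W \<Longrightarrow> (\<And>s. s \<in> S \<Longrightarrow> rad (act t (sr s) - sr s)) \<Longrightarrow> t \<in> T" by (simp add: T_def)

definition \<tau> where "\<tau> t v = (act t v - v) s0"

lemma \<tau>_lin: "t \<in> carrier W \<Longrightarrow> lin (\<tau> t)"
  by (simp add: lin_def \<tau>_def act_add act_smul pw_simps algebra_simps)

lemma \<tau>_zero: "t \<in> T \<Longrightarrow> supp v \<Longrightarrow> act t v = v \<longleftrightarrow> \<tau> t v = 0"
proof
  assume "t \<in> T" "supp v" "\<tau> t v = 0"
  then have "act t v - v = 0" using T_rad by (intro rad_eq_zero) (simp_all add: \<tau>_def)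
  then show "act t v = v" by simp
qed (simp add: \<tau>_def pw_simps)

lemma \<tau>_rad: "rad x \<Longrightarrow> t \<in> carrier W \<Longrightarrow> \<tau> t x = 0" by (simp add: \<tau>_def rad_fix pw_simps)

lemma \<tau>_mult: "t \<in> T \<Longrightarrow> t' \<in> T \<Longrightarrow> supp v \<Longrightarrow> \<tau> (t \<otimes> t') v = \<tau> t v + \<tau> t' v"
proof -
  assume t: "t \<in> T" "t' \<in> T" and v: "supp v"
  have "act (t \<otimes> t') v = act t (v + (act t' v - v))" using t T_c by (simp add: act_mult)
  also have "\<dots> = act t v + (act t' v - v)" unfolding act_add[OF T_c[OF t(1)]] using rad_fix[OF T_rad[OF t(2) v] T_c[OF t(1)]] by simp
  finally show ?thesis by (simp add: \<tau>_def pw_simps)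
qed

lemma T_subgroup: "subgroup T W"
proof (rule subgroupI)
  show "T \<subseteq> carrier W" using T_c by blast
  have "\<one> \<in> T" by (rule TI) (simp_all add: rad_zero)
  then show "T \<noteq> {}" by blast
  fix t assume t: "t \<in> T"
  have tc: "t \<in> carrier W" using T_c[OF t] .
  show "inv t \<in> T"
  proof (rule TI)
    fix s assume s: "s \<in> S"
    have d: "rad (act t (sr s) - sr s)" using t s by (simp add: T_def)
    have "act (inv t) (act t (sr s) - sr s) = act t (sr s) - sr s" by (rule rad_fix[OF d]) (use tc in simp)
    then have e: "sr s - act (inv t) (sr s) = act t (sr s) - sr s" using tc by (simp add: act_diff)
    have "act (inv t) (sr s) - sr s = (-1) \<cdot> (sr s - act (inv t) (sr s))" by (auto simp: pw)
    then have "act (inv t) (sr s) - sr s = (-1) \<cdot> (act t (sr s) - sr s)" unfolding e .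
    then show "rad (act (inv t) (sr s) - sr s)" using rad_smul[OF d] by metis
  qed (use tc in simp)
  fix t' assume t': "t' \<in> T"
  show "t \<otimes> t' \<in> T"
  proof (rule TI)
    fix s assume s: "s \<in> S"
    have v: "supp (sr s)" "supp (act t' (sr s))" using supp_root[OF roots_sr[OF s]] supp_act T_c[OF t'] by auto
    have "act (t \<otimes> t') (sr s) - sr s = (act t (act t' (sr s)) - act t' (sr s)) + (act t' (sr s) - sr s)"
      using tc T_c[OF t'] by (simp add: act_mult)
    then show "rad (act (t \<otimes> t') (sr s) - sr s)" using rad_add[OF T_rad[OF t v(2)] T_rad[OF t' v(1)]] by simp
  qed (use tc T_c[OF t'] in simp)
qed

lemma T_mult: "x \<in> T \<Longrightarrow> y \<in> T \<Longrightarrow> x \<otimes> y \<in> T" using subgroup.m_closed[OF T_subgroup] .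
lemma T_inv: "x \<in> T \<Longrightarrow> inv x \<in> T" using subgroup.m_inv_closed[OF T_subgroup] .
lemma T_one: "\<one> \<in> T" using subgroup.one_closed[OF T_subgroup] .

lemma T_comm:
  assumes "x \<in> T" "y \<in> T"
  shows "x \<otimes> y = y \<otimes> x"
proof (rule eq_by_act)
  fix s assume s: "s \<in> S"
  have v: "supp (sr s)" using supp_root[OF roots_sr[OF s]] .
  have *: "act (x \<otimes> y) (sr s) = act x (sr s) + (act y (sr s) - sr s)" if t: "x \<in> T" "y \<in> T" for x y
  proof -
    have "act (x \<otimes> y) (sr s) = act x (sr s + (act y (sr s) - sr s))" using t T_c by (simp add: act_mult)
    also have "\<dots> = act x (sr s) + (act y (sr s) - sr s)"
      unfolding act_add[OF T_c[OF t(1)]] using rad_fix[OF T_rad[OF t(2) v] T_c[OF t(1)]] by simp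
    finally show ?thesis .
  qed
  show "act (x \<otimes> y) (sr s) = act (y \<otimes> x) (sr s)" unfolding *[OF assms] *[OF assms(2,1)] by (simp add: algebra_simps)
qed (use assms T_c in auto)

lemma T_conj:
  assumes t: "t \<in> T" and w: "w \<in> carrier W"
  shows "w \<otimes> t \<otimes> inv w \<in> T" "supp v \<Longrightarrow> \<tau> (w \<otimes> t \<otimes> inv w) (act w v) = \<tau> t v"
proof -
  have tc: "t \<in> carrier W" using T_c[OF t] .
  have *: "act (w \<otimes> t \<otimes> inv w) (act w v) - act w v = act t v - v" if v: "supp v" for v
  proof -
    have "act (w \<otimes> t \<otimes> inv w) (act w v) - act w v = act w (act t v - v)" using w tc by (simp add: act_mult act_diff)
    then show ?thesis using rad_fix[OF T_rad[OF t v] w] by simp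
  qed
  then show "supp v \<Longrightarrow> \<tau> (w \<otimes> t \<otimes> inv w) (act w v) = \<tau> t v" by (simp only: \<tau>_def)
  show "w \<otimes> t \<otimes> inv w \<in> T"
  proof (rule TI)
    fix s assume s: "s \<in> S"
    have v: "supp (act (inv w) (sr s))" using supp_act[OF supp_root[OF roots_sr[OF s]]] w by simp
    show "rad (act (w \<otimes> t \<otimes> inv w) (sr s) - sr s)" using *[OF v] T_rad[OF t v] w by simp
  qed (use w tc in simp)
qed

lemma \<tau>_\<kappa>: "t \<in> carrier W \<Longrightarrow> \<beta> \<in> roots \<Longrightarrow> \<gamma> \<in> roots \<Longrightarrow> \<kappa> \<beta> = \<kappa> \<gamma> \<Longrightarrow> \<tau> t \<beta> = \<tau> t \<gamma>"
proof -
  assume a: "t \<in> carrier W" "\<beta> \<in> roots" "\<gamma> \<in> roots" "\<kappa> \<beta> = \<kappa> \<gamma>"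
  have "\<tau> t (\<beta> - \<gamma>) = 0" using \<tau>_rad[OF \<kappa>_rad[OF a(2-4)] a(1)] .
  then show ?thesis using lin_diff[OF \<tau>_lin[OF a(1)], of \<beta> \<gamma>] by simp
qed

lemma \<tau>_fin: "t \<in> carrier W \<Longrightarrow> finite (\<tau> t ` roots)"
  by (rule finite_factor[OF \<kappa>_fin]) (rule \<tau>_\<kappa>)

text \<open>A translation moves a root in an arithmetic progression along \<delta>, so a finite
  orbit is a single point.\<close>

lemma T_isolated:
  assumes t: "t \<in> T"
  shows "isolated t"
  unfolding isolated_def
proof (intro ballI impI)
  fix \<beta> assume b: "\<beta> \<in> roots" and f: "finite (range (\<lambda>n::nat. act (t [^] n) \<beta>))"
  let ?x = "act t \<beta> - \<beta>"
  have x: "rad ?x" by (rule T_rad[OF t supp_root[OF b]])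
  have e: "act (t [^] n) \<beta> = \<beta> + int n \<cdot> ?x" for n :: nat
  proof (induction n)
    case 0 show ?case by (auto simp: pw)
  next
    case (Suc n)
    have "act (t [^] Suc n) \<beta> = act t (\<beta> + int n \<cdot> ?x)" unfolding act_pow_Suc(2)[OF T_c[OF t]] Suc ..
    also have "\<dots> = act t \<beta> + int n \<cdot> ?x"
      unfolding act_add[OF T_c[OF t]] act_smul[OF T_c[OF t]] rad_fix[OF x T_c[OF t]] ..
    also have "\<dots> = \<beta> + int (Suc n) \<cdot> ?x" by (auto simp: pw algebra_simps)
    finally show ?case .
  qed
  show "act t \<beta> = \<beta>"
  proof (rule ccontr)
    assume "act t \<beta> \<noteq> \<beta>"
    then have "?x \<noteq> 0" by simp
    then obtain y where y: "?x y \<noteq> 0" by (auto simp: pw)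
    have "inj (\<lambda>n::nat. act (t [^] n) \<beta>)"
    proof (rule injI)
      fix m n :: nat assume "act (t [^] m) \<beta> = act (t [^] n) \<beta>"
      then have "\<beta> + int m \<cdot> ?x = \<beta> + int n \<cdot> ?x" unfolding e .
      then have "int m * ?x y = int n * ?x y" by (drule_tac fun_cong[of _ _ y]) (simp add: pw_simps)
      then show "m = n" using y by simp
    qed
    then show False using f range_inj_infinite by blast
  qed
qed

text \<open>The class of \<open>h\<close> in the finite quotient of W by the translations, recorded
  by the coroots of the preimages of the simple roots.\<close>

definition lab where "lab h = restrict (\<lambda>s. \<kappa> (act (inv h) (sr s))) S"

lemma lab_fin: "finite (lab ` carrier W)"
proof -
  have "lab ` carrier W \<subseteq> S \<rightarrow>\<^sub>E \<kappa> ` roots" unfolding lab_def using roots_act roots_sr by fastforce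
  moreover have "finite (S \<rightarrow>\<^sub>E \<kappa> ` roots)" using fin \<kappa>_fin by (intro finite_PiE) auto
  ultimately show ?thesis by (rule finite_subset)
qed

lemma lab_T:
  assumes h: "h \<in> carrier W" "h' \<in> carrier W" and e: "lab h = lab h'"
  shows "h \<otimes> inv h' \<in> T"
proof (rule TI)
  fix s assume s: "s \<in> S"
  have r: "act (inv h) (sr s) \<in> roots" "act (inv h') (sr s) \<in> roots" using h s roots_sr roots_act by auto
  have "\<kappa> (act (inv h) (sr s)) = \<kappa> (act (inv h') (sr s))" using fun_cong[OF e, of s] s by (simp add: lab_def)
  then have d: "rad (act (inv h') (sr s) - act (inv h) (sr s))" using \<kappa>_rad[OF r(2,1)] by simp
  have "act (h \<otimes> inv h') (sr s) - sr s = act h (act (inv h') (sr s) - act (inv h) (sr s))"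
    using h by (simp add: act_mult act_diff)
  then show "rad (act (h \<otimes> inv h') (sr s) - sr s)" using rad_fix[OF d h(1)] d by simp
qed (use h in simp)

text \<open>Pigeonhole on the finitely many labels: two powers with the same label differ by a
  translation.\<close>

lemma T_pow:
  assumes a: "a \<in> carrier W"
  shows "\<exists>n>0. a [^] (n::nat) \<in> T"
proof -
  have "finite ((\<lambda>n::nat. lab (a [^] n)) ` UNIV)"
    by (rule finite_subset[OF _ lab_fin]) (use a in auto)
  then have "\<not> inj (\<lambda>n::nat. lab (a [^] n))" using finite_imageD infinite_UNIV_nat by blast
  then obtain m n :: nat where mn: "lab (a [^] m) = lab (a [^] n)" "m < n"
    unfolding inj_def by (metis nat_neq_iff)
  have c: "a [^] m \<in> carrier W" "a [^] n \<in> carrier W" "a [^] (n - m) \<in> carrier W" using a by auto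
  have "a [^] n \<otimes> inv (a [^] m) \<in> T" by (rule lab_T[OF c(2,1) mn(1)[symmetric]])
  moreover have "a [^] n = a [^] (n - m) \<otimes> a [^] m" using a mn(2) by (simp add: nat_pow_mult)
  then have "a [^] n \<otimes> inv (a [^] m) = a [^] (n - m)" using c by (simp add: m_assoc)
  ultimately show ?thesis using mn(2) by (intro exI[of _ "n - m"]) simp
qed

text \<open>Reflections in two roots with the same coroot multiply to a translation.\<close>

lemma T_fixed_rad:
  assumes e: "supp e" and z: "\<And>t. t \<in> T \<Longrightarrow> \<tau> t e = 0"
  shows "rad e"
proof -
  \<comment> \<open>Y consists of the roots that share their coroot with another root. It is
    nonempty because there are infinitely many roots and finitely many coroots, it is stable under
    W, and it is closed under non-orthogonality, so it contains every simple root. The resulting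
    translation for s moves \<open>e\<close> by a nonzero multiple of
    \<open>coroot s e\<close>.\<close>
  define Y where "Y = {\<gamma> \<in> roots. \<exists>\<gamma>'\<in>roots. \<gamma>' \<noteq> \<gamma> \<and> \<kappa> \<gamma>' = \<kappa> \<gamma>}"
  have "\<not> inj_on \<kappa> roots" using inf \<kappa>_fin finite_imageD by blast
  then obtain \<beta>1 \<beta>2 where "\<beta>1 \<in> roots" "\<beta>2 \<in> roots" "\<kappa> \<beta>1 = \<kappa> \<beta>2" "\<beta>1 \<noteq> \<beta>2" unfolding inj_on_def by blast
  then have "\<beta>2 \<in> Y" unfolding Y_def by blast
  then have Yne: "Y \<noteq> {}" by blast
  have Yact: "act w \<gamma> \<in> Y" if w: "w \<in> carrier W" and y: "\<gamma> \<in> Y" for w \<gamma>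
  proof -
    obtain \<gamma>' where g: "\<gamma> \<in> roots" "\<gamma>' \<in> roots" "\<gamma>' \<noteq> \<gamma>" "\<kappa> \<gamma>' = \<kappa> \<gamma>" using y unfolding Y_def by blast
    have "act w \<gamma>' \<noteq> act w \<gamma>" "\<kappa> (act w \<gamma>') = \<kappa> (act w \<gamma>)"
      using g(3) act_eq_iff[OF w] \<kappa>_act[OF g(2,1,4) w] by blast+
    then show ?thesis using roots_act[OF w g(1)] roots_act[OF w g(2)] unfolding Y_def by blast
  qed
  have tr: "act (rfl \<gamma> \<otimes> rfl \<gamma>') v = v + npair v \<gamma> \<cdot> (\<gamma> - \<gamma>')"
    if g: "\<gamma> \<in> roots" "\<gamma>' \<in> roots" "\<kappa> \<gamma>' = \<kappa> \<gamma>" and v: "supp v" for \<gamma> \<gamma>' v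
  proof -
    have n: "npair v \<gamma>' = npair v \<gamma>" by (rule \<kappa>_npair[OF g(2,1,3) v])
    have "npair \<gamma>' \<gamma> = 2" using \<kappa>_npair[OF g(2,1,3) supp_root[OF g(2)]] npair_self[OF g(2)] by simp
    then have "act (rfl \<gamma>) \<gamma>' = \<gamma>' - 2 \<cdot> \<gamma>" using act_rfl[OF g(1)] by simp
    then have "act (rfl \<gamma> \<otimes> rfl \<gamma>') v = v - npair v \<gamma> \<cdot> \<gamma> - npair v \<gamma> \<cdot> (\<gamma>' - 2 \<cdot> \<gamma>)"
      using g act_rfl[OF g(1), of v] act_rfl[OF g(2), of v] n by (simp add: act_mult act_diff act_smul)
    then show ?thesis by (auto simp: pw algebra_simps)
  qed
  have trT: "rfl \<gamma> \<otimes> rfl \<gamma>' \<in> T" if g: "\<gamma> \<in> roots" "\<gamma>' \<in> roots" "\<kappa> \<gamma>' = \<kappa> \<gamma>" for \<gamma> \<gamma>'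
  proof (rule TI)
    fix s assume s: "s \<in> S"
    have "act (rfl \<gamma> \<otimes> rfl \<gamma>') (sr s) - sr s = npair (sr s) \<gamma> \<cdot> (\<gamma> - \<gamma>')"
      using tr[OF g supp_root[OF roots_sr[OF s]]] by simp
    then show "rad (act (rfl \<gamma> \<otimes> rfl \<gamma>') (sr s) - sr s)" using rad_smul[OF \<kappa>_rad[OF g(1,2) g(3)[symmetric]]] by simp
  qed (use g in simp)
  have Yadj: "\<beta> \<in> Y" if y: "\<gamma> \<in> Y" and b: "\<beta> \<in> roots" "npair \<beta> \<gamma> \<noteq> 0" for \<beta> \<gamma>
  proof -
    obtain \<gamma>' where g: "\<gamma> \<in> roots" "\<gamma>' \<in> roots" "\<gamma>' \<noteq> \<gamma>" "\<kappa> \<gamma>' = \<kappa> \<gamma>" using y unfolding Y_def by blast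
    let ?t = "rfl \<gamma> \<otimes> rfl \<gamma>'"
    have t: "?t \<in> T" by (rule trT[OF g(1,2,4)])
    have e: "act ?t \<beta> = \<beta> + npair \<beta> \<gamma> \<cdot> (\<gamma> - \<gamma>')" by (rule tr[OF g(1,2,4) supp_root[OF b(1)]])
    obtain x where "(\<gamma> - \<gamma>') x \<noteq> 0" using diff_nonzero_at[OF g(3)] by blast
    then have "act ?t \<beta> x \<noteq> \<beta> x" unfolding e using b(2) by (simp add: pw_simps)
    then have ne: "act ?t \<beta> \<noteq> \<beta>" by metis
    have "\<kappa> (act ?t \<beta>) = \<kappa> \<beta>"
    proof (rule \<kappa>I)
      fix v assume v: "supp v"
      have ti: "inv ?t \<in> T" by (rule T_inv[OF t])
      have "npair v (act ?t \<beta>) = npair (act (inv ?t) v) \<beta>"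
        using rfl_act(2)[OF T_c[OF t] b(1), of "act (inv ?t) v"] T_c[OF t] by (simp only: act_inv(1))
      also have "\<dots> = npair (v + (act (inv ?t) v - v)) \<beta>" by simp
      also have "\<dots> = npair v \<beta>" unfolding npair_lin(1)[OF b(1)] npair_rad[OF T_rad[OF ti v] b(1)] by simp
      finally show "npair v (act ?t \<beta>) = npair v \<beta>" .
    qed
    then show ?thesis using ne b(1) roots_act[OF T_c[OF t] b(1)] unfolding Y_def by blast
  qed
  have "{s \<in> S. sr s \<in> Y} = S"
  proof (rule conn)
    obtain \<gamma> where g: "\<gamma> \<in> Y" using Yne by blast
    then obtain w s where ws: "w \<in> carrier W" "s \<in> S" "\<gamma> = act w (sr s)" by (auto simp: Y_def roots_def)
    have "act (inv w) \<gamma> \<in> Y" using ws g by (intro Yact) auto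
    then show "{s \<in> S. sr s \<in> Y} \<noteq> {}" using ws by auto
    show "t \<in> {s \<in> S. sr s \<in> Y}" if s: "s \<in> {s \<in> S. sr s \<in> Y}" and t: "t \<in> S" and a: "A s t \<noteq> 0" for s t
    proof -
      have sS: "s \<in> S" using s by simp
      have "npair (sr t) (sr s) = A s t" using npair_sr(1)[OF sS, of "sr t"] t by (simp add: coroot_sr)
      then have "sr t \<in> Y" using Yadj[of "sr s" "sr t"] s a roots_sr[OF t] by simp
      then show ?thesis using t by simp
    qed
  qed auto
  then have YS: "sr s \<in> Y" if "s \<in> S" for s using that by blast
  have "coroot s e \<le> 0" if s: "s \<in> S" for s
  proof -
    obtain \<gamma>' where g: "sr s \<in> roots" "\<gamma>' \<in> roots" "\<gamma>' \<noteq> sr s" "\<kappa> \<gamma>' = \<kappa> (sr s)" using YS[OF s] unfolding Y_def by blast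
    let ?t = "rfl (sr s) \<otimes> rfl \<gamma>'"
    have "act ?t e = e" using z[OF trT[OF g(1,2,4)]] \<tau>_zero[OF trT[OF g(1,2,4)] e] by blast
    then have z: "npair e (sr s) \<cdot> (sr s - \<gamma>') = 0" using tr[OF g(1,2,4) e] by simp
    have np: "npair e (sr s) * (sr s - \<gamma>') x = 0" for x
      using fun_cong[OF z, of x] by (simp only: smul_apply zero_fun_apply)
    obtain x where "(sr s - \<gamma>') x \<noteq> 0" using diff_nonzero_at[OF g(3)] by blast
    then have "npair e (sr s) = 0" using np[of x] by (metis mult_eq_0_iff)
    then show ?thesis using npair_sr(1)[OF s] by simp
  qed
  then show ?thesis by (rule antidominant_rad[OF e])
qed

section \<open>Generic translations commuting with a given element\<close>

lemma ht_\<delta>: "ht \<delta> > 0"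
proof -
  have "ht \<delta> \<ge> \<delta> s0"
    unfolding ht_def using \<delta>_pos by (intro member_le_sum s0 fin) (simp add: less_imp_le)
  then show ?thesis using \<delta>0 by linarith
qed

lemma rad_ht_zero:
  assumes x: "rad x" and h: "ht x = 0"
  shows "x = 0"
proof (rule rad_eq_zero[OF x])
  have "ht (\<delta> s0 \<cdot> x) = ht (x s0 \<cdot> \<delta>)" using x by (simp add: rad_def)
  then show "x s0 = 0" using h ht_\<delta> by (simp add: ht_smul)
qed

lemma \<tau>_bound: "t \<in> carrier W \<Longrightarrow> \<exists>M>0. \<forall>\<beta>\<in>roots. \<bar>\<tau> t \<beta>\<bar> < M"
proof -
  assume t: "t \<in> carrier W"
  let ?M = "1 + (\<Sum>x\<in>\<tau> t ` roots. \<bar>x\<bar>)"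
  have "\<bar>\<tau> t \<beta>\<bar> < ?M" if "\<beta> \<in> roots" for \<beta>
    using member_le_sum[of "\<tau> t \<beta>" "\<tau> t ` roots" "\<lambda>x. \<bar>x\<bar>"] \<tau>_fin[OF t] that by simp
  moreover have "(\<Sum>x\<in>\<tau> t ` roots. \<bar>x\<bar>) \<ge> 0" by (rule sum_nonneg) simp
  then have "?M > 0" by linarith
  ultimately show ?thesis by blast
qed

lemma dominating_multiple:
  fixes m :: nat and x y :: int
  assumes "\<bar>y\<bar> < int m" "int m * x + y = 0"
  shows "x = 0 \<and> y = 0"
proof -
  have "x = 0"
  proof (rule ccontr)
    assume "x \<noteq> 0"
    then have "int m * 1 \<le> int m * \<bar>x\<bar>" by (intro mult_left_mono) auto
    then have "int m \<le> \<bar>int m * x\<bar>" by (simp add: abs_mult)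
    then show False using assms by linarith
  qed
  then show ?thesis using assms by simp
qed

lemma T_pow_mem:
  assumes t: "t \<in> T"
  shows "t [^] (m::nat) \<in> T \<and> (\<forall>v. supp v \<longrightarrow> \<tau> (t [^] m) v = int m * \<tau> t v)"
proof (induction m)
  case 0 then show ?case using T_one by (simp add: \<tau>_def pw_simps)
next
  case (Suc m)
  then show ?case using T_mult[of "t [^] m" t] t \<tau>_mult[of "t [^] m" t] by (simp add: algebra_simps)
qed

lemma T_prod:
  assumes "\<And>i::nat. t i \<in> T"
  shows "\<exists>N\<in>T. \<forall>v. supp v \<longrightarrow> \<tau> N v = (\<Sum>i<n. \<tau> (t i) v)"
proof (induction n)
  case 0 then show ?case using T_one by (intro bexI[of _ \<one>]) (simp_all add: \<tau>_def pw_simps)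
next
  case (Suc n)
  then obtain N where N: "N \<in> T" "\<And>v. supp v \<Longrightarrow> \<tau> N v = (\<Sum>i<n. \<tau> (t i) v)" by blast
  show ?case
    by (intro bexI[of _ "N \<otimes> t n"] T_mult N assms allI impI) (simp add: \<tau>_mult[OF N(1) assms] N(2))
qed

lemma T_commuteI:
  assumes t: "t \<in> T" and a: "a \<in> carrier W" and e: "\<And>s. s \<in> S \<Longrightarrow> \<tau> t (act a (sr s)) = \<tau> t (sr s)"
  shows "t \<otimes> a = a \<otimes> t"
proof (rule eq_by_act)
  fix s assume s: "s \<in> S"
  have tc: "t \<in> carrier W" using T_c[OF t] .
  have v: "supp (sr s)" "supp (act a (sr s))" using supp_root[OF roots_sr[OF s]] supp_act a by auto
  let ?x = "act t (act a (sr s)) - act a (sr s)" and ?y = "act t (sr s) - sr s"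
  have d: "rad ?x" "rad ?y" using T_rad[OF t] v by auto
  have "?x - ?y = 0"
    by (rule rad_eq_zero[OF rad_diff[OF d]]) (use e[OF s] in \<open>simp add: \<tau>_def pw_simps\<close>)
  then have "?x = ?y" by simp
  then have e1: "act t (act a (sr s)) = act a (sr s) + ?y" by (metis diff_add_cancel add.commute)
  have "act a ?y = ?y" by (rule rad_fix[OF d(2) a])
  then have "act a (act t (sr s)) - act a (sr s) = ?y" using a by (simp add: act_diff)
  then have e2: "act a (act t (sr s)) = act a (sr s) + ?y" by (metis diff_add_cancel add.commute)
  show "act (t \<otimes> a) (sr s) = act (a \<otimes> t) (sr s)"
    unfolding act_mult[OF tc a] act_mult[OF a tc] e1 e2 ..
qed (use assms T_c in auto)

lemma T_commuteD:
  assumes t: "t \<in> T" and a: "a \<in> carrier W" and e: "t \<otimes> a = a \<otimes> t" and v: "supp v"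
  shows "\<tau> t (act a v) = \<tau> t v"
proof -
  have "act t (act a v) = act a (act t v)" using e a T_c[OF t] by (metis act_mult)
  then have "act t (act a v) - act a v = act a (act t v - v)" using a by (simp add: act_diff)
  then show ?thesis using rad_fix[OF T_rad[OF t v] a] by (simp add: \<tau>_def)
qed

text \<open>\<open>g\<close> is as generic as possible among the translations commuting with a: a
  root fixed by g is fixed by all of them. \<open>L\<close> is the form whose facet will give K, and
  the vanishing of the orbit sums at its zeros is what makes u twisted elliptic.\<close>

definition datum :: "'w \<Rightarrow> 'w \<Rightarrow> nat \<Rightarrow> (('w \<Rightarrow> int) \<Rightarrow> int) \<Rightarrow> bool" where
  "datum a g n L \<longleftrightarrow> n > 0 \<and> g \<in> T \<and> g \<otimes> a = a \<otimes> g \<and> lin L \<and> finite {\<beta> \<in> roots. L \<beta> = 0} \<and>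
    (\<forall>t\<in>T. t \<otimes> a = a \<otimes> t \<longrightarrow> (\<forall>\<beta>\<in>roots. act g \<beta> = \<beta> \<longrightarrow> act t \<beta> = \<beta>)) \<and>
    (\<forall>\<beta>\<in>roots. L \<beta> = 0 \<longrightarrow> act g \<beta> = \<beta> \<and> (\<Sum>i<n. act (a [^] i) \<beta>) = 0) \<and>
    (\<forall>\<beta>\<in>roots. act g \<beta> = \<beta> \<longrightarrow> L (act a \<beta>) = L \<beta>)"

text \<open>Let g annihilate the fewest coroot classes. If t moved a root that g fixes, then
  \<open>g^m t\<close>, with m above all absolute values of \<open>\<tau> t\<close> on roots, would
  annihilate strictly fewer.\<close>

lemma ex_generic_translation:
  assumes a: "a \<in> carrier W"
  shows "\<exists>g\<in>T. g \<otimes> a = a \<otimes> g \<and> (\<forall>t\<in>T. t \<otimes> a = a \<otimes> t \<longrightarrow> (\<forall>\<beta>\<in>roots. \<tau> g \<beta> = 0 \<longrightarrow> \<tau> t \<beta> = 0))"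
proof -
  define Ta where "Ta = {t \<in> T. t \<otimes> a = a \<otimes> t}"
  let ?Z = "\<lambda>t. {\<beta> \<in> roots. \<tau> t \<beta> = 0}"
  have "\<one> \<in> Ta" using T_one a by (simp add: Ta_def)
  then obtain g where g: "g \<in> Ta" "\<And>t. t \<in> Ta \<Longrightarrow> card (\<kappa> ` ?Z g) \<le> card (\<kappa> ` ?Z t)"
    using ex_has_least_nat[of "\<lambda>t. t \<in> Ta" \<one> "\<lambda>t. card (\<kappa> ` ?Z t)"] by blast
  have gT: "g \<in> T" "g \<otimes> a = a \<otimes> g" using g(1) by (auto simp: Ta_def)
  have "\<tau> t \<beta> = 0" if t: "t \<in> T" "t \<otimes> a = a \<otimes> t" and b: "\<beta> \<in> roots" "\<tau> g \<beta> = 0" for t \<beta>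
  proof (rule ccontr)
    assume nz: "\<tau> t \<beta> \<noteq> 0"
    obtain M where M: "M > 0" "\<And>\<beta>. \<beta> \<in> roots \<Longrightarrow> \<bar>\<tau> t \<beta>\<bar> < M" using \<tau>_bound[OF T_c[OF t(1)]] by blast
    define m where "m = nat M"
    define g' where "g' = g [^] m \<otimes> t"
    have gm: "g [^] m \<in> T" "\<And>v. supp v \<Longrightarrow> \<tau> (g [^] m) v = int m * \<tau> g v" using T_pow_mem[OF gT(1)] by blast+
    have g'T: "g' \<in> T" unfolding g'_def using gm(1) t(1) by (rule T_mult)
    have "g' \<otimes> a = a \<otimes> g'"
    proof (rule T_commuteI[OF g'T a])
      fix s assume s: "s \<in> S"
      have v: "supp (sr s)" "supp (act a (sr s))" using supp_root[OF roots_sr[OF s]] supp_act a by auto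
      show "\<tau> g' (act a (sr s)) = \<tau> g' (sr s)"
        unfolding g'_def \<tau>_mult[OF gm(1) t(1) v(1)] \<tau>_mult[OF gm(1) t(1) v(2)] gm(2)[OF v(1)] gm(2)[OF v(2)]
          T_commuteD[OF gT(1) a gT(2) v(1)] T_commuteD[OF t(1) a t(2) v(1)] ..
    qed
    then have g'a: "g' \<in> Ta" using g'T by (simp add: Ta_def)
    have tg: "\<tau> g' \<gamma> = int m * \<tau> g \<gamma> + \<tau> t \<gamma>" if "\<gamma> \<in> roots" for \<gamma>
      unfolding g'_def using \<tau>_mult[OF gm(1) t(1) supp_root[OF that]] gm(2)[OF supp_root[OF that]] by simp
    have sub: "?Z g' \<subseteq> ?Z g"
    proof
      fix \<gamma> assume c: "\<gamma> \<in> ?Z g'"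
      have "\<bar>\<tau> t \<gamma>\<bar> < int m" using M c by (simp add: m_def)
      then have "\<tau> g \<gamma> = 0" using dominating_multiple[of "\<tau> t \<gamma>" m "\<tau> g \<gamma>"] tg c by auto
      then show "\<gamma> \<in> ?Z g" using c by simp
    qed
    have "\<kappa> \<beta> \<notin> \<kappa> ` ?Z g'"
    proof
      assume "\<kappa> \<beta> \<in> \<kappa> ` ?Z g'"
      then obtain \<gamma> where c: "\<gamma> \<in> roots" "\<tau> g' \<gamma> = 0" "\<kappa> \<beta> = \<kappa> \<gamma>" by auto
      then have "\<tau> g' \<beta> = 0" using \<tau>_\<kappa>[OF T_c[OF g'T] b(1) c(1,3)] by simp
      then show False using tg[OF b(1)] b(2) nz by simp
    qed
    moreover have "\<kappa> \<beta> \<in> \<kappa> ` ?Z g" using b by blast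
    ultimately have "\<kappa> ` ?Z g' \<subset> \<kappa> ` ?Z g" using sub by blast
    moreover have "finite (\<kappa> ` ?Z g)" by (rule finite_subset[OF _ \<kappa>_fin]) blast
    ultimately have "card (\<kappa> ` ?Z g') < card (\<kappa> ` ?Z g)" using psubset_card_mono by blast
    then show False using g(2)[OF g'a] by simp
  qed
  then show ?thesis using gT by blast
qed

theorem ex_datum:
  assumes a: "a \<in> carrier W"
  shows "\<exists>g n L. datum a g n L \<and> finite {\<beta> \<in> roots. pos \<beta> \<and> L \<beta> < 0}"
proof -
  obtain n :: nat where n: "n > 0" "a [^] n \<in> T" using T_pow[OF a] by blast
  obtain g where g: "g \<in> T" "g \<otimes> a = a \<otimes> g"
    and gz: "\<And>t \<beta>. t \<in> T \<Longrightarrow> t \<otimes> a = a \<otimes> t \<Longrightarrow> \<beta> \<in> roots \<Longrightarrow> \<tau> g \<beta> = 0 \<Longrightarrow> \<tau> t \<beta> = 0"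
    using ex_generic_translation[OF a] by metis
  have gc: "g \<in> carrier W" using T_c[OF g(1)] .
  have pc: "a [^] i \<in> carrier W" for i :: nat using a by simp
  have ana: "a [^] n \<otimes> a = a \<otimes> a [^] n" using a nat_pow_Suc2[OF a, of n] by simp
  \<comment> \<open>Sums over one period of a do not change when \<open>v\<close> is replaced by its
    image under a.\<close>
  have shift: "(\<Sum>i<n. f (act (a [^] i) (act a v))) = (\<Sum>i<n. f (act (a [^] i) v))"
    if "f (act (a [^] n) v) = f v" for f :: "('w \<Rightarrow> int) \<Rightarrow> int" and v
  proof -
    have "(\<Sum>i<n. f (act (a [^] Suc i) v)) + f v = (\<Sum>i<n. f (act (a [^] i) v)) + f v"
      using sum.lessThan_Suc_shift[of "\<lambda>i. f (act (a [^] i) v)" n] that by (simp del: nat_pow_Suc add: add.commute)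
    then show ?thesis by (simp only: act_pow_Suc(1)[OF a] add_right_cancel)
  qed
  define p where "p v = (\<Sum>i<n. ht (act (a [^] i) v))" for v
  have p_lin: "lin p" by (simp add: lin_def p_def act_add act_smul pc ht_add ht_smul sum.distrib sum_distrib_left)
  obtain M where M: "M > 0" "\<And>\<beta>. \<beta> \<in> roots \<Longrightarrow> \<bar>\<tau> g \<beta>\<bar> < M" using \<tau>_bound[OF gc] by blast
  \<comment> \<open>M exceeds all values of \<open>\<tau> g\<close> on roots in absolute value, so a
    zero of L is a common zero of both parts, and where \<open>p\<close> is nonzero it determines
    the sign of L.\<close>
  define L where "L v = M * p v + \<tau> g v" for v
  have lL: "lin L" using p_lin \<tau>_lin[OF gc] by (simp add: lin_def L_def algebra_simps)
  have zero: "p \<beta> = 0 \<and> \<tau> g \<beta> = 0" if b: "\<beta> \<in> roots" "L \<beta> = 0" for \<beta>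
    using dominating_multiple[of "\<tau> g \<beta>" "nat M" "p \<beta>"] M b by (simp add: L_def)
  have fixd: "act t \<beta> = \<beta>" if t: "t \<in> T" "t \<otimes> a = a \<otimes> t" and b: "\<beta> \<in> roots" "act g \<beta> = \<beta>" for t \<beta>
  proof -
    have "\<tau> g \<beta> = 0" using \<tau>_zero[OF g(1) supp_root[OF b(1)]] b(2) by blast
    then show ?thesis using gz[OF t b(1)] \<tau>_zero[OF t(1) supp_root[OF b(1)]] by blast
  qed
  have an: "act (a [^] n) \<beta> = \<beta>" if "\<beta> \<in> roots" "act g \<beta> = \<beta>" for \<beta> by (rule fixd[OF n(2) ana that])
  have orbit_sum: "(\<Sum>i<n. act (a [^] i) \<beta>) = 0" if b: "\<beta> \<in> roots" "L \<beta> = 0" for \<beta>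
  proof -
    let ?e = "\<Sum>i<n. act (a [^] i) \<beta>"
    have se: "supp ?e" by (intro supp_sum supp_act supp_root b pc)
    have "rad ?e"
    \<comment> \<open>The product N of the conjugates of t by the powers of a commutes with a,
      because the n-th power of a is itself a translation. By genericity N fixes \<beta>; rewritten
      in terms of t, this says that t fixes the orbit sum.\<close>
    proof (rule T_fixed_rad[OF se])
      fix t assume t: "t \<in> T"
      have cj: "inv (a [^] i) \<otimes> t \<otimes> inv (inv (a [^] i)) \<in> T" for i :: nat
        by (rule T_conj(1)[OF t]) (use pc in simp)
      obtain N where N: "N \<in> T" "\<And>v. supp v \<Longrightarrow> \<tau> N v = (\<Sum>i<n. \<tau> (inv (a [^] i) \<otimes> t \<otimes> inv (inv (a [^] i))) v)"
        using T_prod[of "\<lambda>i. inv (a [^] i) \<otimes> t \<otimes> inv (inv (a [^] i))" n] cj by blast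
      have cv: "\<tau> (inv (a [^] i) \<otimes> t \<otimes> inv (inv (a [^] i))) v = \<tau> t (act (a [^] i) v)" if "supp v" for v and i :: nat
        using T_conj(2)[OF t, of "inv (a [^] i)" "act (a [^] i) v"] supp_act[OF that pc] pc[of i] by simp
      have Nv: "\<tau> N v = (\<Sum>i<n. \<tau> t (act (a [^] i) v))" if "supp v" for v
        using N(2)[OF that] cv[OF that] by simp
      have tc: "t \<in> carrier W" using T_c[OF t] .
      have "N \<otimes> a = a \<otimes> N"
      proof (rule T_commuteI[OF N(1) a])
        fix s assume s: "s \<in> S"
        have v: "supp (sr s)" "supp (act a (sr s))" using supp_root[OF roots_sr[OF s]] supp_act a by auto
        have "\<tau> t (act (a [^] n) (sr s) - sr s) = 0" by (rule \<tau>_rad[OF T_rad[OF n(2) v(1)] tc])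
        then have "\<tau> t (act (a [^] n) (sr s)) = \<tau> t (sr s)" using lin_diff[OF \<tau>_lin[OF tc]] by simp
        then show "\<tau> N (act a (sr s)) = \<tau> N (sr s)" unfolding Nv[OF v(1)] Nv[OF v(2)] by (rule shift)
      qed
      then have "\<tau> N \<beta> = 0" using gz[OF N(1) _ b(1)] zero[OF b] by blast
      moreover have "\<tau> t ?e = (\<Sum>i<n. \<tau> t (act (a [^] i) \<beta>))"
        by (rule lin_sum[OF \<tau>_lin[OF tc] finite_lessThan])
      ultimately show "\<tau> t ?e = 0" using Nv[OF supp_root[OF b(1)]] by simp
    qed
    moreover have "ht ?e = 0" using zero[OF b] by (simp add: ht_sum p_def)
    ultimately show ?thesis by (rule rad_ht_zero)
  qed
  have "finite {\<beta> \<in> roots. L \<beta> = 0}"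
  proof (rule finite_imageD)
    show "finite (\<kappa> ` {\<beta> \<in> roots. L \<beta> = 0})" by (rule finite_subset[OF _ \<kappa>_fin]) blast
    \<comment> \<open>Two zeros of L with the same coroot differ by a radical vector, and
      \<open>p\<close> shows that its height is 0.\<close>
    show "inj_on \<kappa> {\<beta> \<in> roots. L \<beta> = 0}"
    proof (rule inj_onI)
      fix \<beta> \<gamma> assume b: "\<beta> \<in> {\<beta> \<in> roots. L \<beta> = 0}" and c: "\<gamma> \<in> {\<beta> \<in> roots. L \<beta> = 0}" and e: "\<kappa> \<beta> = \<kappa> \<gamma>"
      let ?x = "\<beta> - \<gamma>"
      have x: "rad ?x" using \<kappa>_rad[OF _ _ e] b c by simp
      have "p ?x = 0" using zero[of \<beta>] zero[of \<gamma>] b c lin_diff[OF p_lin] by simp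
      moreover have "p ?x = int n * ht ?x" unfolding p_def rad_fix[OF x pc] by simp
      ultimately have "ht ?x = 0" using n(1) by simp
      then have "?x = 0" by (rule rad_ht_zero[OF x])
      then show "\<beta> = \<gamma>" by simp
    qed
  qed
  moreover have "act g \<beta> = \<beta>" if b: "\<beta> \<in> roots" "L \<beta> = 0" for \<beta>
    using zero[OF b] \<tau>_zero[OF g(1) supp_root[OF b(1)]] by blast
  moreover have "L (act a \<beta>) = L \<beta>" if b: "\<beta> \<in> roots" "act g \<beta> = \<beta>" for \<beta>
  proof -
    have "p (act a \<beta>) = p \<beta>" unfolding p_def by (rule shift) (simp add: an[OF b])
    then show ?thesis using T_commuteD[OF g(1) a g(2) supp_root[OF b(1)]] by (simp add: L_def)
  qed
  ultimately have d: "datum a g n L"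
    unfolding datum_def using n(1) g lL fixd orbit_sum by blast
  have "{\<beta> \<in> roots. pos \<beta> \<and> L \<beta> < 0} \<subseteq> (\<Union>i<n. Inv (a [^] i))"
  proof
    fix \<beta> assume b: "\<beta> \<in> {\<beta> \<in> roots. pos \<beta> \<and> L \<beta> < 0}"
    show "\<beta> \<in> (\<Union>i<n. Inv (a [^] i))"
    proof (rule ccontr)
      assume nb: "\<beta> \<notin> (\<Union>i<n. Inv (a [^] i))"
      have h: "ht (act (a [^] i) \<beta>) \<ge> 1" if "i < n" for i
      proof (rule ht_pos)
        show "act (a [^] i) \<beta> \<in> roots" using b roots_act[OF pc] by simp
        show "pos (act (a [^] i) \<beta>)" using b nb that by (auto simp: Inv_def)
      qed
      have "ht (act (a [^] i) \<beta>) > 0" if "i < n" for i using h[OF that] by linarith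
      then have "p \<beta> > 0" unfolding p_def using n(1) by (intro sum_pos) auto
      then have "M * 1 \<le> M * p \<beta>" using M(1) by (intro mult_left_mono) auto
      moreover have "\<bar>\<tau> g \<beta>\<bar> < M" using M(2) b by blast
      ultimately have "L \<beta> > 0" unfolding L_def by linarith
      then show False using b by simp
    qed
  qed
  moreover have "finite (\<Union>i<n. Inv (a [^] i))" using finite_Inv[OF pc] by blast
  ultimately have "finite {\<beta> \<in> roots. pos \<beta> \<and> L \<beta> < 0}" by (rule finite_subset)
  then show ?thesis using d by blast
qed

lemma datum_conj:
  assumes d: "datum a g n L" and a: "a \<in> carrier W" and w: "w \<in> carrier W"
  shows "datum (w \<otimes> a \<otimes> inv w) (w \<otimes> g \<otimes> inv w) n (\<lambda>v. L (act (inv w) v))"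
proof -
  note D = d[unfolded datum_def]
  have n: "n > 0" and g: "g \<in> T" "g \<otimes> a = a \<otimes> g" and L: "lin L" and fz: "finite {\<beta> \<in> roots. L \<beta> = 0}" using D by blast+
  have fixd: "act t \<beta> = \<beta>" if "t \<in> T" "t \<otimes> a = a \<otimes> t" "\<beta> \<in> roots" "act g \<beta> = \<beta>" for t \<beta> using D that by blast
  have z: "act g \<beta> = \<beta>" "(\<Sum>i<n. act (a [^] i) \<beta>) = 0" if "\<beta> \<in> roots" "L \<beta> = 0" for \<beta> using D that by blast+
  have aL: "L (act a \<beta>) = L \<beta>" if "\<beta> \<in> roots" "act g \<beta> = \<beta>" for \<beta> using D that by blast
  have gc: "g \<in> carrier W" and wi: "inv w \<in> carrier W" using T_c[OF g(1)] w by auto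
  have cm: "(w \<otimes> x \<otimes> inv w) \<otimes> (w \<otimes> y \<otimes> inv w) = w \<otimes> (x \<otimes> y) \<otimes> inv w" if "x \<in> carrier W" "y \<in> carrier W" for x y
    using that w by (simp add: m_assoc cancel_inv)
  have af: "act (w \<otimes> x \<otimes> inv w) v = act w (act x (act (inv w) v))" if "x \<in> carrier W" for x v
    using that w by (simp add: act_mult)
  have fx: "act (w \<otimes> x \<otimes> inv w) v = v \<longleftrightarrow> act x (act (inv w) v) = act (inv w) v" if x: "x \<in> carrier W" for x v
  proof -
    have "act w (act x (act (inv w) v)) = v \<longleftrightarrow> act w (act x (act (inv w) v)) = act w (act (inv w) v)" using w by simp
    then show ?thesis unfolding af[OF x] act_eq_iff[OF w] .
  qed
  have iv: "w \<otimes> (inv w \<otimes> t \<otimes> w) \<otimes> inv w = t" if "t \<in> carrier W" for t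
    using that w by (simp add: m_assoc cancel_inv)
  let ?r = "\<lambda>\<beta>. act (inv w) \<beta>"
  have rr: "?r \<beta> \<in> roots" if "\<beta> \<in> roots" for \<beta> by (rule roots_act[OF wi that])
  show ?thesis unfolding datum_def
  proof (intro conjI ballI impI)
    show "0 < n" by (rule n)
    show "w \<otimes> g \<otimes> inv w \<in> T" by (rule T_conj(1)[OF g(1) w])
    show "w \<otimes> g \<otimes> inv w \<otimes> (w \<otimes> a \<otimes> inv w) = w \<otimes> a \<otimes> inv w \<otimes> (w \<otimes> g \<otimes> inv w)"
      unfolding cm[OF gc a] cm[OF a gc] g(2) ..
    show "lin (\<lambda>v. L (?r v))" by (rule lin_act[OF L wi])
    have "{\<beta> \<in> roots. L (?r \<beta>) = 0} \<subseteq> act w ` {\<beta> \<in> roots. L \<beta> = 0}"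
    proof
      fix \<beta> assume b: "\<beta> \<in> {\<beta> \<in> roots. L (?r \<beta>) = 0}"
      have "?r \<beta> \<in> {\<beta> \<in> roots. L \<beta> = 0}" using b rr by simp
      then have "act w (?r \<beta>) \<in> act w ` {\<beta> \<in> roots. L \<beta> = 0}" by (rule imageI)
      then show "\<beta> \<in> act w ` {\<beta> \<in> roots. L \<beta> = 0}" using w by simp
    qed
    then show "finite {\<beta> \<in> roots. L (?r \<beta>) = 0}" using fz finite_subset by blast
  next
    fix t \<beta> assume t: "t \<in> T" "t \<otimes> (w \<otimes> a \<otimes> inv w) = w \<otimes> a \<otimes> inv w \<otimes> t"
      and b: "\<beta> \<in> roots" "act (w \<otimes> g \<otimes> inv w) \<beta> = \<beta>"
    have tc: "t \<in> carrier W" using T_c[OF t(1)] .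
    let ?t = "inv w \<otimes> t \<otimes> w"
    have tT: "?t \<in> T" using T_conj(1)[OF t(1) wi] w by simp
    have "w \<otimes> (?t \<otimes> a) \<otimes> inv w = t \<otimes> (w \<otimes> a \<otimes> inv w)" using tc a w by (simp add: m_assoc cancel_inv)
    moreover have "w \<otimes> (a \<otimes> ?t) \<otimes> inv w = w \<otimes> a \<otimes> inv w \<otimes> t" using tc a w by (simp add: m_assoc cancel_inv)
    ultimately have "w \<otimes> (?t \<otimes> a) \<otimes> inv w = w \<otimes> (a \<otimes> ?t) \<otimes> inv w" using t(2) by simp
    then have ta: "?t \<otimes> a = a \<otimes> ?t" using w a T_c[OF tT] by simp
    have "act ?t (?r \<beta>) = ?r \<beta>" using b fx[OF gc] by (intro fixd[OF tT ta rr]) auto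
    then have "act (w \<otimes> ?t \<otimes> inv w) \<beta> = \<beta>" using fx[OF T_c[OF tT]] by blast
    then show "act t \<beta> = \<beta>" unfolding iv[OF tc] .
  next
    fix \<beta> assume b: "\<beta> \<in> roots" "L (?r \<beta>) = 0"
    show "act (w \<otimes> g \<otimes> inv w) \<beta> = \<beta>" using z(1)[OF rr[OF b(1)] b(2)] fx[OF gc] by blast
    have "(\<Sum>i<n. act ((w \<otimes> a \<otimes> inv w) [^] i) \<beta>) = act w (\<Sum>i<n. act (a [^] i) (?r \<beta>))"
      unfolding act_sum[OF w] by (rule sum.cong) (use a w in \<open>simp_all add: conj_pow af\<close>)
    then show "(\<Sum>i<n. act ((w \<otimes> a \<otimes> inv w) [^] i) \<beta>) = 0"
      unfolding z(2)[OF rr[OF b(1)] b(2)] act_zero[OF w] .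
  next
    fix \<beta> assume b: "\<beta> \<in> roots" "act (w \<otimes> g \<otimes> inv w) \<beta> = \<beta>"
    have "L (act a (?r \<beta>)) = L (?r \<beta>)" using b fx[OF gc] by (intro aL rr) auto
    then show "L (?r (act (w \<otimes> a \<otimes> inv w) \<beta>)) = L (?r \<beta>)" using w by (simp add: af[OF a])
  qed
qed

end

section \<open>Dickson's lemma\<close>

lemma increasing_subsequence:
  fixes x :: "nat \<Rightarrow> nat"
  shows "\<exists>r. strict_mono r \<and> incseq (\<lambda>i. x (r i))"
proof -
  obtain r where r: "strict_mono r" "monoseq (\<lambda>i. x (r i))" using seq_monosub by blast
  show ?thesis
  proof (cases "incseq (\<lambda>i. x (r i))")
    case True then show ?thesis using r(1) by blast
  next
    case False
    then have d: "decseq (\<lambda>i. x (r i))" using r(2) by (auto simp: monoseq_def incseq_def decseq_def)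
    \<comment> \<open>A decreasing sequence of naturals is constant once its minimum is reached,
      hence increasing from there on.\<close>
    define N where "N = (ARG_MIN (\<lambda>i. x (r i)) i. True)"
    have N: "x (r N) \<le> x (r i)" for i using arg_min_nat_lemma[of "\<lambda>_. True" 0 "\<lambda>i. x (r i)"] by (simp add: N_def)
    have "x (r (i + N)) = x (r N)" for i using N[of "i + N"] decseqD[OF d, of N "i + N"] by simp
    then have "incseq (\<lambda>i. x (r (i + N)))" by (simp add: incseq_def)
    moreover have "strict_mono (\<lambda>i. r (i + N))" using r(1) by (simp add: strict_mono_def)
    ultimately show ?thesis by blast
  qed
qed

lemma dickson_sequence:
  fixes x :: "nat \<Rightarrow> 'a \<Rightarrow> nat"
  assumes "finite K"
  shows "\<exists>r. strict_mono r \<and> (\<forall>k\<in>K. incseq (\<lambda>i. x (r i) k))"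
  using assms
proof (induction K rule: finite_induct)
  case empty then show ?case by (intro exI[of _ id]) (simp add: strict_mono_def)
next
  case (insert k K)
  then obtain r where r: "strict_mono r" "\<And>l. l \<in> K \<Longrightarrow> incseq (\<lambda>i. x (r i) l)" by blast
  obtain q where q: "strict_mono q" "incseq (\<lambda>i. x (r (q i)) k)"
    using increasing_subsequence[of "\<lambda>i. x (r i) k"] by blast
  have "incseq (\<lambda>i. x (r (q i)) l)" if "l \<in> K" for l
    using r(2)[OF that] q(1) by (simp add: incseq_def strict_mono_less_eq)
  moreover have "strict_mono (\<lambda>i. r (q i))" using r(1) q(1) by (simp add: strict_mono_def)
  ultimately show ?case using q(2) by (intro exI[of _ "\<lambda>i. r (q i)"]) simp
qed

text \<open>An infinite set would contain a sequence increasing in every coordinate, and so two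
  distinct comparable members.\<close>

lemma finite_antichain:
  fixes E :: "('a \<Rightarrow> nat) set"
  assumes K: "finite K" and anti: "\<And>x y. x \<in> E \<Longrightarrow> y \<in> E \<Longrightarrow> (\<forall>k\<in>K. x k \<le> y k) \<Longrightarrow> x = y"
  shows "finite E"
proof (rule ccontr)
  assume "infinite E"
  then obtain x :: "nat \<Rightarrow> 'a \<Rightarrow> nat" where x: "inj x" "range x \<subseteq> E" using infinite_countable_subset by blast
  obtain r where r: "strict_mono r" "\<And>k. k \<in> K \<Longrightarrow> incseq (\<lambda>i. x (r i) k)" using dickson_sequence[OF K, of x] by blast
  have "x (r 0) = x (r 1)" using x(2) incseqD[OF r(2), of _ 0 1] by (intro anti) auto
  then have "r 0 = r 1" using x(1) by (simp add: inj_eq)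
  then show False using strict_monoD[OF r(1), of 0 1] by simp
qed

context coxeter_gcm
begin

text \<open>For the last letter k of a reduced word, the form at the root
  \<open>act w (sr k)\<close> is nonnegative by dominance and nonpositive by dominance of the
  translate. It is therefore 0, and k can be removed without changing the translate.\<close>

lemma dominant_translate_stabilizer:
  assumes K: "K \<subseteq> S" and L: "lin L" and d: "\<And>k. k \<in> K \<Longrightarrow> L (sr k) \<ge> 0" and w: "w \<in> generate W K"
    and dw: "\<And>k. k \<in> K \<Longrightarrow> L (act w (sr k)) \<ge> 0"
  shows "w \<in> generate W {k \<in> K. L (sr k) = 0}"
proof -
  let ?J = "{k \<in> K. L (sr k) = 0}"
  have J: "?J \<subseteq> S" using K by blast
  have "(\<forall>k\<in>K. L (act w (sr k)) \<ge> 0) \<longrightarrow> w \<in> generate W ?J"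
    using K w
  proof (induction rule: gen_induct)
    case one then show ?case by (simp add: gen_one)
  next
    case (mult w k)
    show ?case
    proof
      assume h: "\<forall>l\<in>K. L (act (w \<otimes> k) (sr l)) \<ge> 0"
      have wc: "w \<in> carrier W" using gen_sub[OF K mult(1)] .
      have kS: "k \<in> S" using mult(2) K by blast
      have kc: "k \<in> carrier W" using S_carrier[OF kS] .
      have wkp: "pos (act w (sr k))" using pos_iff_len[OF wc kS] mult(3) by simp
      have "L (act w (sr k)) = (\<Sum>l\<in>S. act w (sr k) l * L (sr l))"
        by (rule lin_root[OF L roots_act[OF wc roots_sr[OF kS]]])
      also have "\<dots> \<ge> 0"
      proof (rule sum_nonneg)
        fix l assume "l \<in> S"
        show "0 \<le> act w (sr k) l * L (sr l)"
        proof (cases "l \<in> K")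
          case True then show ?thesis using d root_pos_nonneg[OF wkp] by simp
        next
          case False
          then have "act w (sr k) l = 0" using act_gen_outside[OF K mult(1) False, of "sr k"] mult(2) by (auto simp: sr_apply)
          then show ?thesis by simp
        qed
      qed
      finally have "L (act w (sr k)) \<ge> 0" .
      moreover have "act (w \<otimes> k) (sr k) = - act w (sr k)" using wc kc kS by (simp add: act_mult act_S_sr act_uminus)
      then have "- L (act w (sr k)) \<ge> 0" using h mult(2) lin_uminus[OF L] by metis
      ultimately have z: "L (act w (sr k)) = 0" by linarith
      have inv: "L (act (w \<otimes> k) v) = L (act w v)" for v
      proof -
        have "act (w \<otimes> k) v = act w v - coroot k v \<cdot> act w (sr k)"
          using wc kc kS by (simp add: act_mult act_S rf_def act_diff act_smul)
        moreover have "L (coroot k v \<cdot> act w (sr k)) = coroot k v * L (act w (sr k))" using L by (simp add: lin_def)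
        ultimately show ?thesis using lin_diff[OF L] z by simp
      qed
      have wJ: "w \<in> generate W ?J" using mult(4) h unfolding inv by blast
      have "L (sr k) = 0" using lin_gen_invariant[OF J L _ wJ, of "sr k"] z by simp
      then have "k \<in> ?J" using mult(2) by simp
      then show "w \<otimes> k \<in> generate W ?J" by (rule gen_mult[OF wJ gen_S])
    qed
  qed
  then show ?thesis using dw by blast
qed

end

context affine_gcm
begin

theorem datum_dominant:
  assumes a: "a \<in> carrier W" and dat: "datum a g n L" and Ld: "\<And>s. s \<in> S \<Longrightarrow> L (sr s) \<ge> 0"
  shows "\<exists>f. class_trace (cls a) f"
proof -
  note D = dat[unfolded datum_def]
  have n: "n > 0" and g: "g \<in> T" "g \<otimes> a = a \<otimes> g" and L: "lin L" and fz: "finite {\<beta> \<in> roots. L \<beta> = 0}" using D by blast+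
  have fixd: "act t \<beta> = \<beta>" if "t \<in> T" "t \<otimes> a = a \<otimes> t" "\<beta> \<in> roots" "act g \<beta> = \<beta>" for t \<beta> using D that by blast
  have gz: "act g \<beta> = \<beta>" and orb: "(\<Sum>i<n. act (a [^] i) \<beta>) = 0" if "\<beta> \<in> roots" "L \<beta> = 0" for \<beta> using D that by blast+
  have aL: "L (act a \<beta>) = L \<beta>" if "\<beta> \<in> roots" "act g \<beta> = \<beta>" for \<beta> using D that by blast
  have gc: "g \<in> carrier W" using T_c[OF g(1)] .
  obtain K a0 \<sigma> u where K: "twisted_parabolic W S A K a0 \<sigma>" "K = {s \<in> S. L (sr s) = 0}"
    and u: "u \<in> generate W K" "a = u \<otimes> a0" and a0g: "a0 \<otimes> g = g \<otimes> a0"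
      "\<And>\<beta>. \<beta> \<in> roots \<Longrightarrow> act g \<beta> = \<beta> \<Longrightarrow> pos (act a0 \<beta>) = pos \<beta>"
    and gk: "\<And>k. k \<in> K \<Longrightarrow> act g (sr k) = sr k"
  proof (rule facet[OF a gc g(2)[symmetric] L Ld fz])
    show "act g \<beta> = \<beta>" if "\<beta> \<in> roots" "L \<beta> = 0" for \<beta> by (rule gz[OF that])
    show "L (act a \<beta>) = 0" if "\<beta> \<in> roots" "L \<beta> = 0" for \<beta> using aL[OF that(1) gz[OF that]] that(2) by simp
    show "L (act a \<beta>) > 0" if "\<beta> \<in> roots" "act g \<beta> = \<beta>" "L \<beta> > 0" for \<beta> using aL[OF that(1,2)] that(3) by simp
    fix K a0 \<sigma> u
    assume A: "twisted_parabolic W S A K a0 \<sigma>" "K = {s \<in> S. L (sr s) = 0}" "u \<in> generate W K" "a = u \<otimes> a0"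
      "a0 \<otimes> g = g \<otimes> a0" and B: "\<And>\<beta>. \<beta> \<in> roots \<Longrightarrow> act g \<beta> = \<beta> \<Longrightarrow> pos (act a0 \<beta>) = pos \<beta>"
      "\<And>k. k \<in> K \<Longrightarrow> act g (sr k) = sr k"
    show thesis by (rule that[OF A]) (fact B)+
  qed
  interpret Q: twisted_parabolic W S A K a0 \<sigma> by (rule K(1))
  note a0 = Q.a0 and uc = Q.WK_c[OF u(1)]
  have fK: "finite K" using finite_subset[OF Q.K fin] .
  have \<sigma>K: "\<sigma> k \<in> K" "act a0 (sr k) = sr (\<sigma> k)" if "k \<in> K" for k using Q.\<sigma> that by (auto simp: bij_betw_def)
  have PL: "L \<beta> = 0" if "\<beta> \<in> PhiK K" for \<beta>
  proof -
    have "\<beta> \<in> roots" using that by (simp add: PhiK_def)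
    then show ?thesis using lin_dominant_root(3)[of L, OF L Ld] that K(2) by simp
  qed
  have a0e: "a0 = inv u \<otimes> a" using u(2) uc a0 by (simp add: m_assoc[symmetric])

  \<comment> \<open>Under \<open>w a0\<close> with w in \<open>W_J\<close>, the sum of the
    coordinates in K - J is constant along the orbit of a simple root outside J. So the orbit sum
    could not vanish as the datum requires.\<close>
  have not_conj: "\<not> Q.tconj u w" if w: "w \<in> Q.nonell" for w
  proof
    assume "Q.tconj u w"
    then obtain j where j: "j \<in> generate W K" "w \<otimes> a0 = inv j \<otimes> (u \<otimes> a0) \<otimes> j" by (auto simp: Q.tconj_def)
    obtain J where J: "J \<subset> K" "\<sigma> ` J = J" "w \<in> generate W J" using w unfolding Q.nonell_def by blast
    have JS: "J \<subseteq> S" using J(1) Q.K by blast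
    obtain k where k: "k \<in> K" "k \<notin> J" using J(1) by blast
    have jc: "j \<in> carrier W" and wc: "w \<in> carrier W" using Q.WK_c[OF j(1)] gen_sub[OF JS J(3)] by auto
    define x where "x = w \<otimes> a0"
    have xc: "x \<in> carrier W" using wc a0 by (simp add: x_def)
    define f where "f v = (\<Sum>l\<in>K - J. v l)" for v :: "'w \<Rightarrow> int"
    have fl: "lin f" by (simp add: lin_def f_def pw_simps sum.distrib sum_distrib_left)
    have fs: "f (sr l) = (if l \<in> K - J then 1 else 0)" for l using fK by (simp add: f_def sr_apply)
    have fx: "f (act x v) = f v \<and> (\<forall>l. l \<notin> K \<longrightarrow> act x v l = 0)" if v: "\<forall>l. l \<notin> K \<longrightarrow> v l = 0" for v
    proof -
      have e: "act a0 v = (\<Sum>l\<in>K. v l \<cdot> sr (\<sigma> l))" using act_expand[OF fK _ a0, of v] v \<sigma>K by simp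
      have e1: "v = (\<Sum>l\<in>K. v l \<cdot> sr l)" using support_expand[OF fK, of v] v by simp
      have s: "f (sr (\<sigma> l)) = f (sr l)" if l: "l \<in> K" for l
      proof -
        have "\<sigma> l \<in> J \<longleftrightarrow> l \<in> J"
        proof
          assume "\<sigma> l \<in> J"
          then obtain m where m: "m \<in> J" "\<sigma> l = \<sigma> m" using J(2) by blast
          have "m \<in> K" using m(1) J(1) by blast
          then have "l = m" using inj_onD[of \<sigma> K l m] Q.\<sigma>(1) m(2) l by (simp add: bij_betw_def)
          then show "l \<in> J" using m(1) by simp
        qed (use J(2) in blast)
        then show ?thesis using l \<sigma>K(1)[OF l] by (simp add: fs)
      qed
      have "f (act a0 v) = (\<Sum>l\<in>K. v l * f (sr (\<sigma> l)))" unfolding e lin_sum[OF fl fK] using fl by (simp add: lin_def)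
      also have "\<dots> = (\<Sum>l\<in>K. v l * f (sr l))" by (rule sum.cong) (simp_all add: s)
      also have "\<dots> = f (\<Sum>l\<in>K. v l \<cdot> sr l)" unfolding lin_sum[OF fl fK] using fl by (simp add: lin_def)
      finally have fa: "f (act a0 v) = f v" using e1 by (simp only:)
      have xv: "act x v = act w (act a0 v)" unfolding x_def by (rule act_mult[OF wc a0])
      have o: "act w y l = y l" if "l \<notin> J" for y l by (rule act_gen_outside[OF JS J(3) that])
      have "f (act x v) = f (act a0 v)" unfolding xv f_def by (rule sum.cong) (simp_all add: o)
      moreover have "act x v l = 0" if l: "l \<notin> K" for l
      proof -
        have "act x v l = act a0 v l" unfolding xv using o l J(1) by blast
        also have "\<dots> = (\<Sum>m\<in>K. v m * sr (\<sigma> m) l)" unfolding e by (simp add: sum_fun_apply pw_simps)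
        also have "\<dots> = 0" by (rule sum.neutral) (use \<sigma>K l in \<open>auto simp: sr_apply\<close>)
        finally show ?thesis .
      qed
      ultimately show ?thesis using fa by simp
    qed
    have it: "f (act (x [^] i) (sr k)) = 1 \<and> (\<forall>l. l \<notin> K \<longrightarrow> act (x [^] i) (sr k) l = 0)" for i :: nat
    proof (induction i)
      case 0
      have "f (sr k) = 1" using k fs[of k] by simp
      moreover have "\<forall>l. l \<notin> K \<longrightarrow> sr k l = 0" using k by (auto simp: sr_apply)
      ultimately show ?case by (simp only: nat_pow_0 act_one)
    next
      case (Suc i)
      then show ?case unfolding act_pow_Suc(2)[OF xc] using fx[of "act (x [^] i) (sr k)"] by simp
    qed
    have xe: "x = inv j \<otimes> a \<otimes> inv (inv j)" unfolding x_def j(2) u(2) using jc by simp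
    have ac: "act (x [^] i) v = act (inv j) (act (a [^] i) (act j v))" for i :: nat and v
      unfolding xe conj_pow[OF a inv_closed[OF jc]] using a jc by (simp add: act_mult)
    have jk: "act j (sr k) \<in> PhiK K" using Q.PhiK_gen[OF j(1) Q.PhiK_sr[OF k(1)]] .
    have "(\<Sum>i<n. act (x [^] i) (sr k)) = act (inv j) (\<Sum>i<n. act (a [^] i) (act j (sr k)))"
      unfolding ac using jc by (simp add: act_sum)
    also have "(\<Sum>i<n. act (a [^] i) (act j (sr k))) = 0"
      by (rule orb) (use jk PL in \<open>auto simp: PhiK_def\<close>)
    finally have z: "(\<Sum>i<n. act (x [^] i) (sr k)) = 0" using jc by (simp add: act_zero)
    have "f (\<Sum>i<n. act (x [^] i) (sr k)) = (\<Sum>i<n. f (act (x [^] i) (sr k)))"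
      by (rule lin_sum[OF fl finite_lessThan])
    also have "\<dots> = int n" using it by simp
    finally show False unfolding z lin_zero[OF fl] using n by simp
  qed
  obtain f where f: "Q.tt f" "\<And>w. w \<in> Q.WK \<Longrightarrow> ev1 (f w) \<ge> 0" "\<And>w. w \<in> Q.WK \<Longrightarrow> ev1 (f w) > 0 \<longleftrightarrow> Q.tconj u w"
    "\<And>w. w \<in> Q.nonell \<Longrightarrow> f w = 0"
    using Q.elliptic_phi[OF u(1) not_conj] by metis

  define \<Gamma> where "\<Gamma> = {z \<in> T. z \<otimes> a = a \<otimes> z}"
  have \<Gamma>D: "z \<in> T" "z \<otimes> a = a \<otimes> z" "z \<in> carrier W" if "z \<in> \<Gamma>" for z using that T_c[of z] by (simp_all add: \<Gamma>_def)
  have \<Gamma>k: "act z (sr k) = sr k" if "z \<in> \<Gamma>" "k \<in> K" for z k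
    by (rule fixd[OF \<Gamma>D(1,2)[OF that(1)] roots_sr gk[OF that(2)]]) (use that(2) Q.K in blast)
  have sub: "subgroup \<Gamma> W"
  proof (rule subgroupI)
    show "\<Gamma> \<subseteq> carrier W" using \<Gamma>D(3) by (rule subsetI)
    have "\<one> \<in> \<Gamma>" using a T_one by (simp add: \<Gamma>_def)
    then show "\<Gamma> \<noteq> {}" by blast
    fix x assume x: "x \<in> \<Gamma>"
    show "inv x \<in> \<Gamma>" using T_inv[OF \<Gamma>D(1)[OF x]] inv_comm_of[OF \<Gamma>D(3)[OF x] a \<Gamma>D(2)[OF x]] by (simp add: \<Gamma>_def)
    fix y assume y: "y \<in> \<Gamma>"
    have "x \<otimes> y \<otimes> a = a \<otimes> (x \<otimes> y)"
      using \<Gamma>D(2,3)[OF x] \<Gamma>D(2,3)[OF y] a by (metis m_assoc)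
    then show "x \<otimes> y \<in> \<Gamma>" using T_mult[OF \<Gamma>D(1)[OF x] \<Gamma>D(1)[OF y]] by (simp add: \<Gamma>_def)
  qed
  have \<Gamma>a0: "z \<otimes> a0 = a0 \<otimes> z" if z: "z \<in> \<Gamma>" for z
  proof -
    have "z \<otimes> inv u = inv u \<otimes> z"
      by (rule fix_simple_commute[OF Q.K \<Gamma>D(3)[OF z] \<Gamma>k[OF z] gen_inv[OF Q.K u(1)]])
    then show ?thesis unfolding a0e using \<Gamma>D(2,3)[OF z] uc a by (metis m_assoc inv_closed)
  qed

  have fin_orb: "\<exists>F. finite F \<and> F \<subseteq> carrier W \<and>
        (\<forall>h\<in>carrier W. (\<forall>k\<in>K. pos (act (inv h) (sr k))) \<longrightarrow> w \<otimes> a0 \<otimes> h = h \<otimes> v \<longrightarrow>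
           (\<exists>z\<in>\<Gamma>. \<exists>h'\<in>F. h = z \<otimes> h'))"
    if w: "w \<in> Q.WK" and fw: "f w \<noteq> 0" and v: "v \<in> carrier W" for w v
  proof -
    define x where "x = w \<otimes> a0"
    have wc: "w \<in> carrier W" using Q.WK_c[OF w] .
    have x: "x \<in> carrier W" using wc a0 by (simp add: x_def)
    have wn: "w \<notin> Q.nonell" using f(4) fw by blast
    define H where "H = {h \<in> carrier W. (\<forall>k\<in>K. pos (act (inv h) (sr k))) \<and> x \<otimes> h = h \<otimes> v}"
    have HD: "h \<in> carrier W" "x \<otimes> h = h \<otimes> v" "\<And>k. k \<in> K \<Longrightarrow> pos (act (inv h) (sr k))" if "h \<in> H" for h
      using that by (auto simp: H_def)
    \<comment> \<open>The coordinate at \<open>s0\<close> measures the position along \<delta> of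
      the roots to which \<open>inv h\<close> sends the simple roots of K; \<open>lab h\<close>
      records the rest. Minimality of h in its coset makes these numbers nonnegative.\<close>
    define e where "e h k = (if k \<in> K then nat (act (inv h) (sr k) s0) else 0)" for h k
    \<comment> \<open>If h and h' have equal labels and comparable exponents, the translation t
      between them is nonnegative on the simple roots of K, and so is its translate by w. Then w
      lies in the stable parabolic subgroup of the zeros of t. As \<phi> is nonzero at w, this must
      be all of \<open>W_K\<close>, so t fixes K, commutes with a, and the exponents agree. Hence
      for each label the exponents form an antichain.\<close>
    have key: "h \<otimes> inv h' \<in> \<Gamma> \<and> e h = e h'"
      if h: "h \<in> H" "h' \<in> H" and c: "lab h = lab h'" and le: "\<forall>k\<in>K. e h k \<le> e h' k" for h h'
    proof -
      note hc = HD(1)[OF h(1)] HD(1)[OF h(2)]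
      let ?t = "h \<otimes> inv h'"
      have t: "?t \<in> T" by (rule lab_T[OF hc c])
      have tc: "?t \<in> carrier W" using T_c[OF t] .
      have tx: "?t \<otimes> x = x \<otimes> ?t" by (rule conj_solutions_commute[OF hc x v HD(2)[OF h(1)] HD(2)[OF h(2)]])
      have p: "act (inv h') (sr k) s0 = act (inv h) (sr k) s0 + \<tau> ?t (sr k)" if k: "k \<in> K" for k
      proof -
        have d: "rad (act ?t (sr k) - sr k)" using T_rad[OF t supp_root[OF roots_sr]] k Q.K by blast
        have "act (inv h') (sr k) = act (inv h) (act ?t (sr k))" using hc by (simp add: act_mult)
        also have "\<dots> = act (inv h) (sr k + (act ?t (sr k) - sr k))" by simp
        also have "\<dots> = act (inv h) (sr k) + (act ?t (sr k) - sr k)"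
          unfolding act_add[OF inv_closed[OF hc(1)]] rad_fix[OF d inv_closed[OF hc(1)]] ..
        finally show ?thesis by (simp add: \<tau>_def pw_simps)
      qed
      have nn: "act (inv i) (sr k) s0 \<ge> 0" if "i \<in> H" "k \<in> K" for i k
        using root_pos_nonneg[OF HD(3)[OF that]] .
      have t0: "\<tau> ?t (sr k) \<ge> 0" if k: "k \<in> K" for k
      proof -
        have "nat (act (inv h) (sr k) s0) \<le> nat (act (inv h') (sr k) s0)" using le k by (simp add: e_def)
        then have "act (inv h) (sr k) s0 \<le> act (inv h') (sr k) s0" using nn[OF h(2) k] by linarith
        then show ?thesis using p[OF k] by linarith
      qed
      have tl: "lin (\<tau> ?t)" by (rule \<tau>_lin[OF tc])
      let ?J = "{k \<in> K. \<tau> ?t (sr k) = 0}"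
      have inv: "\<tau> ?t (act w (sr (\<sigma> k))) = \<tau> ?t (sr k)" if k: "k \<in> K" for k
      proof -
        have "act x (sr k) = act w (sr (\<sigma> k))" unfolding x_def using wc a0 \<sigma>K(2)[OF k] by (simp add: act_mult)
        moreover have "supp (sr k)" using supp_root[OF roots_sr] k Q.K by blast
        ultimately show ?thesis using T_commuteD[OF t x tx] by metis
      qed
      have wJ: "w \<in> generate W ?J"
      proof (rule dominant_translate_stabilizer[OF Q.K tl t0 w])
        fix k assume "k \<in> K"
        then obtain k' where k': "k' \<in> K" "k = \<sigma> k'" using Q.\<sigma>(1) by (auto simp: bij_betw_def)
        show "\<tau> ?t (act w (sr k)) \<ge> 0" unfolding k'(2) inv[OF k'(1)] by (rule t0[OF k'(1)])
      qed
      have JS: "?J \<subseteq> S" using Q.K by blast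
      have sJ1: "\<sigma> ` ?J \<subseteq> ?J"
      proof
        fix l assume "l \<in> \<sigma> ` ?J"
        then obtain k where k: "k \<in> K" "\<tau> ?t (sr k) = 0" "l = \<sigma> k" by blast
        have "\<tau> ?t (act w (sr (\<sigma> k))) = \<tau> ?t (sr (\<sigma> k))"
          by (rule lin_gen_invariant[OF JS tl _ wJ]) simp
        then show "l \<in> ?J" using inv[OF k(1)] k \<sigma>K(1) by simp
      qed
      have "inj_on \<sigma> K" using Q.\<sigma>(1) by (simp add: bij_betw_def)
      then have "inj_on \<sigma> ?J" by (rule inj_on_subset) blast
      moreover have "finite ?J" using fK by simp
      ultimately have sJ: "\<sigma> ` ?J = ?J" using endo_inj_surj sJ1 by blast
      have "?J = K"
      proof (rule ccontr)
        assume "?J \<noteq> K"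
        then have "?J \<subset> K" by blast
        then have "w \<in> Q.nonell" by (rule Q.nonellI[OF _ sJ wJ])
        then show False using wn by blast
      qed
      then have tz: "\<tau> ?t (sr k) = 0" if "k \<in> K" for k using that by blast
      have tk: "act ?t (sr k) = sr k" if k: "k \<in> K" for k
        using \<tau>_zero[OF t supp_root[OF roots_sr]] tz[OF k] k Q.K by blast
      define w' where "w' = w \<otimes> inv u"
      have w': "w' \<in> generate W K" unfolding w'_def using w u(1) gen_mult gen_inv Q.K by metis
      have w'c: "w' \<in> carrier W" using Q.WK_c[OF w'] .
      have "x = w' \<otimes> a" unfolding x_def w'_def a0e using wc uc a by (simp add: m_assoc)
      then have ax: "a = inv w' \<otimes> x" using w'c a by (simp add: m_assoc[symmetric])
      have "?t \<otimes> inv w' = inv w' \<otimes> ?t"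
        by (rule fix_simple_commute[OF Q.K tc tk gen_inv[OF Q.K w']])
      then have "?t \<otimes> a = a \<otimes> ?t" unfolding ax using tx tc w'c x by (metis m_assoc inv_closed)
      then have "?t \<in> \<Gamma>" using t by (simp add: \<Gamma>_def)
      moreover have "e h = e h'"
      proof (rule ext)
        fix k show "e h k = e h' k" using p[of k] tz[of k] by (cases "k \<in> K") (simp_all add: e_def)
      qed
      ultimately show ?thesis by blast
    qed
    have "finite (e ` {h \<in> H. lab h = c})" for c
    proof (rule finite_antichain[OF fK])
      fix y z assume "y \<in> e ` {h \<in> H. lab h = c}" "z \<in> e ` {h \<in> H. lab h = c}" and le: "\<forall>k\<in>K. y k \<le> z k"
      then obtain h h' where h: "h \<in> H" "lab h = c" "y = e h" "h' \<in> H" "lab h' = c" "z = e h'" by blast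
      have "lab h = lab h'" using h(2,5) by simp
      then show "y = z" using key[OF h(1,4)] le unfolding h(3,6) by blast
    qed
    moreover have "finite (lab ` H)" by (rule finite_subset[OF _ lab_fin]) (use HD(1) in blast)
    ultimately have "finite (\<Union>c\<in>lab ` H. Pair c ` e ` {h \<in> H. lab h = c})" by blast
    moreover have "(\<lambda>h. (lab h, e h)) ` H \<subseteq> (\<Union>c\<in>lab ` H. Pair c ` e ` {h \<in> H. lab h = c})" by blast
    ultimately have "finite ((\<lambda>h. (lab h, e h)) ` H)" by (rule finite_subset[rotated])
    then obtain F where F: "F \<subseteq> H" "finite F" "(\<lambda>h. (lab h, e h)) ` H = (\<lambda>h. (lab h, e h)) ` F"
      using finite_subset_image[of "(\<lambda>h. (lab h, e h)) ` H" "\<lambda>h. (lab h, e h)" H] by blast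
    show ?thesis unfolding x_def[symmetric]
    proof (intro exI[of _ F] conjI ballI impI)
      show "finite F" "F \<subseteq> carrier W" using F HD(1) by auto
      fix h assume "h \<in> carrier W" "\<forall>k\<in>K. pos (act (inv h) (sr k))" "x \<otimes> h = h \<otimes> v"
      then have h: "h \<in> H" by (simp add: H_def)
      then have "(lab h, e h) \<in> (\<lambda>h. (lab h, e h)) ` F" using F(3) by blast
      then obtain i where i: "i \<in> F" "lab h = lab i" "e h = e i" by auto
      have iH: "i \<in> H" using i F by blast
      have "h \<otimes> inv i \<in> \<Gamma>" using key[OF h iH i(2)] i(3) by simp
      moreover have "h = (h \<otimes> inv i) \<otimes> i" using HD(1)[OF h] HD(1)[OF iH] by (simp add: m_assoc)
      ultimately show "\<exists>z\<in>\<Gamma>. \<exists>h'\<in>F. h = z \<otimes> h'" using i by blast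
    qed
  qed
  show ?thesis unfolding u(2)
  proof (rule Q.class_trace_exists[where g = g and \<Gamma> = \<Gamma> and f = f])
    show "isolated g" by (rule T_isolated[OF g(1)])
    show "g \<in> carrier W" "\<And>k. k \<in> K \<Longrightarrow> act g (sr k) = sr k" "a0 \<otimes> g = g \<otimes> a0"
      "\<And>\<beta>. \<beta> \<in> roots \<Longrightarrow> act g \<beta> = \<beta> \<Longrightarrow> pos (act a0 \<beta>) = pos \<beta>" "u \<in> Q.WK" "subgroup \<Gamma> W"
      "\<And>z. z \<in> \<Gamma> \<Longrightarrow> z \<otimes> a0 = a0 \<otimes> z" "Q.tt f" "\<And>w. w \<in> Q.WK \<Longrightarrow> ev1 (f w) \<ge> 0"
      "\<And>w. w \<in> Q.WK \<Longrightarrow> ev1 (f w) > 0 \<longleftrightarrow> Q.tconj u w"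
      by (fact gc gk a0g u(1) sub \<Gamma>a0 f)+
    show "z \<otimes> g = g \<otimes> z" if "z \<in> \<Gamma>" for z by (rule T_comm[OF \<Gamma>D(1)[OF that] g(1)])
    show "act z (sr k) = sr k" if "z \<in> \<Gamma>" "k \<in> K" for z k by (rule \<Gamma>k[OF that])
    show "pos (act z \<beta>) = pos \<beta>" if "z \<in> \<Gamma>" "\<beta> \<in> roots" "act g \<beta> = \<beta>" for z \<beta>
      using fixd[OF \<Gamma>D(1,2)[OF that(1)] that(2,3)] by simp
    show "\<exists>F. finite F \<and> F \<subseteq> carrier W \<and>
        (\<forall>h\<in>carrier W. (\<forall>k\<in>K. pos (act (inv h) (sr k))) \<longrightarrow> w \<otimes> a0 \<otimes> h = h \<otimes> v \<longrightarrow>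
           (\<exists>z\<in>\<Gamma>. \<exists>h'\<in>F. h = z \<otimes> h'))" if "w \<in> Q.WK" "f w \<noteq> 0" "v \<in> carrier W" for w v
      by (rule fin_orb[OF that])
  qed
qed

theorem affine_class_trace:
  assumes a: "a \<in> carrier W"
  shows "\<exists>f. class_trace (cls a) f"
proof -
  obtain g n L where d: "datum a g n L" and fn: "finite {\<beta> \<in> roots. pos \<beta> \<and> L \<beta> < 0}" using ex_datum[OF a] by blast
  have L: "lin L" using d unfolding datum_def by blast
  obtain w where w: "w \<in> carrier W" "\<And>s. s \<in> S \<Longrightarrow> L (act (inv w) (sr s)) \<ge> 0"
    using dominant_conjugate[OF L fn] by blast
  have "\<exists>f. class_trace (cls (w \<otimes> a \<otimes> inv w)) f"
    by (rule datum_dominant[OF _ datum_conj[OF d a w(1)] w(2)]) (use a w in simp_all)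
  then show ?thesis using cls_conj[OF a w(1)] by simp
qed

end

context coxeter_gcm
begin

theorem elliptic_class_trace:
  assumes irr: "irreducible_coxeter W S" and a: "a \<in> carrier W"
    and ell: "\<And>J. J \<subset> S \<Longrightarrow> cls a \<inter> generate W J = {}"
  shows "\<exists>f. class_trace (cls a) f"
proof (cases "finite (Per a)")
  case True then show ?thesis by (rule finite_Per[OF a])
next
  case False
  obtain \<delta> where d: "imag \<delta>" "act a \<delta> = \<delta>" using infinite_Per[OF a False] by blast
  have fixd: "act w \<delta> = \<delta>" if "w \<in> carrier W" for w by (rule elliptic_imag_fixed[OF a ell d that])
  have rad: "coroot s \<delta> = 0" if s: "s \<in> S" for s
  proof -
    have "act s \<delta> = \<delta>" using fixd S_carrier[OF s] by blast
    then have "\<delta> - coroot s \<delta> \<cdot> sr s = \<delta>" using s by (simp add: act_S rf_def)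
    then have "(\<delta> - coroot s \<delta> \<cdot> sr s) s = \<delta> s" by simp
    then show ?thesis by (simp add: pw_simps)
  qed
  have conn: "Z = S" if Z: "Z \<subseteq> S" "Z \<noteq> {}" "\<And>s t. s \<in> Z \<Longrightarrow> t \<in> S \<Longrightarrow> A s t \<noteq> 0 \<Longrightarrow> t \<in> Z" for Z
  proof (rule ccontr)
    assume "Z \<noteq> S"
    then have "Z \<subset> S" using Z(1) by blast
    moreover have "cox_m W s t = 2" if s: "s \<in> Z" and t: "t \<in> S - Z" for s t
    proof -
      have "A s t = 0" using Z(3)[OF s, of t] t by blast
      then show ?thesis using A_rel[of s t] s t Z(1) by auto
    qed
    ultimately show False using irr Z(2) unfolding irreducible_coxeter_def by blast
  qed
  have nn: "\<delta> s \<ge> 0" for s using d(1) act_one[of \<delta>] one_closed unfolding imag_def nonneg_def by metis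
  have su: "supp \<delta>" using d(1) by (simp add: imag_def supp_def)
  have p: "\<delta> s > 0" if s: "s \<in> S" for s
  proof (rule ccontr)
    assume "\<not> ?thesis"
    then have z: "\<delta> s = 0" using nn[of s] by linarith
    have "{t \<in> S. \<delta> t = 0} = S"
    proof (rule conn)
      show "{t \<in> S. \<delta> t = 0} \<noteq> {}" using s z by blast
      show "t \<in> {t \<in> S. \<delta> t = 0}" if r: "r \<in> {t \<in> S. \<delta> t = 0}" and t: "t \<in> S" "A r t \<noteq> 0" for r t
        using coroot_eq_zero_closed[of r \<delta> t] r t nn rad by simp
    qed blast
    then have "\<delta> x = 0" for x using su by (cases "x \<in> S") (auto simp: supp_def)
    then show False using d(1) by (auto simp: imag_def pw)
  qed
  obtain s0 where s0: "s0 \<in> S" using irr unfolding irreducible_coxeter_def by blast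
  have inf: "infinite roots"
  proof
    assume "finite roots"
    moreover have "Per a \<subseteq> roots" by (auto simp: Per_def)
    ultimately show False using False finite_subset by blast
  qed
  interpret affine_gcm W S A \<delta> s0
    by (intro affine_gcm.intro coxeter_gcm_axioms affine_gcm_axioms.intro) (fact su p rad s0 conn inf)+
  show ?thesis by (rule affine_class_trace[OF a])
qed

end

section \<open>Functionals on the cocenter\<close>

definition word_sum :: "('w list \<Rightarrow> laurent) \<Rightarrow> 'w free_alg \<Rightarrow> laurent" where
  "word_sum f x = (\<Sum>k\<in>keys x. lookup x k * f (letters k))"

lemma word_sum_superset:
  assumes "finite A" "keys x \<subseteq> A"
  shows "word_sum f x = (\<Sum>k\<in>A. lookup x k * f (letters k))"
  unfolding word_sum_def using assms by (intro sum.mono_neutral_left) (auto simp: in_keys_iff)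

lemma word_sum_add: "word_sum f (x + y) = word_sum f x + word_sum f y"
  by (simp add: word_sum_superset[of "keys x \<union> keys y"] keys_add
      lookup_add sum.distrib distrib_right)

lemma word_sum_zero [simp]: "word_sum f 0 = 0" by (simp add: word_sum_def)

lemma word_sum_diff: "word_sum f (x - y) = word_sum f x - word_sum f y"
  using word_sum_add[of f "x - y" y] by simp

lemma word_sum_uminus: "word_sum f (- x) = - word_sum f x"
  using word_sum_diff[of f 0 x] by simp

lemma word_sum_sum: "word_sum f (\<Sum>i\<in>I. x i) = (\<Sum>i\<in>I. word_sum f (x i))"
  by (induction I rule: infinite_finite_induct) (auto simp: word_sum_add)

lemma word_sum_single: "word_sum f (single k c) = c * f (letters k)"
  by (simp add: word_sum_def)

lemma poly_mapping_expand: "(\<Sum>k\<in>keys x. single k (lookup x k)) = x"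
proof (rule poly_mapping_eqI)
  fix l
  have "(\<Sum>k\<in>keys x. lookup (single k (lookup x k)) l)
      = (\<Sum>k\<in>keys x. if k = l then lookup x k else 0)"
    by (simp only: lookup_single when_def)
  also have "\<dots> = (if l \<in> keys x then lookup x l else 0)"
    by (rule sum.delta) (rule finite_keys)
  also have "\<dots> = lookup x l" using in_keys_iff[of l x] by (cases "l \<in> keys x") simp_all
  finally show "lookup (\<Sum>k\<in>keys x. single k (lookup x k)) l
      = lookup x l" by (simp only: lookup_sum)
qed

lemma word_sum_mult:
  "word_sum f (x * y) = (\<Sum>k\<in>keys x. \<Sum>l\<in>keys y.
     lookup x k * lookup y l * f (letters k @ letters l))"
proof -
  have "x * y = (\<Sum>k\<in>keys x. \<Sum>l\<in>keys y.
      single k (lookup x k) * single l (lookup y l))"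
    using sum_product[of "\<lambda>k. single k (lookup x k)" "keys x"
        "\<lambda>k. single k (lookup y k)" "keys y"]
    by (simp only: poly_mapping_expand)
  then show ?thesis
    by (simp add: word_sum_sum mult_single word_sum_single plus_free_monoid_def)
qed

lemma word_sum_scalar: "word_sum f (scalar c * y) = c * word_sum f y"
  unfolding word_sum_mult scalar_def
  by (simp add: word_sum_def sum_distrib_left zero_free_monoid_def mult.assoc)

locale word_trace =
  fixes W :: "'w monoid" and S :: "'w set" and f :: "'w list \<Rightarrow> laurent"
  assumes rotate: "\<And>u v. u \<in> lists S \<Longrightarrow> v \<in> lists S \<Longrightarrow> f (u @ v) = f (v @ u)"
    and quadratic: "\<And>s v. s \<in> S \<Longrightarrow> v \<in> lists S \<Longrightarrow> f (s # s # v) = (qq - 1) * f (s # v) + qq * f v"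
    and braid: "\<And>s t v. s \<in> S \<Longrightarrow> t \<in> S \<Longrightarrow> v \<in> lists S \<Longrightarrow> s \<noteq> t \<Longrightarrow> cox_m W s t \<noteq> 0 \<Longrightarrow>
        f (alt_word (cox_m W s t) s t @ v) = f (alt_word (cox_m W s t) t s @ v)"
begin

abbreviation FA where "FA \<equiv> free_algebra S"
abbreviation I where "I \<equiv> hecke_ideal W S"
abbreviation H where "H \<equiv> hecke_algebra W S"
abbreviation C where "C \<equiv> commutator_span W S"

lemma FA_simps: "mult FA = (*)" "one FA = 1" "zero FA = 0" "add FA = (+)"
  by (simp_all add: free_algebra_def)

lemma FA_carrier: "x \<in> carrier FA \<longleftrightarrow> (\<forall>k\<in>keys x. letters k \<in> lists S)"
  by (simp add: free_algebra_def)

lemma FA_add: "x \<in> carrier FA \<Longrightarrow> y \<in> carrier FA \<Longrightarrow> x + y \<in> carrier FA"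
  unfolding FA_carrier using keys_add[of x y] by blast

lemma FA_uminus: "x \<in> carrier FA \<Longrightarrow> - x \<in> carrier FA"
  unfolding FA_carrier by (simp add: in_keys_iff)

lemma FA_diff: "x \<in> carrier FA \<Longrightarrow> y \<in> carrier FA \<Longrightarrow> x - y \<in> carrier FA"
  using FA_add[of x "- y"] FA_uminus by simp

lemma FA_mult: "x \<in> carrier FA \<Longrightarrow> y \<in> carrier FA \<Longrightarrow> x * y \<in> carrier FA"
proof -
  assume a: "x \<in> carrier FA" "y \<in> carrier FA"
  show ?thesis unfolding FA_carrier
  proof
    fix k assume "k \<in> keys (x * y)"
    then obtain i j where "k = i + j" "i \<in> keys x" "j \<in> keys y" using keys_mult[of x y] by blast
    then show "letters k \<in> lists S" using a by (simp add: FA_carrier plus_free_monoid_def)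
  qed
qed

lemma FA_scalar: "scalar c \<in> carrier FA" by (simp add: FA_carrier scalar_def zero_free_monoid_def)
lemma FA_one: "1 \<in> carrier FA" by (simp add: FA_carrier zero_free_monoid_def)
lemma FA_word: "w \<in> lists S \<Longrightarrow> word_monom w \<in> carrier FA" by (simp add: FA_carrier word_monom_def)

lemma FA_abelian: "abelian_group FA"
proof (rule abelian_groupI)
  fix x assume x: "x \<in> carrier FA"
  show "\<exists>y\<in>carrier FA. y \<oplus>\<^bsub>FA\<^esub> x = \<zero>\<^bsub>FA\<^esub>"
    by (rule bexI[OF _ FA_uminus[OF x]]) (simp add: FA_simps)
next
  show "x \<oplus>\<^bsub>FA\<^esub> y \<in> carrier FA" if "x \<in> carrier FA" "y \<in> carrier FA" for x y
    using FA_add[OF that] by (simp add: FA_simps)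
  show "\<zero>\<^bsub>FA\<^esub> \<in> carrier FA" by (simp add: FA_simps FA_carrier)
qed (simp_all add: FA_simps algebra_simps)

lemma FA_ring: "ring FA"
  using FA_abelian
  by (intro ringI monoidI) (auto simp: FA_simps FA_mult FA_one algebra_simps)

lemma trace: "x \<in> carrier FA \<Longrightarrow> y \<in> carrier FA \<Longrightarrow> word_sum f (x * y) = word_sum f (y * x)"
  unfolding word_sum_mult
  by (subst sum.swap, intro sum.cong refl) (simp add: FA_carrier rotate mult.commute)

lemma word_sum_mult_zero:
  assumes y: "y \<in> carrier FA" and z: "\<And>v. v \<in> lists S \<Longrightarrow> word_sum f (x * word_monom v) = 0"
  shows "word_sum f (x * y) = 0"
proof -
  have s: "single l c = scalar c * word_monom (letters l)" for l :: "'w free_monoid" and c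
    by (simp add: scalar_def word_monom_def mult_single)
  have "word_sum f (x * single l c) = 0" if l: "letters l \<in> lists S" for l c
  proof -
    have "word_sum f (x * single l c) = c * word_sum f (x * word_monom (letters l))"
      unfolding word_sum_mult word_monom_def by (simp add: sum_distrib_left mult.commute mult.left_commute)
    then show ?thesis using z[OF l] by simp
  qed
  moreover have "x * y = (\<Sum>l\<in>keys y. x * single l (lookup y l))"
    using sum_distrib_left[of x "\<lambda>l. single l (lookup y l)" "keys y"]
    by (simp only: poly_mapping_expand)
  ultimately show ?thesis using y by (simp add: word_sum_sum FA_carrier)
qed

text \<open>The radical of the trace form on the free algebra. Rotation invariance makes it a
  two-sided ideal, so it contains the Hecke ideal as soon as it contains the relators.\<close>

definition Z where "Z = {x \<in> carrier FA. \<forall>y\<in>carrier FA. word_sum f (x * y) = 0}"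

lemma Z_ideal: "ideal Z FA"
proof (rule idealI[OF FA_ring])
  interpret ring FA by (rule FA_ring)
  show "subgroup Z (add_monoid FA)"
  proof (rule add.subgroupI)
    show "Z \<subseteq> carrier FA" by (auto simp: Z_def)
    have "0 \<in> Z" by (simp add: Z_def FA_carrier)
    then show "Z \<noteq> {}" by blast
    fix x assume x: "x \<in> Z"
    have xc: "x \<in> carrier FA" using x by (simp add: Z_def)
    have "\<ominus>\<^bsub>FA\<^esub> x = - x"
      using minus_equality[of "- x" x] xc FA_uminus[OF xc] by (simp add: FA_simps)
    moreover have "- x \<in> Z" using x FA_uminus[OF xc] by (simp add: Z_def word_sum_uminus)
    ultimately show "\<ominus>\<^bsub>FA\<^esub> x \<in> Z" by simp
    fix y assume y: "y \<in> Z"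
    show "x \<oplus>\<^bsub>FA\<^esub> y \<in> Z" using x y by (simp add: Z_def FA_simps FA_add distrib_right word_sum_add)
  qed
  fix x r assume x: "x \<in> Z" and r: "r \<in> carrier FA"
  have xc: "x \<in> carrier FA" and xz: "\<And>y. y \<in> carrier FA \<Longrightarrow> word_sum f (x * y) = 0" using x by (auto simp: Z_def)
  have "word_sum f ((r * x) * y) = 0" if y: "y \<in> carrier FA" for y
    using trace[OF r FA_mult[OF xc y]] xz[OF FA_mult[OF y r]] by (simp add: mult.assoc)
  then show "r \<otimes>\<^bsub>FA\<^esub> x \<in> Z" using FA_mult[OF r xc] by (simp add: Z_def FA_simps)
  have "word_sum f ((x * r) * y) = 0" if y: "y \<in> carrier FA" for y
    using xz[OF FA_mult[OF r y]] by (simp add: mult.assoc)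
  then show "x \<otimes>\<^bsub>FA\<^esub> r \<in> Z" using FA_mult[OF xc r] by (simp add: Z_def FA_simps)
qed

lemma word_sum_monom: "word_sum f (word_monom w) = f w"
  by (simp add: word_monom_def word_sum_single)

lemma monom_mult: "word_monom u * word_monom v = word_monom (u @ v)"
  by (simp add: word_monom_def mult_single plus_free_monoid_def)

lemma alt_word_set: "x \<in> set (alt_word n s t) \<Longrightarrow> x = s \<or> x = t"
  by (auto simp: alt_word_def split: if_splits)

lemma relators_carrier: "hecke_relators W S \<subseteq> carrier FA"
  unfolding hecke_relators_def
  by (auto intro!: FA_mult FA_add FA_diff FA_word FA_one FA_scalar dest: alt_word_set)

lemma relators_Z: "hecke_relators W S \<subseteq> Z"
proof
  fix r assume r: "r \<in> hecke_relators W S"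
  have "word_sum f (r * word_monom v) = 0" if v: "v \<in> lists S" for v
  proof -
    consider s where "s \<in> S" "r = (word_monom [s] + 1) * (word_monom [s] - scalar qq)"
      | s t where "s \<in> S" "t \<in> S" "s \<noteq> t" "cox_m W s t \<noteq> 0"
        "r = word_monom (alt_word (cox_m W s t) s t) - word_monom (alt_word (cox_m W s t) t s)"
      using r unfolding hecke_relators_def by blast
    then show ?thesis
    proof cases
      case 1
      have c: "word_sum f (word_monom [s] * (scalar qq * word_monom v)) = qq * f (s # v)"
        by (simp add: word_monom_def scalar_def mult_single word_sum_single plus_free_monoid_def zero_free_monoid_def)
      have "r * word_monom v = word_monom [s] * (word_monom [s] * word_monom v) - word_monom [s] * (scalar qq * word_monom v)
          + word_monom [s] * word_monom v - scalar qq * word_monom v"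
        unfolding 1(2) by (simp add: algebra_simps)
      then show ?thesis
        by (simp add: word_sum_add word_sum_diff c monom_mult word_sum_monom word_sum_scalar quadratic[OF 1(1) v])
          (simp add: algebra_simps)
    next
      case 2
      show ?thesis unfolding 2(5)
        by (simp add: left_diff_distrib word_sum_diff monom_mult word_sum_monom braid[OF 2(1,2) v 2(3,4)])
    qed
  qed
  then show "r \<in> Z" unfolding Z_def using relators_carrier r word_sum_mult_zero by blast
qed

lemma I_ideal: "ideal I FA"
  unfolding hecke_ideal_def by (rule ring.genideal_ideal[OF FA_ring relators_carrier])

lemma I_Z: "I \<subseteq> Z"
  unfolding hecke_ideal_def by (rule ring.genideal_minimal[OF FA_ring Z_ideal relators_Z])

lemma I_zero: "x \<in> I \<Longrightarrow> y \<in> carrier FA \<Longrightarrow> word_sum f (x * y) = 0" "x \<in> I \<Longrightarrow> word_sum f x = 0"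
proof -
  show *: "x \<in> I \<Longrightarrow> y \<in> carrier FA \<Longrightarrow> word_sum f (x * y) = 0" for x y using I_Z by (auto simp: Z_def)
  show "x \<in> I \<Longrightarrow> word_sum f x = 0" using *[of x 1] FA_one by simp
qed

lemma I_carrier: "x \<in> I \<Longrightarrow> x \<in> carrier FA" using I_Z by (auto simp: Z_def)

text \<open>Records that \<open>word_sum f\<close> is constant on a coset, so values on the quotient
  are handled without choosing representatives.\<close>

definition rep :: "'w free_alg set \<Rightarrow> laurent \<Rightarrow> bool" where
  "rep Y c \<longleftrightarrow> Y \<noteq> {} \<and> Y \<subseteq> carrier FA \<and> (\<forall>y\<in>Y. word_sum f y = c)"

lemma rep_unique: "rep Y c \<Longrightarrow> rep Y d \<Longrightarrow> c = d" by (auto simp: rep_def)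

lemma H_simps: "carrier H = a_rcosets\<^bsub>FA\<^esub> I" "add H = set_add FA" "mult H = rcoset_mult FA I" "zero H = I"
  "smult H c X = rcoset_mult FA I (I +>\<^bsub>FA\<^esub> scalar c) X"
  by (simp_all add: hecke_algebra_def ring.defs module.defs FactRing_def)

lemma rep_coset: "x \<in> carrier FA \<Longrightarrow> rep (I +>\<^bsub>FA\<^esub> x) (word_sum f x)"
proof -
  interpret ideal I FA by (rule I_ideal)
  assume x: "x \<in> carrier FA"
  have "0 \<in> I" using additive_subgroup.zero_closed[OF ideal.axioms(1)[OF I_ideal]] by (simp add: FA_simps)
  then show ?thesis using x I_carrier FA_add
    by (auto simp: rep_def a_r_coset_def' FA_simps word_sum_add I_zero(2))
qed

lemma rep_H: "X \<in> carrier H \<Longrightarrow> \<exists>c. rep X c"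
  unfolding H_simps A_RCOSETS_def' using rep_coset by blast

lemma rep_add: "rep X c \<Longrightarrow> rep Y d \<Longrightarrow> rep (X \<oplus>\<^bsub>H\<^esub> Y) (c + d)"
  unfolding H_simps set_add_def' FA_simps by (fastforce simp: rep_def word_sum_add FA_add)

lemma rep_mult:
  assumes X: "X \<in> carrier H" and Y: "Y \<in> carrier H"
  shows "\<exists>x\<in>X. \<exists>y\<in>Y. x \<in> carrier FA \<and> y \<in> carrier FA \<and> X = I +>\<^bsub>FA\<^esub> x \<and> Y = I +>\<^bsub>FA\<^esub> y
    \<and> X \<otimes>\<^bsub>H\<^esub> Y = I +>\<^bsub>FA\<^esub> (x * y)"
proof -
  interpret ideal I FA by (rule I_ideal)
  obtain x y where xy: "x \<in> carrier FA" "X = I +>\<^bsub>FA\<^esub> x" "y \<in> carrier FA" "Y = I +>\<^bsub>FA\<^esub> y"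
    using X Y unfolding H_simps A_RCOSETS_def' by blast
  have "x \<in> X" "y \<in> Y" using xy a_rcos_self by auto
  moreover have "X \<otimes>\<^bsub>H\<^esub> Y = I +>\<^bsub>FA\<^esub> (x * y)"
    unfolding H_simps xy(2,4) using rcoset_mult_add[OF xy(1,3)] by (simp add: FA_simps)
  ultimately show ?thesis using xy by blast
qed

lemma rep_smult:
  assumes X: "X \<in> carrier H" and r: "rep X d"
  shows "c \<odot>\<^bsub>H\<^esub> X \<in> carrier H" "rep (c \<odot>\<^bsub>H\<^esub> X) (c * d)"
proof -
  interpret ideal I FA by (rule I_ideal)
  obtain x where x: "x \<in> carrier FA" "X = I +>\<^bsub>FA\<^esub> x" using X unfolding H_simps A_RCOSETS_def' by blast
  have e: "c \<odot>\<^bsub>H\<^esub> X = I +>\<^bsub>FA\<^esub> (scalar c * x)"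
    unfolding H_simps(5) x(2) using rcoset_mult_add[OF FA_scalar x(1)] by (simp add: FA_simps)
  have sx: "scalar c * x \<in> carrier FA" by (rule FA_mult[OF FA_scalar x(1)])
  show "c \<odot>\<^bsub>H\<^esub> X \<in> carrier H" unfolding e H_simps(1) A_RCOSETS_def' using sx by blast
  have "word_sum f x = d" using rep_unique[OF rep_coset[OF x(1)]] r x(2) by simp
  then show "rep (c \<odot>\<^bsub>H\<^esub> X) (c * d)" unfolding e using rep_coset[OF sx] by (simp add: word_sum_scalar)
qed

lemma H_abelian: "abelian_group H"
proof -
  interpret Q: ring "FA Quot I" by (rule ideal.quotient_is_ring[OF I_ideal])
  have e: "carrier H = carrier (FA Quot I)" "add H = add (FA Quot I)" "zero H = zero (FA Quot I)"
    by (simp_all add: H_simps FactRing_def)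
  show ?thesis
  proof (rule abelian_groupI; unfold e)
    fix x assume "x \<in> carrier (FA Quot I)"
    then show "\<exists>y\<in>carrier (FA Quot I). y \<oplus>\<^bsub>FA Quot I\<^esub> x = \<zero>\<^bsub>FA Quot I\<^esub>"
      by (intro bexI[of _ "\<ominus>\<^bsub>FA Quot I\<^esub> x"]) (simp_all add: Q.l_neg)
  qed (simp_all add: Q.a_ac)
qed

lemma rep_minus:
  assumes X: "X \<in> carrier H" "rep X c" and Y: "Y \<in> carrier H" "rep Y d"
  shows "rep (X \<ominus>\<^bsub>H\<^esub> Y) (c - d)"
proof -
  interpret abelian_group H by (rule H_abelian)
  obtain e where e: "rep (X \<ominus>\<^bsub>H\<^esub> Y) e" using rep_H[OF minus_closed[OF X(1) Y(1)]] by blast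
  have "X \<ominus>\<^bsub>H\<^esub> Y \<oplus>\<^bsub>H\<^esub> Y = X" using X(1) Y(1) by (simp add: a_minus_def a_assoc l_neg)
  then have "rep X (e + d)" using rep_add[OF e Y(2)] by simp
  then have "e + d = c" using rep_unique X(2) by blast
  then have "c - d = e" by (simp add: algebra_simps)
  then show ?thesis using e by (simp only:)
qed

lemma H_mult_closed: "X \<in> carrier H \<Longrightarrow> Y \<in> carrier H \<Longrightarrow> X \<otimes>\<^bsub>H\<^esub> Y \<in> carrier H"
proof -
  interpret Q: ring "FA Quot I" by (rule ideal.quotient_is_ring[OF I_ideal])
  assume "X \<in> carrier H" "Y \<in> carrier H"
  then show ?thesis using Q.m_closed[of X Y] by (simp add: H_simps FactRing_def)
qed

text \<open>The kernel of the induced functional on the Hecke algebra. It is one of the submodules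
  whose intersection defines the commutator span.\<close>

definition ker0 where "ker0 = {Y \<in> carrier H. rep Y 0}"

lemma ker0_submodule: "submodule ker0 laurent_ring H"
proof (intro submodule.intro submodule_axioms.intro)
  interpret abelian_group H by (rule H_abelian)
  have I0: "rep \<zero>\<^bsub>H\<^esub> 0"
  proof -
    obtain c where c: "rep \<zero>\<^bsub>H\<^esub> c" using rep_H[OF zero_closed] by blast
    then have "rep \<zero>\<^bsub>H\<^esub> (c + c)" using rep_add[OF c c] by simp
    then have "c + c = c" using rep_unique[OF _ c] by blast
    then show ?thesis using c by simp
  qed
  show "subgroup ker0 (add_monoid H)"
  proof (rule add.subgroupI)
    show "ker0 \<subseteq> carrier H" by (auto simp: ker0_def)
    show "ker0 \<noteq> {}" using I0 zero_closed unfolding ker0_def by blast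
    fix X assume X: "X \<in> ker0"
    have "\<ominus>\<^bsub>H\<^esub> X = \<zero>\<^bsub>H\<^esub> \<ominus>\<^bsub>H\<^esub> X" using X by (simp add: ker0_def a_minus_def)
    then show "\<ominus>\<^bsub>H\<^esub> X \<in> ker0" using rep_minus[OF zero_closed I0, of X 0] X by (simp add: ker0_def)
    fix Y assume Y: "Y \<in> ker0"
    show "X \<oplus>\<^bsub>H\<^esub> Y \<in> ker0" using rep_add[of X 0 Y 0] X Y by (simp add: ker0_def)
  qed
  show "c \<odot>\<^bsub>H\<^esub> X \<in> ker0" if "X \<in> ker0" for c X using rep_smult[of X 0 c] that by (simp add: ker0_def)
qed

lemma C_ker0: "C \<subseteq> ker0"
proof -
  have "{a \<otimes>\<^bsub>H\<^esub> b \<ominus>\<^bsub>H\<^esub> b \<otimes>\<^bsub>H\<^esub> a | a b. a \<in> carrier H \<and> b \<in> carrier H} \<subseteq> ker0"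
  proof
    fix X assume "X \<in> {a \<otimes>\<^bsub>H\<^esub> b \<ominus>\<^bsub>H\<^esub> b \<otimes>\<^bsub>H\<^esub> a | a b. a \<in> carrier H \<and> b \<in> carrier H}"
    then obtain a b where ab: "a \<in> carrier H" "b \<in> carrier H" "X = a \<otimes>\<^bsub>H\<^esub> b \<ominus>\<^bsub>H\<^esub> b \<otimes>\<^bsub>H\<^esub> a" by blast
    interpret ideal I FA by (rule I_ideal)
    interpret G: abelian_group H by (rule H_abelian)
    obtain x y where xy: "x \<in> carrier FA" "y \<in> carrier FA" "a = I +>\<^bsub>FA\<^esub> x" "b = I +>\<^bsub>FA\<^esub> y" "a \<otimes>\<^bsub>H\<^esub> b = I +>\<^bsub>FA\<^esub> (x * y)"
      using rep_mult[OF ab(1,2)] by blast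
    have ba: "b \<otimes>\<^bsub>H\<^esub> a = I +>\<^bsub>FA\<^esub> (y * x)"
      unfolding H_simps xy(3,4) using rcoset_mult_add[OF xy(2,1)] by (simp add: FA_simps)
    have r: "rep (a \<otimes>\<^bsub>H\<^esub> b) (word_sum f (x * y))" "rep (b \<otimes>\<^bsub>H\<^esub> a) (word_sum f (y * x))"
      unfolding xy(5) ba by (intro rep_coset FA_mult xy)+
    have c: "a \<otimes>\<^bsub>H\<^esub> b \<in> carrier H" "b \<otimes>\<^bsub>H\<^esub> a \<in> carrier H"
      using H_mult_closed[OF ab(1,2)] H_mult_closed[OF ab(2,1)] .
    have "rep X (word_sum f (x * y) - word_sum f (y * x))" "X \<in> carrier H"
      unfolding ab(3) using rep_minus[OF c(1) r(1) c(2) r(2)] G.minus_closed[OF c] .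
    then show "X \<in> ker0" using trace[OF xy(1,2)] by (simp add: ker0_def)
  qed
  then show ?thesis unfolding commutator_span_def module_span_def
    by (intro Inter_lower CollectI conjI ker0_submodule)
qed

lemma C_zero: "\<zero>\<^bsub>H\<^esub> \<in> C"
  unfolding commutator_span_def module_span_def
proof (rule InterI)
  fix N assume "N \<in> {N. submodule N laurent_ring H \<and>
    {a \<otimes>\<^bsub>H\<^esub> b \<ominus>\<^bsub>H\<^esub> b \<otimes>\<^bsub>H\<^esub> a | a b. a \<in> carrier H \<and> b \<in> carrier H} \<subseteq> N}"
  then have "submodule N laurent_ring H" by blast
  then have "subgroup N (add_monoid H)" by (rule submodule.axioms(1))
  then show "\<zero>\<^bsub>H\<^esub> \<in> N" using subgroup.one_closed by fastforce
qed

text \<open>The choice is irrelevant on the cocenter, since \<open>word_sum f\<close> is constant on each of its classes.\<close>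

definition F where "F X = word_sum f (SOME x. x \<in> \<Union>X)"

text \<open>The analogue of \<open>rep\<close> one quotient further, for cosets whose members are
  themselves cosets.\<close>

definition rep_class :: "'w free_alg set set \<Rightarrow> laurent \<Rightarrow> bool" where
  "rep_class X c \<longleftrightarrow> X \<noteq> {} \<and> (\<forall>Y\<in>X. Y \<in> carrier H \<and> rep Y c)"

lemma rep_class_F: "rep_class X c \<Longrightarrow> F X = c"
proof -
  assume r: "rep_class X c"
  have "\<exists>x. x \<in> \<Union>X" using r by (fastforce simp: rep_class_def rep_def)
  from someI_ex[OF this] show "F X = c" using r unfolding F_def rep_class_def rep_def by blast
qed

lemma rep_class_coset: "h \<in> carrier H \<Longrightarrow> rep h c \<Longrightarrow> rep_class (C +>\<^bsub>H\<^esub> h) c"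
proof -
  interpret abelian_group H by (rule H_abelian)
  assume h: "h \<in> carrier H" "rep h c"
  have "n \<oplus>\<^bsub>H\<^esub> h \<in> carrier H \<and> rep (n \<oplus>\<^bsub>H\<^esub> h) c" if "n \<in> C" for n
    using rep_add[of n 0 h c] C_ker0 that h by (auto simp: ker0_def)
  then show ?thesis using C_zero by (auto simp: rep_class_def a_r_coset_def')
qed

theorem F_linear: "linear_functional (cocenter W S) F"
  unfolding linear_functional_def
proof (intro conjI ballI allI)
  interpret abelian_group H by (rule H_abelian)
  have c: "\<exists>c. rep_class X c" if "X \<in> carrier (cocenter W S)" for X
  proof -
    have "X \<in> a_rcosets\<^bsub>H\<^esub> C" using that by (simp add: cocenter_def quotient_module_def)
    then obtain h where "h \<in> carrier H" "X = C +>\<^bsub>H\<^esub> h" unfolding A_RCOSETS_def' by blast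
    moreover obtain e where "rep h e" using rep_H[OF \<open>h \<in> carrier H\<close>] by blast
    ultimately show ?thesis using rep_class_coset by blast
  qed
  fix X assume "X \<in> carrier (cocenter W S)"
  then obtain d where d: "rep_class X d" using c by blast
  show "F (k \<odot>\<^bsub>cocenter W S\<^esub> X) = k * F X" for k
  proof -
    have e: "k \<odot>\<^bsub>cocenter W S\<^esub> X = (\<Union>x\<in>X. C +>\<^bsub>H\<^esub> (k \<odot>\<^bsub>H\<^esub> x))" by (simp add: cocenter_def quotient_module_def)
    have r: "rep_class (C +>\<^bsub>H\<^esub> (k \<odot>\<^bsub>H\<^esub> x)) (k * d)" if x: "x \<in> X" for x
    proof -
      have xH: "x \<in> carrier H" and xr: "rep x d" using d x by (auto simp: rep_class_def)
      show ?thesis by (rule rep_class_coset[OF rep_smult[OF xH xr]])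
    qed
    have "rep_class (k \<odot>\<^bsub>cocenter W S\<^esub> X) (k * d)"
      unfolding e rep_class_def
    proof (intro conjI ballI)
      obtain x where x: "x \<in> X" using d unfolding rep_class_def by blast
      then show "(\<Union>x\<in>X. C +>\<^bsub>H\<^esub> (k \<odot>\<^bsub>H\<^esub> x)) \<noteq> {}" using r[OF x] unfolding rep_class_def by blast
      fix Y assume "Y \<in> (\<Union>x\<in>X. C +>\<^bsub>H\<^esub> (k \<odot>\<^bsub>H\<^esub> x))"
      then obtain x where x: "x \<in> X" "Y \<in> C +>\<^bsub>H\<^esub> (k \<odot>\<^bsub>H\<^esub> x)" by blast
      show "Y \<in> carrier H" "rep Y (k * d)" using r[OF x(1)] x(2) unfolding rep_class_def by blast+
    qed
    then have "F (k \<odot>\<^bsub>cocenter W S\<^esub> X) = k * d" by (rule rep_class_F)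
    then show ?thesis unfolding rep_class_F[OF d] .
  qed
  fix Y assume "Y \<in> carrier (cocenter W S)"
  then obtain e where e: "rep_class Y e" using c by blast
  have "X \<oplus>\<^bsub>cocenter W S\<^esub> Y = X <+>\<^bsub>H\<^esub> Y" by (simp add: cocenter_def quotient_module_def)
  moreover have "rep_class (X <+>\<^bsub>H\<^esub> Y) (d + e)"
    unfolding rep_class_def set_add_def'
  proof (intro conjI ballI)
    obtain x y where "x \<in> X" "y \<in> Y" using d e unfolding rep_class_def by blast
    then show "(\<Union>h\<in>X. \<Union>k\<in>Y. {h \<oplus>\<^bsub>H\<^esub> k}) \<noteq> {}" by blast
    fix z assume "z \<in> (\<Union>h\<in>X. \<Union>k\<in>Y. {h \<oplus>\<^bsub>H\<^esub> k})"
    then obtain x y where xy: "x \<in> X" "y \<in> Y" "z = x \<oplus>\<^bsub>H\<^esub> y" by blast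
    have x: "x \<in> carrier H" "rep x d" using d xy(1) by (auto simp: rep_class_def)
    have y: "y \<in> carrier H" "rep y e" using e xy(2) by (auto simp: rep_class_def)
    show "z \<in> carrier H" "rep z (d + e)" unfolding xy(3) using a_closed[OF x(1) y(1)] rep_add[OF x(2) y(2)] .
  qed
  ultimately have "rep_class (X \<oplus>\<^bsub>cocenter W S\<^esub> Y) (d + e)" by (simp only:)
  then have "F (X \<oplus>\<^bsub>cocenter W S\<^esub> Y) = d + e" by (rule rep_class_F)
  then show "F (X \<oplus>\<^bsub>cocenter W S\<^esub> Y) = F X + F Y" unfolding rep_class_F[OF d] rep_class_F[OF e] .
qed

lemma F_T:
  assumes ss: "reduced_expressions W S w \<noteq> {}"
  shows "\<exists>v\<in>reduced_expressions W S w. F (to_cocenter W S (hecke_T W S w)) = f v"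
proof -
  let ?v = "SOME ss. ss \<in> reduced_expressions W S w"
  have v: "?v \<in> reduced_expressions W S w" using some_in_eq ss by metis
  then have vS: "?v \<in> lists S" by (simp add: reduced_expressions_def)
  have "rep (hecke_T W S w) (f ?v)"
    unfolding hecke_T_def using rep_coset[OF FA_word[OF vS]] by (simp add: word_sum_monom)
  moreover have "hecke_T W S w \<in> carrier H"
    unfolding hecke_T_def H_simps A_RCOSETS_def' using FA_word[OF vS] by blast
  ultimately have "rep_class (to_cocenter W S (hecke_T W S w)) (f ?v)" unfolding to_cocenter_def by (rule rep_class_coset[rotated])
  then show ?thesis using v rep_class_F by blast
qed

end

text \<open>For m = 4 and m = 6 the two off-diagonal entries differ; an injection of S into the
  naturals decides which of them is -1.\<close>

lemma ex_gcm:
  fixes W :: "'w monoid" (structure)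
  assumes W: "crystallographic_coxeter_system W S"
  shows "\<exists>A. coxeter_gcm W S A"
proof -
  have cox: "coxeter_system W S" and fin: "finite S"
    and m: "\<And>s t. s \<in> S \<Longrightarrow> t \<in> S \<Longrightarrow> s \<noteq> t \<Longrightarrow> cox_m W s t \<in> {2, 3, 4, 6, 0}"
    using W by (auto simp: crystallographic_coxeter_system_def)
  interpret group W using cox by (simp add: coxeter_system_def)
  have Sc: "s \<in> carrier W" and o: "ord s = 2" if "s \<in> S" for s using cox that by (auto simp: coxeter_system_def)
  have inv_s: "inv s = s" if s: "s \<in> S" for s
  proof -
    have "s [^] (2::nat) = \<one>" using pow_ord_eq_1[OF Sc[OF s]] o[OF s] by simp
    then have "s \<otimes> s = \<one>" using Sc[OF s] by (simp add: numeral_2_eq_2)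
    then show ?thesis using inv_equality Sc[OF s] by blast
  qed
  have sym: "cox_m W s t = cox_m W t s" if "s \<in> S" "t \<in> S" for s t
    using ord_inv[of "s \<otimes> t"] that by (simp add: cox_m_def inv_mult_group Sc inv_s)
  obtain idx :: "_ \<Rightarrow> nat" where idx: "inj_on idx S" using finite_imp_inj_to_nat_seg[OF fin] by blast
  define A :: "_ \<Rightarrow> _ \<Rightarrow> int" where "A s t =
    (if s = t then 2 else if cox_m W s t = 2 then 0 else if cox_m W s t = 3 then -1
     else if cox_m W s t = 0 then -2 else if idx s < idx t then -1
     else if cox_m W s t = 4 then -2 else -3)" for s t
  have "(cox_m W s t, A s t, A t s) \<in>
      {(2,0,0), (3,-1,-1), (4,-1,-2), (4,-2,-1), (6,-1,-3), (6,-3,-1), (0,-2,-2)}"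
    if st: "s \<in> S" "t \<in> S" "s \<noteq> t" for s t
  proof -
    have i: "idx s < idx t \<and> \<not> idx t < idx s \<or> idx t < idx s \<and> \<not> idx s < idx t"
      using inj_onD[OF idx, of s t] st by fastforce
    show ?thesis using m[OF st] i sym[OF st(1,2)] st(3) unfolding A_def by auto
  qed
  then have "coxeter_gcm W S A"
    by (intro coxeter_gcm.intro coxeter_gcm_axioms.intro is_group cox fin) (simp_all add: A_def)
  then show ?thesis by blast
qed

theorem theorem4p1:
  fixes W :: "'w monoid" and S :: "'w set" and \<O> :: "'w set"
  assumes "crystallographic_coxeter_system W S"
    and "irreducible_coxeter W S"
    and "\<O> \<in> conj_classes W"
    and "elliptic W S \<O>"
  shows "\<exists>(F :: 'w free_alg set set \<Rightarrow> laurent) (z :: int).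
           linear_functional (cocenter W S) F \<and> z > 0 \<and>
           (\<forall>\<O>'\<in>conj_classes W. \<forall>T\<O>'\<in>class_T W S \<O>'.
              (qq - 1) dvd (F T\<O>' - of_int (z * (if \<O> = \<O>' then 1 else 0))))"
proof -
  obtain A where "coxeter_gcm W S A" using ex_gcm[OF assms(1)] by blast
  then interpret coxeter_gcm W S A .
  have classes: "conj_classes W = cls ` carrier W" by (auto simp: conj_classes_def cls_def)
  obtain a where a: "a \<in> carrier W" "\<O> = cls a" using assms(3) unfolding classes by blast
  have self: "x \<in> cls x" if "x \<in> carrier W" for x using that unfolding cls_def by (auto intro!: exI[of _ "\<one>\<^bsub>W\<^esub>"])
  have mem: "cls x = cls w" if x: "x \<in> carrier W" and w: "w \<in> cls x" for x w
  proof -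
    obtain g where g: "g \<in> carrier W" "w = g \<otimes>\<^bsub>W\<^esub> x \<otimes>\<^bsub>W\<^esub> inv\<^bsub>W\<^esub> g" using w unfolding cls_def by blast
    show ?thesis unfolding g(2) by (rule cls_conj[OF x g(1), symmetric])
  qed
  have "cls a \<inter> generate W J = {}" if "J \<subset> S" for J using assms(4) that unfolding elliptic_def a(2) by blast
  then obtain f where f: "class_trace (cls a) f" using elliptic_class_trace[OF assms(2) a(1)] by blast
  note fD = f[unfolded class_trace_def]
  obtain z where z: "z > 0" "\<And>v. v \<in> lists S \<Longrightarrow> ev1 (f v) = (if word_prod W v \<in> cls a then z else 0)"
    using fD by blast
  interpret word_trace W S f
  proof
    show "f (u @ v) = f (v @ u)" if "u \<in> lists S" "v \<in> lists S" for u v using fD that by blast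
    show "f (s # s # v) = (qq - 1) * f (s # v) + qq * f v" if "s \<in> S" "v \<in> lists S" for s v using fD that by blast
    show "f (alt_word (cox_m W s t) s t @ v) = f (alt_word (cox_m W s t) t s @ v)"
      if "s \<in> S" "t \<in> S" "v \<in> lists S" "s \<noteq> t" "cox_m W s t \<noteq> 0" for s t v
      using fD that by blast
  qed
  have "(qq - 1) dvd (F TO' - of_int (z * (if \<O> = \<O>' then 1 else 0)))"
    if O': "\<O>' \<in> conj_classes W" and T': "TO' \<in> class_T W S \<O>'" for \<O>' TO'
  proof -
    obtain x where x: "x \<in> carrier W" "\<O>' = cls x" using O' unfolding classes by blast
    obtain w where w: "w \<in> cls x" "TO' = to_cocenter W S (hecke_T W S w)"
      using T' unfolding class_T_def min_length_elements_def x(2) by blast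
    have wc: "w \<in> carrier W" using w(1) x(1) unfolding cls_def by auto
    have "\<exists>n. \<exists>ss\<in>lists S. length ss = n \<and> word_prod W ss = w" using ex_word[OF wc] by blast
    from LeastI_ex[OF this] have "reduced_expressions W S w \<noteq> {}"
      unfolding reduced_expressions_def cox_length_def by blast
    then obtain v where v: "v \<in> reduced_expressions W S w" "F TO' = f v" using F_T w(2) by blast
    have vw: "v \<in> lists S" "word_prod W v = w" using v(1) unfolding reduced_expressions_def by blast+
    \<comment> \<open>Conjugacy classes are disjoint, so membership of w in the class of a decides
      the Kronecker delta; congruence modulo q - 1 then amounts to equality at q = 1.\<close>
    have "w \<in> cls a \<longleftrightarrow> \<O> = \<O>'"
      unfolding a(2) x(2) using mem[OF x(1) w(1)] mem[OF a(1), of w] self[OF wc] by auto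
    then have "ev1 (F TO') = z * (if \<O> = \<O>' then 1 else 0)" using z(2)[OF vw(1)] vw(2) v(2) by simp
    then show ?thesis unfolding dvd_iff_ev1 ev1_diff ev1_of_int by simp
  qed
  then show ?thesis using F_linear z(1) by blast
qed

end
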